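(* Fix $u\in[0,1]$ and $\theta>0$, and put $c_{\theta,u}:=1+\theta\max\{u,1-u\}$. (i) (Random regular graphs) Let $d\ge3$ be an integer and let $G_n$ be the uniformly random simple $d$-regular graph on $[n]$, with law $p_{d,n}$. If $d>2c_{\theta,u}$, then there exist $\eta>0$, $s>0$ and $c>0$ such that for every $a\ge0$, $$p_{d,n}\left(\frac1s\int_a^{a+s}\mathbb P^{G_n}_{\theta,t,u}(A_\eta)\,\mathrm dt\ge c\right)\xrightarrow[n\to\infty]{}1.$$ (ii) (Sparse Erdős–Rényi graphs) Let $\lambda>0$ and $G_n\sim G(n,\lambda/n)$. If $\lambda>2c_{\theta,u}$, then there exist $\eta>0$, $s>0$ and $c>0$ such that for every $a\ge0$, $$\mathbb P\left(\frac1s\int_a^{a+s}\mathbb P^{G_n}_{\theta,t,u}(A_\eta)\,\mathrm dt\ge c\right)\xrightarrow[n\to\infty]{}1.$$ (iii) (Simple bounded-degree configuration model) Let $G_n$ be the simple graph obtained from the configuration model with deterministic degree sequence $(d_i^{(n)})_{i=1}^n$. Assume that there is $\Delta$ with $1\le d_i^{(n)}\le\Delta$ for all $i,n$, and that $\frac1n\sum_{i=1}^n d_i^{(n)}\to\rho$. If $\rho>2c_{\theta,u}$, then there exist $\eta>0$, $s>0$ and $c>0$ such that for every $a\ge0$, $$\mathbb P\left(\frac1s\int_a^{a+s}\mathbb P^{G_n}_{\theta,t,u}(A_\eta)\,\mathrm dt\ge c\right)\xrightarrow[n\to\infty]{}1.$$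
   Context: Random graph ensembles on $[n]=\{1,\dots,n\}$. The random $d$-regular graph is uniform among simple graphs on $[n]$ with all degrees equal to $d$ (only $n$ with $nd$ even are considered). In $G(n,\lambda/n)$ each edge $\{i,j\}$, $i<j$, is present independently with probability $\lambda/n$. In the configuration model with deterministic degree sequence $(d_i^{(n)})_{i=1}^n$ of even total degree, one attaches $d_i^{(n)}$ half-edges to vertex $i$ and chooses a uniformly random pairing of all half-edges, giving a random multigraph $\widetilde G_n$ (self-loops and multiple edges allowed); the simple graph $G_n$ has the law of $\widetilde G_n$ conditioned on being simple. $\mathbb P$ denotes the law of the random graph. Random loop model. Let $G=(V,E)$ be a finite simple graph with $|V|=n$, and $S^1=\mathbb R/\mathbb Z$. For $t\ge0$ and $u\in[0,1]$, let $\omega=(\omega_e)_{e\in E}$ be independent marked Poisson point processes on $S^1\times\{\times,\mid\}$ with intensity measure $t\,\mathrm ds\otimes(u\,\delta_\times+(1-u)\,\delta_\mid)$; the law of $\omega$ is $\rho^G_{t,u}$. A point $(s,\times)\in\omega_e$ is a cross, and a point $(s,\mid)\in\omega_e$ a bar, on the edge $e$ at time $s$. Almost surely there are finitely many marks, at distinct times. Loops: a particle moves in $G\times S^1\times\{-1,+1\}$, the third coordinate being its vertical direction. Between marks it moves vertically (in the $S^1$ coordinate) at unit speed in its current direction; when at vertex $x$ it meets a mark on an edge $\{x,y\}$, it jumps instantaneously from $x$ to $y$, keeping its direction if the mark is a cross and reversing it if the mark is a bar. All trajectories are closed; the resulting closed trajectories, regarded as (unoriented) subsets of $V\times S^1$,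 are the loops. $\mathcal L(\omega)$ is the set of loops and $\lambda(\omega)=|\mathcal L(\omega)|$. For a loop $\gamma$, $\operatorname{supp}_V(\gamma)=\{x\in V:\exists s\in S^1,\ (x,s)\in\gamma\}$. For $\theta>0$, the weighted measure is $\mathbb P^G_{\theta,t,u}(\mathrm d\omega)=Z_G(\theta,t,u)^{-1}\theta^{\lambda(\omega)}\rho^G_{t,u}(\mathrm d\omega)$ with $Z_G(\theta,t,u)=\int\theta^{\lambda(\omega)}\rho^G_{t,u}(\mathrm d\omega)$. For $\eta>0$, $A_\eta=\{\exists\gamma\in\mathcal L(\omega):|\operatorname{supp}_V(\gamma)|>\eta n\}$. For a random graph $G_n$, $\mathbb P^{G_n}_{\theta,t,u}$ is the loop measure conditional on $G_n$, so $\mathbb P^{G_n}_{\theta,t,u}(A_\eta)$ is a random variable depending on $G_n$. *)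

theory Defs
  imports
    "HOL-Probability.Probability"
    "HOL-Probability.Product_PMF"
    "HOL-Combinatorics.Multiset_Permutations"
begin

section \<open>Poisson point processes\<close>

text \<open>Realisations of a point process are finite multisets of points; the configuration space
  carries the sigma-algebra generated by the counting variables.\<close>

definition points_in :: "'a set \<Rightarrow> 'a multiset \<Rightarrow> nat" where
  "points_in B \<xi> = size {#p \<in># \<xi>. p \<in> B#}"

definition configurations :: "'a measure \<Rightarrow> 'a multiset measure" where
  "configurations \<Lambda> = sigma {\<xi>. set_mset \<xi> \<subseteq> space \<Lambda>}
     {{\<xi>. set_mset \<xi> \<subseteq> space \<Lambda> \<and> points_in B \<xi> = k} | B k. B \<in> sets \<Lambda>}"

text \<open>\<open>P\<close> is the law of a Poisson point process with finite intensity measure \<open>\<Lambda>\<close>: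
  the numbers of points in pairwise disjoint sets are independent, and the number of points in
  \<open>B\<close> is Poisson distributed with parameter \<open>\<Lambda> B\<close>.\<close>

definition poisson_process_law :: "'a measure \<Rightarrow> 'a multiset measure \<Rightarrow> bool" where
  "poisson_process_law \<Lambda> P \<longleftrightarrow>
     finite_measure \<Lambda> \<and> prob_space P \<and>
     space P = space (configurations \<Lambda>) \<and> sets P = sets (configurations \<Lambda>) \<and>
     (\<forall>(I :: nat set) B k. finite I \<longrightarrow> (\<forall>i\<in>I. B i \<in> sets \<Lambda>) \<longrightarrow> disjoint_family_on B I \<longrightarrow>
        measure P {\<xi> \<in> space P. \<forall>i\<in>I. points_in (B i) \<xi> = k i} =
        (\<Prod>i\<in>I. measure \<Lambda> (B i) ^ k i / fact (k i) * exp (- measure \<Lambda> (B i))))"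

text \<open>The library's \<^term>\<open>poisson_pmf r\<close> is only specified for \<open>r > 0\<close>.\<close>

definition poisson_count :: "real \<Rightarrow> nat pmf" where
  "poisson_count r = (if r = 0 then return_pmf 0 else poisson_pmf r)"

text \<open>The Poisson process with intensity measure \<open>t \<cdot> \<nu>\<close>, for a probability measure \<open>\<nu>\<close>: a
  Poisson(\<open>t\<close>) number of independent points with law \<open>\<nu>\<close>. Lemma \<open>poisson_process_is_poisson\<close>
  below shows that this is a Poisson point process in the above sense.\<close>

definition poisson_process :: "real \<Rightarrow> 'a measure \<Rightarrow> 'a multiset measure" where
  "poisson_process t \<nu> =
     measure_pmf (poisson_count t) \<bind>
       (\<lambda>k. distr (Pi\<^sub>M {..<k} (\<lambda>_. \<nu>)) (configurations \<nu>) (\<lambda>x. image_mset x (mset_set {..<k})))"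

lemma space_configurations: "space (configurations \<Lambda>) = {\<xi>. set_mset \<xi> \<subseteq> space \<Lambda>}"
  unfolding configurations_def by (rule space_measure_of) auto

lemma sets_configurations: "sets (configurations \<Lambda>) = sigma_sets {\<xi>. set_mset \<xi> \<subseteq> space \<Lambda>}
     {{\<xi>. set_mset \<xi> \<subseteq> space \<Lambda> \<and> points_in B \<xi> = k} | B k. B \<in> sets \<Lambda>}"
  unfolding configurations_def by (rule sets_measure_of) auto

lemma measurable_points_in:
  assumes "B \<in> sets \<Lambda>"
  shows "points_in B \<in> measurable (configurations \<Lambda>) (count_space UNIV)"
proof -
  have "points_in B -` {a} \<inter> space (configurations \<Lambda>) \<in> sets (configurations \<Lambda>)" for a
    unfolding sets_configurations space_configurations
    by (rule sigma_sets.Basic) (use assms in \<open>auto intro!: exI[of _ B] exI[of _ a]\<close>)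
  then show ?thesis by (simp add: measurable_count_space_eq2_countable)
qed

lemma points_in_image_mset:
  "points_in B (image_mset x (mset_set {..<k::nat})) = (\<Sum>j<k. if x j \<in> B then 1 else 0)"
  unfolding points_in_def
  by (induction k) (simp_all add: lessThan_Suc)

lemma measurable_configuration:
  "(\<lambda>x. image_mset x (mset_set {..<k::nat})) \<in> measurable (Pi\<^sub>M {..<k} (\<lambda>_. \<nu>)) (configurations \<nu>)"
proof -
  let ?P = "Pi\<^sub>M {..<k} (\<lambda>_. \<nu>)"
  let ?F = "\<lambda>x. image_mset x (mset_set {..<k})"
  have F: "set_mset (?F x) \<subseteq> space \<nu>" if "x \<in> space ?P" for x
    using that by (auto simp: space_PiM)
  have "?F -` A \<inter> space ?P \<in> sets ?P"
    if "A \<in> {{\<xi>. set_mset \<xi> \<subseteq> space \<nu> \<and> points_in B \<xi> = j} | B j. B \<in> sets \<nu>}" for A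
  proof -
    from that obtain B j where A: "A = {\<xi>. set_mset \<xi> \<subseteq> space \<nu> \<and> points_in B \<xi> = j}"
      and B: "B \<in> sets \<nu>" by blast
    have "points_in B (?F x) = j \<longleftrightarrow> (\<Sum>i<k. indicator B (x i)) = real j" for x
    proof -
      have "(\<Sum>i<k. indicator B (x i)) = real (points_in B (?F x))"
        unfolding points_in_image_mset of_nat_sum by (rule sum.cong) (simp_all add: indicator_def)
      then show ?thesis by (simp only: of_nat_eq_iff)
    qed
    with F have "?F -` A \<inter> space ?P =
        (\<lambda>x. \<Sum>i<k. indicator B (x i) :: real) -` {real j} \<inter> space ?P"
      unfolding A by blast
    also have "\<dots> \<in> sets ?P"
    proof (rule measurable_sets)
      have "(\<lambda>x. indicator B (x i) :: real) \<in> borel_measurable ?P" if "i \<in> {..<k}" for i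
        using measurable_compose[OF measurable_component_singleton[OF that]
            borel_measurable_indicator[OF B]] .
      then show "(\<lambda>x. \<Sum>i<k. indicator B (x i) :: real) \<in> borel_measurable ?P"
        by (rule borel_measurable_sum)
    qed simp
    finally show ?thesis .
  qed
  with F show ?thesis
    unfolding configurations_def by (intro measurable_measure_of) blast+
qed

lemma pmf_poisson_count:
  "t \<ge> 0 \<Longrightarrow> pmf (poisson_count t) k = t ^ k / fact k * exp (- t)"
  by (cases k) (auto simp: poisson_count_def)

lemma multinomial_aux:
  assumes \<nu>: "prob_space \<nu>"
    and I: "finite (I :: nat set)" and B: "\<And>i. i \<in> I \<Longrightarrow> B i \<in> sets \<nu>"
    and dj: "disjoint_family_on B I"
  shows "measure (Pi\<^sub>M {..<n} (\<lambda>_. \<nu>))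
      {x \<in> space (Pi\<^sub>M {..<n} (\<lambda>_. \<nu>)). \<forall>i\<in>I. (\<Sum>j<n. if x j \<in> B i then 1 else 0) = k i} =
    (if n < sum k I then 0
     else fact n / fact (n - sum k I) * (1 - (\<Sum>i\<in>I. measure \<nu> (B i))) ^ (n - sum k I) *
       (\<Prod>i\<in>I. measure \<nu> (B i) ^ k i / fact (k i)))"
proof -
  interpret prob_space \<nu> by fact
  interpret P: finite_product_prob_space "\<lambda>_::nat. \<nu>" "{..<n}" by unfold_locales auto
  let ?P = "Pi\<^sub>M {..<n} (\<lambda>_. \<nu>)"
  define C where "C a = (case a of Some i \<Rightarrow> B i | None \<Rightarrow> space \<nu> - (\<Union>i\<in>I. B i))" for a
  define J where "J = insert None (Some ` I)"
  have finJ: "finite J" using I by (simp add: J_def)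
  have CB: "C a \<in> sets \<nu>" if "a \<in> J" for a
    using that B I by (auto simp: C_def J_def)
  have ex: "\<exists>a\<in>J. z \<in> C a" if "z \<in> space \<nu>" for z
    using that by (force simp: J_def C_def)
  have un: "a = b" if "z \<in> C a" "z \<in> C b" "a \<in> J" "b \<in> J" for z a b
    using that dj unfolding J_def C_def disjoint_family_on_def by (auto; blast)
  define L where "L = {l. length l = n \<and> set l \<subseteq> J \<and> (\<forall>i\<in>I. count (mset l) (Some i) = k i)}"
  define box where "box l = Pi\<^sub>E {..<n} (\<lambda>j. C (l ! j))" for l :: "nat option list"
  have finL: "finite L"
    by (rule finite_subset[OF _ finite_lists_length_eq[OF finJ, of n]]) (auto simp: L_def)
  have boxS: "box l \<in> sets ?P" if "l \<in> L" for l
    unfolding box_def using that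
    by (intro sets_PiM_I_finite CB) (auto simp: L_def subset_iff)
  have cnt: "count (mset l) (Some i) = (\<Sum>j<n. if x j \<in> B i then 1 else 0)"
    if "length l = n" "set l \<subseteq> J" "x \<in> box l" "i \<in> I" for l x i
  proof -
    have "l ! j = Some i \<longleftrightarrow> x j \<in> B i" if "j < n" for j
    proof -
      have "l ! j \<in> J" "x j \<in> C (l ! j)"
        using that \<open>length l = n\<close> \<open>set l \<subseteq> J\<close> \<open>x \<in> box l\<close> by (auto simp: box_def)
      moreover have "Some i \<in> J" "C (Some i) = B i" using \<open>i \<in> I\<close> by (auto simp: J_def C_def)
      ultimately show ?thesis using un by metis
    qed
    moreover have "count (mset l) (Some i) = (\<Sum>j<length l. if l ! j = Some i then 1 else 0)"
      by (induction l rule: rev_induct) (auto simp: nth_append intro!: sum.cong)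
    ultimately show ?thesis using \<open>length l = n\<close> by (auto intro!: sum.cong)
  qed
  have ev: "{x \<in> space ?P. \<forall>i\<in>I. (\<Sum>j<n. if x j \<in> B i then 1 else 0) = k i} = (\<Union>l\<in>L. box l)"
    (is "?E = _")
  proof (intro equalityI subsetI)
    fix x assume x: "x \<in> ?E"
    then have "\<forall>j<n. \<exists>a\<in>J. x j \<in> C a" using ex by (auto simp: space_PiM)
    then obtain f where f: "\<And>j. j < n \<Longrightarrow> f j \<in> J" "\<And>j. j < n \<Longrightarrow> x j \<in> C (f j)" by metis
    define l where "l = map f [0..<n]"
    have l: "length l = n" "set l \<subseteq> J" using f by (auto simp: l_def)
    have b: "x \<in> box l" using x f by (auto simp: box_def l_def space_PiM PiE_iff)
    have "l \<in> L" using l cnt[OF l b] x by (auto simp: L_def)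
    then show "x \<in> (\<Union>l\<in>L. box l)" using b by auto
  next
    fix x assume "x \<in> (\<Union>l\<in>L. box l)"
    then obtain l where l: "l \<in> L" "x \<in> box l" by auto
    have "x \<in> space ?P" using boxS[OF l(1)] l(2) sets.sets_into_space by blast
    then show "x \<in> ?E" using l cnt[of l x] by (auto simp: L_def)
  qed
  have djL: "disjoint_family_on box L"
    unfolding disjoint_family_on_def
  proof (intro ballI impI, rule ccontr)
    fix l l' assume l: "l \<in> L" "l' \<in> L" "l \<noteq> l'" "box l \<inter> box l' \<noteq> {}"
    then obtain x where x: "x \<in> box l" "x \<in> box l'" by auto
    have "l ! j = l' ! j" if "j < n" for j
    proof (rule un)
      show "x j \<in> C (l ! j)" "x j \<in> C (l' ! j)" using x that by (auto simp: box_def)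
      show "l ! j \<in> J" "l' ! j \<in> J" using l that by (auto simp: L_def subset_iff)
    qed
    then have "l = l'" using l by (intro nth_equalityI) (auto simp: L_def)
    with l show False by simp
  qed
  define q where "q a = measure \<nu> (C a)" for a
  have qS: "q (Some i) = measure \<nu> (B i)" for i by (simp add: q_def C_def)
  have "measure \<nu> (\<Union>i\<in>I. B i) = (\<Sum>i\<in>I. measure \<nu> (B i))"
    by (rule finite_measure_finite_Union) (use I B dj in auto)
  then have qN: "q None = 1 - (\<Sum>i\<in>I. measure \<nu> (B i))"
    unfolding q_def C_def using I B by (simp add: prob_compl)
  define m where "m = n - sum k I"
  define K where "K a = (case a of Some i \<Rightarrow> k i | None \<Rightarrow> m)" for a
  have meas: "measure ?P (box l) = (\<Prod>j<n. q (l ! j))" if "l \<in> L" for l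
    unfolding box_def q_def using that
    by (intro P.prob_times CB) (auto simp: L_def subset_iff)
  have sizeL: "n = sum k I + count (mset l) None" if "l \<in> L" for l
  proof -
    have "n = size (mset l)" using that by (simp add: L_def)
    also have "\<dots> = (\<Sum>a\<in>J. count (mset l) a)"
      unfolding size_multiset_overloaded_eq using that finJ
      by (intro sum.mono_neutral_left) (auto simp: L_def count_eq_zero_iff)
    also have "\<dots> = count (mset l) None + (\<Sum>i\<in>I. count (mset l) (Some i))"
      unfolding J_def using I by (subst sum.insert) (auto simp: sum.reindex)
    finally show ?thesis using that by (simp add: L_def)
  qed
  have main: "measure ?P ?E = (\<Sum>l\<in>L. \<Prod>j<n. q (l ! j))"
    unfolding ev using P.finite_measure_finite_Union[OF finL _ djL] boxS meas
    by (simp add: image_subset_iff)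
  show ?thesis
  proof (cases "n < sum k I")
    case True
    then have "L = {}" using sizeL by fastforce
    with main True show ?thesis by simp
  next
    case False
    define M where "M = (\<Sum>a\<in>J. replicate_mset (K a) a)"
    have cM: "count M a = (if a \<in> J then K a else 0)" for a
      unfolding M_def using finJ by (simp add: count_sum sum.delta)
    have setM: "set_mset M \<subseteq> J" using cM by (auto simp: set_mset_def split: if_splits)
    have pr: "(\<Prod>a\<in>J. h a) = h None * (\<Prod>i\<in>I. h (Some i))" for h :: "nat option \<Rightarrow> real"
      unfolding J_def using I by (subst prod.insert) (auto simp: prod.reindex)
    have sM: "size M = n"
    proof -
      have "size M = (\<Sum>a\<in>J. K a)" unfolding M_def by (simp add: size_multiset_sum)
      also have "\<dots> = m + sum k I"
        unfolding J_def using I by (subst sum.insert) (auto simp: sum.reindex K_def)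
      finally show ?thesis using False by (simp add: m_def)
    qed
    have LM: "L = permutations_of_multiset M"
    proof (intro equalityI subsetI)
      fix l assume l: "l \<in> L"
      have "count (mset l) a = count M a" for a
      proof (cases "a \<in> J")
        case True
        then show ?thesis using l sizeL[OF l] unfolding cM
          by (auto simp: J_def K_def m_def L_def)
      next
        case False
        then have "a \<notin> set l" using l by (auto simp: L_def)
        then show ?thesis unfolding cM using False by (simp add: count_eq_zero_iff)
      qed
      then show "l \<in> permutations_of_multiset M"
        by (auto simp: permutations_of_multiset_def intro: multiset_eqI)
    next
      fix l assume "l \<in> permutations_of_multiset M"
      then have l: "mset l = M" by (simp add: permutations_of_multiset_def)
      have "length l = n" using sM l by (metis size_mset)
      moreover have "set l \<subseteq> J" using setM l by (metis set_mset_mset)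
      moreover have "\<forall>i\<in>I. count (mset l) (Some i) = k i"
        unfolding l cM by (auto simp: J_def K_def)
      ultimately show "l \<in> L" by (simp add: L_def)
    qed
    have prod_l: "(\<Prod>j<n. q (l ! j)) = (\<Prod>a\<in>J. q a ^ K a)" if "l \<in> L" for l
    proof -
      have "mset l = M" using that LM by (simp add: permutations_of_multiset_def)
      have "(\<Prod>j<length l. q (l ! j)) = prod_mset (image_mset q (mset l))"
        by (induction l rule: rev_induct) (auto simp: nth_append)
      also have "\<dots> = (\<Prod>a\<in>set_mset M. q a ^ count M a)"
        unfolding \<open>mset l = M\<close> by (rule image_prod_mset_multiplicity)
      also have "\<dots> = (\<Prod>a\<in>J. q a ^ count M a)"
        using setM finJ by (intro prod.mono_neutral_left) (auto simp: not_in_iff)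
      also have "\<dots> = (\<Prod>a\<in>J. q a ^ K a)" by (intro prod.cong) (auto simp: cM)
      finally show ?thesis using that by (simp add: L_def)
    qed
    have cardL: "real (card L) * (\<Prod>a\<in>J. fact (K a)) = fact n"
    proof -
      have "(\<Prod>x\<in>set_mset M. fact (count M x) :: nat) = (\<Prod>a\<in>J. fact (count M a))"
        using setM finJ by (intro prod.mono_neutral_left) (auto simp: not_in_iff)
      also have "\<dots> = (\<Prod>a\<in>J. fact (K a))" by (intro prod.cong) (auto simp: cM)
      finally have "card L * (\<Prod>a\<in>J. fact (K a)) = fact n"
        using card_permutations_of_multiset_aux[of M] by (simp add: LM sM)
      then have "real (card L * (\<Prod>a\<in>J. fact (K a))) = real (fact n)" by (rule arg_cong)
      then show ?thesis by simp
    qed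
    have "measure ?P ?E = real (card L) * (\<Prod>a\<in>J. q a ^ K a)"
      unfolding main using prod_l by simp
    also have "\<dots> = fact n / (\<Prod>a\<in>J. fact (K a)) * (\<Prod>a\<in>J. q a ^ K a)"
      using cardL finJ by (simp add: eq_divide_eq)
    also have "\<dots> = fact n * (\<Prod>a\<in>J. q a ^ K a / fact (K a))"
      by (simp add: prod_dividef)
    finally show ?thesis using False
      unfolding pr by (simp add: qN qS K_def m_def)
  qed
qed

lemma poisson_process_is_poisson:
  assumes t: "t \<ge> 0" and \<nu>: "prob_space \<nu>"
  shows "poisson_process_law (scale_measure (ennreal t) \<nu>) (poisson_process t \<nu>)"
proof -
  interpret prob_space \<nu> by fact
  let ?\<Lambda> = "scale_measure (ennreal t) \<nu>"
  let ?C = "configurations \<nu>"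
  let ?F = "\<lambda>k::nat. \<lambda>x. image_mset x (mset_set {..<k})"
  let ?D = "\<lambda>k. distr (Pi\<^sub>M {..<k} (\<lambda>_. \<nu>)) ?C (?F k)"
  have psD: "prob_space (?D k)" for k
    by (intro prob_space.prob_space_distr prob_space_PiM \<nu> measurable_configuration)
  have f: "?D \<in> measurable (measure_pmf (poisson_count t)) (subprob_algebra ?C)"
    by (auto simp: space_subprob_algebra intro!: prob_space_imp_subprob_space psD)
  have conf: "configurations ?\<Lambda> = ?C"
    by (simp add: configurations_def space_scale_measure)
  have sets: "sets (poisson_process t \<nu>) = sets ?C"
    unfolding poisson_process_def by (rule sets_bind) auto
  have space: "space (poisson_process t \<nu>) = space ?C"
    by (rule sets_eq_imp_space_eq[OF sets])
  have ps: "prob_space (poisson_process t \<nu>)"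
    unfolding poisson_process_def
    by (rule measure_pmf.prob_space_bind[OF _ f]) (auto simp: psD)
  have fm: "finite_measure ?\<Lambda>"
    by (rule finite_measureI) (simp add: emeasure_space_1 space_scale_measure)
  have m\<Lambda>: "measure ?\<Lambda> X = t * measure \<nu> X" for X
    using t by (simp add: measure_def enn2real_mult)
  show ?thesis
    unfolding poisson_process_law_def conf
  proof (intro conjI allI impI fm ps sets space)
    fix I :: "nat set" and B and k :: "nat \<Rightarrow> nat"
    assume I: "finite I" and B': "\<forall>i\<in>I. B i \<in> sets ?\<Lambda>" and dj: "disjoint_family_on B I"
    have B: "B i \<in> sets \<nu>" if "i \<in> I" for i using B' that by simp
    let ?X = "{\<xi> \<in> space ?C. \<forall>i\<in>I. points_in (B i) \<xi> = k i}"
    let ?K = "sum k I"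
    define p0 where "p0 = 1 - (\<Sum>i\<in>I. measure \<nu> (B i))"
    define R where "R = (\<Prod>i\<in>I. measure \<nu> (B i) ^ k i / fact (k i))"
    have "measure \<nu> (\<Union>i\<in>I. B i) = (\<Sum>i\<in>I. measure \<nu> (B i))"
      by (rule finite_measure_finite_Union) (use I B dj in auto)
    then have p0: "p0 \<ge> 0" unfolding p0_def by (metis prob_le_1 diff_ge_0_iff_ge)
    have R0: "R \<ge> 0" unfolding R_def by (intro prod_nonneg) auto
    have X: "?X \<in> sets ?C"
    proof -
      have "{\<xi> \<in> space ?C. points_in (B i) \<xi> = k i} \<in> sets ?C" if "i \<in> I" for i
        using measurable_sets[OF measurable_points_in[OF B[OF that]], of "{k i}"]
        by (simp add: vimage_def Int_def conj_commute)
      then show ?thesis using I by (intro sets.sets_Collect_finite_All) auto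
    qed
    define g where "g n = (if n < ?K then 0 else fact n / fact (n - ?K) * p0 ^ (n - ?K) * R)" for n
    have g: "measure (?D n) ?X = g n" for n
    proof -
      have "measure (?D n) ?X = measure (Pi\<^sub>M {..<n} (\<lambda>_. \<nu>)) (?F n -` ?X \<inter> space (Pi\<^sub>M {..<n} (\<lambda>_. \<nu>)))"
        by (rule measure_distr[OF measurable_configuration X])
      also have "?F n -` ?X \<inter> space (Pi\<^sub>M {..<n} (\<lambda>_. \<nu>)) = {x \<in> space (Pi\<^sub>M {..<n} (\<lambda>_. \<nu>)).
          \<forall>i\<in>I. (\<Sum>j<n. if x j \<in> B i then 1 else 0) = k i}"
        by (auto simp: points_in_image_mset space_configurations space_PiM)
      also have "measure (Pi\<^sub>M {..<n} (\<lambda>_. \<nu>)) \<dots> = g n"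
        unfolding g_def p0_def R_def by (rule multinomial_aux[OF \<nu> I B dj])
      finally show ?thesis .
    qed
    have g0: "g n \<ge> 0" for n unfolding g[symmetric] by (rule measure_nonneg)
    have s: "(\<lambda>n. pmf (poisson_count t) n * g n) sums (t ^ ?K * exp (- t) * R * exp (t * p0))"
    proof -
      have "(\<lambda>m. t ^ ?K * exp (- t) * R * ((t * p0) ^ m / fact m)) sums
          (t ^ ?K * exp (- t) * R * exp (t * p0))"
        using exp_converges[of "t * p0"] by (intro sums_mult) (simp add: divide_inverse mult.commute)
      also have "(\<lambda>m. t ^ ?K * exp (- t) * R * ((t * p0) ^ m / fact m)) =
          (\<lambda>m. pmf (poisson_count t) (m + ?K) * g (m + ?K))"
        by (rule ext) (simp add: pmf_poisson_count[OF t] g_def power_add power_mult_distrib)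
      finally show ?thesis
        by (subst (asm) sums_iff_shift) (simp add: g_def)
    qed
    have "emeasure (poisson_process t \<nu>) ?X =
        (\<integral>\<^sup>+n. emeasure (?D n) ?X \<partial>measure_pmf (poisson_count t))"
      unfolding poisson_process_def by (rule emeasure_bind[OF _ f X]) auto
    also have "\<dots> = (\<integral>\<^sup>+n. ennreal (g n) \<partial>measure_pmf (poisson_count t))"
      by (intro nn_integral_cong)
        (simp add: finite_measure.emeasure_eq_measure[OF prob_space.finite_measure[OF psD]] g)
    also have "\<dots> = (\<Sum>n. ennreal (pmf (poisson_count t) n * g n))"
      by (simp add: nn_integral_measure_pmf nn_integral_count_space_nat ennreal_mult g0)
    also have "\<dots> = ennreal (t ^ ?K * exp (- t) * R * exp (t * p0))"
      using s g0 by (subst suminf_ennreal2) (auto simp: sums_iff)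
    finally have "measure (poisson_process t \<nu>) ?X = t ^ ?K * exp (- t) * R * exp (t * p0)"
      using t R0 by (simp add: measure_def)
    also have "\<dots> = t ^ ?K * R * exp (- (\<Sum>i\<in>I. t * measure \<nu> (B i)))"
      by (simp add: p0_def sum_distrib_left algebra_simps flip: exp_add)
    also have "exp (- (\<Sum>i\<in>I. t * measure \<nu> (B i))) = (\<Prod>i\<in>I. exp (- (t * measure \<nu> (B i))))"
      using exp_sum[OF I, of "\<lambda>i. - (t * measure \<nu> (B i))"] by (simp add: sum_negf)
    also have "t ^ ?K = (\<Prod>i\<in>I. t ^ k i)" by (rule power_sum)
    also have "(\<Prod>i\<in>I. t ^ k i) * R * (\<Prod>i\<in>I. exp (- (t * measure \<nu> (B i)))) =
        (\<Prod>i\<in>I. measure ?\<Lambda> (B i) ^ k i / fact (k i) * exp (- measure ?\<Lambda> (B i)))"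
      unfolding R_def prod.distrib[symmetric] by (simp add: m\<Lambda> power_mult_distrib)
    finally show "measure (poisson_process t \<nu>)
        {\<xi> \<in> space (poisson_process t \<nu>). \<forall>i\<in>I. points_in (B i) \<xi> = k i} =
        (\<Prod>i\<in>I. measure ?\<Lambda> (B i) ^ k i / fact (k i) * exp (- measure ?\<Lambda> (B i)))"
      by (simp add: space)
  qed
qed


section \<open>The random loop model\<close>

datatype mark = Cross | Bar

text \<open>The circle \<open>\<real>/\<int>\<close> is represented by \<open>[0,1)\<close>, with \<^const>\<open>frac\<close> as projection from \<open>\<real>\<close>.\<close>

definition mark_law :: "real \<Rightarrow> (real \<times> mark) measure" where
  "mark_law u = restrict_space lborel {0..<1} \<Otimes>\<^sub>M
     measure_pmf (map_pmf (\<lambda>b. if b then Cross else Bar) (bernoulli_pmf u))"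

lemma prob_space_mark_law: "prob_space (mark_law u)"
proof -
  have "prob_space (restrict_space lborel {0..<1::real})"
    by (rule prob_spaceI) (simp add: space_restrict_space emeasure_restrict_space)
  then interpret a: prob_space "restrict_space lborel {0..<1::real}" .
  interpret pair_prob_space "restrict_space lborel {0..<1::real}"
    "measure_pmf (map_pmf (\<lambda>b. if b then Cross else Bar) (bernoulli_pmf u))"
    by unfold_locales
  show ?thesis unfolding mark_law_def by unfold_locales
qed

type_synonym 'v marking = "'v set \<Rightarrow> (real \<times> mark) multiset"

definition marking_law :: "'v set set \<Rightarrow> real \<Rightarrow> real \<Rightarrow> 'v marking measure" where
  "marking_law E t u = Pi\<^sub>M E (\<lambda>_. poisson_process t (mark_law u))"

definition mark_at ::
    "'v set set \<Rightarrow> 'v marking \<Rightarrow> 'v \<Rightarrow> 'v \<Rightarrow> real \<Rightarrow> mark \<Rightarrow> bool" where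
  "mark_at E \<omega> x y s m \<longleftrightarrow> {x, y} \<in> E \<and> (s, m) \<in># \<omega> {x, y}"

text \<open>Starting at time \<open>s\<close> and moving in direction \<open>\<delta>\<close> (\<open>1\<close> or \<open>-1\<close>), no mark at \<open>x\<close> is met
  strictly between \<open>s\<close> and \<open>s + \<delta> h\<close>.\<close>

definition free_flight ::
    "'v set set \<Rightarrow> 'v marking \<Rightarrow> 'v \<Rightarrow> real \<Rightarrow> real \<Rightarrow> real \<Rightarrow> bool" where
  "free_flight E \<omega> x s \<delta> h \<longleftrightarrow>
     (\<forall>r y m. 0 < r \<longrightarrow> r < h \<longrightarrow> \<not> mark_at E \<omega> x y (frac (s + \<delta> * r)) m)"

text \<open>A state \<open>(x, s, \<delta>)\<close> is a particle leaving \<open>(x, s)\<close> in direction \<open>\<delta>\<close>. The relation lists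
  the initial state of a trajectory and its states directly after each jump.\<close>

inductive trajectory ::
    "'v set set \<Rightarrow> 'v marking \<Rightarrow> 'v \<times> real \<times> real \<Rightarrow> 'v \<times> real \<times> real \<Rightarrow> bool"
  for E \<omega> \<sigma> where
  start: "trajectory E \<omega> \<sigma> \<sigma>"
| jump: "trajectory E \<omega> \<sigma> (x, s, \<delta>) \<Longrightarrow> 0 < h \<Longrightarrow> free_flight E \<omega> x s \<delta> h \<Longrightarrow>
    mark_at E \<omega> x y (frac (s + \<delta> * h)) m \<Longrightarrow>
    trajectory E \<omega> \<sigma> (y, frac (s + \<delta> * h), (if m = Cross then \<delta> else - \<delta>))"

text \<open>The points visited by the trajectory. Each vertical piece contains both of its end points,
  so that the two orientations of a trajectory give the same set.\<close>

definition loop_from ::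
    "'v set set \<Rightarrow> 'v marking \<Rightarrow> 'v \<times> real \<times> real \<Rightarrow> ('v \<times> real) set" where
  "loop_from E \<omega> \<sigma> = {(x, frac (s + \<delta> * h)) | x s \<delta> h.
     trajectory E \<omega> \<sigma> (x, s, \<delta>) \<and> 0 \<le> h \<and> free_flight E \<omega> x s \<delta> h}"

definition loops :: "'v set \<Rightarrow> 'v set set \<Rightarrow> 'v marking \<Rightarrow> ('v \<times> real) set set" where
  "loops V E \<omega> = {loop_from E \<omega> (x, s, \<delta>) | x s \<delta>. x \<in> V \<and> s \<in> {0..<1} \<and> \<delta> \<in> {1, -1}}"

definition num_loops :: "'v set \<Rightarrow> 'v set set \<Rightarrow> 'v marking \<Rightarrow> nat" where
  "num_loops V E \<omega> = card (loops V E \<omega>)"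

definition loop_support :: "('v \<times> real) set \<Rightarrow> 'v set" where
  "loop_support \<gamma> = {x. \<exists>s. (x, s) \<in> \<gamma>}"

definition partition_function ::
    "'v set \<Rightarrow> 'v set set \<Rightarrow> real \<Rightarrow> real \<Rightarrow> real \<Rightarrow> real" where
  "partition_function V E \<theta> t u = (\<integral>\<omega>. \<theta> ^ num_loops V E \<omega> \<partial>marking_law E t u)"

definition loop_measure ::
    "'v set \<Rightarrow> 'v set set \<Rightarrow> real \<Rightarrow> real \<Rightarrow> real \<Rightarrow> 'v marking measure" where
  "loop_measure V E \<theta> t u = density (marking_law E t u)
     (\<lambda>\<omega>. ennreal (\<theta> ^ num_loops V E \<omega> / partition_function V E \<theta> t u))"

definition large_loop :: "'v set \<Rightarrow> 'v set set \<Rightarrow> real \<Rightarrow> 'v marking \<Rightarrow> bool" where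
  "large_loop V E \<eta> \<omega> \<longleftrightarrow>
     (\<exists>\<gamma>\<in>loops V E \<omega>. real (card (loop_support \<gamma>)) > \<eta> * real (card V))"

definition large_loop_prob ::
    "'v set \<Rightarrow> 'v set set \<Rightarrow> real \<Rightarrow> real \<Rightarrow> real \<Rightarrow> real \<Rightarrow> real" where
  "large_loop_prob V E \<theta> t u \<eta> = \<P>(\<omega> in loop_measure V E \<theta> t u. large_loop V E \<eta> \<omega>)"

definition time_averaged_prob ::
    "'v set \<Rightarrow> 'v set set \<Rightarrow> real \<Rightarrow> real \<Rightarrow> real \<Rightarrow> real \<Rightarrow> real \<Rightarrow> real" where
  "time_averaged_prob V E \<theta> u \<eta> a s =
     1 / s * (LBINT t:{a..a + s}. large_loop_prob V E \<theta> t u \<eta>)"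

definition loop_threshold :: "real \<Rightarrow> real \<Rightarrow> real" where
  "loop_threshold \<theta> u = 1 + \<theta> * max u (1 - u)"


section \<open>Random graphs on \<open>{1..n}\<close>\<close>

text \<open>A graph on \<open>{1..n}\<close> is given by its set of edges.\<close>

definition all_edges :: "nat \<Rightarrow> nat set set" where
  "all_edges n = {e. e \<subseteq> {1..n} \<and> card e = 2}"

definition regular_graphs :: "nat \<Rightarrow> nat \<Rightarrow> nat set set set" where
  "regular_graphs d n = {E. E \<subseteq> all_edges n \<and> (\<forall>v\<in>{1..n}. card {e \<in> E. v \<in> e} = d)}"

definition random_regular_graph :: "nat \<Rightarrow> nat \<Rightarrow> nat set set pmf" where
  "random_regular_graph d n = pmf_of_set (regular_graphs d n)"

definition erdos_renyi_graph :: "nat \<Rightarrow> real \<Rightarrow> nat set set pmf" where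
  "erdos_renyi_graph n p =
     map_pmf (\<lambda>present. {e \<in> all_edges n. present e})
       (Pi_pmf (all_edges n) False (\<lambda>_. bernoulli_pmf p))"

definition half_edges :: "nat \<Rightarrow> (nat \<Rightarrow> nat) \<Rightarrow> (nat \<times> nat) set" where
  "half_edges n d = (SIGMA i:{1..n}. {..<d i})"

definition pairings :: "'h set \<Rightarrow> 'h set set set" where
  "pairings H = {\<pi>. \<Union>\<pi> = H \<and> disjoint \<pi> \<and> (\<forall>b\<in>\<pi>. card b = 2)}"

text \<open>A pair \<open>b\<close> of half-edges becomes an edge with set of end points \<open>fst ` b\<close>, a singleton
  if the edge is a self-loop. The pairing \<open>\<pi>\<close> thereby represents the random multigraph.\<close>

definition simple_pairing :: "(nat \<times> nat) set set \<Rightarrow> bool" where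
  "simple_pairing \<pi> \<longleftrightarrow> (\<forall>b\<in>\<pi>. card (fst ` b) = 2) \<and> inj_on (\<lambda>b. fst ` b) \<pi>"

definition simple_configuration_graph :: "nat \<Rightarrow> (nat \<Rightarrow> nat) \<Rightarrow> nat set set pmf" where
  "simple_configuration_graph n d =
     map_pmf (\<lambda>\<pi>. (\<lambda>b. fst ` b) ` \<pi>)
       (cond_pmf (pmf_of_set (pairings (half_edges n d))) {\<pi>. simple_pairing \<pi>})"

end

theory Submission
  imports Defs "HOL-Real_Asymp.Real_Asymp"
begin

text \<open>
  Write \<open>V\<close>, \<open>n\<close>, \<open>m\<close> for the vertex set, its size and the number of edges, \<open>c\<close> for
  \<^const>\<open>loop_threshold\<close>, and \<open>g(t)\<close> for the probability of a large loop under the weighted measure.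
  The proof compares two bounds on the growth of the logarithm of the partition function \<open>Z(t)\<close> over
  a time interval of length \<open>s\<close>.

  A configuration of marks is, up to an orientation preserving homeomorphism of the circle that fixes
  \<open>0\<close>, a word of pairs (edge, mark), and loops only depend on this word. Under the Poisson law a given
  word of length \<open>k\<close> has probability \<open>exp (- t m) t^k / k!\<close> times a product of weights \<open>u\<close> and
  \<open>1 - u\<close>, so \<open>Z(t) exp (t m)\<close> is an exponential generating function whose coefficients are
  weighted sums of \<open>\<theta> ^ \<lambda>(w)\<close> over words \<open>w\<close>. Its derivative is controlled by what happens to the number
  of loops when one letter on an edge \<open>{x, y}\<close> is appended. If \<open>(x, 0)\<close> and \<open>(y, 0)\<close> lie on
  different loops, these are merged and \<open>\<lambda>\<close> decreases by one. If they lie on the same loop, a parity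
  argument shows that at most one of the two kinds of marks splits it, while the other does not
  increase \<open>\<lambda>\<close> (lemma \<open>append_letter\<close>). Hence only edges of the second kind can make the quantity
  \<open>H = (ln Z(t)) / (\<theta> - 1)\<close> (for \<open>\<theta> = 1\<close>: the expected number of loops) increase, and
  they do so at rate at most \<open>max u (1 - u)\<close>, whereas the others decrease it at rate \<open>1 / \<theta>\<close>.

  Without large loops, the vertices that a loop visits at time \<open>0\<close> form a set of size at most
  \<open>\<eta> n\<close>. If such sets \<open>S\<close> span at most \<open>(1 + \<epsilon>) |S|\<close> edges, then at most \<open>(1 + \<epsilon>) n\<close> edges
  join two points of the same loop, and \<open>\<theta> H' \<le> - m + c (1 + \<epsilon>) n + c m g(t)\<close>. On the other hand,
  appending letters destroys at most the \<open>n\<close> loops through time \<open>0\<close>, so \<open>H\<close> decreases by at most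
  a constant times \<open>n\<close> on any time interval, however long. As \<open>m > c (1 + \<epsilon>) n\<close>, a fixed and
  sufficiently long interval forces the average of \<open>g\<close> to be bounded below
  (\<open>time_average_bound\<close>). This is a statement on a fixed graph.

  It remains to see that the random graphs are sparse on small sets and have more than \<open>c n\<close> edges.
  Sparsity follows by a union bound from the estimate \<open>P(F \<subseteq> E) \<le> (C / n) ^ |F|\<close> for
  \<open>|F|\<close> up to a multiple of \<open>n\<close> (\<open>sparse_whp\<close>). This estimate is independence for
  Erdos-Renyi graphs, and for the configuration model it comes from switching two pairs of half-edges
  (\<open>switching_count\<close>). Every graph with the prescribed degrees comes from the same number of simple
  pairings (\<open>card_fibre\<close>), so that the uniform regular graph is a special case.
\<close>

section \<open>Reparametrising time\<close>

text \<open>These are the lifts to the real line of the orientation preserving homeomorphisms of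
  the circle that fix \<open>0\<close>.\<close>

definition circle_lift :: "(real \<Rightarrow> real) \<Rightarrow> bool" where
  "circle_lift \<phi> \<longleftrightarrow> strict_mono \<phi> \<and> surj \<phi> \<and> \<phi> 0 = 0 \<and> (\<forall>y. \<phi> (y + 1) = \<phi> y + 1)"

lemma circle_lift_int:
  assumes "circle_lift \<phi>" shows "\<phi> (y + of_int k) = \<phi> y + of_int k"
proof (induction k rule: int_induct[where k = 0])
  case (step1 i)
  have "\<phi> (y + of_int i + 1) = \<phi> (y + of_int i) + 1" using assms by (simp add: circle_lift_def)
  then show ?case using step1 by (simp add: algebra_simps)
next
  case (step2 i)
  have "\<phi> (y + of_int (i - 1) + 1) = \<phi> (y + of_int (i - 1)) + 1"
    using assms unfolding circle_lift_def by blast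
  then show ?case using step2 by (simp add: algebra_simps)
qed simp

lemma circle_lift_range:
  assumes "circle_lift \<phi>" "s \<in> {0..<1}" shows "\<phi> s \<in> {0..<1}"
proof -
  have "\<phi> 1 = 1" using circle_lift_int[OF assms(1), of 0 1] assms(1) by (simp add: circle_lift_def)
  then show ?thesis
    using assms strict_mono_less_eq[of \<phi> 0 s] strict_mono_less[of \<phi> s 1] by (auto simp: circle_lift_def)
qed

lemma circle_lift_frac:
  assumes "circle_lift \<phi>" shows "frac (\<phi> y) = \<phi> (frac y)"
proof -
  have "\<phi> y = \<phi> (frac y + of_int \<lfloor>y\<rfloor>)" by (simp add: frac_def)
  also have "\<dots> = \<phi> (frac y) + of_int \<lfloor>y\<rfloor>" by (rule circle_lift_int[OF assms])
  finally have *: "\<phi> y = \<phi> (frac y) + of_int \<lfloor>y\<rfloor>" .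
  have "\<phi> (frac y) \<in> {0..<1}" by (rule circle_lift_range[OF assms]) (simp add: frac_lt_1)
  with * show ?thesis by (simp add: frac_unique_iff)
qed

lemma circle_lift_inv:
  assumes "circle_lift \<phi>" shows "circle_lift (inv \<phi>)"
proof -
  have inj: "inj \<phi>" and sur: "surj \<phi>" and sm: "strict_mono \<phi>"
    using assms by (auto simp: circle_lift_def strict_mono_imp_inj_on)
  have ff: "\<phi> (inv \<phi> y) = y" for y using sur by (simp add: surj_f_inv_f)
  have "inv \<phi> (y + 1) = inv \<phi> y + 1" for y
    using assms inj_eq[OF inj] ff by (metis circle_lift_def)
  moreover have "inv \<phi> 0 = 0" using assms inj by (metis circle_lift_def inv_f_f)
  moreover have "strict_mono (inv \<phi>)"
    by (rule strict_monoI) (metis ff sm strict_mono_less)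
  moreover have "surj (inv \<phi>)" using inj by (simp add: inj_imp_surj_inv)
  ultimately show ?thesis by (simp add: circle_lift_def)
qed

text \<open>Two subdivisions of the circle into the same number of arcs differ by a piecewise
  linear reparametrisation. It is written as a sum of clamped linear functions, one for each
  arc, which makes continuity immediate.\<close>

lemma circle_lift_exists:
  fixes p q :: "nat \<Rightarrow> real"
  assumes k: "0 < k"
    and p: "\<And>j. j < k \<Longrightarrow> p j < p (Suc j)" "p 0 = 0" "p k = 1"
    and q: "\<And>j. j < k \<Longrightarrow> q j < q (Suc j)" "q 0 = 0" "q k = 1"
  shows "\<exists>\<phi>. circle_lift \<phi> \<and> (\<forall>j<k. \<phi> (p j) = q j)"
proof -
  define g where "g j y = max 0 (min 1 ((y - p j) / (p (Suc j) - p j)))" for j y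
  define \<psi> where "\<psi> y = (\<Sum>j<k. (q (Suc j) - q j) * g j y)" for y
  have p_le: "p i \<le> p j" if "i \<le> j" "j \<le> k" for i j
    using that(1,2) by (induction rule: dec_induct) (auto intro: order_trans[OF _ less_imp_le[OF p(1)]])
  have g_mono: "g j y \<le> g j z" if "y \<le> z" "j < k" for j y z
    unfolding g_def using that p(1)[of j] by (intro max.mono min.mono divide_right_mono) auto
  have \<psi>p: "\<psi> (p i) = q i" if "i \<le> k" for i
  proof -
    have "\<psi> (p i) = (\<Sum>j<k. if j < i then q (Suc j) - q j else 0)"
      unfolding \<psi>_def
    proof (rule sum.cong[OF refl])
      fix j assume "j \<in> {..<k}"
      then have j: "j < k" by simp
      show "(q (Suc j) - q j) * g j (p i) = (if j < i then q (Suc j) - q j else 0)"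
      proof (cases "j < i")
        case True
        then have "p (Suc j) \<le> p i" using that by (intro p_le) auto
        then have "g j (p i) = 1" unfolding g_def using p(1)[OF j] by (simp add: field_simps)
        with True show ?thesis by simp
      next
        case False
        then have "p i \<le> p j" using j by (intro p_le) auto
        then have "g j (p i) = 0" unfolding g_def using p(1)[OF j]
          by (simp add: field_simps divide_nonpos_pos)
        with False show ?thesis by simp
      qed
    qed
    also have "\<dots> = (\<Sum>j\<in>{..<i}. q (Suc j) - q j)"
      using that by (simp add: sum.If_cases Int_def)
        (rule arg_cong[where f = "\<lambda>A. sum _ A"], auto)
    also have "\<dots> = q i" using q(2) by (simp add: sum_lessThan_telescope)
    finally show ?thesis .
  qed
  have \<psi>0: "\<psi> 0 = 0" and \<psi>1: "\<psi> 1 = 1" using \<psi>p[of 0] \<psi>p[of k] p q by auto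
  have \<psi>_less: "\<psi> y < \<psi> z" if "0 \<le> y" "y < z" "z \<le> 1" for y z
  proof -
    define j where "j = Max {j. j \<le> k \<and> p j \<le> y}"
    have fin: "finite {j. j \<le> k \<and> p j \<le> y}" by simp
    have "0 \<in> {j. j \<le> k \<and> p j \<le> y}" using p(2) that by simp
    then have j: "j \<le> k" "p j \<le> y" using Max_in[OF fin] unfolding j_def by blast+
    have jk: "j < k"
    proof (rule ccontr)
      assume "\<not> j < k" then have "j = k" using j by simp
      then show False using j p(3) that by simp
    qed
    have "y < p (Suc j)"
    proof (rule ccontr)
      assume "\<not> y < p (Suc j)"
      then have "Suc j \<in> {j. j \<le> k \<and> p j \<le> y}" using jk by simp
      then have "Suc j \<le> j" using Max_ge[OF fin] unfolding j_def by blast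
      then show False by simp
    qed
    have pos: "p (Suc j) - p j > 0" using p(1)[OF jk] by simp
    have a: "0 \<le> (y - p j) / (p (Suc j) - p j)" "(y - p j) / (p (Suc j) - p j) < 1"
      using pos j \<open>y < p (Suc j)\<close> by auto
    have b: "(y - p j) / (p (Suc j) - p j) < (z - p j) / (p (Suc j) - p j)"
      using that pos by (intro divide_strict_right_mono) auto
    have "g j y < g j z" unfolding g_def using a b by auto
    then have "(q (Suc j) - q j) * g j y < (q (Suc j) - q j) * g j z"
      using q(1)[OF jk] by simp
    then show ?thesis unfolding \<psi>_def
      using that jk q(1) by (intro sum_strict_mono_ex1) (auto intro!: mult_left_mono g_mono less_imp_le[OF q(1)])
  qed
  have cont: "continuous_on {0..1} \<psi>" unfolding \<psi>_def g_def
    by (intro continuous_intros) (use p(1) in \<open>auto simp: less_le\<close>, metis less_irrefl p(1))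
  define \<phi> where "\<phi> y = of_int \<lfloor>y\<rfloor> + \<psi> (frac y)" for y
  have range: "0 \<le> \<psi> y \<and> \<psi> y < 1" if "0 \<le> y" "y < 1" for y
    using \<psi>_less[of 0 y] \<psi>_less[of y 1] that \<psi>0 \<psi>1 by (cases "y = 0") auto
  have "strict_mono \<phi>"
  proof (rule strict_monoI)
    fix y z :: real assume "y < z"
    show "\<phi> y < \<phi> z"
    proof (cases "\<lfloor>y\<rfloor> = \<lfloor>z\<rfloor>")
      case True
      then have "frac y < frac z" using \<open>y < z\<close> by (simp add: frac_def)
      then show ?thesis unfolding \<phi>_def True
        using \<psi>_less[of "frac y" "frac z"] frac_lt_1[of z] by simp
    next
      case False
      then have "\<lfloor>y\<rfloor> + 1 \<le> \<lfloor>z\<rfloor>" using \<open>y < z\<close> floor_mono[of y z] by linarith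
      then have "real_of_int \<lfloor>y\<rfloor> + 1 \<le> of_int \<lfloor>z\<rfloor>" by linarith
      then show ?thesis unfolding \<phi>_def
        using range[of "frac y"] range[of "frac z"] frac_lt_1[of z] frac_lt_1[of y] by auto
    qed
  qed
  moreover have "surj \<phi>"
    unfolding surj_def
  proof
    fix y
    show "\<exists>x. y = \<phi> x"
    proof -
      have "\<exists>x\<ge>0. x \<le> 1 \<and> \<psi> x = frac y"
        by (rule IVT') (use \<psi>0 \<psi>1 cont frac_lt_1[of y] in auto)
      then obtain x where x: "0 \<le> x" "x \<le> 1" "\<psi> x = frac y" by auto
      with \<psi>1 frac_lt_1[of y] have "x < 1" by (cases "x = 1") auto
      with x have "\<lfloor>x\<rfloor> = 0" by (simp add: floor_eq_iff)
      with x have "\<phi> (x + of_int \<lfloor>y\<rfloor>) = y" by (simp add: \<phi>_def frac_def)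
      then show ?thesis by metis
    qed
  qed
  moreover have "\<phi> 0 = 0" "\<phi> (y + 1) = \<phi> y + 1" for y using \<psi>0 by (auto simp: \<phi>_def frac_def)
  moreover have "\<phi> (p j) = q j" if "j < k" for j
  proof -
    have "p j < p (Suc j)" "p (Suc j) \<le> p k" "p 0 \<le> p j" using that p p_le[of "Suc j" k] p_le[of 0 j] by auto
    then have "0 \<le> p j" "p j < 1" using p by auto
    then have "\<lfloor>p j\<rfloor> = 0" by (simp add: floor_eq_iff)
    then show ?thesis using \<psi>p[of j] that by (simp add: \<phi>_def frac_def)
  qed
  ultimately show ?thesis unfolding circle_lift_def by blast
qed

lemma trajectory_range:
  assumes "trajectory E \<omega> \<sigma> \<tau>" "fst (snd \<sigma>) \<in> {0..<1}" "snd (snd \<sigma>) \<in> {1, -1}"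
  shows "fst (snd \<tau>) \<in> {0..<1} \<and> snd (snd \<tau>) \<in> {1, -1}"
  using assms by (induction rule: trajectory.induct) (auto simp: frac_lt_1)

text \<open>A reparametrisation of time does not preserve durations, so the flight of length
  \<open>h\<close> corresponds to one of another length \<open>h'\<close>; only its end point is
  transported.\<close>

lemma free_flight_lift:
  assumes \<phi>: "circle_lift \<phi>"
    and m: "\<And>x y s m. s \<in> {0..<1} \<Longrightarrow> mark_at E \<omega>' x y (\<phi> s) m \<Longrightarrow> mark_at E \<omega> x y s m"
    and \<delta>: "\<delta> \<in> {1, -1}" and h: "0 \<le> h" and f: "free_flight E \<omega> x s \<delta> h"
  obtains h' where "0 \<le> h'" "0 < h \<Longrightarrow> 0 < h'" "free_flight E \<omega>' x (\<phi> s) \<delta> h'"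
    "\<phi> s + \<delta> * h' = \<phi> (s + \<delta> * h)"
proof -
  have sm: "strict_mono \<phi>" and sj: "surj \<phi>" using \<phi> by (auto simp: circle_lift_def)
  define h' where "h' = \<delta> * (\<phi> (s + \<delta> * h) - \<phi> s)"
  have dd: "\<delta> * (\<delta> * z) = z" for z using \<delta> by auto
  have eq: "\<phi> s + \<delta> * h' = \<phi> (s + \<delta> * h)" unfolding h'_def dd by simp
  have lt: "r < r' \<longleftrightarrow> \<delta> * (\<phi> (s + \<delta> * r) - \<phi> s) < \<delta> * (\<phi> (s + \<delta> * r') - \<phi> s)" for r r'
    using \<delta> strict_mono_less[OF sm] by auto
  have h'0: "0 \<le> h'" using lt[of h 0] h unfolding h'_def by auto
  have h'1: "0 < h'" if "0 < h" using lt[of 0 h] that unfolding h'_def by auto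
  have "free_flight E \<omega>' x (\<phi> s) \<delta> h'" unfolding free_flight_def
  proof (intro allI impI notI)
    fix r' y mk assume r': "0 < r'" "r' < h'" and mk: "mark_at E \<omega>' x y (frac (\<phi> s + \<delta> * r')) mk"
    obtain z where z: "\<phi> s + \<delta> * r' = \<phi> z" using sj by (metis surjD)
    define r where "r = \<delta> * (z - s)"
    have zr: "z = s + \<delta> * r" unfolding r_def dd by simp
    have r'r: "r' = \<delta> * (\<phi> (s + \<delta> * r) - \<phi> s)" using z zr dd[of r']
      by (metis add_diff_cancel_left')
    have "0 < r" using lt[of 0 r] r' r'r by simp
    moreover have "r < h" using lt[of r h] r' r'r unfolding h'_def by simp
    moreover have "mark_at E \<omega> x y (frac (s + \<delta> * r)) mk"
      using mk unfolding z circle_lift_frac[OF \<phi>] zr by (intro m) (auto simp: frac_lt_1)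
    ultimately show False using f unfolding free_flight_def by blast
  qed
  then show ?thesis using that eq h'0 h'1 by blast
qed

lemma loop_from_lift_subset:
  assumes \<phi>: "circle_lift \<phi>"
    and m: "\<And>x y s m. s \<in> {0..<1} \<Longrightarrow> mark_at E \<omega>' x y (\<phi> s) m \<longleftrightarrow> mark_at E \<omega> x y s m"
    and s: "s \<in> {0..<1}" and \<delta>: "\<delta> \<in> {1, -1}"
  shows "map_prod id \<phi> ` loop_from E \<omega> (x, s, \<delta>) \<subseteq> loop_from E \<omega>' (x, \<phi> s, \<delta>)"
proof -
  have tr: "trajectory E \<omega>' (x, \<phi> s, \<delta>) (map_prod id (map_prod \<phi> id) \<tau>)"
    if "trajectory E \<omega> (x, s, \<delta>) \<tau>" for \<tau>
    using that
  proof (induction rule: trajectory.induct)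
    case start
    then show ?case by (auto intro: trajectory.start)
  next
    case (jump x' s' \<delta>' h y mk)
    have \<delta>': "\<delta>' \<in> {1, -1}" using trajectory_range[OF jump(1)] s \<delta> by simp
    obtain h' where h': "0 \<le> h'" "0 < h \<Longrightarrow> 0 < h'" "free_flight E \<omega>' x' (\<phi> s') \<delta>' h'"
      "\<phi> s' + \<delta>' * h' = \<phi> (s' + \<delta>' * h)"
      using free_flight_lift[OF \<phi> _ \<delta>' _ jump(3), of \<omega>'] m jump(2) by (metis less_imp_le)
    have "mark_at E \<omega>' x' y (frac (\<phi> s' + \<delta>' * h')) mk"
      unfolding h' circle_lift_frac[OF \<phi>] using jump(4) by (subst m) (auto simp: frac_lt_1)
    from trajectory.jump[OF _ h'(2)[OF jump(2)] h'(3) this] jump(5)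
    show ?case by (simp add: h'(4) circle_lift_frac[OF \<phi>])
  qed
  show ?thesis
  proof
    fix z assume "z \<in> map_prod id \<phi> ` loop_from E \<omega> (x, s, \<delta>)"
    then obtain x' s' \<delta>' h where z: "z = (x', \<phi> (frac (s' + \<delta>' * h)))"
      and t: "trajectory E \<omega> (x, s, \<delta>) (x', s', \<delta>')" and h: "0 \<le> h" and f: "free_flight E \<omega> x' s' \<delta>' h"
      unfolding loop_from_def by auto
    have \<delta>': "\<delta>' \<in> {1, -1}" using trajectory_range[OF t] s \<delta> by simp
    obtain h' where h': "0 \<le> h'" "free_flight E \<omega>' x' (\<phi> s') \<delta>' h'"
      "\<phi> s' + \<delta>' * h' = \<phi> (s' + \<delta>' * h)"
      using free_flight_lift[OF \<phi> _ \<delta>' h f, of \<omega>'] m by metis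
    have "z = (x', frac (\<phi> s' + \<delta>' * h'))" unfolding z h'(3) circle_lift_frac[OF \<phi>] ..
    moreover have t': "trajectory E \<omega>' (x, \<phi> s, \<delta>) (x', \<phi> s', \<delta>')" using tr[OF t] by simp
    ultimately show "z \<in> loop_from E \<omega>' (x, \<phi> s, \<delta>)"
      unfolding loop_from_def using t' h'(1,2) by blast
  qed
qed

lemma loop_from_lift:
  assumes \<phi>: "circle_lift \<phi>"
    and m: "\<And>x y s m. s \<in> {0..<1} \<Longrightarrow> mark_at E \<omega>' x y (\<phi> s) m \<longleftrightarrow> mark_at E \<omega> x y s m"
    and s: "s \<in> {0..<1}" and \<delta>: "\<delta> \<in> {1, -1}"
  shows "loop_from E \<omega>' (x, \<phi> s, \<delta>) = map_prod id \<phi> ` loop_from E \<omega> (x, s, \<delta>)"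
proof
  have inj: "inj \<phi>" and sur: "surj \<phi>"
    using \<phi> by (auto simp: circle_lift_def strict_mono_imp_inj_on)
  note ff = surj_f_inv_f[OF sur] inv_f_f[OF inj]
  have "map_prod id (inv \<phi>) ` loop_from E \<omega>' (x, \<phi> s, \<delta>) \<subseteq> loop_from E \<omega> (x, inv \<phi> (\<phi> s), \<delta>)"
  proof (rule loop_from_lift_subset[OF circle_lift_inv[OF \<phi>] _ _ \<delta>])
    fix x y s mk assume "s \<in> {0..<1::real}"
    then have "inv \<phi> s \<in> {0..<1}" by (rule circle_lift_range[OF circle_lift_inv[OF \<phi>]])
    from m[OF this, of x y mk] show "mark_at E \<omega> x y (inv \<phi> s) mk = mark_at E \<omega>' x y s mk" by (simp add: ff)
  next
    show "\<phi> s \<in> {0..<1}" by (rule circle_lift_range[OF \<phi> s])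
  qed
  then have "map_prod id \<phi> ` map_prod id (inv \<phi>) ` loop_from E \<omega>' (x, \<phi> s, \<delta>)
      \<subseteq> map_prod id \<phi> ` loop_from E \<omega> (x, s, \<delta>)" by (intro image_mono) (simp add: ff)
  then show "loop_from E \<omega>' (x, \<phi> s, \<delta>) \<subseteq> map_prod id \<phi> ` loop_from E \<omega> (x, s, \<delta>)"
    by (simp add: image_image map_prod_def split_def ff)
qed (rule loop_from_lift_subset[OF assms])

text \<open>The particle dynamics only depends on the cyclic order of the marks.\<close>

lemma loops_lift:
  assumes \<phi>: "circle_lift \<phi>"
    and m: "\<And>x y s m. s \<in> {0..<1} \<Longrightarrow> mark_at E \<omega>' x y (\<phi> s) m \<longleftrightarrow> mark_at E \<omega> x y s m"
  shows "loops V E \<omega>' = (\<lambda>\<gamma>. map_prod id \<phi> ` \<gamma>) ` loops V E \<omega>"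
proof (intro equalityI subsetI)
  fix \<gamma> assume "\<gamma> \<in> loops V E \<omega>'"
  then obtain x s \<delta> where g: "\<gamma> = loop_from E \<omega>' (x, s, \<delta>)" "x \<in> V" "s \<in> {0..<1}" "\<delta> \<in> {1, -1}"
    unfolding loops_def by auto
  have i: "inv \<phi> s \<in> {0..<1}" by (rule circle_lift_range[OF circle_lift_inv[OF \<phi>] g(3)])
  have "\<phi> (inv \<phi> s) = s" using \<phi> by (simp add: circle_lift_def surj_f_inv_f)
  with loop_from_lift[OF \<phi> m i g(4), of x]
  have "\<gamma> = map_prod id \<phi> ` loop_from E \<omega> (x, inv \<phi> s, \<delta>)" using g by simp
  then show "\<gamma> \<in> (\<lambda>\<gamma>. map_prod id \<phi> ` \<gamma>) ` loops V E \<omega>"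
    using g i unfolding loops_def by blast
next
  fix \<gamma> assume "\<gamma> \<in> (\<lambda>\<gamma>. map_prod id \<phi> ` \<gamma>) ` loops V E \<omega>"
  then obtain x s \<delta> where g: "\<gamma> = map_prod id \<phi> ` loop_from E \<omega> (x, s, \<delta>)" "x \<in> V" "s \<in> {0..<1}" "\<delta> \<in> {1, -1}"
    unfolding loops_def by auto
  then show "\<gamma> \<in> loops V E \<omega>'"
    using loop_from_lift[OF \<phi> m g(3,4), of x] circle_lift_range[OF \<phi> g(3)] unfolding loops_def by blast
qed

text \<open>The pattern \<open>Ls\<close> of a configuration records which marks occur at each
  of the successive times \<open>ts\<close>. Time \<open>0\<close> is always listed, possibly
  with an empty set of marks, because it has to be fixed by the reparametrisations. A pattern
  allows several marks at the same time: it thus exists for every configuration and not only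
  almost surely, which is what measurability requires.\<close>

definition has_pattern :: "'v set set \<Rightarrow> 'v marking \<Rightarrow> real list \<Rightarrow> ('v set \<times> mark) set list \<Rightarrow> bool" where
  "has_pattern E \<omega> ts Ls \<longleftrightarrow> length ts = length Ls \<and> Ls \<noteq> [] \<and> sorted_wrt (<) ts \<and> hd ts = 0 \<and> last ts < 1 \<and>
     (\<forall>e\<in>E. \<forall>s m. (s, m) \<in># \<omega> e \<longleftrightarrow> (\<exists>j<length Ls. s = ts ! j \<and> (e, m) \<in> Ls ! j))"

text \<open>A reparametrisation maps the times of one configuration to those of the other.\<close>

lemma same_pattern:
  assumes 1: "has_pattern E \<omega> ts Ls" and 2: "has_pattern E \<omega>' ts' Ls"
  shows "num_loops V E \<omega>' = num_loops V E \<omega>" "large_loop V E \<eta> \<omega>' = large_loop V E \<eta> \<omega>"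
proof -
  let ?k = "length Ls"
  define ext where "ext l j = (if j < ?k then l ! j else 1)" for l :: "real list" and j
  have ext: "\<And>j. j < ?k \<Longrightarrow> ext l j < ext l (Suc j)" "ext l 0 = 0" "ext l ?k = 1"
    if "has_pattern E \<omega>0 l Ls" for l \<omega>0
  proof -
    have l: "length l = ?k" "?k > 0" "sorted_wrt (<) l" "hd l = 0" "last l < 1"
      using that by (auto simp: has_pattern_def)
    show "ext l j < ext l (Suc j)" if "j < ?k" for j
    proof (cases "Suc j < ?k")
      case True
      then show ?thesis using l by (auto simp: ext_def sorted_wrt_iff_nth_less)
    next
      case False
      then have "j = ?k - 1" using that by simp
      moreover from l have "l \<noteq> []" by auto
      ultimately show ?thesis using l that False by (auto simp: ext_def last_conv_nth)
    qed
    show "ext l 0 = 0" using l by (cases l) (auto simp: ext_def)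
    show "ext l ?k = 1" by (simp add: ext_def)
  qed
  have k: "0 < ?k" using 1 by (auto simp: has_pattern_def)
  obtain \<phi> where \<phi>: "circle_lift \<phi>" and pq: "\<And>j. j < ?k \<Longrightarrow> \<phi> (ext ts j) = ext ts' j"
    using circle_lift_exists[OF k ext(1)[OF 1] ext(2,3)[OF 1] ext(1)[OF 2] ext(2,3)[OF 2]] by blast
  have pq: "\<phi> (ts ! j) = ts' ! j" if "j < ?k" for j using pq[OF that] that by (simp add: ext_def)
  have inj: "inj \<phi>" using \<phi> by (auto simp: circle_lift_def strict_mono_imp_inj_on)
  have "mark_at E \<omega>' x y (\<phi> s) m \<longleftrightarrow> mark_at E \<omega> x y s m" for x y s m
  proof (cases "{x, y} \<in> E")
    case True
    have "(s, m) \<in># \<omega> {x, y} \<longleftrightarrow> (\<exists>j<?k. s = ts ! j \<and> ({x, y}, m) \<in> Ls ! j)"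
      "(\<phi> s, m) \<in># \<omega>' {x, y} \<longleftrightarrow> (\<exists>j<?k. \<phi> s = ts' ! j \<and> ({x, y}, m) \<in> Ls ! j)"
      using 1 2 True unfolding has_pattern_def by auto
    moreover have "s = ts ! j \<longleftrightarrow> \<phi> s = ts' ! j" if "j < ?k" for j
      using pq[OF that] inj_eq[OF inj, of s "ts ! j"] by simp
    ultimately show ?thesis unfolding mark_at_def using True by auto
  qed (simp add: mark_at_def)
  then have L: "loops V E \<omega>' = (\<lambda>\<gamma>. map_prod id \<phi> ` \<gamma>) ` loops V E \<omega>"
    by (intro loops_lift[OF \<phi>])
  have "inj (map_prod (id :: 'a \<Rightarrow> 'a) \<phi>)" by (rule prod.inj_map[OF inj_on_id inj])
  then have "inj ((`) (map_prod (id :: 'a \<Rightarrow> 'a) \<phi>))"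
    by (intro injI) (simp add: inj_image_eq_iff)
  then show "num_loops V E \<omega>' = num_loops V E \<omega>"
    unfolding num_loops_def L by (intro card_image) (rule inj_on_subset, auto)
  have "loop_support (map_prod id \<phi> ` \<gamma>) = loop_support \<gamma>" for \<gamma> :: "('a \<times> real) set"
    unfolding loop_support_def by force
  then show "large_loop V E \<eta> \<omega>' = large_loop V E \<eta> \<omega>"
    unfolding large_loop_def L by simp
qed

section \<open>Connected components\<close>

text \<open>The equivalence relation generated by \<open>r\<close>.\<close>

definition conn :: "('a \<times> 'a) set \<Rightarrow> ('a \<times> 'a) set" where
  "conn r = (r \<union> r\<inverse>)\<^sup>*"

definition ncomp :: "'a set \<Rightarrow> ('a \<times> 'a) set \<Rightarrow> nat" where
  "ncomp N r = card ((\<lambda>x. conn r `` {x}) ` N)"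

lemma conn_refl [simp]: "(x, x) \<in> conn r" by (simp add: conn_def)
lemma conn_trans: "(x, y) \<in> conn r \<Longrightarrow> (y, z) \<in> conn r \<Longrightarrow> (x, z) \<in> conn r"
  unfolding conn_def by (rule rtrancl_trans)
lemma conn_sym: "(x, y) \<in> conn r \<Longrightarrow> (y, x) \<in> conn r"
  unfolding conn_def by (rule symD[OF sym_rtrancl[OF sym_Un_converse]])
lemma conn_base: "(x, y) \<in> r \<Longrightarrow> (x, y) \<in> conn r" unfolding conn_def by auto
lemma conn_class_eq: "conn r `` {x} = conn r `` {y} \<longleftrightarrow> (x, y) \<in> conn r"
proof
  assume "conn r `` {x} = conn r `` {y}"
  moreover have "y \<in> conn r `` {y}" by simp
  ultimately show "(x, y) \<in> conn r" by blast
next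
  assume xy: "(x, y) \<in> conn r"
  have "(x, z) \<in> conn r \<longleftrightarrow> (y, z) \<in> conn r" for z
    using conn_trans[OF xy] conn_trans[OF conn_sym[OF xy]] by blast
  then show "conn r `` {x} = conn r `` {y}" by blast
qed

lemma conn_subset: assumes "\<And>x y. (x, y) \<in> r \<Longrightarrow> (x, y) \<in> conn s" shows "conn r \<subseteq> conn s"
proof -
  have "(x, y) \<in> conn s" if "(x, y) \<in> (r \<union> r\<inverse>)\<^sup>*" for x y
    using that
  proof (induction rule: rtrancl_induct)
    case (step y z)
    have "(y, z) \<in> conn s" using step(2) assms[of y z] conn_sym[OF assms[of z y]] by blast
    with step(3) show ?case by (rule conn_trans)
  qed simp
  then show ?thesis unfolding conn_def[of r] by auto
qed

lemma conn_map:
  assumes "\<And>x y. (x, y) \<in> r \<Longrightarrow> (f x, f y) \<in> conn s" "(x, y) \<in> conn r"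
  shows "(f x, f y) \<in> conn s"
  using assms(2) unfolding conn_def[of r]
proof (induction rule: rtrancl_induct)
  case (step y z)
  have "(f y, f z) \<in> conn s" using step(2) assms(1)[of y z] conn_sym[OF assms(1)[of z y]] by blast
  with step(3) show ?case by (rule conn_trans)
qed simp

lemma conn_mono: "r \<subseteq> s \<Longrightarrow> conn r \<subseteq> conn s"
  by (rule conn_subset) (auto intro: conn_base)

text \<open>A map between vertex sets that sends different components to different components
  bounds their numbers.\<close>

lemma ncomp_le:
  assumes B: "finite B" and f: "\<And>x. x \<in> A \<Longrightarrow> f x \<in> B"
    and i: "\<And>x y. x \<in> A \<Longrightarrow> y \<in> A \<Longrightarrow> (f x, f y) \<in> conn s \<Longrightarrow> (x, y) \<in> conn r"
  shows "ncomp A r \<le> ncomp B s"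
proof -
  define k where "k X = conn r `` {SOME x. x \<in> A \<and> conn s `` {f x} = X}" for X
  have "conn r `` {x} = k (conn s `` {f x})" if "x \<in> A" for x
  proof -
    define z where "z = (SOME z. z \<in> A \<and> conn s `` {f z} = conn s `` {f x})"
    have "z \<in> A \<and> conn s `` {f z} = conn s `` {f x}"
      unfolding z_def by (rule someI[of _ x]) (use that in auto)
    then have "(x, z) \<in> conn r" using i[OF that, of z] conn_class_eq[of s "f x" "f z"] by simp
    then have "conn r `` {x} = conn r `` {z}" by (simp only: conn_class_eq)
    then show ?thesis unfolding k_def z_def .
  qed
  then have "(\<lambda>x. conn r `` {x}) ` A = k ` (\<lambda>x. conn s `` {x}) ` f ` A"
    by (auto simp: image_image)
  also have "\<dots> \<subseteq> k ` (\<lambda>x. conn s `` {x}) ` B" using f by auto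
  finally have "ncomp A r \<le> card (k ` (\<lambda>x. conn s `` {x}) ` B)"
    unfolding ncomp_def using B by (intro card_mono) auto
  also have "\<dots> \<le> ncomp B s" unfolding ncomp_def using B by (intro card_image_le) auto
  finally show ?thesis .
qed

lemma ncomp_eq:
  assumes "finite A" "finite B" "\<And>x. x \<in> A \<Longrightarrow> f x \<in> B" "\<And>x. x \<in> B \<Longrightarrow> g x \<in> A"
    and f: "\<And>x y. (x, y) \<in> r \<Longrightarrow> (f x, f y) \<in> conn s" and g: "\<And>x y. (x, y) \<in> s \<Longrightarrow> (g x, g y) \<in> conn r"
    and gf: "\<And>x. x \<in> A \<Longrightarrow> (g (f x), x) \<in> conn r" and fg: "\<And>x. x \<in> B \<Longrightarrow> (f (g x), x) \<in> conn s"
  shows "ncomp A r = ncomp B s"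
proof (rule antisym)
  show "ncomp A r \<le> ncomp B s"
  proof (rule ncomp_le[where f = f])
    fix x y assume "x \<in> A" "y \<in> A" "(f x, f y) \<in> conn s"
    then show "(x, y) \<in> conn r" using conn_map[OF g] gf by (meson conn_trans conn_sym)
  qed (use assms in auto)
  show "ncomp B s \<le> ncomp A r"
  proof (rule ncomp_le[where f = g])
    fix x y assume "x \<in> B" "y \<in> B" "(g x, g y) \<in> conn r"
    then show "(x, y) \<in> conn s" using conn_map[OF f] fg by (meson conn_trans conn_sym)
  qed (use assms in auto)
qed

lemma conn_insert:
  "(x, y) \<in> conn (insert (p, q) r) \<longleftrightarrow> (x, y) \<in> conn r \<or>
     (x, p) \<in> conn r \<and> (q, y) \<in> conn r \<or> (x, q) \<in> conn r \<and> (p, y) \<in> conn r" (is "?L = ?R x y")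
proof
  assume "(x, y) \<in> conn (insert (p, q) r)"
  then have "(x, y) \<in> (insert (p, q) r \<union> (insert (p, q) r)\<inverse>)\<^sup>*" by (simp add: conn_def)
  then show "?R x y"
  proof (induction rule: rtrancl_induct)
    case (step y z)
    have "(y, z) \<in> r \<or> (z, y) \<in> r \<or> y = p \<and> z = q \<or> y = q \<and> z = p" using step(2) by auto
    then consider "(y, z) \<in> conn r" | "y = p" "z = q" | "y = q" "z = p"
      using conn_sym[OF conn_base[of z y r]] conn_base[of y z r] by blast
    then show ?case using step(3) by cases (meson conn_trans conn_sym conn_refl)+
  qed auto
next
  have r: "conn r \<subseteq> conn (insert (p, q) r)" by (rule conn_mono) auto
  have pq: "(p, q) \<in> conn (insert (p, q) r)" by (rule conn_base) auto
  show "?R x y \<Longrightarrow> ?L" using r pq by (meson conn_trans conn_sym subsetD)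
qed

text \<open>An edge reduces the number of components by one exactly if it joins two of them.
  This rule is all that the comparison of loop numbers needs.\<close>

lemma ncomp_insert:
  assumes N: "finite N" and pq: "p \<in> N" "q \<in> N"
  shows "ncomp N r = ncomp N (insert (p, q) r) + (if (p, q) \<in> conn r then 0 else 1)"
proof (cases "(p, q) \<in> conn r")
  case True
  then have "(x, y) \<in> conn (insert (p, q) r) \<longleftrightarrow> (x, y) \<in> conn r" for x y
    unfolding conn_insert by (meson conn_trans conn_sym)
  then have "conn (insert (p, q) r) = conn r" by auto
  with True show ?thesis by (simp add: ncomp_def)
next
  case False
  let ?C = "\<lambda>x. conn r `` {x}"
  let ?D = "\<lambda>x. conn (insert (p, q) r) `` {x}"
  have D1: "?D x = ?C p \<union> ?C q" if "(x, p) \<in> conn r \<or> (x, q) \<in> conn r" for x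
  proof -
    have "(x, y) \<in> conn (insert (p, q) r) \<longleftrightarrow> (p, y) \<in> conn r \<or> (q, y) \<in> conn r" for y
      using that unfolding conn_insert by (meson conn_trans conn_sym conn_refl)
    then show ?thesis by blast
  qed
  have D2: "?D x = ?C x" if "\<not> ((x, p) \<in> conn r \<or> (x, q) \<in> conn r)" for x
    using that by (auto simp: conn_insert)
  have "?D ` N = insert (?C p \<union> ?C q) (?C ` N - {?C p, ?C q})"
  proof (intro equalityI subsetI)
    fix X assume "X \<in> ?D ` N"
    then obtain x where x: "x \<in> N" "X = ?D x" by auto
    show "X \<in> insert (?C p \<union> ?C q) (?C ` N - {?C p, ?C q})"
    proof (cases "(x, p) \<in> conn r \<or> (x, q) \<in> conn r")
      case True then show ?thesis using D1 x by simp
    next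
      case False
      then have "?C x \<noteq> ?C p" "?C x \<noteq> ?C q" by (simp_all only: conn_class_eq) auto
      then show ?thesis using D2[OF False] x by simp
    qed
  next
    fix X assume "X \<in> insert (?C p \<union> ?C q) (?C ` N - {?C p, ?C q})"
    then consider "X = ?C p \<union> ?C q" | x where "x \<in> N" "X = ?C x" "X \<noteq> ?C p" "X \<noteq> ?C q" by auto
    then show "X \<in> ?D ` N"
    proof cases
      case 1
      then show ?thesis using D1[of p] pq by (metis conn_refl imageI)
    next
      case 2
      then have "\<not> ((x, p) \<in> conn r \<or> (x, q) \<in> conn r)" by (metis conn_class_eq)
      from D2[OF this] 2 show ?thesis by (metis imageI)
    qed
  qed
  moreover have "?C p \<union> ?C q \<notin> ?C ` N"
  proof
    assume "?C p \<union> ?C q \<in> ?C ` N"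
    then obtain x where "?C p \<union> ?C q = ?C x" by auto
    then have "(x, p) \<in> conn r" "(x, q) \<in> conn r" by (auto intro: conn_refl)
    then show False using False by (meson conn_trans conn_sym)
  qed
  moreover have "?C p \<noteq> ?C q" using False by (simp only: conn_class_eq) auto
  moreover have "card (?C ` N - {?C p, ?C q}) + 2 = card (?C ` N)"
  proof -
    have "card (?C ` N - {?C p, ?C q}) = card (?C ` N) - card {?C p, ?C q}"
      using pq by (intro card_Diff_subset) auto
    moreover have "card {?C p, ?C q} \<le> card (?C ` N)" using pq N by (intro card_mono) auto
    ultimately show ?thesis using \<open>?C p \<noteq> ?C q\<close> by simp
  qed
  ultimately show ?thesis using False N by (simp add: ncomp_def)
qed

lemma involution_even_card:
  assumes "finite A" "\<And>x. x \<in> A \<Longrightarrow> f x \<in> A" "\<And>x. x \<in> A \<Longrightarrow> f (f x) = x" "\<And>x. x \<in> A \<Longrightarrow> f x \<noteq> x"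
  shows "even (card A)"
  using assms
proof (induction "card A" arbitrary: A rule: less_induct)
  case less
  show ?case
  proof (cases "A = {}")
    case False
    then obtain x where x: "x \<in> A" by auto
    let ?B = "A - {x, f x}"
    have c: "card ?B + 2 = card A"
    proof -
      have "card {x, f x} \<le> card A" using x less.prems by (intro card_mono) auto
      moreover have "card {x, f x} = 2" using x less.prems by (metis card_2_iff)
      ultimately show ?thesis using x less.prems by (subst card_Diff_subset) auto
    qed
    moreover have "even (card ?B)"
    proof (rule less.hyps)
      fix y assume y: "y \<in> ?B"
      then have "f (f y) = y" "f (f x) = x" using less.prems x by auto
      with y less.prems show "f y \<in> ?B" by (metis DiffD1 DiffD2 DiffI insert_iff singletonD)
    qed (use c less.prems in auto)
    ultimately show ?thesis by presburger
  qed simp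
qed

section \<open>Loops of a word of marks\<close>

definition swap_on :: "'v set \<Rightarrow> 'v \<Rightarrow> 'v" where
  "swap_on e x = (if x \<in> e then the_elem (e - {x}) else x)"

lemma swap_on_doubleton: "x \<noteq> y \<Longrightarrow> swap_on {x, y} x = y" "x \<noteq> y \<Longrightarrow> swap_on {x, y} y = x"
  by (auto simp: swap_on_def insert_Diff_if)

lemma swap_on_props:
  assumes "card e = 2"
  shows "swap_on e (swap_on e x) = x" "swap_on e x \<in> e \<longleftrightarrow> x \<in> e" "x \<in> e \<Longrightarrow> swap_on e x \<noteq> x"
    "x \<in> e \<Longrightarrow> {x, swap_on e x} = e"
proof -
  obtain a b where e: "e = {a, b}" "a \<noteq> b" using assms by (meson card_2_iff)
  have "swap_on e a = b" "swap_on e b = a" using swap_on_doubleton[OF e(2)] unfolding e(1) by auto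
  moreover have "swap_on e x = x" if "x \<notin> e" using that by (simp add: swap_on_def)
  ultimately show "swap_on e (swap_on e x) = x" "swap_on e x \<in> e \<longleftrightarrow> x \<in> e"
    "x \<in> e \<Longrightarrow> swap_on e x \<noteq> x" "x \<in> e \<Longrightarrow> {x, swap_on e x} = e"
    using e by (cases "x \<in> e"; auto)+
qed

type_synonym 'v letter = "('v set \<times> mark) option"

text \<open>The time circle is cut into segments by finitely many layers. A layer is a letter: a
  mark on an edge, or \<open>None\<close> for a layer without mark. A port \<open>(x, d)\<close>
  of a layer is the end of the segment just below (\<open>d = True\<close>) or just above
  (\<open>d = False\<close>) it at the vertex \<open>x\<close>, and the letter matches the ports
  in pairs: straight through, crosswise, or, for a bar, back on the same side.\<close>

fun turn :: "'v letter \<Rightarrow> 'v \<times> bool \<Rightarrow> 'v \<times> bool" where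
  "turn None (x, d) = (x, \<not> d)"
| "turn (Some (e, m)) (x, d) = (swap_on e x, if x \<in> e \<and> m = Bar then d else \<not> d)"

definition letter_ok :: "'v set \<Rightarrow> 'v letter \<Rightarrow> bool" where
  "letter_ok V a \<longleftrightarrow> (\<forall>e m. a = Some (e, m) \<longrightarrow> e \<subseteq> V \<and> card e = 2)"

lemma letter_ok_None [simp]: "letter_ok V None" by (simp add: letter_ok_def)

lemma turn_props:
  assumes "letter_ok V a"
  shows "turn a (turn a p) = p" "turn a p \<noteq> p" "fst p \<in> V \<Longrightarrow> fst (turn a p) \<in> V"
proof -
  obtain x d where p: "p = (x, d)" by (cases p)
  consider "a = None" | e m where "a = Some (e, m)" "card e = 2" "e \<subseteq> V"
    using assms unfolding letter_ok_def by (cases a) auto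
  then have "turn a (turn a p) = p \<and> turn a p \<noteq> p \<and> (fst p \<in> V \<longrightarrow> fst (turn a p) \<in> V)"
  proof cases
    case 2
    then have "swap_on e x \<in> V" if "x \<in> V" using that swap_on_props[OF 2(2), of x]
      by (cases "x \<in> e") (auto simp: swap_on_def)
    then show ?thesis using 2 p swap_on_props[OF 2(2), of x] by (auto simp: swap_on_def)
  qed (simp add: p)
  then show "turn a (turn a p) = p" "turn a p \<noteq> p" "fst p \<in> V \<Longrightarrow> fst (turn a p) \<in> V" by auto
qed

definition cyc_up :: "nat \<Rightarrow> nat \<Rightarrow> nat" where "cyc_up M i = (if Suc i = M then 0 else Suc i)"

text \<open>Port \<open>(x, j, d)\<close> belongs to layer \<open>j\<close>, which separates the
  segments \<open>j\<close> and \<open>j + 1\<close> (cyclically).\<close>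

definition port_node :: "nat \<Rightarrow> 'v \<times> nat \<times> bool \<Rightarrow> 'v \<times> nat" where
  "port_node M p = (fst p, if snd (snd p) then fst (snd p) else cyc_up M (fst (snd p)))"

definition port_link :: "'v letter list \<Rightarrow> 'v \<times> nat \<times> bool \<Rightarrow> 'v \<times> nat \<times> bool" where
  "port_link ls p = (let q = turn (ls ! fst (snd p)) (fst p, snd (snd p)) in (fst q, fst (snd p), snd q))"

definition ports :: "'v set \<Rightarrow> nat \<Rightarrow> ('v \<times> nat \<times> bool) set" where
  "ports V M = V \<times> {..<M} \<times> UNIV"

definition nodes :: "'v set \<Rightarrow> nat \<Rightarrow> ('v \<times> nat) set" where
  "nodes V M = V \<times> {..<M}"

definition links :: "'v set \<Rightarrow> 'v letter list \<Rightarrow> (('v \<times> nat) \<times> ('v \<times> nat)) set" where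
  "links V ls = (\<lambda>p. (port_node (length ls) p, port_node (length ls) (port_link ls p))) ` ports V (length ls)"

definition word_ok :: "'v set \<Rightarrow> 'v letter list \<Rightarrow> bool" where
  "word_ok V ls \<longleftrightarrow> (\<forall>a\<in>set ls. letter_ok V a)"

lemma port_link_props:
  assumes "word_ok V ls" "p \<in> ports V (length ls)"
  shows "port_link ls p \<in> ports V (length ls)" "port_link ls (port_link ls p) = p" "port_link ls p \<noteq> p"
    "fst (snd (port_link ls p)) = fst (snd p)"
proof -
  obtain x j d where p: "p = (x, j, d)" "x \<in> V" "j < length ls" using assms(2) by (auto simp: ports_def)
  have "letter_ok V (ls ! j)" using assms(1) p unfolding word_ok_def by simp
  note t = turn_props[OF this, of "(x, d)"]
  show "port_link ls p \<in> ports V (length ls)" "port_link ls (port_link ls p) = p" "port_link ls p \<noteq> p"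
    "fst (snd (port_link ls p)) = fst (snd p)"
    using t p unfolding port_link_def ports_def Let_def by (auto simp: prod_eq_iff)
qed

lemma port_node_nodes: "p \<in> ports V M \<Longrightarrow> port_node M p \<in> nodes V M"
  by (auto simp: ports_def nodes_def port_node_def cyc_up_def)

lemma links_sym: assumes "word_ok V ls" shows "(links V ls)\<inverse> = links V ls"
proof -
  have "(a, b) \<in> links V ls" if "(b, a) \<in> links V ls" for a b
  proof -
    from that obtain p where p: "p \<in> ports V (length ls)" "b = port_node (length ls) p"
      "a = port_node (length ls) (port_link ls p)" by (auto simp: links_def)
    show ?thesis unfolding links_def
      by (rule image_eqI[of _ _ "port_link ls p"]) (simp_all add: p(2,3) port_link_props[OF assms p(1)])
  qed
  then show ?thesis by auto
qed

lemma links_nodes: assumes "word_ok V ls" shows "links V ls \<subseteq> nodes V (length ls) \<times> nodes V (length ls)"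
  unfolding links_def using port_node_nodes port_link_props(1)[OF assms] by blast

text \<open>Loops are the components of the graph that has the segments \<open>(x, j)\<close> as
  nodes and one edge for each matched pair of ports.\<close>

definition nloops :: "'v set \<Rightarrow> 'v letter list \<Rightarrow> nat" where
  "nloops V ls = ncomp (nodes V (length ls)) (links V ls)"

lemma finite_nodes: "finite V \<Longrightarrow> finite (nodes V M)" by (simp add: nodes_def)

text \<open>A component is determined by the edges at its own nodes.\<close>

lemma conn_class_transfer:
  assumes "\<And>a b. a \<in> conn r `` {n} \<Longrightarrow> (a, b) \<in> r \<union> r\<inverse> \<longleftrightarrow> (a, b) \<in> s \<union> s\<inverse>"
  shows "conn r `` {n} = conn s `` {n}"
proof -
  have 1: "m \<in> conn s `` {n}" if "(n, m) \<in> (r \<union> r\<inverse>)\<^sup>*" for m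
    using that
  proof (induction rule: rtrancl_induct)
    case (step y z)
    have "y \<in> conn r `` {n}" using step(1) by (simp add: conn_def)
    then have "(y, z) \<in> s \<union> s\<inverse>" using assms step(2) by blast
    then show ?case using step(3) unfolding conn_def by (auto intro: rtrancl_into_rtrancl)
  qed simp
  have 2: "m \<in> conn r `` {n}" if "(n, m) \<in> (s \<union> s\<inverse>)\<^sup>*" for m
    using that
  proof (induction rule: rtrancl_induct)
    case (step y z)
    then have "(y, z) \<in> r \<union> r\<inverse>" using assms by blast
    then show ?case using step(3) unfolding conn_def by (auto intro: rtrancl_into_rtrancl)
  qed simp
  show ?thesis using 1 2 unfolding conn_def by blast
qed

text \<open>A loop of the shorter word that does not pass through time \<open>0\<close> never
  leaves the inner segments, whose neighbourhoods are the same in the longer word. At most one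
  loop for each vertex passes through time \<open>0\<close>.\<close>

lemma nloops_append_ge:
  assumes V: "finite V" and ok: "word_ok V (w @ v @ [None])"
  shows "nloops V (w @ [None]) \<le> nloops V (w @ v @ [None]) + card V"
proof -
  let ?r = "links V (w @ [None])" and ?s = "links V (w @ v @ [None])"
  let ?k = "length w" let ?M' = "length (w @ v @ [None])"
  let ?N = "nodes V (Suc ?k)" and ?N' = "nodes V ?M'"
  let ?C = "\<lambda>x. conn ?r `` {x}" and ?D = "\<lambda>x. conn ?s `` {x}"
  have okr: "word_ok V (w @ [None])" using ok by (auto simp: word_ok_def)
  have rs: "(a, b) \<in> ?r \<longleftrightarrow> (a, b) \<in> ?s" if a: "snd a \<noteq> 0" "snd a < ?k" for a b
  proof -
    have P: "port_node (Suc ?k) p = a \<and> p \<in> ports V (Suc ?k) \<longleftrightarrow> port_node ?M' p = a \<and> p \<in> ports V ?M'" for p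
      using a by (auto simp: port_node_def ports_def cyc_up_def split: if_splits)
    have Q: "port_node (Suc ?k) (port_link (w @ [None]) p) = port_node ?M' (port_link (w @ v @ [None]) p)"
      if "port_node (Suc ?k) p = a" "p \<in> ports V (Suc ?k)" for p
    proof -
      obtain x j d where p: "p = (x, j, d)" by (cases p)
      have j: "j < ?k" using that a p by (auto simp: port_node_def ports_def cyc_up_def split: if_splits)
      then show ?thesis by (simp add: p port_link_def port_node_def nth_append Let_def cyc_up_def)
    qed
    have "(a, b) \<in> ?r \<longleftrightarrow> (\<exists>p. (port_node (Suc ?k) p = a \<and> p \<in> ports V (Suc ?k)) \<and>
        b = port_node (Suc ?k) (port_link (w @ [None]) p))" by (auto simp: links_def)
    also have "\<dots> \<longleftrightarrow> (\<exists>p. (port_node ?M' p = a \<and> p \<in> ports V ?M') \<and>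
        b = port_node ?M' (port_link (w @ v @ [None]) p))" using P Q by metis
    also have "\<dots> \<longleftrightarrow> (a, b) \<in> ?s" by (auto simp: links_def)
    finally show ?thesis .
  qed
  have top: "((x, ?k), (x, 0)) \<in> ?r" if "x \<in> V" for x
    unfolding links_def by (rule image_eqI[of _ _ "(x, ?k, True)"])
      (use that in \<open>auto simp: port_node_def port_link_def ports_def cyc_up_def\<close>)
  have key: "?C n \<in> ?D ` ?N'" if n: "n \<in> ?N" and no: "\<And>x. x \<in> V \<Longrightarrow> ?C n \<noteq> ?C (x, 0)" for n
  proof -
    have inN: "a \<in> ?N" if "a \<in> ?C n" for a
    proof -
      have "(n, a) \<in> (?r \<union> ?r\<inverse>)\<^sup>*" using that by (simp add: conn_def)
      then show ?thesis using n links_nodes[OF okr] by (induction rule: rtrancl_induct) auto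
    qed
    have mid: "snd a \<noteq> 0 \<and> snd a < ?k" if "a \<in> ?C n" for a
    proof -
      have "a \<in> ?N" by (rule inN[OF that])
      then obtain x i where a: "a = (x, i)" "x \<in> V" "i \<le> ?k" by (cases a) (auto simp: nodes_def)
      have na: "(n, a) \<in> conn ?r" using that by simp
      have "(n, (x, 0)) \<in> conn ?r" if "i = 0 \<or> i = ?k"
        using conn_trans[OF na, of "(x, 0)"] conn_base[OF top[OF a(2)]] na a that by auto
      then have "\<not> (i = 0 \<or> i = ?k)" using no[OF a(2)] unfolding conn_class_eq by blast
      then show ?thesis using a by auto
    qed
    have "?C n = ?D n"
    proof (rule conn_class_transfer)
      fix a b assume "a \<in> ?C n"
      then show "(a, b) \<in> ?r \<union> ?r\<inverse> \<longleftrightarrow> (a, b) \<in> ?s \<union> ?s\<inverse>"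
        using mid rs unfolding links_sym[OF okr] links_sym[OF ok] by simp
    qed
    moreover have "n \<in> ?N'" using n by (auto simp: nodes_def)
    ultimately show ?thesis by auto
  qed
  have "?C ` ?N \<subseteq> ?D ` ?N' \<union> (\<lambda>x. ?C (x, 0)) ` V" using key by blast
  then have "card (?C ` ?N) \<le> card (?D ` ?N' \<union> (\<lambda>x. ?C (x, 0)) ` V)"
    using V finite_nodes[OF V] by (intro card_mono) auto
  also have "\<dots> \<le> card (?D ` ?N') + card ((\<lambda>x. ?C (x, 0)) ` V)" by (rule card_Un_le)
  also have "\<dots> \<le> card (?D ` ?N') + card V" using card_image_le[OF V] by simp
  finally show ?thesis by (simp add: nloops_def ncomp_def)
qed

text \<open>A layer without mark can be contracted: the two segments that it separates lie on
  the same loop.\<close>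

lemma nloops_identity_layer:
  assumes V: "finite V" and ok: "word_ok V w"
  shows "nloops V (w @ [None, None]) = nloops V (w @ [None])"
    and "((x, 0), (y, 0)) \<in> conn (links V (w @ [None, None])) \<longleftrightarrow> ((x, 0), (y, 0)) \<in> conn (links V (w @ [None]))"
proof -
  let ?k = "length w"
  let ?r = "links V (w @ [None, None])" and ?s = "links V (w @ [None])"
  define f where "f a = (fst a, min ?k (snd a))" for a :: "'a \<times> nat"
  have okr: "word_ok V (w @ [None, None])" and oks: "word_ok V (w @ [None])" using ok by (auto simp: word_ok_def)
  have f: "(f a, f b) \<in> conn ?s" if "(a, b) \<in> ?r" for a b
  proof -
    from that obtain x j d where p: "x \<in> V" "j < ?k + 2" "a = port_node (?k + 2) (x, j, d)"
      "b = port_node (?k + 2) (port_link (w @ [None, None]) (x, j, d))" by (auto simp: links_def ports_def)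
    have *: "(port_node (Suc ?k) (x, j, d), port_node (Suc ?k) (port_link (w @ [None]) (x, j, d))) \<in> ?s"
      if "j \<le> ?k" unfolding links_def using that p by (auto simp: ports_def)
    consider "j < ?k" | "j = ?k" | "j = Suc ?k" using p(2) by linarith
    then show ?thesis
    proof cases
      case 1
      then have "min ?k (Suc j) = Suc j" "min ?k j = j" by auto
      with 1 show ?thesis using conn_base[OF *] p
        by (simp add: f_def port_node_def port_link_def nth_append Let_def cyc_up_def split: if_splits)
    next
      case 2
      then have "f a = f b" using p by (cases d) (auto simp: f_def port_node_def port_link_def nth_append Let_def cyc_up_def)
      then show ?thesis by simp
    next
      case 3
      have "((x, ?k), (x, 0)) \<in> ?s" unfolding links_def by (rule image_eqI[of _ _ "(x, ?k, True)"])
        (use p in \<open>auto simp: port_node_def port_link_def ports_def cyc_up_def\<close>)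
      then show ?thesis using 3 p conn_base[of "(x, ?k)" "(x, 0)" ?s] conn_sym[of "(x, ?k)" "(x, 0)" ?s]
        by (cases d) (auto simp: f_def port_node_def port_link_def nth_append Let_def cyc_up_def)
    qed
  qed
  have l: "((x, ?k), (x, Suc ?k)) \<in> conn ?r" "((x, Suc ?k), (x, 0)) \<in> conn ?r" if "x \<in> V" for x
  proof -
    show "((x, ?k), (x, Suc ?k)) \<in> conn ?r" unfolding links_def 
      by (rule conn_base, rule image_eqI[of _ _ "(x, ?k, True)"])
        (use that in \<open>auto simp: port_node_def port_link_def ports_def cyc_up_def nth_append\<close>)
    show "((x, Suc ?k), (x, 0)) \<in> conn ?r" unfolding links_def 
      by (rule conn_base, rule image_eqI[of _ _ "(x, Suc ?k, True)"])
        (use that in \<open>auto simp: port_node_def port_link_def ports_def cyc_up_def nth_append\<close>)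
  qed
  have g: "(a, b) \<in> conn ?r" if "(a, b) \<in> ?s" for a b
  proof -
    from that obtain x j d where p: "x \<in> V" "j < Suc ?k" "a = port_node (Suc ?k) (x, j, d)"
      "b = port_node (Suc ?k) (port_link (w @ [None]) (x, j, d))" by (auto simp: links_def ports_def)
    show ?thesis
    proof (cases "j < ?k")
      case True
      then have "(a, b) \<in> ?r" unfolding links_def
        by (intro image_eqI[of _ _ "(x, j, d)"])
         (use p in \<open>auto simp: port_node_def port_link_def ports_def cyc_up_def nth_append Let_def\<close>)
      then show ?thesis by (rule conn_base)
    next
      case False
      then have "j = ?k" using p by simp
      then show ?thesis using p conn_trans[OF l[OF p(1)]] conn_sym[OF conn_trans[OF l[OF p(1)]]]
        by (cases d) (auto simp: port_node_def port_link_def cyc_up_def)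
    qed
  qed
  have fr: "(f a, a) \<in> conn ?r" if "a \<in> nodes V (?k + 2)" for a
  proof -
    from that obtain x i where a: "a = (x, i)" "x \<in> V" "i \<le> Suc ?k" by (auto simp: nodes_def)
    show ?thesis
    proof (cases "i = Suc ?k")
      case True
      then show ?thesis using l(1)[OF a(2)] a by (simp add: f_def)
    next
      case False
      then have "min ?k i = i" using a(3) by simp
      then show ?thesis using a by (simp add: f_def)
    qed
  qed
  have "ncomp (nodes V (?k + 2)) ?r = ncomp (nodes V (Suc ?k)) ?s"
    by (rule ncomp_eq[where f = f and g = id]) (use f g fr V in \<open>auto simp: nodes_def f_def\<close>)
  then show "nloops V (w @ [None, None]) = nloops V (w @ [None])" by (simp add: nloops_def)
  show "((x, 0), (y, 0)) \<in> conn ?r \<longleftrightarrow> ((x, 0), (y, 0)) \<in> conn ?s"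
    using conn_map[where f = f and x = "(x, 0)" and y = "(y, 0)", OF f] conn_subset[of ?s ?r, OF g]
    by (auto simp: f_def)
qed

text \<open>The other end of the segment to which a port belongs.\<close>

definition port_rev :: "nat \<Rightarrow> 'v \<times> nat \<times> bool \<Rightarrow> 'v \<times> nat \<times> bool" where
  "port_rev M p = (case p of (x, j, d) \<Rightarrow>
     (x, if d then (if j = 0 then M - 1 else j - 1) else cyc_up M j, \<not> d))"

lemma port_rev_props:
  assumes "p \<in> ports V M"
  shows "port_rev M p \<in> ports V M" "port_rev M (port_rev M p) = p" "port_rev M p \<noteq> p"
    "port_node M (port_rev M p) = port_node M p"
  using assms by (auto simp: ports_def port_rev_def port_node_def cyc_up_def split: if_splits)

text \<open>The appended layer is compared with a layer without mark by opening both: removing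
  the links of the layer at \<open>x\<close> and \<open>y\<close> leaves a graph
  \<open>B\<close> with four open ends at the segments \<open>a\<close>, \<open>b\<close> below
  and \<open>a'\<close>, \<open>b'\<close> above. Every component of \<open>B\<close> contains
  an even number of open ends, so they are connected in pairs or all four together. The three
  ways to close the ends are no mark (\<open>a - a'\<close>, \<open>b - b'\<close>), a cross
  (\<open>a - b'\<close>, \<open>b - a'\<close>) and a bar (\<open>a - b\<close>, \<open>a' -
  b'\<close>), and a closing gives one loop more if it coincides with the pairing in
  \<open>B\<close>.\<close>

lemma append_letter:
  assumes V: "finite V" and ok: "word_ok V w" and x: "x \<in> V" and y: "y \<in> V" and xy: "x \<noteq> y"
  defines "same \<equiv> ((x, 0), (y, 0)) \<in> conn (links V (w @ [None]))"
  defines "L0 \<equiv> nloops V (w @ [None])"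
  defines "L \<equiv> \<lambda>m. nloops V (w @ [Some ({x, y}, m), None])"
  shows "\<not> same \<Longrightarrow> L m + 1 = L0"
    and "same \<Longrightarrow> L Cross \<le> L0 \<and> L Bar \<le> L0 + 1 \<or> L Bar \<le> L0 \<and> L Cross \<le> L0 + 1"
proof -
  let ?k = "length w" and ?e = "{x, y}"
  define M where "M = ?k + 2"
  let ?N = "nodes V M"
  let ?ls = "\<lambda>c. w @ [c, None]"
  \<comment> \<open>The four ports of the new layer at \<open>x\<close> and \<open>y\<close>; \<open>B\<close> consists of all links between other ports.\<close>
  define D where "D = {(x, ?k, True), (y, ?k, True), (x, ?k, False), (y, ?k, False)}"
  define B where "B = (\<lambda>p. (port_node M p, port_node M (port_link (?ls None) p))) ` (ports V M - D)"
  define a a' b b' where ab_def: "a = (x, ?k)" "a' = (x, Suc ?k)" "b = (y, ?k)" "b' = (y, Suc ?k)"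
  have okc: "word_ok V (?ls c)" if "c = None \<or> (\<exists>m. c = Some (?e, m))" for c
    using that ok x y xy by (auto simp: word_ok_def letter_ok_def)
  have ok0: "word_ok V (?ls None)" by (rule okc) simp
  have Dp: "D \<subseteq> ports V M" using x y by (auto simp: D_def ports_def M_def)
  have same_link: "port_link (?ls c) p = port_link (?ls None) p"
    if c: "c = None \<or> (\<exists>m. c = Some (?e, m))" and p: "p \<in> ports V M - D" for c p
  proof -
    obtain z j d where z: "p = (z, j, d)" by (cases p)
    show ?thesis
    proof (cases "j = ?k")
      case True
      then have "z \<notin> ?e" using p z by (cases d) (auto simp: D_def)
      then show ?thesis using c z True by (auto simp: port_link_def swap_on_def)
    next
      case False
      then show ?thesis using z by (auto simp: port_link_def nth_append nth_Cons split: nat.split)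
    qed
  qed
  have Lsplit: "links V (?ls c) = B \<union> (\<lambda>p. (port_node M p, port_node M (port_link (?ls c) p))) ` D"
    if c: "c = None \<or> (\<exists>m. c = Some (?e, m))" for c
  proof -
    have "links V (?ls c) = (\<lambda>p. (port_node M p, port_node M (port_link (?ls c) p))) ` (ports V M - D)
        \<union> (\<lambda>p. (port_node M p, port_node M (port_link (?ls c) p))) ` D"
      unfolding links_def using Dp by (auto simp: M_def)
    moreover have "(\<lambda>p. (port_node M p, port_node M (port_link (?ls c) p))) ` (ports V M - D) = B"
      unfolding B_def by (rule image_cong) (use same_link[OF c] in auto)
    ultimately show ?thesis by simp
  qed
  have Deq: "(\<lambda>p. (port_node M p, port_node M (port_link (?ls None) p))) ` D = {(a, a'), (a', a), (b, b'), (b', b)}"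
    "(\<lambda>p. (port_node M p, port_node M (port_link (?ls (Some (?e, Cross))) p))) ` D = {(a, b'), (b', a), (b, a'), (a', b)}"
    "(\<lambda>p. (port_node M p, port_node M (port_link (?ls (Some (?e, Bar))) p))) ` D = {(a, b), (b, a), (a', b'), (b', a')}"
    using swap_on_doubleton[OF xy]
    by (auto simp: D_def ab_def port_node_def port_link_def cyc_up_def M_def nth_append)
  have nl: "nloops V (?ls c) = ncomp ?N (insert (p, q) (insert (p', q') B))"
    if "links V (?ls c) = B \<union> {(p, q), (q, p), (p', q'), (q', p')}" for c p q p' q'
  proof -
    have "conn (links V (?ls c)) = conn (insert (p, q) (insert (p', q') B))"
    proof (intro equalityI conn_subset)
      fix u v assume "(u, v) \<in> links V (?ls c)"
      then have "(u, v) \<in> insert (p, q) (insert (p', q') B) \<or> (v, u) \<in> insert (p, q) (insert (p', q') B)"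
        unfolding that by auto
      then show "(u, v) \<in> conn (insert (p, q) (insert (p', q') B))"
        using conn_base[of _ _ "insert (p, q) (insert (p', q') B)"] conn_sym[OF conn_base[of _ _ "insert (p, q) (insert (p', q') B)"]]
        by blast
    next
      fix u v assume "(u, v) \<in> insert (p, q) (insert (p', q') B)"
      then show "(u, v) \<in> conn (links V (?ls c))" unfolding that by (intro conn_base) auto
    qed
    then show ?thesis unfolding nloops_def ncomp_def by (simp add: M_def)
  qed
  have L0': "L0 = ncomp ?N (insert (a, a') (insert (b, b') B))"
    unfolding L0_def nloops_identity_layer(1)[OF V ok, symmetric]
    by (rule nl) (simp only: Lsplit[of None, simplified] Deq)
  have LC: "L Cross = ncomp ?N (insert (a, b') (insert (b, a') B))"
    unfolding L_def by (rule nl) (subst Lsplit, simp, simp only: Deq)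
  have LB: "L Bar = ncomp ?N (insert (a, b) (insert (a', b') B))"
    unfolding L_def by (rule nl) (subst Lsplit, simp, simp only: Deq)
  have N: "a \<in> ?N" "b \<in> ?N" "a' \<in> ?N" "b' \<in> ?N" using x y by (auto simp: ab_def nodes_def M_def)
  have top: "((z, Suc ?k), (z, 0)) \<in> B" if "z \<in> V" for z
    unfolding B_def by (rule image_eqI[of _ _ "(z, Suc ?k, True)"])
      (use that in \<open>auto simp: port_node_def port_link_def ports_def cyc_up_def D_def M_def nth_append\<close>)
  have same': "same \<longleftrightarrow> (a, b) \<in> conn (insert (a, a') (insert (b, b') B))"
  proof -
    let ?R = "conn (links V (?ls None))"
    have R: "links V (?ls None) = B \<union> {(a, a'), (a', a), (b, b'), (b', b)}"
      by (simp only: Lsplit[of None, simplified] Deq)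
    have e: "?R = conn (insert (a, a') (insert (b, b') B))" (is "_ = ?R'")
    proof (intro equalityI conn_subset)
      fix u v assume "(u, v) \<in> links V (?ls None)"
      then have "(u, v) \<in> insert (a, a') (insert (b, b') B) \<or> (v, u) \<in> insert (a, a') (insert (b, b') B)"
        unfolding R by auto
      then show "(u, v) \<in> ?R'"
        using conn_base[of _ _ "insert (a, a') (insert (b, b') B)"] conn_sym[OF conn_base[of _ _ "insert (a, a') (insert (b, b') B)"]]
        by blast
    next
      fix u v assume "(u, v) \<in> insert (a, a') (insert (b, b') B)"
      then show "(u, v) \<in> ?R" unfolding R by (intro conn_base) auto
    qed
    have z: "((z, ?k), (z, 0)) \<in> ?R" if "z \<in> {x, y}" for z
    proof -
      have "((z, ?k), (z, Suc ?k)) \<in> ?R" using that unfolding R by (intro conn_base) (auto simp: ab_def)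
      moreover have "((z, Suc ?k), (z, 0)) \<in> ?R" using that top x y unfolding R by (intro conn_base) auto
      ultimately show ?thesis by (rule conn_trans)
    qed
    have "same \<longleftrightarrow> ((x, 0), (y, 0)) \<in> ?R" unfolding same_def using nloops_identity_layer(2)[OF V ok] by simp
    also have "\<dots> \<longleftrightarrow> (a, b) \<in> ?R"
    proof -
      have zx: "(a, (x, 0)) \<in> ?R" and zy: "(b, (y, 0)) \<in> ?R" using z unfolding ab_def by auto
      show ?thesis
        using conn_trans[OF conn_trans[OF zx] conn_sym[OF zy]] conn_trans[OF conn_trans[OF conn_sym[OF zx]] zy]
        by blast
    qed
    finally show ?thesis unfolding e .
  qed
  \<comment> \<open>The ports in a component of \<open>B\<close> are even in number, as each segment has two. Those outside
    \<open>D\<close> are matched among themselves.\<close>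
  have par: "even (card {z \<in> {a, b, a', b'}. (n, z) \<in> conn B})" if n: "n \<in> ?N" for n
  proof -
    define P where "P = {p \<in> ports V M. (n, port_node M p) \<in> conn B}"
    have finP: "finite P" using V by (simp add: P_def ports_def)
    have "even (card P)"
    proof (rule involution_even_card[where f = "port_rev M"])
      fix p assume "p \<in> P"
      then have p: "p \<in> ports V M" "(n, port_node M p) \<in> conn B" by (simp_all add: P_def)
      show "port_rev M p \<in> P" using p(2) by (simp add: P_def port_rev_props[OF p(1)])
      show "port_rev M (port_rev M p) = p" "port_rev M p \<noteq> p" by (fact port_rev_props[OF p(1)])+
    qed (fact finP)
    moreover have "even (card (P - D))"
    proof (rule involution_even_card[where f = "port_link (?ls None)"])
      fix p assume "p \<in> P - D"
      then have p: "p \<in> ports V M" "p \<notin> D" "(n, port_node M p) \<in> conn B" by (auto simp: P_def)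
      have pl: "p \<in> ports V (length (?ls None))" using p by (simp add: M_def)
      note props = port_link_props[OF ok0 pl]
      show "port_link (?ls None) (port_link (?ls None) p) = p" "port_link (?ls None) p \<noteq> p"
        using props by auto
      have "(port_node M p, port_node M (port_link (?ls None) p)) \<in> B" unfolding B_def using p by auto
      then have "(n, port_node M (port_link (?ls None) p)) \<in> conn B"
        using p(3) conn_base conn_trans by metis
      moreover have "port_link (?ls None) p \<notin> D"
      proof
        assume "port_link (?ls None) p \<in> D"
        then have "port_link (?ls None) (port_link (?ls None) p) \<in> D"
          by (auto simp: D_def port_link_def)
        then show False using props p by simp
      qed
      ultimately show "port_link (?ls None) p \<in> P - D" using props(1) by (simp add: P_def M_def)
    qed (use finP in auto)
    moreover have "card P = card (P - D) + card (P \<inter> D)"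
      using finP by (metis Un_Diff_Int card_Un_disjoint finite_Diff finite_Int inf_commute Diff_disjoint Int_Diff_disjoint)
    ultimately have "even (card (P \<inter> D))" by presburger
    moreover have "card (P \<inter> D) = card (port_node M ` (P \<inter> D))"
    proof (rule card_image[symmetric], rule inj_on_subset)
      show "inj_on (port_node M) D" using xy by (auto simp: inj_on_def D_def port_node_def cyc_up_def M_def)
    qed auto
    moreover have "port_node M ` (P \<inter> D) = {z \<in> {a, b, a', b'}. (n, z) \<in> conn B}"
    proof -
      have "port_node M ` D = {a, b, a', b'}" by (auto simp: D_def port_node_def cyc_up_def M_def ab_def)
      moreover have "P \<inter> D = {p \<in> D. (n, port_node M p) \<in> conn B}" using Dp by (auto simp: P_def)
      moreover have "port_node M ` {p \<in> D. (n, port_node M p) \<in> conn B} =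
          {z \<in> port_node M ` D. (n, z) \<in> conn B}" by auto
      ultimately show ?thesis by simp
    qed
    ultimately show ?thesis by simp
  qed
  have dist: "a \<noteq> b" "a \<noteq> a'" "a \<noteq> b'" "b \<noteq> a'" "b \<noteq> b'" "a' \<noteq> b'" using xy by (auto simp: ab_def)
  have par': "even ((if (n, a) \<in> conn B then 1 else 0) + (if (n, b) \<in> conn B then 1 else 0) + (if (n, a') \<in> conn B then 1 else 0)
      + (if (n, b') \<in> conn B then 1 else (0::nat)))" if "n \<in> ?N" for n
  proof -
    have "card {z \<in> {a, b, a', b'}. (n, z) \<in> conn B} = (\<Sum>z\<in>{a, b, a', b'}. if (n, z) \<in> conn B then 1 else 0)"
      by (simp only: card_eq_sum) (rule sum.inter_filter, simp)
    also have "\<dots> = (if (n, a) \<in> conn B then 1 else 0) + (if (n, b) \<in> conn B then 1 else 0) + (if (n, a') \<in> conn B then 1 else 0)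
      + (if (n, b') \<in> conn B then 1 else (0::nat))" using dist by simp
    finally show ?thesis using par[OF that] by simp
  qed
  define Q where "Q u v \<longleftrightarrow> (u, v) \<in> conn B" for u v
  have Q: "Q u u" "Q u v \<longleftrightarrow> Q v u" "Q u v \<Longrightarrow> Q v z \<Longrightarrow> Q u z" for u v z
    using conn_sym conn_trans by (auto simp: Q_def)
  have fin: "finite ?N" using V by (rule finite_nodes)
  \<comment> \<open>The possible partitions of the open ends into blocks of even size.\<close>
  have pa: "Q a a' \<and> \<not> Q a b \<and> \<not> Q a b' \<and> Q b b' \<and> \<not> Q a' b \<and> \<not> Q a' b' \<or>
     Q a b \<and> \<not> Q a a' \<and> \<not> Q a b' \<and> Q a' b' \<and> \<not> Q b b' \<and> \<not> Q a' b \<or>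
     Q a b' \<and> \<not> Q a a' \<and> \<not> Q a b \<and> Q a' b \<and> \<not> Q b b' \<and> \<not> Q a' b' \<or>
     Q a b \<and> Q a a' \<and> Q a b' \<and> Q b b' \<and> Q a' b \<and> Q a' b'"
  proof -
    note sy = Q(2)[of b a] Q(2)[of a' a] Q(2)[of b' a] Q(2)[of a' b] Q(2)[of b' b] Q(2)[of b' a']
    note p = par'[unfolded Q_def[symmetric]]
    note p = p[OF N(1), unfolded sy] p[OF N(2), unfolded sy] p[OF N(3), unfolded sy] p[OF N(4), unfolded sy]
    have t1: "Q v z" if "Q u v" "Q u z" for u v z using Q(3)[of v u z] Q(2)[of u v] that by simp
    have t2: "Q u v" if "Q u z" "Q v z" for u v z using Q(3)[of u z v] Q(2)[of v z] that by simp
    have t: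
      "\<not> Q a b \<or> \<not> Q a a' \<or> Q b a'"
      "\<not> Q a b \<or> \<not> Q a b' \<or> Q b b'"
      "\<not> Q a a' \<or> \<not> Q a b' \<or> Q a' b'"
      "\<not> Q b a' \<or> \<not> Q b b' \<or> Q a' b'"
      "\<not> Q a a' \<or> \<not> Q b a' \<or> Q a b"
      "\<not> Q a b' \<or> \<not> Q b b' \<or> Q a b"
      using t1[of a b a'] t1[of a b b'] t1[of a a' b'] t1[of b a' b'] t2[of a a' b] t2[of a b' b] by argo+
    show ?thesis using p t unfolding sy Q(1)
      by (cases "Q a b"; cases "Q a a'"; cases "Q a b'"; cases "Q b a'"; cases "Q b b'"; cases "Q a' b'"; simp add: Q(1))
  qed
  have ins: "ncomp ?N B = ncomp ?N (insert (p, q) (insert (p', q') B)) + (if Q p' q' then 0 else 1) +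
      (if Q p q \<or> Q p p' \<and> Q q' q \<or> Q p q' \<and> Q p' q then 0 else 1)"
    if "p \<in> ?N" "q \<in> ?N" "p' \<in> ?N" "q' \<in> ?N" for p q p' q'
    using ncomp_insert[OF fin that(3,4), of B] ncomp_insert[OF fin that(1,2), of "insert (p', q') B"]
    unfolding conn_insert Q_def by simp
  note ins1 = ins[OF N(1,3,2,4)] and ins2 = ins[OF N(1,4,2,3)] and ins3 = ins[OF N(1,2,3,4)]
  have same'': "same \<longleftrightarrow> \<not> (Q a a' \<and> \<not> Q a b \<and> \<not> Q a b')"
    unfolding same' conn_insert Q_def[symmetric] using pa Q(1) Q(2) by meson
  show "L m + 1 = L0" if "\<not> same"
    using that pa ins1 ins2 ins3 Q(2)[of a' b] Q(2)[of b' b] Q(2)[of b' a'] Q(2)[of b' a]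
    unfolding same'' L0'[symmetric] LC[symmetric] LB[symmetric] by (cases m) auto
  show "L Cross \<le> L0 \<and> L Bar \<le> L0 + 1 \<or> L Bar \<le> L0 \<and> L Cross \<le> L0 + 1" if same
    using that pa ins1 ins2 ins3 Q(2)[of a' b] Q(2)[of b' b] Q(2)[of b' a'] Q(2)[of b' a]
    unfolding same'' L0'[symmetric] LC[symmetric] LB[symmetric] by auto
qed

section \<open>Loops of a configuration of marks\<close>

lemma frac_eq_iff_int: "frac a = frac b \<longleftrightarrow> (\<exists>z::int. a = b + of_int z)" for a b :: real
proof
  assume "frac a = frac b"
  then have "a = b + of_int (\<lfloor>a\<rfloor> - \<lfloor>b\<rfloor>)" by (simp add: frac_def)
  then show "\<exists>z::int. a = b + of_int z" ..
qed (auto simp: frac_def)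

lemma frac_shift: "frac a = frac b \<Longrightarrow> frac (a + c) = frac (b + c)" for a b :: real
  unfolding frac_eq_iff_int by (auto simp: algebra_simps)

lemma frac_in: "s \<in> {0..<1::real} \<Longrightarrow> frac s = s" by (simp add: frac_eq)

text \<open>The marks of a word \<open>w\<close> are placed at the times \<open>1/M, ...,
  |w|/M\<close> with \<open>M = |w| + 1\<close>. The layer at time \<open>0\<close> carries no
  mark, which accounts for the final \<open>None\<close>.\<close>

locale canonical_marking =
  fixes V :: "'v set" and E :: "'v set set" and w :: "('v set \<times> mark) list" and \<omega> :: "'v marking"
    and M :: nat and ls :: "'v letter list"
  defines "M \<equiv> Suc (length w)" and "ls \<equiv> map Some w @ [None]"
  assumes V: "finite V" and w: "\<And>e m. (e, m) \<in> set w \<Longrightarrow> e \<subseteq> V \<and> card e = 2"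
    and marks: "\<And>x y s m. mark_at E \<omega> x y s m \<longleftrightarrow>
      (\<exists>j<length w. s = real (Suc j) / real M \<and> w ! j = ({x, y}, m))"
begin

lemma M_pos: "0 < M" "real M > 0" by (simp_all add: M_def)

lemma len: "length ls = M" by (simp add: ls_def M_def)

lemma ok: "word_ok V ls"
  using w by (auto simp: word_ok_def letter_ok_def ls_def)

definition dir :: "bool \<Rightarrow> real" where "dir d = (if d then 1 else -1)"

text \<open>A state of the discrete dynamics is the port at which the particle is about to
  arrive. A step crosses the layer there and flies along the next segment.\<close>

definition step :: "'v \<times> nat \<times> bool \<Rightarrow> 'v \<times> nat \<times> bool" where
  "step p = port_rev M (port_link ls p)"

text \<open>The time at which the particle enters the segment that ends at the given port, up to
  an integer.\<close>

definition start :: "'v \<times> nat \<times> bool \<Rightarrow> real" where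
  "start p = (real (fst (snd p)) + 1 - dir (snd (snd p))) / M"

abbreviation "P \<equiv> ports V M"

lemma finite_P: "finite P" using V by (simp add: ports_def)

lemma step_props: assumes "p \<in> P"
  shows "step p \<in> P" "port_node M (step p) = port_node M (port_link ls p)" "port_link ls (port_rev M (step p)) = p"
proof -
  have "port_link ls p \<in> P" using port_link_props(1)[OF ok] assms len by simp
  note r = port_rev_props[OF this]
  show "step p \<in> P" "port_node M (step p) = port_node M (port_link ls p)" using r by (simp_all add: step_def)
  show "port_link ls (port_rev M (step p)) = p" using r(2) port_link_props(2)[OF ok, of p] assms len by (simp add: step_def)
qed

lemma start_step: assumes "p \<in> P" shows "frac (start (step p)) = frac ((real (fst (snd p)) + 1) / M)"
proof -
  obtain x j d where p: "p = (x, j, d)" by (cases p)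
  obtain y d'' where q: "port_link ls p = (y, j, d'')" by (auto simp: port_link_def p Let_def)
  have j: "j < M" using assms p by (simp add: ports_def)
  have "\<exists>z::int. start (step p) = (real j + 1) / M + of_int z"
  proof (cases d'')
    case True
    then show ?thesis using j q M_pos
      by (cases "j = 0") (auto simp: step_def port_rev_def start_def dir_def field_simps of_nat_diff intro: exI[of _ 1] exI[of _ 0])
  next
    case False
    then show ?thesis using j q M_pos
      by (cases "Suc j = M") (auto simp: step_def port_rev_def start_def dir_def cyc_up_def field_simps intro: exI[of _ "-1"] exI[of _ 0])
  qed
  then show ?thesis unfolding frac_eq_iff_int p by simp
qed

lemma no_mark_between:
  assumes that: "c = 1 \<or> c = -1" and q: "0 < q" "q < 1"
  shows "\<not> mark_at E \<omega> x y (frac ((real j + c * q) / M)) m"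
proof
  assume "mark_at E \<omega> x y (frac ((real j + c * q) / M)) m"
  then obtain i where "frac ((real j + c * q) / M) = real (Suc i) / M" using marks by auto
  then have "(real j + c * q) / M = real (Suc i) / M + of_int \<lfloor>(real j + c * q) / M\<rfloor>" by (simp add: frac_def)
  then have "real j + c * q = real (Suc i) + of_int \<lfloor>(real j + c * q) / M\<rfloor> * M" using M_pos by (simp add: field_simps)
  then have "c * q = of_int (int (Suc i) + \<lfloor>(real j + c * q) / M\<rfloor> * int M - int j)" by simp
  then obtain z :: int where "c * q = of_int z" by blast
  then have "0 < (of_int z::real) \<and> of_int z < (1::real) \<or> -1 < (of_int z::real) \<and> (of_int z::real) < 0" using that q by auto
  then have "0 < z \<and> z < 1 \<or> -1 < z \<and> z < 0" by linarith
  then show False by auto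
qed

lemma mark_at_cut:
  assumes "j < M"
  shows "mark_at E \<omega> x y (frac ((real j + 1) / M)) m \<longleftrightarrow> j < length w \<and> w ! j = ({x, y}, m)"
proof (cases "j < length w")
  case True
  then have "frac ((real j + 1) / M) = real (Suc j) / M" by (subst frac_in) (auto simp: M_def)
  then show ?thesis using True M_pos by (auto simp: marks)
next
  case False
  then have "j = length w" using assms by (simp add: M_def)
  then have "(real j + 1) / M = 1" by (simp add: M_def field_simps)
  then have f0: "frac ((real j + 1) / M) = 0" by simp
  show ?thesis using False M_pos unfolding marks f0 by simp
qed

lemma step_free:
  assumes p: "(x, j, d) \<in> P" and free: "\<And>y m. \<not> mark_at E \<omega> x y (frac ((real j + 1) / M)) m"
  shows "\<exists>j'. step (x, j, d) = (x, j', d)"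
proof -
  have j: "j < M" using p by (simp add: ports_def)
  have "turn (ls ! j) (x, d) = (x, \<not> d)"
  proof (cases "j < length w")
    case True
    obtain e m where em: "w ! j = (e, m)" by (cases "w ! j")
    then have "(e, m) \<in> set w" using True nth_mem by metis
    then have c: "card e = 2" using w by blast
    have "x \<notin> e"
    proof
      assume "x \<in> e"
      then have "{x, swap_on e x} = e" by (rule swap_on_props(4)[OF c])
      then have "mark_at E \<omega> x (swap_on e x) (frac ((real j + 1) / M)) m" using mark_at_cut[OF j] True em by simp
      then show False using free by blast
    qed
    then show ?thesis using True em by (simp add: ls_def nth_append swap_on_def)
  next
    case False
    then have "j = length w" using j by (simp add: M_def)
    then show ?thesis by (simp add: ls_def nth_append)
  qed
  then show ?thesis by (auto simp: step_def port_link_def port_rev_def)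
qed

lemma step_mark:
  assumes p: "(x, j, d) \<in> P" and m: "mark_at E \<omega> x y (frac ((real j + 1) / M)) m"
  shows "\<exists>j'. step (x, j, d) = (y, j', if m = Cross then d else \<not> d)" "dir (if m = Cross then d else \<not> d) = (if m = Cross then dir d else - dir d)"
proof -
  have j: "j < M" using p by (simp add: ports_def)
  then have wj: "j < length w" "w ! j = ({x, y}, m)" using mark_at_cut m by auto
  then have "({x, y}, m) \<in> set w" using nth_mem by metis
  then have "card {x, y} = 2" using w by blast
  then have "x \<noteq> y" by auto
  then have "swap_on {x, y} x = y" by (rule swap_on_doubleton)
  then show "\<exists>j'. step (x, j, d) = (y, j', if m = Cross then d else \<not> d)"
    using wj by (cases m) (auto simp: step_def port_link_def port_rev_def ls_def nth_append)
  show "dir (if m = Cross then d else \<not> d) = (if m = Cross then dir d else - dir d)" by (auto simp: dir_def)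
qed

definition arc :: "'v \<times> nat \<times> bool \<Rightarrow> ('v \<times> real) set" where
  "arc p = {(fst p, frac (start p + dir (snd (snd p)) * q / M)) | q. 0 \<le> q \<and> q \<le> 1}"

lemma end_start: "start (x, j, d) + dir d * 1 / M = (real j + 1) / M"
  by (simp add: start_def flip: add_divide_distrib)

text \<open>A free flight of the particle from the fraction \<open>r\<close> of a segment
  follows the discrete dynamics, as all layers that it passes carry no mark at \<open>x\<close>.\<close>

lemma fly:
  assumes p: "(x, j, d) \<in> P" and r: "0 \<le> r" "r < 1" and s: "frac s = frac (start (x, j, d) + dir d * r / M)"
    and f: "free_flight E \<omega> x s (dir d) h" and n: "real n < r + h * M \<or> n = 0"
  shows "\<exists>j'. (step ^^ n) (x, j, d) = (x, j', d) \<and> (x, j', d) \<in> P \<and>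
    frac (start (x, j', d)) = frac (s + dir d * (real n - r) / M)"
  using n
proof (induction n)
  case 0
  then show ?case using p frac_shift[OF s, of "- dir d * r / M"] by (simp add: field_simps)
next
  case (Suc n)
  then have "real n < r + h * M \<or> n = 0" by auto
  from Suc.IH[OF this] obtain j' where j': "(step ^^ n) (x, j, d) = (x, j', d)" "(x, j', d) \<in> P"
    "frac (start (x, j', d)) = frac (s + dir d * (real n - r) / M)" by auto
  have e: "frac ((real j' + 1) / M) = frac (s + dir d * ((real (Suc n) - r) / M))"
  proof -
    have eq: "s + dir d * ((real (Suc n) - r) / M) = s + dir d * (real n - r) / M + dir d * 1 / M"
      using M_pos by (simp add: field_simps)
    show ?thesis unfolding eq using frac_shift[OF j'(3), of "dir d * 1 / M"] unfolding end_start .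
  qed
  have "real (Suc n) < r + h * M" using Suc.prems by simp
  then have "0 < (real (Suc n) - r) / M" "(real (Suc n) - r) / M < h" using r M_pos by (auto simp: field_simps)
  then have free: "\<not> mark_at E \<omega> x y (frac ((real j' + 1) / M)) m" for y m
    unfolding e using f unfolding free_flight_def by blast
  obtain j'' where j'': "step (x, j', d) = (x, j'', d)" using step_free[OF j'(2) free] by blast
  have "frac (start (x, j'', d)) = frac ((real j' + 1) / M)" using start_step[OF j'(2)] j'' by simp
  then show ?case using j' j'' e step_props(1)[OF j'(2)] by auto
qed

lemma fly_end:
  assumes p: "(x, j, d) \<in> P" and r: "0 \<le> r" "r < 1" and s: "frac s = frac (start (x, j, d) + dir d * r / M)"
    and f: "free_flight E \<omega> x s (dir d) h" and h: "0 \<le> h"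
  obtains n j' q where "(step ^^ n) (x, j, d) = (x, j', d)" "(x, j', d) \<in> P" "0 \<le> q" "q \<le> 1"
    "frac (s + dir d * h) = frac (start (x, j', d) + dir d * q / M)" "0 < h \<Longrightarrow> 0 < q"
proof -
  define n where "n = nat (\<lceil>r + h * M\<rceil> - 1)"
  have rh: "0 \<le> r + h * M" using r h M_pos by simp
  have n: "real n < r + h * M \<or> n = 0" "r + h * M \<le> real n + 1" "0 < h \<Longrightarrow> real n < r + h * M"
  proof -
    show "real n < r + h * M \<or> n = 0" unfolding n_def using ceiling_correct[of "r + h * M"] by linarith
    show "r + h * M \<le> real n + 1" unfolding n_def using ceiling_correct[of "r + h * M"] by linarith
    assume "0 < h" then have "0 < r + h * M" using r M_pos by (simp add: add_nonneg_pos)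
    then show "real n < r + h * M" unfolding n_def using ceiling_correct[of "r + h * M"] by linarith
  qed
  obtain j' where j': "(step ^^ n) (x, j, d) = (x, j', d)" "(x, j', d) \<in> P"
    "frac (start (x, j', d)) = frac (s + dir d * (real n - r) / M)" using fly[OF p r s f n(1)] by blast
  have q: "0 \<le> r + h * M - n" using n(1) rh by auto
  have "frac (s + dir d * h) = frac (start (x, j', d) + dir d * (r + h * M - n) / M)"
  proof -
    have eq: "s + dir d * h = s + dir d * (real n - r) / M + dir d * (r + h * M - n) / M"
      using M_pos by (simp add: field_simps)
    show ?thesis unfolding eq using frac_shift[OF j'(3), of "dir d * (r + h * M - n) / M"] by simp
  qed
  with that[OF j'(1,2), of "r + h * M - n"] q n(2,3) show ?thesis by auto
qed

text \<open>The states of a trajectory need not lie at layers, because a trajectory may start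
  anywhere. They are tracked as a discrete state together with the fraction \<open>r\<close> of
  the segment already covered.\<close>

lemma trajectory_on:
  assumes t: "trajectory E \<omega> \<sigma> (x, s, \<delta>)"
    and p0: "\<sigma> = (fst p0, s0, dir (snd (snd p0)))" "p0 \<in> P" "frac s0 = frac (start p0 + dir (snd (snd p0)) * r0 / M)" "0 \<le> r0" "r0 < 1"
  shows "\<exists>n j d r. (step ^^ n) p0 = (x, j, d) \<and> (x, j, d) \<in> P \<and> \<delta> = dir d \<and> 0 \<le> r \<and> r < 1 \<and>
    frac s = frac (start (x, j, d) + dir d * r / M)"
  using t
proof (induction "(x, s, \<delta>)" arbitrary: x s \<delta> rule: trajectory.induct)
  case start
  then show ?case using p0
    by (intro exI[of _ "0::nat"] exI[of _ "fst (snd p0)"] exI[of _ "snd (snd p0)"] exI[of _ r0]) auto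
next
  case (jump x s \<delta> h y m)
  obtain n j d r where p: "(step ^^ n) p0 = (x, j, d)" "(x, j, d) \<in> P" "\<delta> = dir d" and r: "0 \<le> r" "r < 1"
    and s: "frac s = frac (start (x, j, d) + dir d * r / M)" using jump(2) by blast
  have f: "free_flight E \<omega> x s (dir d) h" using jump p by simp
  obtain n' j' q where j': "(step ^^ n') (x, j, d) = (x, j', d)" "(x, j', d) \<in> P" and q: "0 \<le> q" "q \<le> 1"
    and e: "frac (s + dir d * h) = frac (start (x, j', d) + dir d * q / M)" and q0: "0 < h \<Longrightarrow> 0 < q"
    using fly_end[OF p(2) r s f less_imp_le[OF jump(3)]] by metis
  have se: "start (x, j', d) + dir d * q / M = (real (j' + 1) + (- dir d) * (1 - q)) / M"
    by (simp add: start_def add_divide_distrib diff_divide_distrib algebra_simps)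
  have "q = 1"
  proof (rule ccontr)
    assume "q \<noteq> 1"
    then have "0 < 1 - q" "1 - q < 1" using q q0 jump(3) by auto
    from no_mark_between[OF _ this, of "- dir d" x y "j' + 1" m] jump(5) show False
      unfolding p(3) e se by (auto simp: dir_def)
  qed
  then have e': "frac (s + dir d * h) = frac ((real j' + 1) / M)" using e end_start by simp
  have m: "mark_at E \<omega> x y (frac ((real j' + 1) / M)) m" using jump(5) e' p(3) by simp
  from step_mark[OF j'(2) m] obtain j'' where st: "step (x, j', d) = (y, j'', if m = Cross then d else \<not> d)" by blast
  have "(step ^^ (Suc (n' + n))) p0 = (y, j'', if m = Cross then d else \<not> d)"
    using st j'(1) p(1) by (simp add: funpow_add)
  moreover have "(y, j'', if m = Cross then d else \<not> d) \<in> P" using step_props(1)[OF j'(2)] st by simp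
  moreover have "frac (start (y, j'', if m = Cross then d else \<not> d)) = frac (s + \<delta> * h)"
    using start_step[OF j'(2)] st e' p(3) by simp
  ultimately show ?case using step_mark(2)[OF j'(2) m] p(3)
    by (intro exI[of _ "Suc (n' + n)"] exI[of _ j''] exI[of _ "if m = Cross then d else \<not> d"] exI[of _ 0]) simp
qed

lemma loop_from_subset:
  assumes p0: "p0 \<in> P" "frac s0 = frac (start p0 + dir (snd (snd p0)) * r0 / M)" "0 \<le> r0" "r0 < 1"
  shows "loop_from E \<omega> (fst p0, s0, dir (snd (snd p0))) \<subseteq> (\<Union>n. arc ((step ^^ n) p0))"
proof
  fix z assume "z \<in> loop_from E \<omega> (fst p0, s0, dir (snd (snd p0)))"
  then obtain x s \<delta> h where z: "z = (x, frac (s + \<delta> * h))" and h: "0 \<le> h" and f: "free_flight E \<omega> x s \<delta> h"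
    and t: "trajectory E \<omega> (fst p0, s0, dir (snd (snd p0))) (x, s, \<delta>)" unfolding loop_from_def by auto
  from trajectory_on[OF t refl p0]
  obtain n j d r where p: "(step ^^ n) p0 = (x, j, d)" "(x, j, d) \<in> P" "\<delta> = dir d" and r: "0 \<le> r" "r < 1"
    and s: "frac s = frac (start (x, j, d) + dir d * r / M)" by blast
  obtain n' j' q where j': "(step ^^ n') (x, j, d) = (x, j', d)" and q: "0 \<le> q" "q \<le> 1"
    and e: "frac (s + dir d * h) = frac (start (x, j', d) + dir d * q / M)"
    using fly_end[OF p(2) r s f[unfolded p(3)] h] by metis
  have "z \<in> arc ((step ^^ (n' + n)) p0)" using p j' q e z unfolding arc_def by (auto simp: funpow_add)
  then show "z \<in> (\<Union>n. arc ((step ^^ n) p0))" by blast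
qed

text \<open>The point at fraction \<open>r\<close> of the segment of \<open>p\<close> lies on
  the trajectory and has been reached by a flight that can be continued: no mark is met at the
  end point of the flight, unless the flight has length zero and the state was just entered.\<close>

definition reach :: "'v \<times> real \<times> real \<Rightarrow> 'v \<times> nat \<times> bool \<Rightarrow> real \<Rightarrow> bool" where
  "reach \<sigma> p r \<longleftrightarrow> (\<exists>s h. trajectory E \<omega> \<sigma> (fst p, s, dir (snd (snd p))) \<and> 0 \<le> h \<and>
     free_flight E \<omega> (fst p) s (dir (snd (snd p))) h \<and>
     frac (s + dir (snd (snd p)) * h) = frac (start p + dir (snd (snd p)) * r / M) \<and>
     (h = 0 \<or> (\<forall>y m. \<not> mark_at E \<omega> (fst p) y (frac (s + dir (snd (snd p)) * h)) m)))"

lemma reach_extend: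
  assumes f: "free_flight E \<omega> x s (dir d) h" and h: "0 \<le> h"
    and e: "frac (s + dir d * h) = frac (start (x, j, d) + dir d * r / M)"
    and nm: "h = 0 \<or> (\<forall>y m. \<not> mark_at E \<omega> x y (frac (s + dir d * h)) m)" and r: "0 \<le> r" "r < 1"
  shows "free_flight E \<omega> x s (dir d) (h + (1 - r) / M)"
  unfolding free_flight_def
proof (intro allI impI)
  fix r' y m assume r': "0 < r'" "r' < h + (1 - r) / M"
  show "\<not> mark_at E \<omega> x y (frac (s + dir d * r')) m"
  proof (cases "r' < h")
    case True
    then show ?thesis using f r' unfolding free_flight_def by blast
  next
    case False
    show ?thesis
    proof (cases "r' = h")
      case True
      then show ?thesis using nm r' by auto
    next
      case ne: False
      define q where "q = r + (r' - h) * M"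
      have "0 < (r' - h) * M" using False ne M_pos by simp
      moreover have "(r' - h) * M < 1 - r" using r' M_pos by (simp add: field_simps)
      ultimately have "0 < 1 - q" "1 - q < 1" using r by (auto simp: q_def)
      moreover have "frac (s + dir d * r') = frac ((real (j + 1) + (- dir d) * (1 - q)) / M)"
      proof -
        have "s + dir d * r' = s + dir d * h + dir d * (r' - h)" by (simp add: algebra_simps)
        moreover have "start (x, j, d) + dir d * r / M + dir d * (r' - h) = (real (j + 1) + (- dir d) * (1 - q)) / M"
          using M_pos by (simp add: start_def q_def field_simps)
        ultimately show ?thesis using frac_shift[OF e, of "dir d * (r' - h)"] by (simp only:)
      qed
      ultimately show ?thesis using no_mark_between[of "- dir d" "1 - q" x y "j + 1" m] by (auto simp: dir_def)
    qed
  qed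
qed

text \<open>At the end of a segment the flight either goes on, if the layer has no mark at the
  vertex, or ends in a jump that starts a new flight of length zero.\<close>

lemma reach_step:
  assumes re: "reach \<sigma> p r" and p: "p \<in> P" and r: "0 \<le> r" "r < 1"
  shows "reach \<sigma> (step p) 0"
proof -
  obtain x j d where pe: "p = (x, j, d)" by (cases p)
  obtain s h where t: "trajectory E \<omega> \<sigma> (x, s, dir d)" and h: "0 \<le> h" and f: "free_flight E \<omega> x s (dir d) h"
    and e: "frac (s + dir d * h) = frac (start (x, j, d) + dir d * r / M)"
    and nm: "h = 0 \<or> (\<forall>y m. \<not> mark_at E \<omega> x y (frac (s + dir d * h)) m)"
    using re unfolding reach_def pe by auto
  let ?h = "h + (1 - r) / M"
  have f': "free_flight E \<omega> x s (dir d) ?h" by (rule reach_extend[OF f h e nm r])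
  have h': "0 < ?h" using h r M_pos by (simp add: add_nonneg_pos)
  have e': "frac (s + dir d * ?h) = frac ((real j + 1) / M)"
  proof -
    have "s + dir d * ?h = s + dir d * h + dir d * ((1 - r) / M)" by (simp add: algebra_simps)
    moreover have "start (x, j, d) + dir d * r / M + dir d * ((1 - r) / M) = (real j + 1) / M"
      using M_pos by (simp add: start_def field_simps)
    ultimately show ?thesis using frac_shift[OF e, of "dir d * ((1 - r) / M)"] by (simp only:)
  qed
  have p': "(x, j, d) \<in> P" using p pe by simp
  show ?thesis
  proof (cases "\<exists>y m. mark_at E \<omega> x y (frac ((real j + 1) / M)) m")
    case True
    then obtain y m where m: "mark_at E \<omega> x y (frac ((real j + 1) / M)) m" by blast
    from step_mark[OF p' m] obtain j'' where st: "step (x, j, d) = (y, j'', if m = Cross then d else \<not> d)" by blast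
    have "trajectory E \<omega> \<sigma> (y, frac (s + dir d * ?h), if m = Cross then dir d else - dir d)"
      by (rule trajectory.jump[OF t h' f']) (use m e' in simp)
    then show ?thesis using st start_step[OF p'] e' step_mark(2)[OF p' m] unfolding reach_def pe
      by (intro exI[of _ "frac (s + dir d * ?h)"] exI[of _ 0]) (auto simp: free_flight_def)
  next
    case False
    then obtain j' where st: "step (x, j, d) = (x, j', d)" using step_free[OF p'] by blast
    show ?thesis using st start_step[OF p'] e' t h' f' False unfolding reach_def pe
      by (intro exI[of _ s] exI[of _ ?h]) auto
  qed
qed

lemma reach_arc:
  assumes re: "reach \<sigma> p 0"
  shows "arc p \<subseteq> loop_from E \<omega> \<sigma>"
proof
  fix z assume "z \<in> arc p"
  obtain x j d where pe: "p = (x, j, d)" by (cases p)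
  from \<open>z \<in> arc p\<close> obtain q where z: "z = (x, frac (start p + dir d * q / M))" and q: "0 \<le> q" "q \<le> 1"
    unfolding arc_def pe by auto
  obtain s h where t: "trajectory E \<omega> \<sigma> (x, s, dir d)" and h: "0 \<le> h" and f: "free_flight E \<omega> x s (dir d) h"
    and e: "frac (s + dir d * h) = frac (start (x, j, d) + dir d * 0 / M)"
    and nm: "h = 0 \<or> (\<forall>y m. \<not> mark_at E \<omega> x y (frac (s + dir d * h)) m)"
    using re unfolding reach_def pe by auto
  have f': "free_flight E \<omega> x s (dir d) (h + (1 - 0) / M)" by (rule reach_extend[OF f h e nm]) auto
  have "q / M \<le> 1 / M" using q M_pos by (intro divide_right_mono) auto
  then have "free_flight E \<omega> x s (dir d) (h + q / M)" using f' unfolding free_flight_def by fastforce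
  moreover have "z = (x, frac (s + dir d * (h + q / M)))"
    using frac_shift[OF e, of "dir d * (q / M)"] unfolding z pe by (simp add: field_simps)
  moreover have "0 \<le> h + q / M" using h q M_pos by simp
  ultimately show "z \<in> loop_from E \<omega> \<sigma>" unfolding loop_from_def using t by blast
qed

lemma funpow_P: "p \<in> P \<Longrightarrow> (step ^^ n) p \<in> P"
  by (induction n) (simp_all add: step_props(1))

lemma step_inj: assumes "p \<in> P" "q \<in> P" "step p = step q" shows "p = q"
proof -
  have "p = port_link ls (port_rev M (step p))" using step_props(3)[OF assms(1)] by (rule sym)
  also have "\<dots> = q" unfolding assms(3) by (rule step_props(3)[OF assms(2)])
  finally show ?thesis .
qed

text \<open>A step is injective on a finite set.\<close>

lemma periodic: assumes "p \<in> P" obtains N where "0 < N" "(step ^^ N) p = p"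
proof -
  have cancel: "a = b" if "a \<in> P" "b \<in> P" "(step ^^ n) a = (step ^^ n) b" for a b n
    using that(3)
  proof (induction n)
    case (Suc n)
    then have "step ((step ^^ n) a) = step ((step ^^ n) b)" by simp
    then have "(step ^^ n) a = (step ^^ n) b" by (rule step_inj[OF funpow_P[OF that(1)] funpow_P[OF that(2)]])
    then show ?case by (rule Suc.IH)
  qed simp
  have "\<not> inj_on (\<lambda>n. (step ^^ n) p) UNIV"
  proof
    assume "inj_on (\<lambda>n. (step ^^ n) p) UNIV"
    moreover have "finite (range (\<lambda>n. (step ^^ n) p))"
      by (rule finite_subset[OF _ finite_P]) (use funpow_P[OF assms] in auto)
    ultimately show False using finite_imageD by blast
  qed
  then obtain i j where "i \<noteq> j" "(step ^^ i) p = (step ^^ j) p" by (auto simp: inj_on_def)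
  then obtain i j where ij: "i < j" "(step ^^ i) p = (step ^^ j) p"
    by (metis nat_neq_iff)
  then have "(step ^^ i) p = (step ^^ i) ((step ^^ (j - i)) p)"
    by (metis add_diff_inverse_nat funpow_add less_imp_not_less o_apply)
  then have "p = (step ^^ (j - i)) p" using cancel assms funpow_P by blast
  then show ?thesis using that[of "j - i"] ij by simp
qed

text \<open>By periodicity the orbit returns to the first segment, so that the part of it before
  the starting point is covered too.\<close>

lemma loop_from_eq:
  assumes p0: "p0 \<in> P" "frac s0 = frac (start p0 + dir (snd (snd p0)) * r0 / M)" "0 \<le> r0" "r0 < 1"
  shows "loop_from E \<omega> (fst p0, s0, dir (snd (snd p0))) = (\<Union>n. arc ((step ^^ n) p0))"
proof
  let ?\<sigma> = "(fst p0, s0, dir (snd (snd p0)))"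
  have 0: "reach ?\<sigma> p0 r0" unfolding reach_def
    by (intro exI[of _ s0] exI[of _ 0]) (use p0 in \<open>auto intro: trajectory.start simp: free_flight_def\<close>)
  have S: "reach ?\<sigma> ((step ^^ Suc n) p0) 0" for n
  proof (induction n)
    case 0
    then show ?case using reach_step[OF \<open>reach ?\<sigma> p0 r0\<close> p0(1,3,4)] by simp
  next
    case (Suc n)
    then show ?case using reach_step[OF Suc funpow_P[OF p0(1)]] by simp
  qed
  obtain N where N: "0 < N" "(step ^^ N) p0 = p0" using periodic[OF p0(1)] .
  have "reach ?\<sigma> ((step ^^ n) p0) 0" for n
  proof (cases n)
    case 0
    then show ?thesis using S[of "N - 1"] N by simp
  next
    case (Suc n')
    then show ?thesis using S[of n'] by simp
  qed
  then show "(\<Union>n. arc ((step ^^ n) p0)) \<subseteq> loop_from E \<omega> ?\<sigma>" using reach_arc by blast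
qed (rule loop_from_subset[OF p0])

lemma same_node: assumes "p \<in> P" "q \<in> P" "port_node M p = port_node M q" shows "q = p \<or> q = port_rev M p"
  using assms by (auto simp: ports_def port_node_def port_rev_def cyc_up_def split: if_splits)

text \<open>The orbit of a port under the steps runs through the whole component: at a node it
  enters through one of the two ports and leaves through the other, and reversing the
  orientation is the same as exchanging the ports.\<close>

lemma orbit_nodes:
  assumes p0: "p0 \<in> P"
  shows "conn (links V ls) `` {port_node M p0} = range (\<lambda>n. port_node M ((step ^^ n) p0))"
proof (intro equalityI subsetI)
  fix b assume "b \<in> conn (links V ls) `` {port_node M p0}"
  then have "(port_node M p0, b) \<in> (links V ls)\<^sup>*" unfolding conn_def links_sym[OF ok] by simp
  then show "b \<in> range (\<lambda>n. port_node M ((step ^^ n) p0))"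
  proof (induction rule: rtrancl_induct)
    case base
    then show ?case by (rule range_eqI[of _ _ 0]) simp
  next
    case (step a b)
    from step(3) obtain n where a: "a = port_node M ((local.step ^^ n) p0)" by auto
    let ?p = "(local.step ^^ n) p0"
    have p: "?p \<in> P" by (rule funpow_P[OF p0])
    from step(2) obtain q where q: "q \<in> P" "a = port_node M q" "b = port_node M (port_link ls q)"
      unfolding links_def len by auto
    from same_node[OF p q(1)] a q(2) consider "q = ?p" | "q = port_rev M ?p" by auto
    then show ?case
    proof cases
      case 1
      then have "b = port_node M ((local.step ^^ Suc n) p0)" using q(3) step_props(2)[OF p] by simp
      then show ?thesis by blast
    next
      case 2
      obtain N where N: "0 < N" "(local.step ^^ N) p0 = p0" using periodic[OF p0] .
      have "?p = (local.step ^^ (n + N)) p0" using N by (simp add: funpow_add)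
      moreover have "(local.step ^^ (n + N)) p0 = local.step ((local.step ^^ (n + N - 1)) p0)"
        using N by (metis Suc_diff_1 add_gr_0 comp_apply funpow.simps(2))
      ultimately have "port_link ls q = (local.step ^^ (n + N - 1)) p0"
        using step_props(3)[OF funpow_P[OF p0, of "n + N - 1"]] 2 by simp
      then show ?thesis using q(3) by (intro range_eqI[of _ _ "n + N - 1"]) simp
    qed
  qed
next
  fix b assume "b \<in> range (\<lambda>n. port_node M ((step ^^ n) p0))"
  then obtain n where b: "b = port_node M ((step ^^ n) p0)" by blast
  have "(port_node M p0, port_node M ((step ^^ n) p0)) \<in> conn (links V ls)"
  proof (induction n)
    case (Suc n)
    have "(port_node M ((step ^^ n) p0), port_node M ((step ^^ Suc n) p0)) \<in> links V ls"
      using step_props(2)[OF funpow_P[OF p0]] funpow_P[OF p0] unfolding links_def len by auto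
    then show ?case using conn_trans[OF Suc conn_base] by blast
  qed simp
  then show "b \<in> conn (links V ls) `` {port_node M p0}" using b by simp
qed

definition narc :: "'v \<times> nat \<Rightarrow> ('v \<times> real) set" where
  "narc n = {(fst n, frac ((real (snd n) + q) / M)) | q. 0 \<le> q \<and> q \<le> 1}"

lemma arc_narc: assumes "p \<in> P" shows "arc p = narc (port_node M p)"
proof -
  obtain x j d where p: "p = (x, j, d)" "j < M" using assms by (auto simp: ports_def)
  show ?thesis
  proof (cases d)
    case True
    then show ?thesis unfolding arc_def narc_def p port_node_def start_def dir_def by (simp add: add_divide_distrib)
  next
    case False
    have e: "frac (start p + dir False * q / M) = frac ((real (cyc_up M j) + (1 - q)) / M)" for q
    proof (cases "Suc j = M")
      case True
      then have "start p + dir False * q / M = (real (cyc_up M j) + (1 - q)) / M + of_int 1"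
        using M_pos False by (auto simp: start_def dir_def cyc_up_def p field_simps)
      then show ?thesis unfolding frac_eq_iff_int by blast
    qed (simp add: start_def dir_def cyc_up_def p False algebra_simps add_divide_distrib diff_divide_distrib)
    have "arc p = {(x, frac ((real (cyc_up M j) + (1 - q)) / M)) | q. 0 \<le> q \<and> q \<le> 1}"
      unfolding arc_def using e False p by simp
    also have "\<dots> = {(x, frac ((real (cyc_up M j) + q) / M)) | q. 0 \<le> q \<and> q \<le> 1}"
    proof (intro equalityI subsetI; clarify)
      fix q :: real assume "0 \<le> q" "q \<le> 1"
      then show "\<exists>q'. (x, frac ((real (cyc_up M j) + (1 - q)) / M)) = (x, frac ((real (cyc_up M j) + q') / M)) \<and> 0 \<le> q' \<and> q' \<le> 1"
        "\<exists>q'. (x, frac ((real (cyc_up M j) + q) / M)) = (x, frac ((real (cyc_up M j) + (1 - q')) / M)) \<and> 0 \<le> q' \<and> q' \<le> 1"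
        by (auto intro: exI[of _ "1 - q"])
    qed
    finally show ?thesis using False p by (simp add: narc_def port_node_def)
  qed
qed

definition comp_points :: "'v \<times> nat \<Rightarrow> ('v \<times> real) set" where
  "comp_points n = (\<Union>b\<in>conn (links V ls) `` {n}. narc b)"

lemma loop_from_comp:
  assumes p0: "p0 \<in> P" "frac s0 = frac (start p0 + dir (snd (snd p0)) * r0 / M)" "0 \<le> r0" "r0 < 1"
  shows "loop_from E \<omega> (fst p0, s0, dir (snd (snd p0))) = comp_points (port_node M p0)"
  unfolding loop_from_eq[OF p0] comp_points_def orbit_nodes[OF p0(1)]
  by (simp add: arc_narc[OF funpow_P[OF p0(1)]])

lemma loops_eq: "loops V E \<omega> = comp_points ` nodes V M"
proof (intro equalityI subsetI)
  fix \<gamma> assume "\<gamma> \<in> loops V E \<omega>"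
  then obtain x s \<delta> where g: "\<gamma> = loop_from E \<omega> (x, s, \<delta>)" "x \<in> V" "s \<in> {0..<1}" "\<delta> \<in> {1, -1}"
    unfolding loops_def by auto
  define d where "d = (\<delta> = 1)"
  have d: "\<delta> = dir d" using g(4) by (auto simp: d_def dir_def)
  have sM: "0 \<le> s * M" "s * M < M" using g(3) M_pos by auto
  define i where "i = nat \<lfloor>s * M\<rfloor>"
  have i: "real i \<le> s * M" "s * M < real i + 1" "i < M"
    using sM floor_correct[of "s * M"] unfolding i_def by linarith+
  have "\<exists>j r. (x, j, d) \<in> P \<and> 0 \<le> r \<and> r < 1 \<and> frac s = frac (start (x, j, d) + dir d * r / M)"
  proof (cases d)
    case True
    have "s = start (x, i, d) + dir d * (s * M - i) / M" using True M_pos by (simp add: start_def dir_def field_simps)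
    then show ?thesis using i g(2) True by (intro exI[of _ i] exI[of _ "s * M - i"]) (auto simp: ports_def)
  next
    case False
    define c where "c = nat \<lceil>s * M\<rceil>"
    have c: "s * M \<le> real c" "real c < s * M + 1" using sM ceiling_correct[of "s * M"] unfolding c_def by linarith+
    define j where "j = (if c = 0 then M - 2 else if c = 1 then M - 1 else c - 2)"
    show ?thesis
    proof (cases "c = 0")
      case True
      then have "s * M = 0" using c sM by simp
      then have s: "s = 0" using M_pos by simp
      show ?thesis
      proof (cases "M = 1")
        case True
        have "frac s = frac (start (x, 0, d) + dir d * 0 / M)" using False s True by (simp add: start_def dir_def)
        then show ?thesis using g(2) True by (intro exI[of _ 0]) (auto simp: ports_def)
      next
        case M1: False
        then have "M \<ge> 2" using M_pos by linarith
        then have "start (x, M - 2, d) + dir d * 0 / M = 1" using False by (simp add: start_def dir_def of_nat_diff)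
        then have "frac s = frac (start (x, M - 2, d) + dir d * 0 / M)" using s by simp
        then show ?thesis using g(2) M_pos by (intro exI[of _ "M - 2"] exI[of _ 0]) (auto simp: ports_def)
      qed
    next
      case c0: False
      have cM: "c \<le> M" using c sM by linarith
      show ?thesis
      proof (cases "c = 1")
        case True
        have "start (x, M - 1, d) + dir d * (c - s * M) / M = s + of_int 1"
          using False True M_pos by (simp add: start_def dir_def field_simps of_nat_diff)
        then have "frac s = frac (start (x, M - 1, d) + dir d * (c - s * M) / M)" by (simp add: frac_def)
        then show ?thesis using g(2) M_pos c by (intro exI[of _ "M - 1"] exI[of _ "c - s * M"]) (auto simp: ports_def)
      next
        case c1: False
        then have "s = start (x, c - 2, d) + dir d * (c - s * M) / M"
          using False c0 M_pos by (simp add: start_def dir_def field_simps of_nat_diff)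
        then show ?thesis using g(2) M_pos c cM c0 c1 by (intro exI[of _ "c - 2"] exI[of _ "c - s * M"]) (auto simp: ports_def)
      qed
    qed
  qed
  then obtain j r where j: "(x, j, d) \<in> P" and r: "frac s = frac (start (x, j, d) + dir d * r / M)" "0 \<le> r" "r < 1" by blast
  have "\<gamma> = comp_points (port_node M (x, j, d))"
    using loop_from_comp[OF j, of s r] r d g(1) by simp
  then show "\<gamma> \<in> comp_points ` nodes V M" using port_node_nodes[OF j] by blast
next
  fix \<gamma> assume "\<gamma> \<in> comp_points ` nodes V M"
  then obtain x i where g: "\<gamma> = comp_points (x, i)" "x \<in> V" "i < M" by (auto simp: nodes_def)
  have j: "(x, i, True) \<in> P" using g by (simp add: ports_def)
  have s: "real i / M \<in> {0..<1}" using g(3) M_pos by simp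
  have "\<gamma> = loop_from E \<omega> (x, real i / M, 1)"
    using loop_from_comp[OF j, of "real i / M" 0] g by (simp add: start_def dir_def port_node_def)
  then show "\<gamma> \<in> loops V E \<omega>" unfolding loops_def using g s by blast
qed

lemma conn_nodes: assumes "n \<in> nodes V M" "(n, b) \<in> conn (links V ls)" shows "b \<in> nodes V M"
proof -
  have "(n, b) \<in> (links V ls)\<^sup>*" using assms(2) unfolding conn_def links_sym[OF ok] by simp
  then show ?thesis
  proof (induction rule: rtrancl_induct)
    case (step y z)
    then show ?case using links_nodes[OF ok] unfolding len by blast
  qed (rule assms)
qed

text \<open>The midpoint of a segment lies in no other segment; this shows that different
  components have different loops even though closed segments share end points.\<close>

lemma narc_mid: assumes i: "i < M" and b: "snd b < M"
  shows "(x, (real i + 1/2) / M) \<in> narc b \<longleftrightarrow> b = (x, i)"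
proof
  assume "b = (x, i)"
  moreover have "frac ((real i + 1/2) / M) = (real i + 1/2) / M" using i by (subst frac_in) auto
  ultimately show "(x, (real i + 1/2) / M) \<in> narc b" unfolding narc_def by (auto intro!: exI[of _ "1/2"])
next
  assume "(x, (real i + 1/2) / M) \<in> narc b"
  then obtain q where q: "x = fst b" "(real i + 1/2) / M = frac ((real (snd b) + q) / M)" "0 \<le> q" "q \<le> 1"
    unfolding narc_def by auto
  show "b = (x, i)"
  proof (cases "real (snd b) + q < M")
    case True
    then have "frac ((real (snd b) + q) / M) = (real (snd b) + q) / M" using q by (subst frac_in) auto
    then have "real i + 1/2 = real (snd b) + q" using q(2) M_pos by simp
    then have "i = snd b" using q by linarith
    then show ?thesis using q(1) by (cases b) auto
  next
    case False
    then have "real (snd b) + q = M" using b q by linarith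
    then have "(real i + 1/2) / M = 0" using q(2) M_pos by simp
    then show ?thesis using M_pos by simp
  qed
qed

lemma num_loops_eq: "num_loops V E \<omega> = nloops V ls"
proof -
  let ?C = "\<lambda>n. conn (links V ls) `` {n}"
  let ?G = "\<lambda>C. \<Union>b\<in>C. narc b"
  have inj: "inj_on ?G (?C ` nodes V M)"
  proof (rule inj_onI)
    fix A B assume A: "A \<in> ?C ` nodes V M" and B: "B \<in> ?C ` nodes V M" and eq: "?G A = ?G B"
    have sub: "A \<subseteq> nodes V M" "B \<subseteq> nodes V M" using A B conn_nodes by auto
    have iff: "(x, i) \<in> X \<longleftrightarrow> (x, (real i + 1/2) / M) \<in> ?G X" if "X \<subseteq> nodes V M" "i < M" for X x i
    proof -
      have "(x, (real i + 1/2) / M) \<in> narc b \<longleftrightarrow> b = (x, i)" if "b \<in> X" for b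
        by (rule narc_mid) (use that \<open>i < M\<close> \<open>X \<subseteq> nodes V M\<close> in \<open>auto simp: nodes_def\<close>)
      then show ?thesis by auto
    qed
    have "(x, i) \<in> A \<longleftrightarrow> (x, i) \<in> B" if "i < M" for x i
      unfolding iff[OF sub(1) that] iff[OF sub(2) that] eq ..
    then show "A = B" using sub unfolding nodes_def by auto
  qed
  have "loops V E \<omega> = ?G ` ?C ` nodes V M" unfolding loops_eq comp_points_def by auto
  then show ?thesis unfolding num_loops_def nloops_def ncomp_def len using card_image[OF inj] by simp
qed

text \<open>The vertices that a loop visits at time \<open>0\<close> are part of its support.\<close>

lemma slice_le:
  assumes "\<not> large_loop V E \<eta> \<omega>" "x \<in> V"
  shows "real (card {y \<in> V. ((x, 0), (y, 0)) \<in> conn (links V ls)}) \<le> \<eta> * card V"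
proof -
  have x: "(x, 0) \<in> nodes V M" using assms(2) M_pos by (simp add: nodes_def)
  have "{y \<in> V. ((x, 0), (y, 0)) \<in> conn (links V ls)} \<subseteq> loop_support (comp_points (x, 0))"
  proof
    fix y assume y: "y \<in> {y \<in> V. ((x, 0), (y, 0)) \<in> conn (links V ls)}"
    have "(y, 0) \<in> narc (y, 0)" unfolding narc_def by (auto intro!: exI[of _ 0])
    then show "y \<in> loop_support (comp_points (x, 0))" using y unfolding loop_support_def comp_points_def by auto
  qed
  moreover have "loop_support (comp_points (x, 0)) \<subseteq> V"
    using conn_nodes[OF x] by (auto simp: loop_support_def comp_points_def narc_def nodes_def)
  ultimately have "card {y \<in> V. ((x, 0), (y, 0)) \<in> conn (links V ls)} \<le> card (loop_support (comp_points (x, 0)))"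
    using V by (meson card_mono finite_subset)
  moreover have "real (card (loop_support (comp_points (x, 0)))) \<le> \<eta> * card V"
    using assms(1) x unfolding large_loop_def loops_eq by force
  ultimately show ?thesis by linarith
qed

end

section \<open>Measurability\<close>

lemma UNIV_mark: "(UNIV :: mark set) = {Cross, Bar}" by (auto intro: mark.exhaust)
lemma all_mark: "(\<forall>m. R m) \<longleftrightarrow> R Cross \<and> R Bar" by (metis mark.exhaust)
instance mark :: finite by standard (simp add: UNIV_mark)

definition mark_weight :: "real \<Rightarrow> mark \<Rightarrow> real" where
  "mark_weight u m = (if m = Cross then u else 1 - u)"

lemma sets_strip:
  assumes "A \<in> sets borel" "A \<subseteq> {0..<1}" shows "A \<times> {m} \<in> sets (mark_law u)"
  unfolding mark_law_def by (rule pair_measureI) (use assms in \<open>auto simp: sets_restrict_space\<close>)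

lemma space_mark_law: "space (mark_law u) = {0..<1} \<times> UNIV"
  by (simp add: mark_law_def space_pair_measure space_restrict_space)

lemma measure_strip:
  assumes u: "0 \<le> u" "u \<le> 1" and ab: "0 \<le> a" "a \<le> b" "b \<le> 1"
  shows "measure (mark_law u) ({a..<b} \<times> {m}) = (b - a) * mark_weight u m"
proof -
  let ?p = "map_pmf (\<lambda>b. if b then Cross else Bar) (bernoulli_pmf u)"
  have s: "{a..<b} \<in> sets (restrict_space lborel {0..<1})" using ab by (auto simp: sets_restrict_space)
  have "emeasure (mark_law u) ({a..<b} \<times> {m}) = emeasure (restrict_space lborel {0..<1}) {a..<b} * emeasure (measure_pmf ?p) {m}"
    unfolding mark_law_def by (rule measure_pmf.emeasure_pair_measure_Times[OF s]) simp
  also have "emeasure (restrict_space lborel {0..<1}) {a..<b} = ennreal (b - a)"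
    using ab by (subst emeasure_restrict_space) auto
  also have "emeasure (measure_pmf ?p) {m} = ennreal (pmf ?p m)" by (rule emeasure_pmf_single)
  also have "pmf ?p m = mark_weight u m"
  proof -
    have "pmf ?p m = measure (measure_pmf (bernoulli_pmf u)) ((\<lambda>b. if b then Cross else Bar) -` {m})"
      by (simp add: pmf_map)
    also have "(\<lambda>b. if b then Cross else Bar) -` {m} = {m = Cross}" by (cases m) (auto split: if_splits)
    also have "measure (measure_pmf (bernoulli_pmf u)) {m = Cross} = mark_weight u m"
      using u by (simp add: measure_pmf_single mark_weight_def)
    finally show ?thesis .
  qed
  finally have "emeasure (mark_law u) ({a..<b} \<times> {m}) = ennreal ((b - a) * mark_weight u m)"
    using ab u by (simp add: ennreal_mult mark_weight_def)
  then show ?thesis using ab u by (simp add: measure_def mark_weight_def)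
qed

lemma points_in_pos: "points_in B \<xi> > 0 \<longleftrightarrow> (\<exists>p\<in>#\<xi>. p \<in> B)"
proof -
  have "points_in B \<xi> = 0 \<longleftrightarrow> (\<forall>p\<in>#\<xi>. p \<notin> B)"
    unfolding points_in_def size_eq_0_iff_empty set_mset_eq_empty_iff[symmetric] by auto
  then show ?thesis by auto
qed

lemma points_in_le_1: assumes "points_in B \<xi> \<le> 1" "p \<in># \<xi>" "q \<in># \<xi>" "p \<in> B" "q \<in> B" shows "p = q"
proof (rule ccontr)
  assume "p \<noteq> q"
  then have "{p, q} \<subseteq> set_mset (filter_mset (\<lambda>p. p \<in> B) \<xi>)" using assms by auto
  then have "card {p, q} \<le> card (set_mset (filter_mset (\<lambda>p. p \<in> B) \<xi>))" by (intro card_mono) auto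
  also have "\<dots> \<le> size (filter_mset (\<lambda>p. p \<in> B) \<xi>)"
  proof -
    have "card (set_mset M) \<le> size M" for M :: "'a multiset" by (induction M) (auto simp: card_insert_if)
    then show ?thesis .
  qed
  finally show False using assms(1) \<open>p \<noteq> q\<close> by (simp add: points_in_def)
qed

locale poisson_marking =
  fixes E :: "'v set set" and t u :: real
  assumes E: "finite E" and t: "0 \<le> t" and u: "0 \<le> u" "u \<le> 1"
begin

abbreviation "L \<equiv> marking_law E t u"
abbreviation "PP \<equiv> poisson_process t (mark_law u)"

lemma PP_law: "poisson_process_law (scale_measure (ennreal t) (mark_law u)) PP"
  by (rule poisson_process_is_poisson[OF t prob_space_mark_law])

lemma conf_eq: "configurations (scale_measure (ennreal t) (mark_law u)) = configurations (mark_law u)"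
  by (simp add: configurations_def space_scale_measure)

lemma PP: "prob_space PP" "sets PP = sets (configurations (mark_law u))" "space PP = space (configurations (mark_law u))"
  using PP_law unfolding poisson_process_law_def conf_eq by auto

lemma prob_L: "prob_space L" unfolding marking_law_def by (rule prob_space_PiM) (rule PP)

lemma space_L: "\<omega> \<in> space L \<Longrightarrow> e \<in> E \<Longrightarrow> (s, m) \<in># \<omega> e \<Longrightarrow> s \<in> {0..<1}"
proof -
  assume a: "\<omega> \<in> space L" "e \<in> E" "(s, m) \<in># \<omega> e"
  then have "\<omega> e \<in> space PP" by (auto simp: marking_law_def space_PiM)
  then have "set_mset (\<omega> e) \<subseteq> {0..<1} \<times> UNIV" unfolding PP(3) space_configurations space_mark_law by simp
  with a(3) show "s \<in> {0..<1}" by blast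
qed

lemma points_measurable:
  assumes "e \<in> E" "A \<in> sets borel" "A \<subseteq> {0..<1}"
  shows "(\<lambda>\<omega>. points_in (A \<times> {m}) (\<omega> e)) \<in> measurable L (count_space UNIV)"
proof -
  have "points_in (A \<times> {m}) \<in> measurable PP (count_space UNIV)"
    using measurable_points_in[OF sets_strip[OF assms(2,3)]] measurable_cong_sets[OF PP(2) refl] by blast
  moreover have "(\<lambda>\<omega>. \<omega> e) \<in> measurable L PP" unfolding marking_law_def
    by (rule measurable_component_singleton[OF assms(1)])
  ultimately show ?thesis by (rule measurable_compose[rotated])
qed

lemma points_event:
  assumes "e \<in> E" "A \<in> sets borel" "A \<subseteq> {0..<1}"
  shows "{\<omega> \<in> space L. Q (points_in (A \<times> {m}) (\<omega> e))} \<in> sets L"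
  using measurable_sets[OF points_measurable[OF assms], of "{n. Q n}"] by (simp add: vimage_def Int_def conj_commute)

text \<open>The point \<open>0\<close> is a cell of its own, as patterns treat time
  \<open>0\<close> separately.\<close>

definition pcell :: "nat \<Rightarrow> nat \<Rightarrow> real set" where
  "pcell N i = (if i = 0 then {0} else if i = 1 then {0<..<1 / N} else {(real i - 1) / N..<real i / N})"

text \<open>All marks in \<open>J\<close> occur at the same time and form the set
  \<open>B\<close>. That two marks do not have different times is expressed by rational
  separators, which gives a countable intersection of counting events.\<close>

definition cell_cond :: "real set \<Rightarrow> ('v set \<times> mark) set \<Rightarrow> 'v marking \<Rightarrow> bool" where
  "cell_cond J B \<omega> \<longleftrightarrow> (\<forall>e\<in>E. \<forall>m. points_in (J \<times> {m}) (\<omega> e) > 0 \<longleftrightarrow> (e, m) \<in> B) \<and>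
     (\<forall>q\<in>\<rat>. \<forall>e\<in>E. \<forall>m. \<forall>e'\<in>E. \<forall>m'. \<not> (points_in ((J \<inter> {..<q}) \<times> {m}) (\<omega> e) > 0 \<and> points_in ((J \<inter> {q..}) \<times> {m'}) (\<omega> e') > 0))"

lemma cell_cond_event:
  assumes J: "J \<in> sets borel" "J \<subseteq> {0..<1}"
  shows "{\<omega> \<in> space L. cell_cond J B \<omega>} \<in> sets L"
proof -
  have 1: "{\<omega> \<in> space L. \<forall>e\<in>E. \<forall>m. points_in (J \<times> {m}) (\<omega> e) > 0 \<longleftrightarrow> (e, m) \<in> B} \<in> sets L"
    unfolding all_mark by (intro sets.sets_Collect_finite_All[OF _ E] sets.sets_Collect_conj points_event J)
  have 2: "{\<omega> \<in> space L. \<not> (points_in ((J \<inter> {..<q}) \<times> {m}) (\<omega> e) > 0 \<and> points_in ((J \<inter> {q..}) \<times> {m'}) (\<omega> e') > 0)} \<in> sets L"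
    if "e \<in> E" "e' \<in> E" for q e e' m m'
    by (intro sets.sets_Collect_neg sets.sets_Collect_conj points_event that) (use J in auto)
  have 3: "{\<omega> \<in> space L. \<forall>e\<in>E. \<forall>m. \<forall>e'\<in>E. \<forall>m'. \<not> (points_in ((J \<inter> {..<q}) \<times> {m}) (\<omega> e) > 0 \<and> points_in ((J \<inter> {q..}) \<times> {m'}) (\<omega> e') > 0)} \<in> sets L" for q
    unfolding all_mark by (intro sets.sets_Collect_finite_All[OF _ E] sets.sets_Collect_conj 2)
  show ?thesis unfolding cell_cond_def
    by (intro sets.sets_Collect_conj 1 sets.sets_Collect_countable_All'[OF _ countable_rat] 3)
qed

lemma cell_cond_unique:
  assumes "cell_cond J B \<omega>" "e \<in> E" "e' \<in> E" "(s, m) \<in># \<omega> e" "(s', m') \<in># \<omega> e'" "s \<in> J" "s' \<in> J"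
  shows "s = s'"
proof -
  have F: False if st: "s < s'" "e \<in> E" "e' \<in> E" "(s, m) \<in># \<omega> e" "(s', m') \<in># \<omega> e'" "s \<in> J" "s' \<in> J" for s s' m m' e e'
  proof -
    obtain q where q: "q \<in> \<rat>" "s < q" "q < s'" using Rats_dense_in_real[OF st(1)] by blast
    have "points_in ((J \<inter> {..<q}) \<times> {m}) (\<omega> e) > 0" "points_in ((J \<inter> {q..}) \<times> {m'}) (\<omega> e') > 0"
      unfolding points_in_pos using st q by force+
    then show False using assms(1) q(1) st(2,3) unfolding cell_cond_def by blast
  qed
  show ?thesis
  proof (rule ccontr)
    assume "s \<noteq> s'"
    then consider "s < s'" | "s' < s" by linarith
    then show False using F[of s s' e e' m m'] F[of s' s e' e m' m] assms by cases blast+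
  qed
qed

lemma pcell_props:
  assumes "0 < N" "i \<le> N"
  shows "pcell N i \<in> sets borel" "pcell N i \<subseteq> {0..<1}" "pcell N i \<noteq> {}"
    "s \<in> pcell N i \<Longrightarrow> s' \<in> pcell N i \<Longrightarrow> \<bar>s - s'\<bar> < 1 / N"
    "i < j \<Longrightarrow> j \<le> N \<Longrightarrow> s \<in> pcell N i \<Longrightarrow> s' \<in> pcell N j \<Longrightarrow> s < s'"
proof -
  have N: "real N > 0" using assms by simp
  show "pcell N i \<in> sets borel" by (simp add: pcell_def)
  have f: "real i / N \<le> 1" "1 / real N \<le> 1" using assms by simp_all
  have c: "i = 0 \<or> i = 1 \<or> 2 \<le> i" by linarith
  show "pcell N i \<subseteq> {0..<1}"
  proof
    fix x assume x: "x \<in> pcell N i"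
    from c show "x \<in> {0..<1}"
    proof (elim disjE)
      assume "i = 0" then show ?thesis using x by (simp add: pcell_def)
    next
      assume "i = 1" then have "0 < x" "x < 1 / N" using x by (simp_all add: pcell_def)
      then show ?thesis using f by simp
    next
      assume 3: "2 \<le> i" then have "(real i - 1) / N \<le> x" "x < real i / N" using x by (simp_all add: pcell_def)
      moreover have "(real i - 1) / N \<ge> 0" using 3 by simp
      ultimately show ?thesis using f by (simp only: atLeastLessThan_iff) linarith
    qed
  qed
  from c show "pcell N i \<noteq> {}"
  proof (elim disjE)
    assume "i = 0" then show ?thesis by (simp add: pcell_def)
  next
    assume "i = 1" then have "(1 / 2) / N \<in> pcell N i" using N by (simp add: pcell_def field_simps)
    then show ?thesis by blast
  next
    assume "2 \<le> i" then have "(real i - 1) / N \<in> pcell N i" using N by (simp add: pcell_def divide_strict_right_mono)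
    then show ?thesis by blast
  qed
  show "\<bar>s - s'\<bar> < 1 / N" if s: "s \<in> pcell N i" "s' \<in> pcell N i"
    using c
  proof (elim disjE)
    assume "i = 0" then show ?thesis using s N by (simp add: pcell_def)
  next
    assume "i = 1" then have "0 < s" "s < 1 / N" "0 < s'" "s' < 1 / N" using s by (simp_all add: pcell_def)
    then show ?thesis by linarith
  next
    assume "2 \<le> i" then have "(real i - 1) / N \<le> s" "s < real i / N" "(real i - 1) / N \<le> s'" "s' < real i / N" using s by (simp_all add: pcell_def)
    moreover have "real i / N - (real i - 1) / N = 1 / N" by (simp add: diff_divide_distrib)
    ultimately show ?thesis by linarith
  qed
  show "s < s'" if ij: "i < j" "j \<le> N" and s: "s \<in> pcell N i" "s' \<in> pcell N j"
  proof -
    have 1: "s' \<ge> (real j - 1) / N \<and> s' > 0"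
    proof (cases "j = 1")
      case False
      then have "(real j - 1) / N \<le> s'" using s ij by (simp add: pcell_def)
      moreover have "(real j - 1) / N > 0" using False ij N by simp
      ultimately show ?thesis by linarith
    qed (use s in \<open>simp add: pcell_def\<close>)
    have 2: "s < real i / N \<or> s = 0" using s by (auto simp: pcell_def split: if_splits)
    have "real i / N \<le> (real j - 1) / N" using ij N by (intro divide_right_mono) auto
    with 1 2 show ?thesis by linarith
  qed
qed

lemma cells_cover: assumes "0 < N" "s \<in> {0..<1}" obtains i where "i \<le> N" "s \<in> pcell N i"
proof (cases "s = 0")
  case True
  then show ?thesis using that[of 0] by (simp add: pcell_def)
next
  case False
  define i where "i = nat \<lfloor>s * N\<rfloor> + 1"
  have N: "real N > 0" using assms by simp
  have sN: "0 \<le> s * N" "s * N < N" using assms by auto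
  have i: "real i - 1 \<le> s * N" "s * N < real i" "i \<le> N" "i \<ge> 1"
    using sN floor_correct[of "s * N"] unfolding i_def by linarith+
  have "s \<in> pcell N i" using i False assms(2) N by (auto simp: pcell_def field_simps)
  then show ?thesis using that i by blast
qed

definition pattern_event :: "nat \<Rightarrow> ('v set \<times> mark) set list \<Rightarrow> 'v marking set" where
  "pattern_event N Ls = {\<omega> \<in> space L. \<forall>i\<in>{..N}. cell_cond (pcell N i) (Ls ! i) \<omega>}"

lemma pattern_event_sets: "0 < N \<Longrightarrow> pattern_event N Ls \<in> sets L"
  unfolding pattern_event_def
  by (intro sets.sets_Collect_finite_All cell_cond_event) (auto simp: pcell_props(1,2) dest: pcell_props(2))

lemma pattern_event_pattern:
  assumes N: "0 < N" and w: "\<omega> \<in> pattern_event N Ls" and l: "length Ls = Suc N"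
  shows "\<exists>ts. has_pattern E \<omega> ts Ls"
proof -
  have sp: "\<omega> \<in> space L" and c: "\<And>i. i \<le> N \<Longrightarrow> cell_cond (pcell N i) (Ls ! i) \<omega>"
    using w by (auto simp: pattern_event_def)
  define tm where "tm i = (if \<exists>e\<in>E. \<exists>m. \<exists>s\<in>pcell N i. (s, m) \<in># \<omega> e
    then SOME s. s \<in> pcell N i \<and> (\<exists>e\<in>E. \<exists>m. (s, m) \<in># \<omega> e) else SOME s. s \<in> pcell N i)" for i
  have tm_in: "tm i \<in> pcell N i" if "i \<le> N" for i
  proof (cases "\<exists>e\<in>E. \<exists>m. \<exists>s\<in>pcell N i. (s, m) \<in># \<omega> e")
    case True
    then have "\<exists>s. s \<in> pcell N i \<and> (\<exists>e\<in>E. \<exists>m. (s, m) \<in># \<omega> e)" by blast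
    from someI_ex[OF this] True show ?thesis unfolding tm_def by simp
  next
    case False
    have "\<exists>s. s \<in> pcell N i" using pcell_props(3)[OF N that] by blast
    from someI_ex[OF this] False show ?thesis unfolding tm_def by simp
  qed
  have tm_eq: "s = tm i" if "i \<le> N" "e \<in> E" "(s, m) \<in># \<omega> e" "s \<in> pcell N i" for i s m e
  proof -
    have ex: "\<exists>s. s \<in> pcell N i \<and> (\<exists>e\<in>E. \<exists>m. (s, m) \<in># \<omega> e)" using that by blast
    then have "\<exists>e\<in>E. \<exists>m. \<exists>s\<in>pcell N i. (s, m) \<in># \<omega> e" by blast
    then have "tm i \<in> pcell N i \<and> (\<exists>e\<in>E. \<exists>m. (tm i, m) \<in># \<omega> e)"
      unfolding tm_def using someI_ex[OF ex] by simp
    then show ?thesis using cell_cond_unique[OF c[OF that(1)] that(2) _ that(3) _ that(4)] by blast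
  qed
  have "has_pattern E \<omega> (map tm [0..<Suc N]) Ls"
    unfolding has_pattern_def
  proof (intro conjI ballI allI)
    show "length (map tm [0..<Suc N]) = length Ls" "Ls \<noteq> []" using l by auto
    show "sorted_wrt (<) (map tm [0..<Suc N])"
      unfolding sorted_wrt_map sorted_wrt_iff_nth_less
      using pcell_props(5)[OF N] tm_in by (auto simp del: upt_Suc)
    have "tm 0 \<in> pcell N 0" by (rule tm_in) simp
    then show "hd (map tm [0..<Suc N]) = 0" by (simp add: hd_map pcell_def del: upt_Suc)
    have "tm N \<in> {0..<1}" using tm_in[of N] pcell_props(2)[OF N, of N] by auto
    then show "last (map tm [0..<Suc N]) < 1" by simp
    fix e s m assume e: "e \<in> E"
    show "(s, m) \<in># \<omega> e \<longleftrightarrow> (\<exists>j<length Ls. s = map tm [0..<Suc N] ! j \<and> (e, m) \<in> Ls ! j)"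
    proof
      assume s: "(s, m) \<in># \<omega> e"
      obtain i where i: "i \<le> N" "s \<in> pcell N i" using cells_cover[OF N space_L[OF sp e s]] .
      have "points_in (pcell N i \<times> {m}) (\<omega> e) > 0" unfolding points_in_pos using s i by auto
      then have "(e, m) \<in> Ls ! i" using c[OF i(1)] e unfolding cell_cond_def by blast
      moreover have "s = tm i" by (rule tm_eq[OF i(1) e s i(2)])
      ultimately show "\<exists>j<length Ls. s = map tm [0..<Suc N] ! j \<and> (e, m) \<in> Ls ! j"
        using i l by (intro exI[of _ i]) (auto simp del: upt_Suc)
    next
      assume "\<exists>j<length Ls. s = map tm [0..<Suc N] ! j \<and> (e, m) \<in> Ls ! j"
      then obtain j where "j < length Ls" "s = map tm [0..<Suc N] ! j" "(e, m) \<in> Ls ! j" by blast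
      then have j: "j \<le> N" "s = tm j" "(e, m) \<in> Ls ! j" using l by (auto simp del: upt_Suc)
      then have "points_in (pcell N j \<times> {m}) (\<omega> e) > 0" using c[OF j(1)] e unfolding cell_cond_def by blast
      then obtain s' where "(s', m) \<in># \<omega> e" "s' \<in> pcell N j" unfolding points_in_pos by auto
      then show "(s, m) \<in># \<omega> e" using tm_eq[OF j(1) e] j(2) by metis
    qed
  qed
  then show ?thesis by blast
qed

text \<open>For a configuration with finitely many marks, a fine enough grid separates all the
  different times.\<close>

lemma pattern_event_exists:
  assumes "\<omega> \<in> space L"
  obtains N Ls where "0 < N" "length Ls = Suc N" "set Ls \<subseteq> Pow (E \<times> UNIV)" "\<omega> \<in> pattern_event N Ls"
proof -
  define T where "T = fst ` (\<Union>e\<in>E. set_mset (\<omega> e))"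
  have T: "finite T" using E by (simp add: T_def)
  define D where "D = insert 1 ((\<lambda>(s, s'). \<bar>s - s'\<bar>) ` {(s, s') \<in> T \<times> T. s \<noteq> s'})"
  have D: "finite D" "D \<noteq> {}" using T unfolding D_def by (auto intro: finite_subset[of _ "T \<times> T"])
  have "Min D > 0" using D by (subst Min_gr_iff) (auto simp: D_def)
  then obtain N where N: "0 < N" "1 / real N < Min D" using reals_Archimedean
    by (metis inverse_eq_divide zero_less_Suc)
  have sep: "s = s'" if "s \<in> T" "s' \<in> T" "\<bar>s - s'\<bar> < 1 / N" for s s'
  proof (rule ccontr)
    assume "s \<noteq> s'"
    then have "\<bar>s - s'\<bar> \<in> D" using that by (auto simp: D_def)
    then have "Min D \<le> \<bar>s - s'\<bar>" using D by simp
    with that N show False by linarith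
  qed
  define Ls where "Ls = map (\<lambda>i. {(e, m). e \<in> E \<and> (\<exists>s\<in>pcell N i. (s, m) \<in># \<omega> e)}) [0..<Suc N]"
  have "cell_cond (pcell N i) (Ls ! i) \<omega>" if i: "i \<le> N" for i
    unfolding cell_cond_def
  proof (intro conjI ballI allI notI)
    fix e m assume "e \<in> E"
    then show "points_in (pcell N i \<times> {m}) (\<omega> e) > 0 \<longleftrightarrow> (e, m) \<in> Ls ! i"
      unfolding points_in_pos using i by (auto simp: Ls_def simp del: upt_Suc)
  next
    fix q e m e' m' assume e: "e \<in> E" "e' \<in> E" and p: "0 < points_in ((pcell N i \<inter> {..<q}) \<times> {m}) (\<omega> e) \<and>
      0 < points_in ((pcell N i \<inter> {q..}) \<times> {m'}) (\<omega> e')"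
    then obtain s s' where s: "(s, m) \<in># \<omega> e" "s \<in> pcell N i" "s < q" "(s', m') \<in># \<omega> e'" "s' \<in> pcell N i" "q \<le> s'"
      unfolding points_in_pos by auto
    then have "s \<in> T" "s' \<in> T" using e by (force simp: T_def)+
    then have "s = s'" using sep pcell_props(4)[OF N(1) i s(2,5)] by blast
    then show False using s by simp
  qed
  then have "\<omega> \<in> pattern_event N Ls" using assms by (simp add: pattern_event_def)
  then show ?thesis using that[of N Ls] N by (auto simp: Ls_def simp del: upt_Suc)
qed

text \<open>There are countably many patterns, and each of the corresponding events is
  measurable. Hence every property that depends only on the pattern is an event. Loop numbers
  and the existence of large loops are such properties, although they are defined by means of
  trajectories.\<close>

lemma pattern_invariant_event:
  assumes inv: "\<And>\<omega> \<omega>' ts ts' Ls. has_pattern E \<omega> ts Ls \<Longrightarrow> has_pattern E \<omega>' ts' Ls \<Longrightarrow> Q \<omega> \<Longrightarrow> Q \<omega>'"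
  shows "{\<omega> \<in> space L. Q \<omega>} \<in> sets L"
proof -
  define I where "I = {(N, Ls). 0 < N \<and> length Ls = Suc N \<and> set Ls \<subseteq> Pow (E \<times> UNIV) \<and> (\<exists>\<omega>\<in>pattern_event N Ls. Q \<omega>)}"
  have "countable {Ls. set Ls \<subseteq> Pow (E \<times> (UNIV :: mark set))}"
    using E countable_lists[of "Pow (E \<times> (UNIV :: mark set))"] by (simp add: lists_eq_set countable_finite)
  then have "countable (UNIV \<times> {Ls. set Ls \<subseteq> Pow (E \<times> (UNIV :: mark set))} :: (nat \<times> _) set)" by (intro countable_SIGMA) auto
  then have I: "countable I" by (rule countable_subset[rotated]) (auto simp: I_def)
  have "{\<omega> \<in> space L. Q \<omega>} = (\<Union>(N, Ls)\<in>I. pattern_event N Ls)"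
  proof (intro equalityI subsetI)
    fix \<omega> assume "\<omega> \<in> {\<omega> \<in> space L. Q \<omega>}"
    then have w: "\<omega> \<in> space L" "Q \<omega>" by auto
    obtain N Ls where "0 < N" "length Ls = Suc N" "set Ls \<subseteq> Pow (E \<times> UNIV)" "\<omega> \<in> pattern_event N Ls"
      using pattern_event_exists[OF w(1)] .
    then show "\<omega> \<in> (\<Union>(N, Ls)\<in>I. pattern_event N Ls)" using w(2) by (auto simp: I_def)
  next
    fix \<omega> assume "\<omega> \<in> (\<Union>(N, Ls)\<in>I. pattern_event N Ls)"
    then obtain N Ls \<omega>' where *: "\<omega> \<in> pattern_event N Ls" "0 < N" "length Ls = Suc N" "\<omega>' \<in> pattern_event N Ls" "Q \<omega>'"
      by (auto simp: I_def)
    then have "Q \<omega>" using pattern_event_pattern inv by metis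
    then show "\<omega> \<in> {\<omega> \<in> space L. Q \<omega>}" using * by (auto simp: pattern_event_def)
  qed
  also have "\<dots> \<in> sets L" by (rule sets.countable_UN'[OF I]) (auto simp: I_def pattern_event_sets)
  finally show ?thesis .
qed

end

section \<open>The law of the word of marks\<close>

context poisson_marking
begin

definition ucell :: "nat \<Rightarrow> nat \<Rightarrow> real set" where
  "ucell N i = {real i / N..<(real i + 1) / N}"

text \<open>A counting cell is indexed by \<open>i < 2 N\<close>: its time interval is \<open>i
  div 2\<close> and its kind of mark is given by the parity of \<open>i\<close>.\<close>

definition mk :: "nat \<Rightarrow> mark" where "mk i = (if even i then Cross else Bar)"
definition par :: "mark \<Rightarrow> nat" where "par m = (if m = Cross then 0 else 1)"

lemma mk_par: "mk (2 * c + par m) = m" "(2 * c + par m) div 2 = c" "c < N \<Longrightarrow> 2 * c + par m < 2 * N"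
  by (cases m; simp add: mk_def par_def)+

lemma par_mk: "2 * (i div 2) + par (mk i) = i" by (simp add: mk_def par_def)

lemma letter_in: "set w \<subseteq> E \<times> UNIV \<Longrightarrow> l < length w \<Longrightarrow> fst (w ! l) \<in> E"
  by (metis mem_Times_iff nth_mem subsetD)

text \<open>The first interval is left out, so that no mark is at time \<open>0\<close>.\<close>

definition positions :: "nat \<Rightarrow> nat \<Rightarrow> nat list set" where
  "positions N k = {js. sorted_wrt (<) js \<and> length js = k \<and> set js \<subseteq> {1..<N}}"

definition hits :: "nat list \<Rightarrow> ('v set \<times> mark) list \<Rightarrow> 'v set \<Rightarrow> nat \<Rightarrow> bool" where
  "hits js w e i \<longleftrightarrow> (\<exists>l<length w. w ! l = (e, mk i) \<and> js ! l = i div 2)"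

definition cell_event :: "nat \<Rightarrow> nat list \<Rightarrow> ('v set \<times> mark) list \<Rightarrow> 'v marking set" where
  "cell_event N js w = {\<omega> \<in> space L. \<forall>e\<in>E. \<forall>i\<in>{..<2 * N}.
     points_in (ucell N (i div 2) \<times> {mk i}) (\<omega> e) = (if hits js w e i then 1 else 0)}"

text \<open>The marks form the word \<open>w\<close> at times in different intervals of some
  grid.\<close>

definition word_event :: "('v set \<times> mark) list \<Rightarrow> 'v marking set" where
  "word_event w = (\<Union>N\<in>{0<..}. \<Union>js\<in>positions N (length w). cell_event N js w)"

definition wpattern :: "('v set \<times> mark) list \<Rightarrow> ('v set \<times> mark) set list" where
  "wpattern w = {} # map (\<lambda>a. {a}) w"

definition words :: "nat \<Rightarrow> ('v set \<times> mark) list set" where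
  "words k = {w. length w = k \<and> set w \<subseteq> E \<times> UNIV}"

definition weight :: "('v set \<times> mark) list \<Rightarrow> real" where
  "weight w = (\<Prod>a\<leftarrow>w. mark_weight u (snd a))"

definition word_prob :: "('v set \<times> mark) list \<Rightarrow> real" where
  "word_prob w = exp (- (t * card E)) * t ^ length w / fact (length w) * weight w"

lemma ucell_sub: assumes "i < N" shows "ucell N i \<subseteq> {0..<1}" "ucell N i \<in> sets borel"
proof -
  have "(real i + 1) / N \<le> 1" "real i / N \<ge> 0" using assms by simp_all
  then show "ucell N i \<subseteq> {0..<1}" "ucell N i \<in> sets borel" unfolding ucell_def by auto
qed

lemma ucell_less: assumes "i < j" "s \<in> ucell N i" "s' \<in> ucell N j" shows "s < s'"
proof -
  have "(real i + 1) / N \<le> real j / N" using assms(1) by (intro divide_right_mono) auto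
  then show ?thesis using assms(2,3) unfolding ucell_def by auto
qed

lemma cell_event_sets: "cell_event N js w \<in> sets L"
proof -
  have "i div 2 < N" if "i \<in> {..<2 * N}" for i using that by auto
  then show ?thesis unfolding cell_event_def
    by (intro sets.sets_Collect_finite_All E finite_lessThan points_event ucell_sub)
qed

lemma finite_positions: "finite (positions N k)"
  by (rule finite_subset[OF _ finite_lists_length_eq[of "{1..<N}" k]]) (auto simp: positions_def)

lemma word_event_sets: "word_event w \<in> sets L"
  unfolding word_event_def
  by (intro sets.countable_UN'' sets.finite_UN finite_positions cell_event_sets) auto

text \<open>On a cell event the marks have distinct positive times, in the order prescribed by
  the word.\<close>

lemma cell_event_pattern:
  assumes N: "0 < N" and js: "js \<in> positions N (length w)" and w: "set w \<subseteq> E \<times> UNIV" and om: "\<omega> \<in> cell_event N js w"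
  shows "\<exists>ts. has_pattern E \<omega> ts (wpattern w)"
proof -
  let ?k = "length w"
  have sp: "\<omega> \<in> space L" using om by (simp add: cell_event_def)
  have cnt: "points_in (ucell N c \<times> {m}) (\<omega> e) = (if \<exists>l<?k. w ! l = (e, m) \<and> js ! l = c then 1 else 0)"
    if "e \<in> E" "c < N" for e c m
  proof -
    have "2 * c + par m \<in> {..<2 * N}" using mk_par(3)[OF that(2)] by simp
    then have "points_in (ucell N ((2 * c + par m) div 2) \<times> {mk (2 * c + par m)}) (\<omega> e) =
        (if hits js w e (2 * c + par m) then 1 else 0)" using om that(1) unfolding cell_event_def by blast
    then show ?thesis unfolding hits_def mk_par .
  qed
  have js': "js ! l < N" "1 \<le> js ! l" if "l < ?k" for l
  proof -
    have "js ! l \<in> set js" using that js by (simp add: positions_def)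
    then show "js ! l < N" "1 \<le> js ! l" using js by (auto simp: positions_def)
  qed
  have "\<exists>s. s \<in> ucell N (js ! l) \<and> (s, snd (w ! l)) \<in># \<omega> (fst (w ! l))" if l: "l < ?k" for l
  proof -
    have "fst (w ! l) \<in> E" using letter_in[OF w l] .
    from cnt[OF this js'(1)[OF l], of "snd (w ! l)"]
    have "points_in (ucell N (js ! l) \<times> {snd (w ! l)}) (\<omega> (fst (w ! l))) > 0" using l by auto
    then show ?thesis unfolding points_in_pos by auto
  qed
  then obtain tm where tm: "\<And>l. l < ?k \<Longrightarrow> tm l \<in> ucell N (js ! l)"
    "\<And>l. l < ?k \<Longrightarrow> (tm l, snd (w ! l)) \<in># \<omega> (fst (w ! l))" by metis
  have tm0: "0 < tm l" "tm l < 1" if "l < ?k" for l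
  proof -
    have "0 < real (js ! l) / N" using js'[OF that] N by simp
    then show "0 < tm l" using tm(1)[OF that] unfolding ucell_def by auto
    show "tm l < 1" using tm(1)[OF that] ucell_sub[OF js'(1)[OF that]] by auto
  qed
  have mono: "tm l < tm l'" if "l < l'" "l' < ?k" for l l'
    using ucell_less[of "js ! l" "js ! l'"] tm(1)[of l] tm(1)[of l'] that js
    by (auto simp: positions_def sorted_wrt_iff_nth_less)
  have "has_pattern E \<omega> (0 # map tm [0..<?k]) (wpattern w)"
    unfolding has_pattern_def
  proof (intro conjI ballI allI)
    show "length (0 # map tm [0..<?k]) = length (wpattern w)" "wpattern w \<noteq> []" "hd (0 # map tm [0..<?k]) = 0"
      by (auto simp: wpattern_def)
    show "sorted_wrt (<) (0 # map tm [0..<?k])"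
    proof -
      have "sorted_wrt (<) (map tm [0..<?k])" unfolding sorted_wrt_iff_nth_less using mono by auto
      then show ?thesis using tm0 by auto
    qed
    show "last (0 # map tm [0..<?k]) < 1" using tm0(2)[of "?k - 1"] by (auto simp: last_map)
    fix e s m assume e: "e \<in> E"
    have "(s, m) \<in># \<omega> e \<longleftrightarrow> (\<exists>l<?k. s = tm l \<and> w ! l = (e, m))"
    proof
      assume s: "(s, m) \<in># \<omega> e"
      have s01: "0 \<le> s" "s < 1" using space_L[OF sp e s] by auto
      define c where "c = nat \<lfloor>s * N\<rfloor>"
      have sN: "0 \<le> s * N" "s * N < N" using s01 N by auto
      have c: "real c \<le> s * N" "s * N < real c + 1" "c < N" using sN floor_correct[of "s * N"] unfolding c_def by linarith+
      have sc: "s \<in> ucell N c" using c N by (simp add: ucell_def field_simps)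
      have "points_in (ucell N c \<times> {m}) (\<omega> e) > 0" unfolding points_in_pos using s sc by auto
      then obtain l where l: "l < ?k" "w ! l = (e, m)" "js ! l = c" using cnt[OF e c(3), of m] by (auto split: if_splits)
      have "points_in (ucell N c \<times> {m}) (\<omega> e) \<le> 1" using cnt[OF e c(3), of m] by simp
      then have "(s, m) = (tm l, m)" by (rule points_in_le_1) (use s sc tm[OF l(1)] l in auto)
      then show "\<exists>l<?k. s = tm l \<and> w ! l = (e, m)" using l by auto
    next
      assume "\<exists>l<?k. s = tm l \<and> w ! l = (e, m)"
      then show "(s, m) \<in># \<omega> e" using tm(2) by force
    qed
    also have "\<dots> \<longleftrightarrow> (\<exists>j<length (wpattern w). s = (0 # map tm [0..<?k]) ! j \<and> (e, m) \<in> wpattern w ! j)"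
      (is "?l \<longleftrightarrow> ?r")
    proof
      assume ?l
      then obtain l where "l < ?k" "s = tm l" "w ! l = (e, m)" by blast
      then show ?r by (intro exI[of _ "Suc l"]) (auto simp: wpattern_def)
    next
      assume ?r
      then obtain j where j: "j < length (wpattern w)" "s = (0 # map tm [0..<?k]) ! j" "(e, m) \<in> wpattern w ! j" by blast
      then show ?l by (cases j) (auto simp: wpattern_def)
    qed
    finally show "(s, m) \<in># \<omega> e \<longleftrightarrow> (\<exists>j<length (wpattern w). s = (0 # map tm [0..<?k]) ! j \<and> (e, m) \<in> wpattern w ! j)" .
  qed
  then show ?thesis by blast
qed

lemma word_event_pattern:
  assumes "w \<in> words k" "\<omega> \<in> word_event w" shows "\<exists>ts. has_pattern E \<omega> ts (wpattern w)"
  using assms cell_event_pattern unfolding word_event_def words_def by blast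

lemma pattern_word_unique:
  assumes w: "set w \<subseteq> E \<times> UNIV" "has_pattern E \<omega> ts (wpattern w)"
    and w': "set w' \<subseteq> E \<times> UNIV" "has_pattern E \<omega> ts' (wpattern w')"
  shows "w = w'"
proof -
  have main: "sorted_wrt (<) (tl ts) \<and> length (tl ts) = length w \<and> set (tl ts) = {s. \<exists>e\<in>E. \<exists>m. (s, m) \<in># \<omega> e} \<and>
      (\<forall>l<length w. \<forall>e\<in>E. \<forall>m. (tl ts ! l, m) \<in># \<omega> e \<longleftrightarrow> w ! l = (e, m))"
    if w: "set w \<subseteq> E \<times> UNIV" and p: "has_pattern E \<omega> ts (wpattern w)" for w ts
  proof -
    have len: "length ts = Suc (length w)" and so: "sorted_wrt (<) ts" using p by (auto simp: has_pattern_def wpattern_def)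
    obtain a ts0 where ts: "ts = a # ts0" using len by (cases ts) auto
    have so0: "sorted_wrt (<) ts0" "length ts0 = length w" using so len ts by auto
    have mem: "(s, m) \<in># \<omega> e \<longleftrightarrow> (\<exists>l<length w. s = ts0 ! l \<and> w ! l = (e, m))" if "e \<in> E" for s m e
    proof -
      have "(s, m) \<in># \<omega> e \<longleftrightarrow> (\<exists>j<length (wpattern w). s = ts ! j \<and> (e, m) \<in> wpattern w ! j)"
        using p that unfolding has_pattern_def by blast
      also have "\<dots> \<longleftrightarrow> (\<exists>l<length w. s = ts0 ! l \<and> w ! l = (e, m))"
        unfolding wpattern_def ts by (auto simp: less_Suc_eq_0_disj)
      finally show ?thesis .
    qed
    have inj: "ts0 ! l = ts0 ! l' \<Longrightarrow> l = l'" if "l < length w" "l' < length w" for l l'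
      using so0 that unfolding sorted_wrt_iff_nth_less by (metis less_irrefl nat_neq_iff)
    have wE: "fst (w ! l) \<in> E" if "l < length w" for l using letter_in[OF w that] .
    have "set ts0 = {s. \<exists>e\<in>E. \<exists>m. (s, m) \<in># \<omega> e}"
    proof (intro equalityI subsetI)
      fix s assume "s \<in> set ts0"
      then obtain l where l: "l < length w" "s = ts0 ! l" using so0 by (auto simp: in_set_conv_nth)
      then have "(s, snd (w ! l)) \<in># \<omega> (fst (w ! l))" using mem[OF wE[OF l(1)]] by auto
      then show "s \<in> {s. \<exists>e\<in>E. \<exists>m. (s, m) \<in># \<omega> e}" using wE[OF l(1)] by blast
    next
      fix s assume "s \<in> {s. \<exists>e\<in>E. \<exists>m. (s, m) \<in># \<omega> e}"
      then show "s \<in> set ts0" using mem so0 by auto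
    qed
    moreover have "(ts0 ! l, m) \<in># \<omega> e \<longleftrightarrow> w ! l = (e, m)" if "l < length w" "e \<in> E" for l e m
      unfolding mem[OF that(2)] using inj that by blast
    ultimately show ?thesis using so0 ts by auto
  qed
  note a = main[OF w] and b = main[OF w']
  have "distinct (tl ts)" "sorted (tl ts)" "distinct (tl ts')" "sorted (tl ts')"
    using a b by (auto simp: strict_sorted_iff)
  then have tl: "tl ts = tl ts'" using a b by (intro sorted_distinct_set_unique) auto
  show ?thesis
  proof (rule nth_equalityI)
    show "length w = length w'" using a b tl by auto
    fix l assume l: "l < length w"
    obtain e m where em: "w ! l = (e, m)" by (cases "w ! l")
    then have e: "e \<in> E" using letter_in[OF w(1) l] by simp
    then have "(tl ts ! l, m) \<in># \<omega> e" using a l em by blast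
    then show "w ! l = w' ! l" using b e l \<open>length w = length w'\<close> em unfolding tl by metis
  qed
qed

lemma word_events_disjoint:
  assumes "w \<in> words k" "w' \<in> words k'" "\<omega> \<in> word_event w" "\<omega> \<in> word_event w'" shows "w = w'"
  using word_event_pattern[OF assms(1,3)] word_event_pattern[OF assms(2,4)] pattern_word_unique assms(1,2)
  unfolding words_def by blast

lemma measure_scaled: "measure (scale_measure (ennreal t) (mark_law u)) X = t * measure (mark_law u) X"
  using t by (simp add: measure_def enn2real_mult)

text \<open>The numbers of points in disjoint cells are independent Poisson variables.\<close>

lemma cell_event_prob:
  assumes N: "0 < N" and js: "js \<in> positions N (length w)" and w: "set w \<subseteq> E \<times> UNIV"
  shows "measure L (cell_event N js w) = exp (- (t * card E)) * (t / N) ^ length w * weight w"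
proof -
  let ?B = "\<lambda>i. ucell N (i div 2) \<times> {mk i}" and ?I = "{..<2 * N}"
  let ?\<Lambda> = "scale_measure (ennreal t) (mark_law u)"
  interpret PP: prob_space PP by (rule PP(1))
  interpret P: finite_product_prob_space "\<lambda>_. PP" E by unfold_locales (rule E)
  define X where "X e = {\<xi> \<in> space PP. \<forall>i\<in>?I. points_in (?B i) \<xi> = (if hits js w e i then 1 else 0)}" for e
  have idiv: "i div 2 < N" if "i \<in> ?I" for i using that by auto
  have Bs: "?B i \<in> sets (mark_law u)" if "i \<in> ?I" for i
    by (rule sets_strip) (use ucell_sub[OF idiv[OF that]] in auto)
  have Xs: "X e \<in> sets PP" for e
    unfolding X_def
  proof (rule sets.sets_Collect_finite_All)
    fix i assume "i \<in> ?I"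
    then have "points_in (?B i) \<in> measurable PP (count_space UNIV)"
      using measurable_points_in[OF Bs] measurable_cong_sets[OF PP(2) refl] by blast
    from measurable_sets[OF this, of "{if hits js w e i then 1 else 0}"]
    show "{\<xi> \<in> space PP. points_in (?B i) \<xi> = (if hits js w e i then 1 else 0)} \<in> sets PP"
      by (simp add: vimage_def Int_def conj_commute)
  qed simp
  have "cell_event N js w = Pi\<^sub>E E X"
    unfolding cell_event_def X_def marking_law_def by (auto simp: space_PiM PiE_def Pi_iff)
  then have "measure L (cell_event N js w) = (\<Prod>e\<in>E. measure PP (X e))"
    unfolding marking_law_def using P.prob_times[of X] Xs by simp
  define lam where "lam i = t / N * mark_weight u (mk i)" for i
  have mB: "measure ?\<Lambda> (?B i) = lam i" if "i \<in> ?I" for i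
  proof -
    have "real (i div 2) / N \<ge> 0" "(real (i div 2) + 1) / N \<le> 1" "real (i div 2) / N \<le> (real (i div 2) + 1) / N"
      using idiv[OF that] by (simp_all add: divide_right_mono)
    then have "measure (mark_law u) (?B i) = ((real (i div 2) + 1) / N - real (i div 2) / N) * mark_weight u (mk i)"
      unfolding ucell_def by (intro measure_strip u)
    then show ?thesis unfolding measure_scaled lam_def by (simp add: diff_divide_distrib[symmetric])
  qed
  have dj: "disjoint_family_on ?B ?I"
    unfolding disjoint_family_on_def
  proof (intro ballI impI, rule ccontr)
    fix i j assume ij: "i \<noteq> j" "?B i \<inter> ?B j \<noteq> {}"
    then obtain s where s: "s \<in> ucell N (i div 2)" "s \<in> ucell N (j div 2)" and m: "mk i = mk j" by auto
    have "i div 2 = j div 2" using ucell_less[of "i div 2" "j div 2" s N s] ucell_less[of "j div 2" "i div 2" s N s] s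
      by (metis less_irrefl nat_neq_iff)
    then show False using m par_mk[of i] par_mk[of j] ij(1) by simp
  qed
  have XP: "measure PP (X e) = (\<Prod>i\<in>?I. (if hits js w e i then lam i else 1) * exp (- lam i))" for e
  proof -
    have "measure PP (X e) = (\<Prod>i\<in>?I. measure ?\<Lambda> (?B i) ^ (if hits js w e i then 1 else 0) / fact (if hits js w e i then 1 else 0) * exp (- measure ?\<Lambda> (?B i)))"
    proof -
      have law: "finite I \<Longrightarrow> (\<forall>i\<in>I. B i \<in> sets ?\<Lambda>) \<Longrightarrow> disjoint_family_on B I \<Longrightarrow>
        measure PP {\<xi> \<in> space PP. \<forall>i\<in>I. points_in (B i) \<xi> = k i} =
        (\<Prod>i\<in>I. measure ?\<Lambda> (B i) ^ k i / fact (k i) * exp (- measure ?\<Lambda> (B i)))" for I :: "nat set" and B k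
        using PP_law unfolding poisson_process_law_def by blast
      show ?thesis unfolding X_def by (rule law[OF _ _ dj]) (use Bs in auto)
    qed
    also have "\<dots> = (\<Prod>i\<in>?I. (if hits js w e i then lam i else 1) * exp (- lam i))"
      by (rule prod.cong[OF refl]) (simp add: mB)
    finally show ?thesis .
  qed
  have sl: "(\<Sum>i\<in>?I. lam i) = t"
  proof -
    have "(\<Sum>i<2 * M. lam i) = M * (t / N)" for M :: nat
      by (induction M) (auto simp: lam_def mk_def mark_weight_def algebra_simps add_divide_distrib diff_divide_distrib)
    then show ?thesis using N by simp
  qed
  have "(\<Prod>i\<in>?I. exp (- lam i)) = exp (- t)"
    unfolding exp_sum[OF finite_lessThan, symmetric] sum_negf sl ..
  then have "measure L (cell_event N js w) = (\<Prod>e\<in>E. (\<Prod>i\<in>?I. if hits js w e i then lam i else 1) * exp (- t))"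
    using \<open>measure L (cell_event N js w) = (\<Prod>e\<in>E. measure PP (X e))\<close> XP by (simp add: prod.distrib)
  also have "\<dots> = (\<Prod>e\<in>E. \<Prod>i\<in>?I. if hits js w e i then lam i else 1) * exp (- (t * card E))"
    by (simp add: prod.distrib flip: exp_of_nat_mult)
  also have "(\<Prod>e\<in>E. \<Prod>i\<in>?I. if hits js w e i then lam i else 1) = (\<Prod>(e, i)\<in>E \<times> ?I. if hits js w e i then lam i else 1)"
    by (rule prod.cartesian_product)
  also have "\<dots> = (\<Prod>(e, i)\<in>(\<lambda>l. (fst (w ! l), 2 * js ! l + par (snd (w ! l)))) ` {..<length w}. lam i)"
  proof (rule prod.mono_neutral_cong_right)
    let ?S = "(\<lambda>l. (fst (w ! l), 2 * js ! l + par (snd (w ! l)))) ` {..<length w}"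
    have "js ! l < N" if "l < length w" for l
    proof -
      have "js ! l \<in> set js" using that js by (simp add: positions_def)
      then show ?thesis using js by (auto simp: positions_def)
    qed
    moreover have "fst (w ! l) \<in> E" if "l < length w" for l using letter_in[OF w that] .
    ultimately show "?S \<subseteq> E \<times> ?I" using mk_par(3) by auto
    have hS: "hits js w e i \<longleftrightarrow> (e, i) \<in> ?S" for e i
    proof
      assume "hits js w e i"
      then obtain l where l: "l < length w" "w ! l = (e, mk i)" "js ! l = i div 2" unfolding hits_def by blast
      then have "(e, i) = (fst (w ! l), 2 * js ! l + par (snd (w ! l)))" using par_mk[of i] by simp
      then show "(e, i) \<in> ?S" using l(1) by blast
    next
      assume "(e, i) \<in> ?S"
      then obtain l where l: "l < length w" "e = fst (w ! l)" "i = 2 * js ! l + par (snd (w ! l))" by auto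
      then show "hits js w e i" unfolding hits_def using mk_par by (intro exI[of _ l]) auto
    qed
    show "\<forall>x\<in>E \<times> ?I - ?S. (case x of (e, i) \<Rightarrow> if hits js w e i then lam i else 1) = 1" using hS by auto
    show "\<And>x. x \<in> ?S \<Longrightarrow> (case x of (e, i) \<Rightarrow> if hits js w e i then lam i else 1) = (case x of (e, i) \<Rightarrow> lam i)"
      using hS by (auto split: prod.split)
  qed (use E in auto)
  also have "\<dots> = (\<Prod>l<length w. lam (2 * js ! l + par (snd (w ! l))))"
  proof (subst prod.reindex)
    have "inj_on (\<lambda>l. js ! l) {..<length w}"
    proof (rule inj_onI, rule ccontr)
      fix l l' assume l: "l \<in> {..<length w}" "l' \<in> {..<length w}" "js ! l = js ! l'" "l \<noteq> l'"
      have lt: "js ! a < js ! b" if "a < b" "b < length w" for a b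
        using js that by (simp add: positions_def sorted_wrt_iff_nth_less)
      show False using lt[of l l'] lt[of l' l] l by (cases "l < l'") simp_all
    qed
    then show "inj_on (\<lambda>l. (fst (w ! l), 2 * js ! l + par (snd (w ! l)))) {..<length w}"
    proof (intro inj_onI)
      fix l l' assume i: "inj_on (\<lambda>l. js ! l) {..<length w}" and l: "l \<in> {..<length w}" "l' \<in> {..<length w}"
        and "(fst (w ! l), 2 * js ! l + par (snd (w ! l))) = (fst (w ! l'), 2 * js ! l' + par (snd (w ! l')))"
      then have "(2 * js ! l + par (snd (w ! l))) div 2 = (2 * js ! l' + par (snd (w ! l'))) div 2" by simp
      then have "js ! l = js ! l'" unfolding mk_par .
      then show "l = l'" using inj_onD[OF i] l by blast
    qed
  qed simp
  also have "\<dots> = (\<Prod>l<length w. t / N * mark_weight u (snd (w ! l)))" by (simp add: lam_def mk_par)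
  also have "\<dots> = (t / N) ^ length w * weight w"
    by (simp add: prod.distrib weight_def prod.list_conv_set_nth atLeast0LessThan del: times_divide_eq_left)
  finally show ?thesis by simp
qed

lemma card_positions: "(N - 1) choose k \<le> card (positions N k)"
proof -
  have "(N - 1) choose k = card {J. J \<subseteq> {1..<N} \<and> card J = k}" by (simp add: n_subsets)
  also have "\<dots> \<le> card (positions N k)"
  proof (rule card_inj_on_le[where f = sorted_list_of_set])
    show "inj_on sorted_list_of_set {J. J \<subseteq> {1..<N} \<and> card J = k}"
      by (rule inj_onI) (metis (no_types, lifting) finite_atLeastLessThan finite_subset mem_Collect_eq set_sorted_list_of_set)
    show "sorted_list_of_set ` {J. J \<subseteq> {1..<N} \<and> card J = k} \<subseteq> positions N k"
      by (auto simp: positions_def finite_subset[OF _ finite_atLeastLessThan] subset_iff)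
  qed (rule finite_positions)
  finally show ?thesis .
qed

lemma weight_nonneg: "weight w \<ge> 0"
  unfolding weight_def using u by (intro prod_list_nonneg) (auto simp: mark_weight_def)

text \<open>For each grid there are at least \<open>(N - 1) choose k\<close> disjoint cell
  events of probability proportional to \<open>1 / N ^ k\<close>. The inequality suffices, as it
  becomes an equality by adding up over all words.\<close>

lemma word_event_prob_ge:
  assumes w: "w \<in> words k"
  shows "word_prob w \<le> measure L (word_event w)"
proof -
  interpret L: prob_space L by (rule prob_L)
  have wE: "set w \<subseteq> E \<times> UNIV" and k: "length w = k" using w by (auto simp: words_def)
  define K where "K = exp (- (t * card E)) * weight w * t ^ k"
  have K: "K \<ge> 0" unfolding K_def using weight_nonneg t by simp
  have le: "K * (real ((N - 1) choose k) / real N ^ k) \<le> measure L (word_event w)" if N: "0 < N" for N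
  proof -
    have "real ((N - 1) choose k) * (K / real N ^ k) \<le> real (card (positions N k)) * (K / real N ^ k)"
      using card_positions K by (intro mult_right_mono) auto
    also have "\<dots> = (\<Sum>js\<in>positions N k. measure L (cell_event N js w))"
      using cell_event_prob[OF N _ wE] by (simp add: k K_def power_divide mult_ac)
    also have "\<dots> = measure L (\<Union>js\<in>positions N k. cell_event N js w)"
    proof (rule L.finite_measure_finite_Union[symmetric, OF finite_positions])
      show "disjoint_family_on (\<lambda>js. cell_event N js w) (positions N k)"
        unfolding disjoint_family_on_def
      proof (intro ballI impI, rule ccontr)
        fix js js' assume js: "js \<in> positions N k" "js' \<in> positions N k" "js \<noteq> js'"
          and "cell_event N js w \<inter> cell_event N js' w \<noteq> {}"
        then obtain \<omega> where o: "\<omega> \<in> cell_event N js w" "\<omega> \<in> cell_event N js' w" by auto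
        have h: "hits js w e i \<longleftrightarrow> hits js' w e i" if "e \<in> E" "i < 2 * N" for e i
        proof -
          have "points_in (ucell N (i div 2) \<times> {mk i}) (\<omega> e) = (if hits js w e i then 1 else 0)"
            using o(1) that unfolding cell_event_def by blast
          moreover have "points_in (ucell N (i div 2) \<times> {mk i}) (\<omega> e) = (if hits js' w e i then 1 else 0)"
            using o(2) that unfolding cell_event_def by blast
          ultimately have "(if hits js w e i then 1 else 0::nat) = (if hits js' w e i then 1 else 0)" by (rule trans[OF sym])
          then show ?thesis by (cases "hits js w e i"; cases "hits js' w e i") simp_all
        qed
        have sub: "set a \<subseteq> set b" if a: "a \<in> positions N k" "b \<in> positions N k"
          and hh: "\<And>e i. e \<in> E \<Longrightarrow> i < 2 * N \<Longrightarrow> hits a w e i \<Longrightarrow> hits b w e i" for a b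
        proof
          fix c assume c: "c \<in> set a"
          then obtain l where l: "l < k" "c = a ! l" using a by (auto simp: positions_def in_set_conv_nth)
          obtain e m where em: "w ! l = (e, m)" by (cases "w ! l")
          then have e: "e \<in> E" using letter_in[OF wE, of l] l k by simp
          have cN: "c < N" using c a by (auto simp: positions_def)
          have "hits a w e (2 * c + par m)" unfolding hits_def mk_par using l em k by auto
          then have "hits b w e (2 * c + par m)" by (rule hh[OF e mk_par(3)[OF cN]])
          then obtain l' where "l' < length w" "b ! l' = c" unfolding hits_def mk_par by blast
          then show "c \<in> set b" using a(2) k by (auto simp: positions_def)
        qed
        have "set js = set js'" using sub[OF js(1,2)] sub[OF js(2,1)] h by blast
        then have "js = js'" using js(1,2) by (auto simp: positions_def intro: strict_sorted_equal)
        then show False using js by simp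
      qed
    qed (use cell_event_sets in auto)
    also have "\<dots> \<le> measure L (word_event w)"
      by (rule L.finite_measure_mono[OF _ word_event_sets]) (use N k in \<open>auto simp: word_event_def\<close>)
    finally show ?thesis by (simp add: mult.commute)
  qed
  have lim: "(\<lambda>N. real ((N - 1) choose k) / real N ^ k) \<longlonglongrightarrow> 1 / fact k"
  proof -
    have "(\<lambda>N. (\<Prod>i<k. (real (N - 1) - real i) / real N) / fact k) \<longlonglongrightarrow> (\<Prod>i<k. 1) / fact k"
    proof (intro tendsto_intros)
      fix i
      have "(\<lambda>N. 1 - (1 + real i) / real N) \<longlonglongrightarrow> 1 - 0" by (intro tendsto_intros lim_const_over_n)
      moreover have "\<forall>\<^sub>F N in sequentially. 1 - (1 + real i) / real N = (real (N - 1) - real i) / real N"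
        using eventually_gt_at_top[of 0] by eventually_elim (simp add: field_simps of_nat_diff)
      ultimately show "(\<lambda>N. (real (N - 1) - real i) / real N) \<longlonglongrightarrow> 1" by (simp add: tendsto_cong)
    qed simp
    moreover have "(\<Prod>i<k. (real (N - 1) - real i) / real N) / fact k = real ((N - 1) choose k) / real N ^ k" for N
      by (simp add: binomial_gbinomial gbinomial_prod_rev prod_dividef atLeast0LessThan)
    ultimately show ?thesis by simp
  qed
  have "K * (1 / fact k) \<le> measure L (word_event w)"
    by (rule LIMSEQ_le_const2[OF tendsto_mult[OF tendsto_const lim]]) (use le in \<open>auto intro!: exI[of _ 1]\<close>)
  then show ?thesis by (simp add: word_prob_def K_def k mult_ac)
qed

lemma words_0: "words 0 = {[]}" by (auto simp: words_def)

lemma finite_words: "finite (words k)"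
  unfolding words_def using E by (intro finite_subset[OF _ finite_lists_length_eq[of "E \<times> UNIV" k]]) auto

lemma words_disjoint: "i \<noteq> j \<Longrightarrow> words i \<inter> words j = {}" by (auto simp: words_def)

lemma sum_words_Suc:
  fixes f :: "('v set \<times> mark) list \<Rightarrow> real"
  shows "(\<Sum>w\<in>words (Suc k). f w) = (\<Sum>w\<in>words k. \<Sum>e\<in>E. f (w @ [(e, Cross)]) + f (w @ [(e, Bar)]))"
proof -
  have "words (Suc k) = (\<lambda>(w, a). w @ [a]) ` (words k \<times> (E \<times> UNIV))"
  proof (intro equalityI subsetI)
    fix w assume "w \<in> words (Suc k)"
    then have w: "length w = Suc k" "set w \<subseteq> E \<times> UNIV" by (auto simp: words_def)
    then have "w \<noteq> []" by auto
    then have "w = butlast w @ [last w]" "last w \<in> set w" by auto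
    then show "w \<in> (\<lambda>(w, a). w @ [a]) ` (words k \<times> (E \<times> UNIV))"
      using w by (intro image_eqI[of _ _ "(butlast w, last w)"]) (auto simp: words_def dest: in_set_butlastD)
  qed (auto simp: words_def)
  then have "(\<Sum>w\<in>words (Suc k). f w) = (\<Sum>(w, a)\<in>words k \<times> (E \<times> UNIV). f (w @ [a]))"
    by (simp add: sum.reindex inj_on_def split_def)
  also have "\<dots> = (\<Sum>w\<in>words k. \<Sum>e\<in>E. \<Sum>m\<in>UNIV. f (w @ [(e, m)]))"
    by (simp add: sum.cartesian_product')
  finally show ?thesis by (simp add: UNIV_mark)
qed

lemma weight_append: "weight (w @ [(e, m)]) = weight w * mark_weight u m" by (simp add: weight_def)

lemma sum_weight: "(\<Sum>w\<in>words k. weight w) = real (card E) ^ k"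
proof (induction k)
  case 0
  then show ?case by (simp add: words_0 weight_def)
next
  case (Suc k)
  have "(\<Sum>w\<in>words (Suc k). weight w) = (\<Sum>w\<in>words k. real (card E) * weight w)"
    unfolding sum_words_Suc weight_append mark_weight_def by (simp flip: distrib_left)
  then show ?case using Suc by (simp flip: sum_distrib_left)
qed

lemma word_prob_sums: "(\<lambda>k. \<Sum>w\<in>words k. word_prob w) sums 1"
proof -
  have "(\<Sum>w\<in>words k. word_prob w) = exp (- (t * card E)) * ((t * card E) ^ k / fact k)" for k
  proof -
    have "(\<Sum>w\<in>words k. word_prob w) = (\<Sum>w\<in>words k. exp (- (t * card E)) * t ^ k / fact k * weight w)"
      by (rule sum.cong) (auto simp: words_def word_prob_def)
    also have "\<dots> = exp (- (t * card E)) * t ^ k / fact k * (\<Sum>w\<in>words k. weight w)"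
      by (simp only: sum_distrib_left)
    finally show ?thesis by (simp add: sum_weight power_mult_distrib)
  qed
  moreover have "(\<lambda>k. exp (- (t * card E)) * ((t * card E) ^ k / fact k)) sums (exp (- (t * card E)) * exp (t * card E))"
    using exp_converges[of "t * card E"] by (intro sums_mult) (simp add: divide_inverse mult.commute)
  ultimately show ?thesis by (simp flip: exp_add)
qed

lemma sum_measure_le:
  "(\<Sum>k<K. \<Sum>w\<in>words k. measure L (word_event w)) = measure L (\<Union>w\<in>(\<Union>k<K. words k). word_event w)"
proof -
  interpret L: prob_space L by (rule prob_L)
  have "(\<Sum>k<K. \<Sum>w\<in>words k. measure L (word_event w)) = (\<Sum>w\<in>(\<Union>k<K. words k). measure L (word_event w))"
    by (rule sum.UNION_disjoint[symmetric]) (auto simp: finite_words words_disjoint)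
  also have "\<dots> = measure L (\<Union>w\<in>(\<Union>k<K. words k). word_event w)"
  proof (rule L.finite_measure_finite_Union[symmetric])
    show "disjoint_family_on word_event (\<Union>k<K. words k)"
      unfolding disjoint_family_on_def using word_events_disjoint by blast
  qed (auto simp: finite_words word_event_sets)
  finally show ?thesis .
qed

text \<open>The lower bounds add up to \<open>1\<close> and the events are disjoint, so that no
  bound can be strict.\<close>

lemma word_event_prob:
  assumes w0: "w0 \<in> words k0"
  shows "measure L (word_event w0) = word_prob w0"
proof -
  interpret L: prob_space L by (rule prob_L)
  have "measure L (word_event w0) - word_prob w0 \<le> 1 - (\<Sum>k<K. \<Sum>w\<in>words k. word_prob w)" if "k0 < K" for K
  proof -
    have fin: "finite (\<Union>k<K. words k)" by (simp add: finite_words)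
    have "measure L (word_event w0) - word_prob w0 \<le> (\<Sum>w\<in>(\<Union>k<K. words k). measure L (word_event w) - word_prob w)"
      by (rule member_le_sum) (use w0 that word_event_prob_ge fin in auto)
    also have "\<dots> = (\<Sum>k<K. \<Sum>w\<in>words k. measure L (word_event w) - word_prob w)"
      by (rule sum.UNION_disjoint) (auto simp: finite_words words_disjoint)
    also have "\<dots> = measure L (\<Union>w\<in>(\<Union>k<K. words k). word_event w) - (\<Sum>k<K. \<Sum>w\<in>words k. word_prob w)"
      by (simp add: sum_subtractf sum_measure_le)
    also have "\<dots> \<le> 1 - (\<Sum>k<K. \<Sum>w\<in>words k. word_prob w)" by simp
    finally show ?thesis .
  qed
  moreover have "(\<lambda>K. 1 - (\<Sum>k<K. \<Sum>w\<in>words k. word_prob w)) \<longlonglongrightarrow> 1 - 1"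
    using word_prob_sums unfolding sums_def by (intro tendsto_intros)
  ultimately have "measure L (word_event w0) - word_prob w0 \<le> 1 - 1"
    by (intro LIMSEQ_le_const) (auto intro!: exI[of _ "Suc k0"])
  then show ?thesis using word_event_prob_ge[OF w0] by simp
qed

lemma AE_word: "AE \<omega> in L. \<exists>k. \<exists>w\<in>words k. \<omega> \<in> word_event w"
proof -
  interpret L: prob_space L by (rule prob_L)
  let ?U = "\<Union>k. \<Union>w\<in>words k. word_event w"
  have U: "?U \<in> sets L" using finite_words word_event_sets by (intro sets.countable_UN sets.finite_UN) auto
  have "(\<Sum>k<K. \<Sum>w\<in>words k. word_prob w) \<le> measure L ?U" for K
  proof -
    have "(\<Sum>k<K. \<Sum>w\<in>words k. word_prob w) = (\<Sum>k<K. \<Sum>w\<in>words k. measure L (word_event w))"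
      by (intro sum.cong refl) (simp add: word_event_prob)
    also have "\<dots> \<le> measure L ?U" unfolding sum_measure_le by (rule L.finite_measure_mono[OF _ U]) auto
    finally show ?thesis .
  qed
  then have "1 \<le> measure L ?U"
    using word_prob_sums unfolding sums_def by (intro LIMSEQ_le_const2) auto
  then have "measure L ?U = 1" using L.prob_le_1[of ?U] by linarith
  then have "AE \<omega> in L. \<omega> \<in> ?U" using L.prob_eq_1[OF U] by simp
  then show ?thesis by simp
qed

text \<open>Almost every configuration realises a word, whence integrals are sums over words.\<close>

lemma nn_integral_words:
  assumes F: "F \<in> borel_measurable L" and c: "\<And>k w \<omega>. w \<in> words k \<Longrightarrow> \<omega> \<in> word_event w \<Longrightarrow> F \<omega> = c w"
  shows "(\<integral>\<^sup>+\<omega>. F \<omega> \<partial>L) = (\<Sum>k. \<Sum>w\<in>words k. c w * ennreal (word_prob w))"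
proof -
  interpret L: prob_space L by (rule prob_L)
  have "(\<integral>\<^sup>+\<omega>. F \<omega> \<partial>L) = (\<integral>\<^sup>+\<omega>. (\<Sum>k. \<Sum>w\<in>words k. c w * indicator (word_event w) \<omega>) \<partial>L)"
  proof (rule nn_integral_cong_AE)
    show "AE \<omega> in L. F \<omega> = (\<Sum>k. \<Sum>w\<in>words k. c w * indicator (word_event w) \<omega>)"
      using AE_word
    proof eventually_elim
      case (elim \<omega>)
      then obtain k0 w0 where w0: "w0 \<in> words k0" "\<omega> \<in> word_event w0" by blast
      have ind: "c w * indicator (word_event w) \<omega> = (if w = w0 then c w0 else 0)" if "w \<in> words k" for k w
      proof (cases "\<omega> \<in> word_event w")
        case True
        then have "w = w0" by (rule word_events_disjoint[OF that w0(1) _ w0(2)])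
        then show ?thesis using w0(2) by simp
      next
        case False
        then have "w \<noteq> w0" using w0(2) by auto
        then show ?thesis using False by simp
      qed
      have "(\<Sum>w\<in>words k. c w * indicator (word_event w) \<omega>) = (if k = k0 then c w0 else 0)" for k
      proof -
        have "(\<Sum>w\<in>words k. c w * indicator (word_event w) \<omega>) = (\<Sum>w\<in>words k. if w = w0 then c w0 else 0)"
          by (rule sum.cong) (auto simp: ind)
        also have "\<dots> = (if w0 \<in> words k then c w0 else 0)" by (rule sum.delta[OF finite_words])
        also have "\<dots> = (if k = k0 then c w0 else 0)" using w0(1) by (simp add: words_def)
        finally show ?thesis .
      qed
      then have "(\<Sum>k. \<Sum>w\<in>words k. c w * indicator (word_event w) \<omega>) = c w0"
        using sums_unique[OF sums_single[of k0 "\<lambda>_. c w0"]] by simp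
      then show ?case using c[OF w0] by simp
    qed
  qed
  also have "\<dots> = (\<Sum>k. \<Sum>w\<in>words k. c w * emeasure L (word_event w))"
    using word_event_sets by (subst nn_integral_suminf) (auto simp: nn_integral_sum nn_integral_cmult_indicator)
  also have "\<dots> = (\<Sum>k. \<Sum>w\<in>words k. c w * ennreal (word_prob w))"
    by (intro suminf_cong sum.cong refl) (simp add: L.emeasure_eq_measure word_event_prob)
  finally show ?thesis .
qed

end

section \<open>A differential inequality for exponential generating functions\<close>

definition exp_growth :: "(nat \<Rightarrow> real) \<Rightarrow> bool" where
  "exp_growth a \<longleftrightarrow> (\<exists>D C. \<forall>k. \<bar>a k\<bar> \<le> D * C ^ k)"

definition egf :: "(nat \<Rightarrow> real) \<Rightarrow> real \<Rightarrow> real" where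
  "egf a t = (\<Sum>k. a k / fact k * t ^ k)"

lemma exp_growth_summable:
  assumes "exp_growth a" shows "summable (\<lambda>k. norm (a k / fact k * t ^ k))"
proof -
  obtain D C where D: "\<And>k. \<bar>a k\<bar> \<le> D * C ^ k" using assms by (auto simp: exp_growth_def)
  have "summable (\<lambda>k. D * (inverse (fact k) * \<bar>C * t\<bar> ^ k))" by (intro summable_mult summable_exp)
  then show ?thesis
  proof (rule summable_comparison_test'[where N = 0])
    fix k :: nat
    have "\<bar>a k\<bar> * \<bar>t\<bar> ^ k / fact k \<le> (D * C ^ k) * \<bar>t\<bar> ^ k / fact k"
      by (intro divide_right_mono mult_right_mono D) auto
    also have "\<dots> \<le> \<bar>(D * C ^ k) * \<bar>t\<bar> ^ k / fact k\<bar>" by (rule abs_ge_self)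
    also have "\<dots> = \<bar>D\<bar> * (inverse (fact k) * \<bar>C * t\<bar> ^ k)"
      by (simp add: abs_mult power_abs power_mult_distrib divide_inverse mult_ac)
    also have "\<bar>D\<bar> = D" using D[of 0] by simp
    finally show "norm (norm (a k / fact k * t ^ k)) \<le> D * (inverse (fact k) * \<bar>C * t\<bar> ^ k)"
      by (simp add: abs_mult power_abs)
  qed
qed

lemma egf_sums: "exp_growth a \<Longrightarrow> (\<lambda>k. a k / fact k * t ^ k) sums egf a t"
  unfolding egf_def using summable_norm_cancel[OF exp_growth_summable] by (rule summable_sums)

lemma exp_growth_Suc: assumes "exp_growth a" shows "exp_growth (\<lambda>k. a (Suc k))"
proof -
  obtain D C where "\<And>k. \<bar>a k\<bar> \<le> D * C ^ k" using assms by (auto simp: exp_growth_def)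
  then have "\<bar>a (Suc k)\<bar> \<le> (D * C) * C ^ k" for k by (simp add: mult_ac) (metis mult.assoc mult.commute power_Suc)
  then show ?thesis unfolding exp_growth_def by blast
qed

lemma exp_growth_cmult: assumes "exp_growth a" shows "exp_growth (\<lambda>k. c * a k)"
proof -
  obtain D C where "\<And>k. \<bar>a k\<bar> \<le> D * C ^ k" using assms by (auto simp: exp_growth_def)
  then have "\<bar>c * a k\<bar> \<le> (\<bar>c\<bar> * D) * C ^ k" for k by (simp add: abs_mult mult.assoc mult_left_mono)
  then show ?thesis unfolding exp_growth_def by blast
qed

lemma exp_growth_add: assumes "exp_growth a" "exp_growth b" shows "exp_growth (\<lambda>k. a k + b k)"
proof -
  obtain D C where a: "\<And>k. \<bar>a k\<bar> \<le> D * C ^ k" using assms by (auto simp: exp_growth_def)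
  obtain D' C' where b: "\<And>k. \<bar>b k\<bar> \<le> D' * C' ^ k" using assms by (auto simp: exp_growth_def)
  have D: "0 \<le> D" "0 \<le> D'" using a[of 0] b[of 0] by auto
  have "\<bar>a k + b k\<bar> \<le> (D + D') * (max \<bar>C\<bar> \<bar>C'\<bar>) ^ k" for k
  proof -
    have pw: "x ^ k \<le> y ^ k" if "\<bar>x\<bar> \<le> y" for x y :: real
    proof -
      have "x ^ k \<le> \<bar>x\<bar> ^ k" unfolding power_abs[symmetric] by (rule abs_ge_self)
      also have "\<dots> \<le> y ^ k" by (rule power_mono[OF that]) simp
      finally show ?thesis .
    qed
    have "C ^ k \<le> max \<bar>C\<bar> \<bar>C'\<bar> ^ k" "C' ^ k \<le> max \<bar>C\<bar> \<bar>C'\<bar> ^ k"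
      by (rule pw, simp)+
    then have "D * C ^ k \<le> D * max \<bar>C\<bar> \<bar>C'\<bar> ^ k" "D' * C' ^ k \<le> D' * max \<bar>C\<bar> \<bar>C'\<bar> ^ k"
      using D by (auto intro: mult_left_mono)
    then show ?thesis using a[of k] b[of k] abs_triangle_ineq[of "a k" "b k"] unfolding distrib_right by linarith
  qed
  then show ?thesis unfolding exp_growth_def by blast
qed

lemma exp_growth_mono: assumes "exp_growth b" "\<And>k. \<bar>a k\<bar> \<le> \<bar>b k\<bar>" shows "exp_growth a"
  using assms unfolding exp_growth_def by (meson order_trans)

lemma egf_cmult: "exp_growth a \<Longrightarrow> egf (\<lambda>k. c * a k) t = c * egf a t"
  using sums_unique[OF sums_mult[OF egf_sums, of a c t]] by (simp add: egf_def mult.assoc)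

lemma egf_add: "exp_growth a \<Longrightarrow> exp_growth b \<Longrightarrow> egf (\<lambda>k. a k + b k) t = egf a t + egf b t"
  using sums_unique[OF sums_add[OF egf_sums egf_sums, of a b t t]] by (simp add: egf_def add_divide_distrib distrib_right)

lemma exp_growth_diff: "exp_growth a \<Longrightarrow> exp_growth b \<Longrightarrow> exp_growth (\<lambda>k. a k - b k)"
  using exp_growth_add[OF _ exp_growth_cmult[of b "- 1"], of a] by simp

lemma egf_diff: "exp_growth a \<Longrightarrow> exp_growth b \<Longrightarrow> egf (\<lambda>k. a k - b k) t = egf a t - egf b t"
  using egf_add[OF _ exp_growth_cmult[of b "- 1"], of a t] egf_cmult[of b "- 1" t] by simp

lemma egf_mono:
  assumes "exp_growth a" "exp_growth b" "\<And>k. a k \<le> b k" "0 \<le> t" shows "egf a t \<le> egf b t"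
  by (rule sums_le[OF _ egf_sums egf_sums]) (use assms in \<open>auto intro!: mult_right_mono divide_right_mono\<close>)

lemma exp_growth_power: "exp_growth (\<lambda>k. m ^ k)"
  unfolding exp_growth_def by (rule exI[of _ 1], rule exI[of _ "\<bar>m\<bar>"]) (simp add: power_abs)

lemma egf_power: "egf (\<lambda>k. m ^ k) t = exp (m * t)"
  unfolding egf_def exp_def by (simp add: power_mult_distrib divide_inverse mult_ac)

lemma egf_deriv:
  assumes "exp_growth a"
  shows "(egf a has_real_derivative egf (\<lambda>k. a (Suc k)) t) (at t)"
proof -
  have s: "summable (\<lambda>k. a k / fact k * y ^ k)" for y
    using summable_norm_cancel[OF exp_growth_summable[OF assms]] .
  have d: "diffs (\<lambda>k. a k / fact k) = (\<lambda>k. a (Suc k) / fact k)"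
    unfolding diffs_def by (rule ext) (simp add: fact_Suc del: of_nat_Suc)
  show ?thesis using termdiffs_strong_converges_everywhere[of "\<lambda>k. a k / fact k" t] s
    unfolding d egf_def by simp
qed

lemma egf_cont: "exp_growth a \<Longrightarrow> continuous_on S (egf a)"
  by (meson DERIV_continuous_on DERIV_subset egf_deriv has_field_derivative_at_within)

text \<open>The product of two exponential generating functions has binomial convolutions as
  coefficients, and \<open>egf a (t + s)\<close> is the double sum of \<open>a (k + l) / (k! l!)
  * t^k * s^l\<close>; the inequality holds term by term.\<close>

lemma egf_shift_ge:
  assumes a: "exp_growth a" and b: "exp_growth b" and m: "0 \<le> m" and t: "0 \<le> t" "0 \<le> s"
    and ab: "\<And>k l. b k * m ^ l \<le> a (k + l)"
  shows "egf b t * exp (m * s) \<le> egf a (t + s)"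
proof -
  let ?x = "\<lambda>k. b k / fact k * t ^ k" and ?y = "\<lambda>k. m ^ k / fact k * s ^ k"
  have "(\<lambda>N. \<Sum>i\<le>N. ?x i * ?y (N - i)) sums ((\<Sum>k. ?x k) * (\<Sum>k. ?y k))"
    by (rule Cauchy_product_sums[OF exp_growth_summable[OF b] exp_growth_summable[OF exp_growth_power]])
  then have 1: "(\<lambda>N. \<Sum>i\<le>N. ?x i * ?y (N - i)) sums (egf b t * exp (m * s))"
    unfolding egf_def[symmetric] egf_power[symmetric] .
  have 2: "(\<lambda>N. a N / fact N * (t + s) ^ N) sums egf a (t + s)" by (rule egf_sums[OF a])
  show ?thesis
  proof (rule sums_le[OF _ 1 2])
    fix N
    have "(\<Sum>i\<le>N. ?x i * ?y (N - i)) = (\<Sum>i\<le>N. (b i * m ^ (N - i)) * (real (N choose i) * t ^ i * s ^ (N - i) / fact N))"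
      by (intro sum.cong refl) (simp add: binomial_fact field_simps)
    also have "\<dots> \<le> (\<Sum>i\<le>N. a N * (real (N choose i) * t ^ i * s ^ (N - i) / fact N))"
    proof (rule sum_mono)
      fix i assume "i \<in> {..N}"
      then have "b i * m ^ (N - i) \<le> a N" using ab[of i "N - i"] by simp
      then show "(b i * m ^ (N - i)) * (real (N choose i) * t ^ i * s ^ (N - i) / fact N) \<le> a N * (real (N choose i) * t ^ i * s ^ (N - i) / fact N)"
        using t by (intro mult_right_mono) auto
    qed
    also have "\<dots> = a N / fact N * (t + s) ^ N"
      unfolding binomial_ring[of t s N] by (simp add: sum_distrib_left sum_divide_distrib mult_ac)
    finally show "(\<Sum>i\<le>N. ?x i * ?y (N - i)) \<le> a N / fact N * (t + s) ^ N" .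
  qed
qed

lemma deriv_bound_integral:
  fixes H H' B :: "real \<Rightarrow> real"
  assumes s: "0 \<le> s" and H: "\<And>t. a \<le> t \<Longrightarrow> t \<le> a + s \<Longrightarrow> (H has_real_derivative H' t) (at t)"
    and H'c: "continuous_on {a..a + s} H'" and B: "continuous_on {a..a + s} B"
    and le: "\<And>t. a \<le> t \<Longrightarrow> t \<le> a + s \<Longrightarrow> H' t \<le> p + q * B t"
  shows "H (a + s) - H a \<le> p * s + q * (LBINT t:{a..a + s}. B t)"
proof -
  have "(H' has_integral (H (a + s) - H a)) {a..a + s}"
    using s H by (intro fundamental_theorem_of_calculus) (auto simp: has_real_derivative_iff_has_vector_derivative[symmetric] intro: has_field_derivative_at_within)
  moreover have "((\<lambda>t. p + q * B t) has_integral (p * s + q * integral {a..a + s} B)) {a..a + s}"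
  proof -
    have "((\<lambda>t. p) has_integral p * s) {a..a + s}"
      using has_integral_const_real[of p a "a + s"] s by (simp add: mult.commute)
    moreover have "((\<lambda>t. q * B t) has_integral q * integral {a..a + s} B) {a..a + s}"
      by (intro has_integral_mult_right integrable_integral integrable_continuous_real B)
    ultimately show ?thesis by (rule has_integral_add)
  qed
  ultimately have "H (a + s) - H a \<le> p * s + q * integral {a..a + s} B"
    by (rule has_integral_le) (use le in auto)
  moreover have "(LBINT t:{a..a + s}. B t) = integral {a..a + s} B"
    by (rule set_borel_integral_eq_integral) (rule borel_integrable_atLeastAtMost'[OF B])
  ultimately show ?thesis by simp
qed

text \<open>With \<open>F\<close>, \<open>G\<close> and \<open>\<Phi>\<close> the weighted sums
  over words of length \<open>k\<close> of \<open>\<theta> ^ \<lambda>\<close>, of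
  \<open>\<theta> ^ \<lambda>\<close> on words with a large loop, and of a discrete
  antiderivative of \<open>\<theta> ^ \<lambda>\<close>, the quotient \<open>egf G t / egf F
  t\<close> is the probability of a large loop. The function \<open>H\<close> is the logarithm
  of the partition function divided by \<open>\<theta> - 1\<close>, or the expected number of
  loops if \<open>\<theta> = 1\<close>. The assumption \<open>diff\<close> bounds its derivative
  from above and the assumptions \<open>far\<close> its total decrease; the fundamental theorem
  of calculus combines the two.\<close>

lemma averaged_bound:
  fixes F \<Phi> G :: "nat \<Rightarrow> real" and m \<theta> :: real
  assumes gr: "exp_growth F" "exp_growth \<Phi>" "exp_growth G" and th: "0 < \<theta>" and m: "0 \<le> m"
    and Fpos: "\<And>t. 0 \<le> t \<Longrightarrow> 0 < egf F t"
    and phi: "\<theta> \<noteq> 1 \<Longrightarrow> \<Phi> = (\<lambda>k. F k / (\<theta> - 1))" "\<theta> = 1 \<Longrightarrow> F = (\<lambda>k. m ^ k)"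
    and diff: "\<And>k. \<Phi> (Suc k) - m * \<Phi> k \<le> p * F k + q * G k"
    and far1: "\<theta> > 1 \<Longrightarrow> (\<And>k l. F k / \<theta> ^ n * m ^ l \<le> F (k + l))"
    and far2: "\<theta> < 1 \<Longrightarrow> (\<And>k l. F (k + l) \<le> F k / \<theta> ^ n * m ^ l)"
    and far3: "\<theta> = 1 \<Longrightarrow> (\<And>k l. (\<Phi> k - n * m ^ k) * m ^ l \<le> \<Phi> (k + l))"
    and a: "0 \<le> a" and s: "0 \<le> s"
  shows "- (if \<theta> = 1 then 1 else ln \<theta> / (\<theta> - 1)) * n \<le> p * s + q * (LBINT t:{a..a + s}. egf G t / egf F t)"
proof -
  \<comment> \<open>In both cases \<open>H'\<close> is the derivative of \<open>H\<close>; the term \<open>- m t\<close> comes from the normalisation of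
    the Poisson law.\<close>
  define H' where "H' t = (egf (\<lambda>k. \<Phi> (Suc k)) t - m * egf \<Phi> t) / egf F t" for t
  define H where "H t = (if \<theta> = 1 then exp (- m * t) * egf \<Phi> t else (ln (egf F t) - m * t) / (\<theta> - 1))" for t
  note F' = egf_deriv[OF gr(1)] and Phi' = egf_deriv[OF gr(2)]
  have HH: "(H has_real_derivative H' t) (at t)" if t: "0 \<le> t" for t
  proof (cases "\<theta> = 1")
    case True
    have "((\<lambda>t. exp (- m * t) * egf \<Phi> t) has_real_derivative
        exp (- m * t) * egf (\<lambda>k. \<Phi> (Suc k)) t + exp (- m * t) * (- m) * egf \<Phi> t) (at t)"
      by (auto intro!: derivative_eq_intros Phi')
    moreover have "H' t = exp (- m * t) * egf (\<lambda>k. \<Phi> (Suc k)) t + exp (- m * t) * (- m) * egf \<Phi> t"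
      unfolding H'_def phi(2)[OF True] egf_power by (simp add: exp_minus field_simps)
    ultimately show ?thesis using True unfolding H_def by simp
  next
    case False
    have "((\<lambda>t. (ln (egf F t) - m * t) / (\<theta> - 1)) has_real_derivative
        (egf (\<lambda>k. F (Suc k)) t / egf F t - m) / (\<theta> - 1)) (at t)"
      using Fpos[OF t] False by (auto intro!: derivative_eq_intros F' simp: divide_inverse)
    moreover have "egf (\<lambda>k. \<Phi> (Suc k)) t = egf (\<lambda>k. F (Suc k)) t / (\<theta> - 1)"
      unfolding phi(1)[OF False] using egf_cmult[OF exp_growth_Suc[OF gr(1)], of "1 / (\<theta> - 1)" t] by simp
    moreover have "egf \<Phi> t = egf F t / (\<theta> - 1)"
      unfolding phi(1)[OF False] using egf_cmult[OF gr(1), of "1 / (\<theta> - 1)" t] by simp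
    ultimately have "H' t = (egf (\<lambda>k. F (Suc k)) t / egf F t - m) / (\<theta> - 1)"
      using False Fpos[OF t] unfolding H'_def by (simp add: diff_divide_distrib mult.commute)
    with \<open>((\<lambda>t. (ln (egf F t) - m * t) / (\<theta> - 1)) has_real_derivative _) (at t)\<close>
    show ?thesis using False unfolding H_def by simp
  qed
  have bound: "H' t \<le> p + q * (egf G t / egf F t)" if t: "0 \<le> t" for t
  proof -
    have "egf (\<lambda>k. \<Phi> (Suc k) - m * \<Phi> k) t \<le> egf (\<lambda>k. p * F k + q * G k) t"
      by (intro egf_mono exp_growth_add exp_growth_diff exp_growth_cmult exp_growth_Suc gr diff t)
    also have "egf (\<lambda>k. \<Phi> (Suc k) - m * \<Phi> k) t = egf (\<lambda>k. \<Phi> (Suc k)) t - m * egf \<Phi> t"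
      by (simp add: egf_diff egf_cmult exp_growth_Suc exp_growth_cmult gr)
    also have "egf (\<lambda>k. p * F k + q * G k) t = p * egf F t + q * egf G t"
      by (simp add: egf_add egf_cmult exp_growth_cmult gr)
    finally show ?thesis unfolding H'_def using Fpos[OF t] by (simp add: pos_divide_le_eq distrib_right)
  qed
  have nz: "\<forall>t\<in>{a..a + s}. egf F t \<noteq> 0"
  proof
    fix t assume "t \<in> {a..a + s}"
    then have "0 \<le> t" using a by simp
    then show "egf F t \<noteq> 0" using Fpos[of t] by simp
  qed
  have up: "H (a + s) - H a \<le> p * s + q * (LBINT t:{a..a + s}. egf G t / egf F t)"
  proof (rule deriv_bound_integral[OF s])
    show "continuous_on {a..a + s} H'" unfolding H'_def
      by (intro continuous_intros egf_cont exp_growth_Suc gr nz)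
    show "continuous_on {a..a + s} (\<lambda>t. egf G t / egf F t)"
      by (intro continuous_intros egf_cont gr nz)
  qed (use HH bound a in auto)
  have as: "0 \<le> a + s" using a s by simp
  have "- (if \<theta> = 1 then 1 else ln \<theta> / (\<theta> - 1)) * n \<le> H (a + s) - H a"
  proof -
    consider "\<theta> = 1" | "\<theta> > 1" | "\<theta> < 1" by linarith
    then show ?thesis
    proof cases
      case 1
      have "egf (\<lambda>k. \<Phi> k - real n * m ^ k) a * exp (m * s) \<le> egf \<Phi> (a + s)"
        by (rule egf_shift_ge[OF gr(2) exp_growth_diff[OF gr(2) exp_growth_cmult[OF exp_growth_power]] m a s far3[OF 1]])
      moreover have "egf (\<lambda>k. \<Phi> k - real n * m ^ k) a = egf \<Phi> a - n * exp (m * a)"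
        by (simp add: egf_diff egf_cmult exp_growth_cmult exp_growth_power egf_power gr)
      ultimately have "exp (- m * (a + s)) * ((egf \<Phi> a - n * exp (m * a)) * exp (m * s)) \<le> exp (- m * (a + s)) * egf \<Phi> (a + s)"
        by (intro mult_left_mono) auto
      also have "exp (- m * (a + s)) * ((egf \<Phi> a - n * exp (m * a)) * exp (m * s)) = exp (- m * a) * egf \<Phi> a - n"
      proof -
        have e1: "exp (- m * (a + s)) * exp (m * s) = exp (- m * a)" by (simp add: exp_add[symmetric] algebra_simps)
        have e2: "exp (- m * a) * exp (m * a) = 1" by (simp add: exp_add[symmetric])
        have "exp (- m * (a + s)) * ((egf \<Phi> a - n * exp (m * a)) * exp (m * s)) = (egf \<Phi> a - n * exp (m * a)) * (exp (- m * (a + s)) * exp (m * s))"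
          by simp
        also have "\<dots> = exp (- m * a) * egf \<Phi> a - n * (exp (- m * a) * exp (m * a))" unfolding e1 by (simp add: left_diff_distrib right_diff_distrib mult_ac)
        finally show ?thesis unfolding e2 by simp
      qed
      finally show ?thesis using 1 by (simp add: H_def)
    next
      case 2
      have "egf (\<lambda>k. (1 / \<theta> ^ n) * F k) a * exp (m * s) \<le> egf F (a + s)"
        by (rule egf_shift_ge[OF gr(1) exp_growth_cmult[OF gr(1)] m a s]) (use far1[OF 2] in simp)
      then have le: "egf F a / \<theta> ^ n * exp (m * s) \<le> egf F (a + s)" unfolding egf_cmult[OF gr(1)] by simp
      have "ln (egf F a / \<theta> ^ n * exp (m * s)) \<le> ln (egf F (a + s))"
        using le Fpos[OF a] th by (subst ln_le_cancel_iff) (auto intro!: Fpos as)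
      then have "ln (egf F a) - n * ln \<theta> + m * s \<le> ln (egf F (a + s))"
        using Fpos[OF a] th by (simp add: ln_mult ln_div ln_realpow)
      then have "- (n * ln \<theta>) \<le> (ln (egf F (a + s)) - m * (a + s)) - (ln (egf F a) - m * a)" by (simp add: algebra_simps)
      then have "- (n * ln \<theta>) / (\<theta> - 1) \<le> ((ln (egf F (a + s)) - m * (a + s)) - (ln (egf F a) - m * a)) / (\<theta> - 1)"
        using 2 by (intro divide_right_mono) auto
      then show ?thesis using 2 by (simp add: H_def diff_divide_distrib mult.commute)
    next
      case 3
      \<comment> \<open>For \<open>\<theta> < 1\<close> the inequality between the coefficients is reversed, and so is the sign of \<open>\<theta> - 1\<close>.\<close>
      have "egf (\<lambda>k. (- 1 / \<theta> ^ n) * F k) a * exp (m * s) \<le> egf (\<lambda>k. (- 1) * F k) (a + s)"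
        by (rule egf_shift_ge[OF exp_growth_cmult[OF gr(1)] exp_growth_cmult[OF gr(1)] m a s]) (use far2[OF 3] in auto)
      then have le: "egf F (a + s) \<le> egf F a / \<theta> ^ n * exp (m * s)" unfolding egf_cmult[OF gr(1)] by simp
      have "ln (egf F (a + s)) \<le> ln (egf F a / \<theta> ^ n * exp (m * s))"
        using le Fpos[OF a] Fpos[OF as] th by (subst ln_le_cancel_iff) auto
      then have "ln (egf F (a + s)) \<le> ln (egf F a) - n * ln \<theta> + m * s"
        using Fpos[OF a] th by (simp add: ln_mult ln_div ln_realpow)
      then have "(ln (egf F (a + s)) - m * (a + s)) - (ln (egf F a) - m * a) \<le> - (n * ln \<theta>)" by (simp add: algebra_simps)
      then have "- (n * ln \<theta>) / (\<theta> - 1) \<le> ((ln (egf F (a + s)) - m * (a + s)) - (ln (egf F a) - m * a)) / (\<theta> - 1)"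
        using 3 by (intro divide_right_mono_neg) auto
      then show ?thesis using 3 by (simp add: H_def diff_divide_distrib mult.commute)
    qed
  qed
  with up show ?thesis by simp
qed

section \<open>Large loops on a sparse graph\<close>

locale loop_graph =
  fixes V :: "'v set" and E :: "'v set set" and u \<theta> \<eta> :: real
  assumes V: "finite V" and E: "\<And>e. e \<in> E \<Longrightarrow> e \<subseteq> V \<and> card e = 2"
    and u: "0 \<le> u" "u \<le> 1" and th: "0 < \<theta>"
begin

lemma finite_E: "finite E" using E V by (meson PowI finite_Pow_iff finite_subset subsetI)

sublocale m0: poisson_marking E 0 u using finite_E u by unfold_locales auto

lemma at_time: "0 \<le> t \<Longrightarrow> poisson_marking E t u" using finite_E u by unfold_locales auto

text \<open>The number of loops of the configuration given by a word.\<close>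

definition lam :: "('v set \<times> mark) list \<Rightarrow> nat" where "lam w = nloops V (map Some w @ [None])"

text \<open>A representative of the configurations that realise a word: the one with equidistant
  marks.\<close>

definition equidistant :: "('v set \<times> mark) list \<Rightarrow> 'v marking" where
  "equidistant w e = mset (map (\<lambda>j. (real (Suc j) / real (Suc (length w)), snd (w ! j))) (filter (\<lambda>j. fst (w ! j) = e) [0..<length w]))"

definition big :: "('v set \<times> mark) list \<Rightarrow> bool" where "big w \<longleftrightarrow> large_loop V E \<eta> (equidistant w)"

text \<open>The two vertices are visited by the same loop at time \<open>0\<close>.\<close>

definition tied :: "('v set \<times> mark) list \<Rightarrow> 'v \<Rightarrow> 'v \<Rightarrow> bool" where
  "tied w x y \<longleftrightarrow> ((x, 0), (y, 0)) \<in> conn (links V (map Some w @ [None]))"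

lemma equidistant_mem: "(s, m) \<in># equidistant w e \<longleftrightarrow> (\<exists>j<length w. s = real (Suc j) / real (Suc (length w)) \<and> w ! j = (e, m))"
  unfolding equidistant_def by (auto simp: prod_eq_iff)

lemma canonical: assumes "set w \<subseteq> E \<times> UNIV" shows "canonical_marking V E w (equidistant w)"
proof
  show "finite V" by (rule V)
  show "e \<subseteq> V \<and> card e = 2" if "(e, m) \<in> set w" for e m using assms that E by blast
  fix x y s m
  show "mark_at E (equidistant w) x y s m \<longleftrightarrow> (\<exists>j<length w. s = real (Suc j) / real (Suc (length w)) \<and> w ! j = ({x, y}, m))"
    unfolding mark_at_def equidistant_mem using m0.letter_in[OF assms] by fastforce
qed

lemma equidistant_pattern: assumes w: "set w \<subseteq> E \<times> UNIV"
  shows "has_pattern E (equidistant w) (map (\<lambda>j. real j / real (Suc (length w))) [0..<Suc (length w)]) (m0.wpattern w)"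
  unfolding has_pattern_def
proof (intro conjI ballI allI)
  let ?ts = "map (\<lambda>j. real j / real (Suc (length w))) [0..<Suc (length w)]"
  show "length ?ts = length (m0.wpattern w)" "m0.wpattern w \<noteq> []" by (auto simp: m0.wpattern_def)
  show "sorted_wrt (<) ?ts" unfolding sorted_wrt_iff_nth_less by (auto simp: divide_strict_right_mono simp del: upt_Suc)
  show "hd ?ts = 0" by (simp add: hd_map del: upt_Suc)
  show "last ?ts < 1" by simp
  fix e s m
  show "(s, m) \<in># equidistant w e \<longleftrightarrow> (\<exists>j<length (m0.wpattern w). s = ?ts ! j \<and> (e, m) \<in> m0.wpattern w ! j)" (is "_ \<longleftrightarrow> ?r")
    unfolding equidistant_mem
  proof
    assume "\<exists>j<length w. s = real (Suc j) / real (Suc (length w)) \<and> w ! j = (e, m)"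
    then obtain j where "j < length w" "s = real (Suc j) / real (Suc (length w))" "w ! j = (e, m)" by blast
    then show ?r by (intro exI[of _ "Suc j"]) (auto simp: m0.wpattern_def simp del: upt_Suc)
  next
    assume ?r
    then obtain j where j: "j < length (m0.wpattern w)" "s = ?ts ! j" "(e, m) \<in> m0.wpattern w ! j" by blast
    then show "\<exists>j<length w. s = real (Suc j) / real (Suc (length w)) \<and> w ! j = (e, m)"
      by (cases j) (auto simp: m0.wpattern_def simp del: upt_Suc)
  qed
qed

lemma loops_of_word:
  assumes t: "0 \<le> t" and w: "w \<in> m0.words k" and om: "\<omega> \<in> poisson_marking.word_event E t u w"
  shows "num_loops V E \<omega> = lam w" "large_loop V E \<eta> \<omega> = big w"
proof -
  interpret m: poisson_marking E t u by (rule at_time[OF t])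
  have wE: "set w \<subseteq> E \<times> UNIV" using w by (simp add: m0.words_def)
  interpret c: canonical_marking V E w "equidistant w" "Suc (length w)" "map Some w @ [None]" by (rule canonical[OF wE]) auto
  obtain ts where ts: "has_pattern E \<omega> ts (m0.wpattern w)" using m.word_event_pattern[OF w om] by blast
  show "num_loops V E \<omega> = lam w" "large_loop V E \<eta> \<omega> = big w"
    using same_pattern[OF equidistant_pattern[OF wE] ts] c.num_loops_eq by (simp_all add: lam_def big_def)
qed

lemma tied_class_small: assumes "set w \<subseteq> E \<times> UNIV" "\<not> big w" "x \<in> V" shows "real (card {y \<in> V. tied w x y}) \<le> \<eta> * card V"
proof -
  interpret c: canonical_marking V E w "equidistant w" "Suc (length w)" "map Some w @ [None]" by (rule canonical[OF assms(1)]) auto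
  show ?thesis using c.slice_le assms unfolding big_def tied_def by blast
qed

definition wsum :: "(('v set \<times> mark) list \<Rightarrow> real) \<Rightarrow> nat \<Rightarrow> real" where
  "wsum c k = (\<Sum>w\<in>m0.words k. m0.weight w * c w)"

text \<open>Poissonisation of the word length turns sums over words into exponential generating
  functions.\<close>

lemma words_ennreal:
  assumes t: "0 \<le> t" and c: "\<And>w. 0 \<le> c w" and g: "exp_growth (wsum c)"
  shows "(\<Sum>k. \<Sum>w\<in>m0.words k. ennreal (c w) * ennreal (poisson_marking.word_prob E t u w)) = ennreal (exp (- (t * card E)) * egf (wsum c) t)"
proof -
  interpret m: poisson_marking E t u by (rule at_time[OF t])
  have "(\<Sum>w\<in>m0.words k. ennreal (c w) * ennreal (m.word_prob w)) = ennreal (exp (- (t * card E)) * (wsum c k / fact k * t ^ k))" for k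
  proof -
    have wp: "0 \<le> m.word_prob w" for w unfolding m.word_prob_def using t m.weight_nonneg by simp
    have "(\<Sum>w\<in>m0.words k. ennreal (c w) * ennreal (m.word_prob w)) = ennreal (\<Sum>w\<in>m0.words k. c w * m.word_prob w)"
      using c wp by (simp add: ennreal_mult[symmetric] sum_ennreal)
    also have "(\<Sum>w\<in>m0.words k. c w * m.word_prob w) = (\<Sum>w\<in>m0.words k. exp (- (t * card E)) * t ^ k / fact k * (m0.weight w * c w))"
      by (rule sum.cong[OF refl]) (auto simp: m.word_prob_def m0.words_def)
    also have "\<dots> = exp (- (t * card E)) * (wsum c k / fact k * t ^ k)"
      unfolding wsum_def sum_distrib_left[symmetric] by simp
    finally show ?thesis .
  qed
  moreover have "0 \<le> wsum c k" for k unfolding wsum_def using c m0.weight_nonneg by (intro sum_nonneg) auto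
  ultimately have "(\<Sum>k. \<Sum>w\<in>m0.words k. ennreal (c w) * ennreal (m.word_prob w)) = ennreal (\<Sum>k. exp (- (t * card E)) * (wsum c k / fact k * t ^ k))"
    using t sums_summable[OF sums_mult[OF egf_sums[OF g]]] by (subst suminf_ennreal2[symmetric]) auto
  also have "(\<Sum>k. exp (- (t * card E)) * (wsum c k / fact k * t ^ k)) = exp (- (t * card E)) * egf (wsum c) t"
    using sums_unique[OF sums_mult[OF egf_sums[OF g]]] by simp
  finally show ?thesis .
qed

lemma word_ok_map: "set w \<subseteq> E \<times> UNIV \<Longrightarrow> word_ok V (map Some w @ [None])" "set w \<subseteq> E \<times> UNIV \<Longrightarrow> word_ok V (map Some w)"
  using E by (auto simp: word_ok_def letter_ok_def)

lemma lam_letter: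
  assumes w: "set w \<subseteq> E \<times> UNIV" and e: "e \<in> E"
  defines "same \<equiv> \<forall>x\<in>e. \<forall>y\<in>e. tied w x y"
  shows "\<not> same \<Longrightarrow> lam (w @ [(e, m)]) + 1 = lam w"
    and "same \<Longrightarrow> lam (w @ [(e, Cross)]) \<le> lam w \<and> lam (w @ [(e, Bar)]) \<le> lam w + 1 \<or> lam (w @ [(e, Bar)]) \<le> lam w \<and> lam (w @ [(e, Cross)]) \<le> lam w + 1"
    and "lam (w @ [(e, m)]) \<le> lam w + 1"
proof -
  obtain x y where xy: "e = {x, y}" "x \<noteq> y" using E[OF e] by (meson card_2_iff)
  have xV: "x \<in> V" "y \<in> V" using E[OF e] xy by auto
  have same: "same \<longleftrightarrow> ((x, 0), (y, 0)) \<in> conn (links V (map Some w @ [None]))"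
    unfolding same_def tied_def xy using conn_sym[of "(x, 0)" "(y, 0)"] by auto
  note a = append_letter[OF V word_ok_map(2)[OF w] xV xy(2), folded same]
  show 1: "lam (w @ [(e, m)]) + 1 = lam w" if "\<not> same" for m using a(1)[OF that, of m] by (simp add: lam_def xy)
  show 2: "lam (w @ [(e, Cross)]) \<le> lam w \<and> lam (w @ [(e, Bar)]) \<le> lam w + 1 \<or> lam (w @ [(e, Bar)]) \<le> lam w \<and> lam (w @ [(e, Cross)]) \<le> lam w + 1"
    if same using a(2)[OF that] by (simp add: lam_def xy)
  show "lam (w @ [(e, m)]) \<le> lam w + 1"
  proof (cases same)
    case True
    then show ?thesis using 2 by (cases m) auto
  next
    case False
    then show ?thesis using 1[of m] by simp
  qed
qed

lemma lam_append: assumes "set w \<subseteq> E \<times> UNIV" "set v \<subseteq> E \<times> UNIV" shows "lam w \<le> lam (w @ v) + card V"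
  using nloops_append_ge[OF V, of "map Some w" "map Some v"] word_ok_map(1)[of "w @ v"] assms by (simp add: lam_def)

lemma lam_le: "set w \<subseteq> E \<times> UNIV \<Longrightarrow> lam w \<le> card V + length w"
proof (induction w rule: rev_induct)
  case Nil
  have "lam [] \<le> card (nodes V 1)" unfolding lam_def nloops_def ncomp_def using finite_nodes[OF V] by (auto intro!: card_image_le)
  then show ?case by (simp add: nodes_def card_cartesian_product)
next
  case (snoc a w)
  obtain e m where a: "a = (e, m)" by (cases a)
  then show ?case using snoc lam_letter(3)[of w e m] by simp
qed

lemma wsum_Suc:
  "wsum c (Suc k) = (\<Sum>w\<in>m0.words k. m0.weight w * (\<Sum>e\<in>E. u * c (w @ [(e, Cross)]) + (1 - u) * c (w @ [(e, Bar)])))"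
  unfolding wsum_def m0.sum_words_Suc m0.weight_append mark_weight_def
  by (simp add: sum_distrib_left algebra_simps)

lemma sum_words_add:
  fixes f :: "('v set \<times> mark) list \<Rightarrow> real"
  shows "(\<Sum>w\<in>m0.words (k + l). f w) = (\<Sum>w\<in>m0.words k. \<Sum>v\<in>m0.words l. f (w @ v))"
proof -
  have "m0.words (k + l) = (\<lambda>(w, v). w @ v) ` (m0.words k \<times> m0.words l)"
  proof (intro equalityI subsetI)
    fix w assume "w \<in> m0.words (k + l)"
    then show "w \<in> (\<lambda>(w, v). w @ v) ` (m0.words k \<times> m0.words l)"
      by (intro image_eqI[of _ _ "(take k w, drop k w)"]) (auto simp: m0.words_def dest: in_set_takeD in_set_dropD)
  qed (auto simp: m0.words_def)
  moreover have "inj_on (\<lambda>(w, v). w @ v) (m0.words k \<times> m0.words l)"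
    by (auto simp: inj_on_def m0.words_def)
  ultimately have "(\<Sum>w\<in>m0.words (k + l). f w) = (\<Sum>(w, v)\<in>m0.words k \<times> m0.words l. f (w @ v))"
    by (simp add: sum.reindex split_def)
  then show ?thesis by (simp add: sum.cartesian_product)
qed

lemma weight_app: "m0.weight (w @ v) = m0.weight w * m0.weight v" by (simp add: m0.weight_def)

lemma wsum_add: "wsum c (k + l) = (\<Sum>w\<in>m0.words k. \<Sum>v\<in>m0.words l. m0.weight w * m0.weight v * c (w @ v))"
  unfolding wsum_def sum_words_add weight_app ..

lemma wsum_mult: "wsum c k * real (card E) ^ l = (\<Sum>w\<in>m0.words k. \<Sum>v\<in>m0.words l. m0.weight w * m0.weight v * c w)"
  unfolding wsum_def m0.sum_weight[symmetric] sum_product by (simp add: mult_ac)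

lemma wsum_mono: "(\<And>w. w \<in> m0.words k \<Longrightarrow> c w \<le> d w) \<Longrightarrow> wsum c k \<le> wsum d k"
  unfolding wsum_def using m0.weight_nonneg by (intro sum_mono mult_left_mono) auto

lemma wsum_const: "wsum (\<lambda>_. c) k = c * real (card E) ^ k"
  unfolding wsum_def m0.sum_weight[symmetric] by (simp add: sum_distrib_left mult.commute)

lemma wsum_growth:
  assumes "\<And>w. w \<in> m0.words k \<Longrightarrow> \<bar>c w\<bar> \<le> D * C ^ k" shows "\<bar>wsum c k\<bar> \<le> D * (C * card E) ^ k"
proof -
  have "wsum c k \<le> wsum (\<lambda>_. D * C ^ k) k" "wsum (\<lambda>_. - (D * C ^ k)) k \<le> wsum c k"
    using assms by (intro wsum_mono; fastforce simp: abs_le_iff)+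
  then show ?thesis unfolding wsum_const by (simp add: power_mult_distrib abs_le_iff)
qed

definition Fw where "Fw = wsum (\<lambda>w. \<theta> ^ lam w)"
definition Gw where "Gw = wsum (\<lambda>w. \<theta> ^ lam w * of_bool (big w))"

text \<open>A discrete antiderivative: \<open>phi (l + 1) - phi l = \<theta> ^ l\<close> (lemma
  \<open>phi_Suc\<close>). This treats \<open>\<theta> < 1\<close>, \<open>\<theta> = 1\<close>
  and \<open>\<theta> > 1\<close> alike; in each case \<open>phi\<close> is increasing.\<close>

definition phi :: "nat \<Rightarrow> real" where "phi l = (if \<theta> = 1 then real l else \<theta> ^ l / (\<theta> - 1))"
lemma phi_1: "\<theta> = 1 \<Longrightarrow> phi l = real l" unfolding phi_def by simp
definition Pw where "Pw = wsum (\<lambda>w. phi (lam w))"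

lemma theta_lam: assumes "w \<in> m0.words k" shows "\<theta> ^ lam w \<le> max 1 \<theta> ^ card V * max 1 \<theta> ^ k"
proof -
  have l: "lam w \<le> card V + k" using lam_le[of w] assms by (simp add: m0.words_def)
  have "\<theta> ^ lam w \<le> max 1 \<theta> ^ lam w" using th by (intro power_mono) auto
  also have "\<dots> \<le> max 1 \<theta> ^ (card V + k)" using l by (intro power_increasing) auto
  finally show ?thesis by (simp add: power_add)
qed

lemma growth: "exp_growth Fw" "exp_growth Gw" "exp_growth Pw"
proof -
  show F: "exp_growth Fw" unfolding exp_growth_def Fw_def
    using wsum_growth[of _ "\<lambda>w. \<theta> ^ lam w" "max 1 \<theta> ^ card V" "max 1 \<theta>"] theta_lam th by (metis abs_of_pos zero_less_power)
  show "exp_growth Gw"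
  proof (rule exp_growth_mono[OF F])
    fix k
    have "0 \<le> Gw k" unfolding Gw_def wsum_def using th m0.weight_nonneg by (intro sum_nonneg) auto
    moreover have "Gw k \<le> Fw k" unfolding Gw_def Fw_def using th by (intro wsum_mono) (auto simp: of_bool_def)
    ultimately show "\<bar>Gw k\<bar> \<le> \<bar>Fw k\<bar>" by simp
  qed
  show "exp_growth Pw"
  proof (cases "\<theta> = 1")
    case True
    have "\<bar>phi (lam w)\<bar> \<le> (real (card V) + 1) * 2 ^ k" if "w \<in> m0.words k" for w k
    proof -
      have "real (lam w) \<le> real (card V) + real k" using lam_le[of w] that by (simp add: m0.words_def)
      also have "real k \<le> 2 ^ k" by (simp add: less_imp_le)
      also have "real (card V) \<le> real (card V) * 2 ^ k" by (simp add: mult_le_cancel_left1)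
      finally show ?thesis unfolding phi_1[OF True] by (simp add: distrib_right)
    qed
    then have "\<bar>wsum (\<lambda>w. phi (lam w)) k\<bar> \<le> (real (card V) + 1) * (2 * real (card E)) ^ k" for k by (rule wsum_growth)
    then show ?thesis unfolding exp_growth_def Pw_def by blast
  next
    case False
    then have "Pw = (\<lambda>k. (1 / (\<theta> - 1)) * Fw k)" unfolding Pw_def Fw_def wsum_def phi_def by (auto simp: sum_divide_distrib)
    then show ?thesis using exp_growth_cmult[OF F, of "1 / (\<theta> - 1)"] by simp
  qed
qed

lemma F_pos: assumes "0 \<le> t" shows "0 < egf Fw t"
proof -
  have "egf (\<lambda>k. Fw 0 * 0 ^ k) t \<le> egf Fw t"
  proof (rule egf_mono[OF exp_growth_cmult[OF exp_growth_power] growth(1) _ assms])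
    fix k
    have "0 \<le> Fw k" unfolding Fw_def wsum_def using th m0.weight_nonneg by (intro sum_nonneg) auto
    then show "Fw 0 * 0 ^ k \<le> Fw k" by (cases k) auto
  qed
  moreover have "egf (\<lambda>k. Fw 0 * 0 ^ k) t = Fw 0"
    using egf_cmult[OF exp_growth_power, of "Fw 0" 0 t] unfolding egf_power by simp
  moreover have "Fw 0 > 0" using th by (simp add: Fw_def wsum_def m0.words_0 m0.weight_def)
  ultimately show ?thesis by simp
qed

lemma num_loops_measurable: "0 \<le> t \<Longrightarrow> num_loops V E \<in> measurable (marking_law E t u) (count_space UNIV)"
proof -
  assume t: "0 \<le> t"
  interpret m: poisson_marking E t u by (rule at_time[OF t])
  have "num_loops V E -` {j} \<inter> space m.L \<in> sets m.L" for j
  proof -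
    have "{\<omega> \<in> space m.L. num_loops V E \<omega> = j} \<in> sets m.L"
      by (rule m.pattern_invariant_event) (use same_pattern(1) in metis)
    then show ?thesis by (simp add: vimage_def Int_def conj_commute)
  qed
  then show ?thesis by (simp add: measurable_count_space_eq2_countable)
qed

lemma large_event: "0 \<le> t \<Longrightarrow> {\<omega> \<in> space (marking_law E t u). large_loop V E \<eta> \<omega>} \<in> sets (marking_law E t u)"
proof -
  assume t: "0 \<le> t"
  interpret m: poisson_marking E t u by (rule at_time[OF t])
  show ?thesis by (rule m.pattern_invariant_event) (use same_pattern(2) in metis)
qed

lemma partition_function_eq:
  assumes t: "0 \<le> t" shows "partition_function V E \<theta> t u = exp (- (t * card E)) * egf Fw t"
proof -
  interpret m: poisson_marking E t u by (rule at_time[OF t])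
  have meas: "(\<lambda>\<omega>. \<theta> ^ num_loops V E \<omega>) \<in> borel_measurable m.L"
    using measurable_compose[OF num_loops_measurable[OF t], of "\<lambda>j. \<theta> ^ j" borel] by simp
  have "partition_function V E \<theta> t u = enn2real (\<integral>\<^sup>+\<omega>. ennreal (\<theta> ^ num_loops V E \<omega>) \<partial>m.L)"
    unfolding partition_function_def using meas th by (intro integral_eq_nn_integral) auto
  also have "(\<integral>\<^sup>+\<omega>. ennreal (\<theta> ^ num_loops V E \<omega>) \<partial>m.L) = (\<Sum>k. \<Sum>w\<in>m0.words k. ennreal (\<theta> ^ lam w) * ennreal (m.word_prob w))"
    by (rule m.nn_integral_words) (use meas loops_of_word(1)[OF t] in auto)
  also have "\<dots> = ennreal (exp (- (t * card E)) * egf Fw t)"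
    unfolding Fw_def by (rule words_ennreal[OF t]) (use th growth(1)[unfolded Fw_def] in auto)
  finally show ?thesis using F_pos[OF t] by simp
qed

text \<open>The factors \<open>exp (- t m)\<close> in numerator and denominator cancel.\<close>

lemma large_loop_prob_eq:
  assumes t: "0 \<le> t" shows "large_loop_prob V E \<theta> t u \<eta> = egf Gw t / egf Fw t"
proof -
  interpret m: poisson_marking E t u by (rule at_time[OF t])
  define Z where "Z = partition_function V E \<theta> t u"
  have Z: "Z > 0" unfolding Z_def partition_function_eq[OF t] using F_pos[OF t] by simp
  let ?A = "{\<omega> \<in> space m.L. large_loop V E \<eta> \<omega>}"
  have meas: "(\<lambda>\<omega>. ennreal (\<theta> ^ num_loops V E \<omega> / Z)) \<in> borel_measurable m.L"
    using measurable_compose[OF num_loops_measurable[OF t], of "\<lambda>j. ennreal (\<theta> ^ j / Z)" borel] by simp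
  have A: "?A \<in> sets m.L" by (rule large_event[OF t])
  define c where "c w = (1 / Z) * (\<theta> ^ lam w * of_bool (big w))" for w
  have wc: "wsum c = (\<lambda>k. (1 / Z) * Gw k)" unfolding c_def wsum_def Gw_def by (simp add: sum_divide_distrib)
  have "emeasure (loop_measure V E \<theta> t u) ?A = (\<integral>\<^sup>+\<omega>. ennreal (\<theta> ^ num_loops V E \<omega> / Z) * indicator ?A \<omega> \<partial>m.L)"
    unfolding loop_measure_def Z_def[symmetric] by (rule emeasure_density[OF meas A])
  also have "\<dots> = (\<Sum>k. \<Sum>w\<in>m0.words k. ennreal (c w) * ennreal (m.word_prob w))"
  proof (rule m.nn_integral_words)
    show "(\<lambda>\<omega>. ennreal (\<theta> ^ num_loops V E \<omega> / Z) * indicator ?A \<omega>) \<in> borel_measurable m.L"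
      using meas A by (intro borel_measurable_times_ennreal borel_measurable_indicator)
    fix k w \<omega> assume w: "w \<in> m0.words k" "\<omega> \<in> m.word_event w"
    have "\<omega> \<in> space m.L" using sets.sets_into_space[OF m.word_event_sets] w(2) by blast
    then show "ennreal (\<theta> ^ num_loops V E \<omega> / Z) * indicator ?A \<omega> = ennreal (c w)"
      using loops_of_word[OF t w] by (auto simp: c_def indicator_def)
  qed
  also have "\<dots> = ennreal (exp (- (t * card E)) * egf (wsum c) t)"
  proof (rule words_ennreal[OF t])
    show "exp_growth (wsum c)" unfolding wc by (rule exp_growth_cmult[OF growth(2)])
  qed (use th Z in \<open>simp add: c_def\<close>)
  also have "exp (- (t * card E)) * egf (wsum c) t = egf Gw t / egf Fw t"
    unfolding wc egf_cmult[OF growth(2)] Z_def partition_function_eq[OF t] by simp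
  finally have *: "emeasure (loop_measure V E \<theta> t u) ?A = ennreal (egf Gw t / egf Fw t)" .
  have "0 \<le> egf Gw t"
  proof -
    have "egf (\<lambda>k. 0 * 1 ^ k) t \<le> egf Gw t"
      by (rule egf_mono[OF exp_growth_cmult[OF exp_growth_power] growth(2) _ t])
        (use th m0.weight_nonneg in \<open>auto simp: Gw_def wsum_def intro!: sum_nonneg\<close>)
    then show ?thesis using egf_cmult[OF exp_growth_power, of 0 1 t] by simp
  qed
  moreover have "space (loop_measure V E \<theta> t u) = space m.L" by (simp add: loop_measure_def)
  ultimately show ?thesis unfolding large_loop_prob_def measure_def using * F_pos[OF t] by simp
qed

lemma phi_Suc: "phi (Suc l) = phi l + \<theta> ^ l"
  by (simp add: phi_def field_simps)

lemma phi_mono: "l \<le> l' \<Longrightarrow> phi l \<le> phi l'"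
  by (rule lift_Suc_mono_le[of phi]) (use th in \<open>auto simp: phi_Suc\<close>)

text \<open>On an edge between different loops every mark merges them, which costs
  \<open>\<theta> ^ (\<lambda> - 1)\<close>. On an edge that joins a loop with itself at most
  one kind of mark splits the loop, which gains \<open>\<theta> ^ \<lambda>\<close> with
  probability at most \<open>max u (1 - u)\<close>.\<close>

lemma letter_bound:
  assumes w: "set w \<subseteq> E \<times> UNIV" and e: "e \<in> E"
  shows "u * phi (lam (w @ [(e, Cross)])) + (1 - u) * phi (lam (w @ [(e, Bar)])) - phi (lam w) \<le>
    \<theta> ^ lam w * (if \<forall>x\<in>e. \<forall>y\<in>e. tied w x y then max u (1 - u) else - 1 / \<theta>)"
proof (cases "\<forall>x\<in>e. \<forall>y\<in>e. tied w x y")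
  case True
  let ?C = "lam (w @ [(e, Cross)])" and ?B = "lam (w @ [(e, Bar)])"
  have a: "u * a + (1 - u) * b - c \<le> d * max u (1 - u)"
    if "a \<le> c \<and> b \<le> c + d \<or> b \<le> c \<and> a \<le> c + d" "0 \<le> d" for a b c d
    using that(1)
  proof
    assume "a \<le> c \<and> b \<le> c + d"
    then have "u * a \<le> u * c" "(1 - u) * b \<le> (1 - u) * (c + d)" using u by (auto intro: mult_left_mono)
    moreover have "(1 - u) * d \<le> max u (1 - u) * d" using that(2) by (intro mult_right_mono) auto
    ultimately show ?thesis by (simp add: algebra_simps)
  next
    assume "b \<le> c \<and> a \<le> c + d"
    then have "u * a \<le> u * (c + d)" "(1 - u) * b \<le> (1 - u) * c" using u by (auto intro: mult_left_mono)
    moreover have "u * d \<le> max u (1 - u) * d" using that(2) by (intro mult_right_mono) auto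
    ultimately show ?thesis by (simp add: algebra_simps)
  qed
  have "phi ?C \<le> phi (lam w) \<and> phi ?B \<le> phi (lam w) + \<theta> ^ lam w \<or> phi ?B \<le> phi (lam w) \<and> phi ?C \<le> phi (lam w) + \<theta> ^ lam w"
    using lam_letter(2)[OF w e True] phi_mono[of _ "lam w"] phi_mono[of _ "Suc (lam w)"] by (auto simp: phi_Suc)
  from a[OF this] th True show ?thesis by simp
next
  case False
  have "phi (lam (w @ [(e, m)])) = phi (lam w) - \<theta> ^ lam w / \<theta>" for m
  proof -
    have l: "lam w = Suc (lam (w @ [(e, m)]))" using lam_letter(1)[OF w e False, of m] by simp
    then have "phi (lam w) = phi (lam (w @ [(e, m)])) + \<theta> ^ lam (w @ [(e, m)])" using phi_Suc by metis
    moreover have "\<theta> ^ lam w / \<theta> = \<theta> ^ lam (w @ [(e, m)])" unfolding l using th by simp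
    ultimately show ?thesis by simp
  qed
  moreover have "u * (a - X) + (1 - u) * (a - X) - a = - X" for a X :: real by (simp add: algebra_simps)
  ultimately have "u * phi (lam (w @ [(e, Cross)])) + (1 - u) * phi (lam (w @ [(e, Bar)])) - phi (lam w) = - (\<theta> ^ lam w / \<theta>)"
    by (simp only:)
  then show ?thesis unfolding if_not_P[OF False] by simp
qed

lemma tied_equiv: "tied w x x" "tied w x y \<Longrightarrow> tied w y x" "tied w x y \<Longrightarrow> tied w y z \<Longrightarrow> tied w x z"
  unfolding tied_def by (auto intro: conn_sym conn_trans)

text \<open>The vertices are partitioned into the sets visited by the same loop at time
  \<open>0\<close>. Without large loops each of these sets is small, so it spans few edges; the
  bounds add up to \<open>(1 + \<epsilon>) n\<close>.\<close>

lemma tied_edges: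
  fixes \<epsilon> :: real
  assumes sparse: "\<And>S. S \<subseteq> V \<Longrightarrow> real (card S) \<le> \<eta> * card V \<Longrightarrow> real (card {e \<in> E. e \<subseteq> S}) \<le> (1 + \<epsilon>) * card S"
    and w: "set w \<subseteq> E \<times> UNIV" "\<not> big w"
  shows "real (card {e \<in> E. \<forall>x\<in>e. \<forall>y\<in>e. tied w x y}) \<le> (1 + \<epsilon>) * card V"
proof -
  define cl where "cl x = {y \<in> V. tied w x y}" for x
  let ?Q = "cl ` V"
  have cl_eq: "cl x = cl y" if "tied w x y" for x y
    using tied_equiv(3)[OF that] tied_equiv(3)[OF tied_equiv(2)[OF that]] by (auto simp: cl_def)
  have dj: "A \<inter> B = {}" if AB: "A \<in> ?Q" "B \<in> ?Q" "A \<noteq> B" for A B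
  proof (rule ccontr)
    assume "A \<inter> B \<noteq> {}"
    then obtain z where z: "z \<in> A" "z \<in> B" by blast
    obtain x y where xy: "A = cl x" "B = cl y" using AB(1,2) by blast
    then have "tied w x z" "tied w y z" using z by (simp_all add: cl_def)
    then show False using cl_eq xy AB(3) by metis
  qed
  have cov: "\<Union>?Q = V" using tied_equiv(1) by (auto simp: cl_def)
  have "{e \<in> E. \<forall>x\<in>e. \<forall>y\<in>e. tied w x y} \<subseteq> (\<Union>S\<in>?Q. {e \<in> E. e \<subseteq> S})"
  proof
    fix e assume e: "e \<in> {e \<in> E. \<forall>x\<in>e. \<forall>y\<in>e. tied w x y}"
    then have "e \<noteq> {}" "e \<subseteq> V" using E by force+
    then obtain x where "x \<in> e" "x \<in> V" by blast
    then have "e \<subseteq> cl x" using e \<open>e \<subseteq> V\<close> by (auto simp: cl_def)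
    then show "e \<in> (\<Union>S\<in>?Q. {e \<in> E. e \<subseteq> S})" using e \<open>x \<in> V\<close> by blast
  qed
  then have "card {e \<in> E. \<forall>x\<in>e. \<forall>y\<in>e. tied w x y} \<le> card (\<Union>S\<in>?Q. {e \<in> E. e \<subseteq> S})"
    using V finite_E by (intro card_mono) auto
  also have "\<dots> \<le> (\<Sum>S\<in>?Q. card {e \<in> E. e \<subseteq> S})" using V by (intro card_UN_le) auto
  finally have "real (card {e \<in> E. \<forall>x\<in>e. \<forall>y\<in>e. tied w x y}) \<le> (\<Sum>S\<in>?Q. real (card {e \<in> E. e \<subseteq> S}))"
    unfolding of_nat_sum[symmetric] of_nat_le_iff .
  also have "\<dots> \<le> (\<Sum>S\<in>?Q. (1 + \<epsilon>) * card S)"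
  proof (rule sum_mono)
    fix S assume "S \<in> ?Q"
    then obtain x where x: "x \<in> V" "S = cl x" by blast
    show "real (card {e \<in> E. e \<subseteq> S}) \<le> (1 + \<epsilon>) * card S"
      by (rule sparse) (use tied_class_small[OF w x(1)] x in \<open>auto simp: cl_def\<close>)
  qed
  also have "\<dots> = (1 + \<epsilon>) * (\<Sum>S\<in>?Q. card S)" by (simp add: sum_distrib_left)
  also have "(\<Sum>S\<in>?Q. card S) = card (\<Union>?Q)"
    by (rule card_Union_disjoint[symmetric]) (use dj V in \<open>auto simp: pairwise_def disjnt_def cl_def\<close>)
  finally show ?thesis unfolding cov .
qed

text \<open>The lower bound on the number of edges makes the drift \<open>p\<close> of
  \<open>H\<close> in the absence of large loops at most \<open>- 2 \<delta> n /
  \<theta>\<close>. The interval length \<open>s\<close> is chosen such that the largest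
  possible decrease \<open>\<kappa> n\<close> of \<open>H\<close> is \<open>s \<delta> n /
  \<theta>\<close>, half of what that drift would give. The difference has to come from large
  loops, at rate at most \<open>c m / \<theta>\<close>.\<close>

theorem time_average_bound:
  fixes \<epsilon> \<delta> a s :: real
  assumes sparse: "\<And>S. S \<subseteq> V \<Longrightarrow> real (card S) \<le> \<eta> * card V \<Longrightarrow> real (card {e \<in> E. e \<subseteq> S}) \<le> (1 + \<epsilon>) * card S"
    and eps: "0 \<le> \<epsilon>" and del: "0 < \<delta>" and n: "0 < card V"
    and many: "(loop_threshold \<theta> u * (1 + \<epsilon>) + 2 * \<delta>) * card V \<le> card E" and a: "0 \<le> a"
    and s: "s = (if \<theta> = 1 then 1 else ln \<theta> / (\<theta> - 1)) * \<theta> / \<delta>" and s0: "0 < s"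
  shows "\<delta> / (loop_threshold \<theta> u * (loop_threshold \<theta> u * (1 + \<epsilon>) + 2 * \<delta>)) \<le> time_averaged_prob V E \<theta> u \<eta> a s"
proof -
  define c where "c = loop_threshold \<theta> u"
  define \<kappa> where "\<kappa> = (if \<theta> = 1 then 1 else ln \<theta> / (\<theta> - 1))"
  let ?m = "real (card E)" and ?n = "real (card V)"
  have c: "c = 1 + \<theta> * max u (1 - u)" "c > 0" using th u by (auto simp: c_def loop_threshold_def add_pos_nonneg)
  \<comment> \<open>\<open>p\<close> bounds the growth of \<open>H\<close> without large loops. On words with a large loop all \<open>m\<close> edges may
    join a loop with itself, whence \<open>q\<close>.\<close>
  define p where "p = (- ?m + c * (1 + \<epsilon>) * ?n) / \<theta>"
  define q where "q = c * ?m / \<theta>"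
  have diff: "Pw (Suc k) - ?m * Pw k \<le> p * Fw k + q * Gw k" for k
  proof -
    let ?T = "\<lambda>w e. \<forall>x\<in>e. \<forall>y\<in>e. tied w x y"
    have "Pw (Suc k) - ?m * Pw k = (\<Sum>w\<in>m0.words k. m0.weight w * (\<Sum>e\<in>E. u * phi (lam (w @ [(e, Cross)])) + (1 - u) * phi (lam (w @ [(e, Bar)])) - phi (lam w)))"
      unfolding Pw_def wsum_Suc unfolding wsum_def by (simp add: sum_subtractf sum_distrib_left right_diff_distrib mult_ac)
    also have "\<dots> \<le> (\<Sum>w\<in>m0.words k. m0.weight w * (\<theta> ^ lam w * (p + q * of_bool (big w))))"
    proof (intro sum_mono mult_left_mono m0.weight_nonneg)
      fix w assume "w \<in> m0.words k"
      then have w: "set w \<subseteq> E \<times> UNIV" by (simp add: m0.words_def)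
      define b where "b = card {e \<in> E. ?T w e}"
      have bm: "b \<le> card E" unfolding b_def using finite_E by (intro card_mono) auto
      have b: "real b \<le> (1 + \<epsilon>) * ?n + ?m * of_bool (big w)"
      proof (cases "big w")
        case True
        have "0 \<le> (1 + \<epsilon>) * ?n" using eps by simp
        then show ?thesis using True bm by simp
      next
        case False
        then show ?thesis using tied_edges[OF sparse w False] by (simp add: b_def)
      qed
      have "(\<Sum>e\<in>E. u * phi (lam (w @ [(e, Cross)])) + (1 - u) * phi (lam (w @ [(e, Bar)])) - phi (lam w))
          \<le> (\<Sum>e\<in>E. \<theta> ^ lam w * (if ?T w e then max u (1 - u) else - 1 / \<theta>))"
        by (rule sum_mono) (rule letter_bound[OF w])
      also have "\<dots> = \<theta> ^ lam w * (\<Sum>e\<in>E. if ?T w e then max u (1 - u) else - 1 / \<theta>)" by (simp only: sum_distrib_left)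
      also have "(\<Sum>e\<in>E. if ?T w e then max u (1 - u) else - 1 / \<theta>) = b * max u (1 - u) - (?m - b) / \<theta>"
      proof -
        have "(\<Sum>e\<in>E. if ?T w e then max u (1 - u) else - 1 / \<theta>) = (\<Sum>e\<in>E. (if ?T w e then max u (1 - u) + 1 / \<theta> else 0) - 1 / \<theta>)"
          by (rule sum.cong) auto
        also have "\<dots> = b * (max u (1 - u) + 1 / \<theta>) - ?m * (1 / \<theta>)"
          using finite_E by (simp add: sum_subtractf sum.If_cases b_def Int_def)
        finally show ?thesis by (simp add: algebra_simps diff_divide_distrib)
      qed
      also have "b * max u (1 - u) - (?m - b) / \<theta> = (- ?m + b * c) / \<theta>" using th by (simp add: c field_simps)
      also have "\<theta> ^ lam w * ((- ?m + b * c) / \<theta>) \<le> \<theta> ^ lam w * (p + q * of_bool (big w))"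
      proof (rule mult_left_mono)
        have "c * b \<le> c * ((1 + \<epsilon>) * ?n + ?m * of_bool (big w))" using b c(2) by (intro mult_left_mono) auto
        then have "(- ?m + b * c) / \<theta> \<le> (- ?m + c * ((1 + \<epsilon>) * ?n + ?m * of_bool (big w))) / \<theta>"
          using th by (intro divide_right_mono) (auto simp: mult.commute)
        also have "\<dots> = p + q * of_bool (big w)" unfolding p_def q_def by (simp add: add_divide_distrib diff_divide_distrib algebra_simps)
        finally show "(- ?m + b * c) / \<theta> \<le> p + q * of_bool (big w)" .
      qed (use th in simp)
      finally show "(\<Sum>e\<in>E. u * phi (lam (w @ [(e, Cross)])) + (1 - u) * phi (lam (w @ [(e, Bar)])) - phi (lam w)) \<le> \<theta> ^ lam w * (p + q * of_bool (big w))" .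
    qed
    also have "\<dots> = p * Fw k + q * Gw k"
      unfolding Fw_def Gw_def wsum_def by (simp add: sum_distrib_left sum.distrib algebra_simps)
    finally show ?thesis .
  qed
  have "- \<kappa> * card V \<le> p * s + q * (LBINT t:{a..a + s}. egf Gw t / egf Fw t)"
    unfolding \<kappa>_def
  proof (rule averaged_bound[OF growth(1,3,2) th _ F_pos _ _ diff _ _ _ a less_imp_le[OF s0]])
    show "Pw = (\<lambda>k. Fw k / (\<theta> - 1))" if "\<theta> \<noteq> 1"
      unfolding Pw_def Fw_def wsum_def phi_def using that by (auto simp: sum_divide_distrib)
    show "Fw = (\<lambda>k. ?m ^ k)" if "\<theta> = 1" unfolding Fw_def using that by (auto simp: wsum_const)
    have F: "Fw k / \<theta> ^ card V * ?m ^ l = (\<Sum>w\<in>m0.words k. \<Sum>v\<in>m0.words l. m0.weight w * m0.weight v * (\<theta> ^ lam w / \<theta> ^ card V))" for k l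
    proof -
      have "Fw k / \<theta> ^ card V = wsum (\<lambda>w. \<theta> ^ lam w / \<theta> ^ card V) k" unfolding Fw_def wsum_def by (simp add: sum_divide_distrib)
      then show ?thesis by (simp add: wsum_mult)
    qed
    have la: "lam w \<le> lam (w @ v) + card V" if "w \<in> m0.words k" "v \<in> m0.words l" for w v k l
      using lam_append[of w v] that by (simp add: m0.words_def)
    show "Fw k / \<theta> ^ card V * ?m ^ l \<le> Fw (k + l)" if "\<theta> > 1" for k l
      unfolding F unfolding Fw_def wsum_add
    proof (intro sum_mono mult_left_mono mult_nonneg_nonneg m0.weight_nonneg)
      fix w v assume "w \<in> m0.words k" "v \<in> m0.words l"
      then have "\<theta> ^ lam w \<le> \<theta> ^ (lam (w @ v) + card V)" using la that by (intro power_increasing) auto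
      then show "\<theta> ^ lam w / \<theta> ^ card V \<le> \<theta> ^ lam (w @ v)" using th by (simp add: pos_divide_le_eq power_add)
    qed
    show "Fw (k + l) \<le> Fw k / \<theta> ^ card V * ?m ^ l" if "\<theta> < 1" for k l
      unfolding F unfolding Fw_def wsum_add
    proof (intro sum_mono mult_left_mono mult_nonneg_nonneg m0.weight_nonneg)
      fix w v assume "w \<in> m0.words k" "v \<in> m0.words l"
      then have "\<theta> ^ (lam (w @ v) + card V) \<le> \<theta> ^ lam w" using la that th by (intro power_decreasing) auto
      then show "\<theta> ^ lam (w @ v) \<le> \<theta> ^ lam w / \<theta> ^ card V" using th by (simp add: pos_le_divide_eq power_add)
    qed
    show "(Pw k - real (card V) * ?m ^ k) * ?m ^ l \<le> Pw (k + l)" if "\<theta> = 1" for k l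
    proof -
      have "Pw k - real (card V) * ?m ^ k = wsum (\<lambda>w. phi (lam w) - real (card V)) k"
        unfolding Pw_def m0.sum_weight[symmetric] wsum_def by (simp add: sum_distrib_left sum_subtractf algebra_simps)
      then have "(Pw k - real (card V) * ?m ^ k) * ?m ^ l = (\<Sum>w\<in>m0.words k. \<Sum>v\<in>m0.words l. m0.weight w * m0.weight v * (phi (lam w) - real (card V)))"
        by (simp add: wsum_mult)
      also have "\<dots> \<le> Pw (k + l)" unfolding Pw_def wsum_add
      proof (intro sum_mono mult_left_mono mult_nonneg_nonneg m0.weight_nonneg)
        fix w v assume "w \<in> m0.words k" "v \<in> m0.words l"
        then show "phi (lam w) - real (card V) \<le> phi (lam (w @ v))" using la[of w k v l] unfolding phi_1[OF that] by simp
      qed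
      finally show ?thesis .
    qed
  qed simp
  also have "(LBINT t:{a..a + s}. egf Gw t / egf Fw t) = (LBINT t:{a..a + s}. large_loop_prob V E \<theta> t u \<eta>)"
    by (rule set_lebesgue_integral_cong) (use a large_loop_prob_eq in auto)
  also have "\<dots> = s * time_averaged_prob V E \<theta> u \<eta> a s" using s0 by (simp add: time_averaged_prob_def)
  finally have main: "- \<kappa> * ?n \<le> p * s + q * (s * time_averaged_prob V E \<theta> u \<eta> a s)" .
  define P where "P = time_averaged_prob V E \<theta> u \<eta> a s"
  \<comment> \<open>It remains to solve for \<open>P\<close>; the resulting bound \<open>(m - A n) / (c m)\<close> is increasing in \<open>m\<close>.\<close>
  have \<kappa>: "\<kappa> = s * \<delta> / \<theta>" using s del th by (simp add: \<kappa>_def)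
  have "s * (- \<delta> / \<theta> * ?n) \<le> s * (p + q * P)" using main unfolding \<kappa> P_def by (simp add: algebra_simps)
  then have "- \<delta> / \<theta> * ?n \<le> p + q * P" by (rule iffD1[OF mult_le_cancel_left_pos[OF s0]])
  then have "\<theta> * (- \<delta> / \<theta> * ?n) \<le> \<theta> * (p + q * P)" using th by (intro mult_left_mono) auto
  then have 1: "?m - (c * (1 + \<epsilon>) + \<delta>) * ?n \<le> c * ?m * P" 
  proof -
    have "\<theta> * (p + q * P) = - ?m + c * (1 + \<epsilon>) * ?n + c * ?m * P"
      unfolding p_def q_def distrib_left using th by simp
    moreover have "\<theta> * (- \<delta> / \<theta> * ?n) = - (\<delta> * ?n)" using th by simp
    ultimately show ?thesis using \<open>\<theta> * (- \<delta> / \<theta> * ?n) \<le> \<theta> * (p + q * P)\<close> by (simp add: algebra_simps)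
  qed
  define A where "A = c * (1 + \<epsilon>) + \<delta>"
  have "0 < c * (1 + \<epsilon>)" using c(2) eps by (intro mult_pos_pos) linarith+
  then have A: "0 < A" unfolding A_def using del by linarith
  have m: "(A + \<delta>) * ?n \<le> ?m" using many by (simp add: A_def c_def[symmetric] algebra_simps)
  have m0: "0 < ?m" using m A del n by (intro less_le_trans[OF _ m]) auto
  have "A * ?n * (A + \<delta>) \<le> A * ?m" using mult_left_mono[OF m less_imp_le[OF A]] by (simp add: mult_ac)
  then have "\<delta> * ?m \<le> (?m - A * ?n) * (A + \<delta>)" by (simp add: algebra_simps)
  also have "\<dots> \<le> (c * ?m * P) * (A + \<delta>)" using 1 A del by (intro mult_right_mono) (auto simp: A_def)
  finally have "?m * \<delta> \<le> ?m * (P * (c * (A + \<delta>)))" by (simp add: mult_ac)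
  then have "\<delta> \<le> P * (c * (A + \<delta>))" by (rule iffD1[OF mult_le_cancel_left_pos[OF m0]])
  then have "\<delta> / (c * (A + \<delta>)) \<le> P" using c A del by (simp add: pos_divide_le_eq)
  then show ?thesis by (simp add: A_def c_def P_def algebra_simps)
qed

end

section \<open>Sparsity of a random graph\<close>

definition edge_bound :: "nat \<Rightarrow> real \<Rightarrow> real \<Rightarrow> nat set set pmf \<Rightarrow> bool" where
  "edge_bound n C c p \<longleftrightarrow> (\<forall>F\<subseteq>all_edges n. real (card F) \<le> c * n \<longrightarrow>
     measure_pmf.prob p {E. F \<subseteq> E} \<le> (C / n) ^ card F)"

definition sparse :: "nat \<Rightarrow> real \<Rightarrow> real \<Rightarrow> nat set set \<Rightarrow> bool" where
  "sparse n \<eta> \<epsilon> E \<longleftrightarrow> (\<forall>S\<subseteq>{1..n}. real (card S) \<le> \<eta> * n \<longrightarrow> real (card {e \<in> E. e \<subseteq> S}) \<le> (1 + \<epsilon>) * card S)"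

lemma fact_ge_power: "(real k / exp 1) ^ k \<le> fact k"
proof -
  have "(\<Sum>i\<in>{k}. real k ^ i / fact i) \<le> (\<Sum>i. real k ^ i / fact i)"
    using summable_exp[of "real k"] by (intro sum_le_suminf) (auto simp: divide_inverse mult.commute)
  also have "\<dots> = exp (real k)" unfolding exp_def by (simp add: divide_inverse mult.commute)
  finally have "real k ^ k / fact k \<le> exp 1 ^ k" by (simp add: exp_of_nat_mult[symmetric])
  then show ?thesis by (simp add: power_divide field_simps)
qed

lemma binomial_le_power: "real (n choose k) \<le> real n ^ k / fact k"
proof -
  have "(n choose k) * fact k \<le> n ^ k"
  proof (cases "k \<le> n")
    case True
    have "fact n div fact (n - k) = (n choose k) * fact k"
      unfolding binomial_fact_lemma[OF True, symmetric] by (simp add: mult_ac)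
    then show ?thesis using fact_div_fact_le_pow[OF True] by simp
  qed (simp add: binomial_eq_0)
  then have "real (n choose k) * fact k \<le> real n ^ k" by (metis of_nat_fact of_nat_le_iff of_nat_mult of_nat_power)
  then show ?thesis by (simp add: pos_le_divide_eq)
qed

text \<open>Here \<open>k\<close> is the size of a set of vertices that spans at least
  \<open>m\<close> edges. The product is at most \<open>(exp 1)^k (exp 1 * C)^m (k / n)^(m -
  k)\<close>. Of the last factor, one half is spent on \<open>sqrt (k / n)\<close>, by \<open>m
  - k \<ge> 1\<close>, and the other half on \<open>\<eta> powr (\<epsilon> k / 2)\<close>, by
  \<open>m - k \<ge> \<epsilon> k\<close>, which beats the exponential factors.\<close>

lemma union_bound_term:
  fixes C \<epsilon> \<eta> :: real
  assumes C: "1 \<le> C" and eps: "0 < \<epsilon>" and r: "2 + \<epsilon> \<le> real r" and k: "1 \<le> k" "real k \<le> \<eta> * n" and eta: "\<eta> \<le> 1"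
    and n: "0 < n" and eta0: "0 < \<eta>" and m: "m = nat \<lfloor>(1 + \<epsilon>) * k\<rfloor> + 1"
    and A: "exp 1 * (exp 1 * C) ^ r * \<eta> powr (\<epsilon> / 2) \<le> 1 / 4"
  shows "real (n choose k) * real ((k choose 2) choose m) * (C / n) ^ m \<le> (1 / 2) ^ k / sqrt n"
proof -
  have k0: "0 < real k" "0 < real n" using k n by auto
  have "0 \<le> (1 + \<epsilon>) * k" using eps by simp
  then have "real m = of_int \<lfloor>(1 + \<epsilon>) * k\<rfloor> + 1" by (simp add: m)
  then have m1: "(1 + \<epsilon>) * k < m" "real m \<le> (1 + \<epsilon>) * k + 1"
    using floor_correct[of "(1 + \<epsilon>) * k"] by simp_all
  have km: "k \<le> m" "real m - k \<ge> 1" "\<epsilon> * k \<le> real m - k"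
  proof -
    have "0 < \<epsilon> * k" using eps k0 by simp
    then have "real k < m" using m1(1) by (simp add: distrib_right)
    then have "Suc k \<le> m" by simp
    moreover from this have "real (Suc k) \<le> real m" by (simp only: of_nat_le_iff)
    ultimately show "k \<le> m" "real m - k \<ge> 1" by simp_all
    show "\<epsilon> * k \<le> real m - k" using m1 by (simp add: distrib_right)
  qed
  have mr: "m \<le> r * k"
  proof -
    have "real m \<le> (2 + \<epsilon>) * k" using m1(2) k by (simp add: distrib_right)
    also have "\<dots> \<le> real r * k" using r by (intro mult_right_mono) auto
    finally show ?thesis by (metis of_nat_le_iff of_nat_mult)
  qed
  define x where "x = real k / n"
  have x: "0 < x" "x \<le> \<eta>" "x \<le> 1" 
  proof -
    show 0: "0 < x" unfolding x_def using k0 by simp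
    show 1: "x \<le> \<eta>" unfolding x_def using k k0 by (simp add: pos_divide_le_eq)
    show "x \<le> 1" using 1 eta by linarith
  qed
  have c1: "real (n choose k) \<le> (exp 1 * n / k) ^ k"
  proof -
    have "real (n choose k) \<le> real n ^ k / fact k" by (rule binomial_le_power)
    also have "\<dots> \<le> real n ^ k / (real k / exp 1) ^ k"
      using k0 fact_ge_power[of k] by (intro divide_left_mono) auto
    also have "\<dots> = (exp 1 * n / k) ^ k" by (simp add: power_divide field_simps power_mult_distrib)
    finally show ?thesis .
  qed
  have c2: "real ((k choose 2) choose m) \<le> (exp 1 * k) ^ m"
  proof -
    have "real ((k choose 2) choose m) \<le> real (k choose 2) ^ m / fact m" by (rule binomial_le_power)
    also have "\<dots> \<le> (real k ^ 2) ^ m / fact m"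
    proof (intro divide_right_mono power_mono)
      have "real (k choose 2) \<le> real k ^ 2 / 2" using binomial_le_power[of k 2] by simp
      also have "\<dots> \<le> real k ^ 2" by simp
      finally show "real (k choose 2) \<le> real k ^ 2" .
    qed simp_all
    also have "\<dots> \<le> (real k ^ 2) ^ m / (real k / exp 1) ^ m"
    proof (intro divide_left_mono)
      have "(real k / exp 1) ^ m \<le> (real m / exp 1) ^ m" using km by (intro power_mono divide_right_mono) auto
      then show "(real k / exp 1) ^ m \<le> fact m" using fact_ge_power[of m] by linarith
    qed (use k0 in auto)
    also have "\<dots> = (exp 1 * k) ^ m" 
    proof -
      have "real k ^ 2 / (real k / exp 1) = exp 1 * k" using k0 by (simp add: power2_eq_square)
      then show ?thesis unfolding power_divide[of "real k ^ 2" "real k / exp 1", symmetric] by simp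
    qed
    finally show ?thesis .
  qed
  have "real (n choose k) * real ((k choose 2) choose m) * (C / n) ^ m \<le> (exp 1 * n / k) ^ k * (exp 1 * k) ^ m * (C / n) ^ m"
    using c1 c2 C by (intro mult_right_mono mult_mono) auto
  also have "\<dots> = (exp 1 / x) ^ k * (exp 1 * C * x) ^ m" 
    unfolding x_def by (simp add: power_mult_distrib power_divide)
  also have "\<dots> = exp 1 ^ k * (exp 1 * C) ^ m * x ^ (m - k)"
    using km(1) x by (simp add: power_divide power_mult_distrib power_diff)
  also have "\<dots> \<le> exp 1 ^ k * (exp 1 * C) ^ (r * k) * x ^ (m - k)"
  proof -
    have "1 \<le> exp 1 * C" using C using mult_mono[of 1 "exp 1" 1 C] by simp
    then have "(exp 1 * C) ^ m \<le> (exp 1 * C) ^ (r * k)" using mr by (intro power_increasing)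
    then show ?thesis using x by (intro mult_right_mono mult_left_mono) auto
  qed
  also have "\<dots> = (exp 1 * (exp 1 * C) ^ r) ^ k * x ^ (m - k)" by (simp add: power_mult_distrib power_mult)
  also have "\<dots> \<le> (exp 1 * (exp 1 * C) ^ r) ^ k * ((\<eta> powr (\<epsilon> / 2)) ^ k * sqrt x)"
  proof (rule mult_left_mono)
    have "x ^ (m - k) = x powr (real m - k)" using x km(1) by (simp add: powr_realpow[symmetric] of_nat_diff)
    also have "\<dots> \<le> x powr (\<epsilon> / 2 * k + 1 / 2)" using x km by (intro powr_mono') (auto simp: field_simps)
    also have "\<dots> = (x powr (\<epsilon> / 2)) ^ k * sqrt x"
    proof -
      have "(x powr (\<epsilon> / 2)) ^ k = x powr (\<epsilon> / 2 * k)" using x by (simp add: powr_realpow[symmetric] powr_powr)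
      then show ?thesis using x by (simp only: powr_add) (simp add: powr_half_sqrt)
    qed
    also have "\<dots> \<le> (\<eta> powr (\<epsilon> / 2)) ^ k * sqrt x"
      using x eps by (intro mult_right_mono power_mono powr_mono2) auto
    finally show "x ^ (m - k) \<le> (\<eta> powr (\<epsilon> / 2)) ^ k * sqrt x" .
  qed (use C in simp)
  also have "\<dots> = (exp 1 * (exp 1 * C) ^ r * \<eta> powr (\<epsilon> / 2)) ^ k * sqrt x" by (simp add: power_mult_distrib)
  also have "\<dots> \<le> (1 / 4) ^ k * (2 ^ k / sqrt n)"
  proof (intro mult_mono power_mono)
    show "exp 1 * (exp 1 * C) ^ r * \<eta> powr (\<epsilon> / 2) \<le> 1 / 4" by (rule A)
    have "sqrt k \<le> 2 ^ k"
    proof (rule real_le_lsqrt)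
      have "real k \<le> 2 ^ k" using less_exp[of k] by (metis less_imp_le of_nat_less_iff of_nat_numeral of_nat_power)
      also have "\<dots> \<le> (2 ^ k)\<^sup>2" by (simp add: power2_eq_square)
      finally show "real k \<le> (2 ^ k)\<^sup>2" .
    qed simp_all
    then show "sqrt x \<le> 2 ^ k / sqrt n" using k0 unfolding x_def real_sqrt_divide by (intro divide_right_mono) auto
  qed (use C x in auto)
  also have "\<dots> = (1 / 2) ^ k / sqrt n" 
  proof -
    have "(1 / 4 :: real) ^ k * 2 ^ k = (1 / 2) ^ k" unfolding power_mult_distrib[symmetric] by simp
    then show ?thesis by simp
  qed
  finally show ?thesis .
qed

lemma sum_half: "(\<Sum>k=1..K. (1 / 2 :: real) ^ k) \<le> 1"
proof -
  have "(\<Sum>k=1..K. (1 / 2 :: real) ^ k) = 1 - (1 / 2) ^ K" by (induction K) (auto simp: field_simps)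
  then show ?thesis by simp
qed

lemma prob_Union_le:
  assumes "finite I" "\<And>i. i \<in> I \<Longrightarrow> measure_pmf.prob p (A i) \<le> f i"
  shows "measure_pmf.prob p (\<Union>i\<in>I. A i) \<le> (\<Sum>i\<in>I. f i)"
proof -
  have "measure_pmf.prob p (\<Union>i\<in>I. A i) \<le> (\<Sum>i\<in>I. measure_pmf.prob p (A i))"
    using assms(1) by (intro measure_pmf.finite_measure_subadditive_finite) auto
  also have "\<dots> \<le> (\<Sum>i\<in>I. f i)" by (rule sum_mono) (rule assms(2))
  finally show ?thesis .
qed

text \<open>A set of \<open>k\<close> vertices that violates sparsity contains a set
  \<open>F\<close> of \<open>\<lfloor>(1 + \<epsilon>) k\<rfloor> + 1\<close> edges. The union
  bound runs over \<open>k\<close>, over the set of vertices and over \<open>F\<close>.\<close>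

lemma sparse_whp:
  assumes C: "1 \<le> C" and eps: "0 < \<epsilon>" and c: "0 < (c::real)"
  obtains \<eta> where "0 < \<eta>" "\<And>n p. 0 < n \<Longrightarrow> edge_bound n C c p \<Longrightarrow>
    measure_pmf.prob p {E. E \<subseteq> all_edges n \<and> \<not> sparse n \<eta> \<epsilon> E} \<le> 1 / sqrt n"
proof -
  obtain r :: nat where r: "2 + \<epsilon> \<le> real r" using real_arch_simple by blast
  define A where "A = exp 1 * (exp 1 * C) ^ r"
  have A: "0 < A" using C by (simp add: A_def)
  \<comment> \<open>The second term keeps the sets \<open>F\<close> within the range of \<open>edge_bound\<close>, the third makes the terms of
    the union bound summable.\<close>
  define \<eta> where "\<eta> = min 1 (min (c / (2 + \<epsilon>)) ((1 / (4 * A)) powr (2 / \<epsilon>)))"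
  have eta: "0 < \<eta>" "\<eta> \<le> 1" "\<eta> \<le> c / (2 + \<epsilon>)" using c eps A by (auto simp: \<eta>_def)
  have "\<eta> powr (\<epsilon> / 2) \<le> ((1 / (4 * A)) powr (2 / \<epsilon>)) powr (\<epsilon> / 2)"
    using eta(1) eps by (intro powr_mono2) (auto simp: \<eta>_def)
  also have "\<dots> = 1 / (4 * A)" using eps A by (simp add: powr_powr)
  finally have Aeta: "exp 1 * (exp 1 * C) ^ r * \<eta> powr (\<epsilon> / 2) \<le> 1 / 4"
    using A unfolding A_def[symmetric] by (simp add: field_simps)
  have "measure_pmf.prob p {E. E \<subseteq> all_edges n \<and> \<not> sparse n \<eta> \<epsilon> E} \<le> 1 / sqrt n"
    if n: "0 < n" and eb: "edge_bound n C c p" for n p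
  proof -
    define K where "K = nat \<lfloor>\<eta> * n\<rfloor>"
    define M where "M k = nat \<lfloor>(1 + \<epsilon>) * real k\<rfloor> + 1" for k
    define SS where "SS k = {S. S \<subseteq> {1..n} \<and> card S = k}" for k
    define FF where "FF k S = {F. F \<subseteq> {e. e \<subseteq> S \<and> card e = 2} \<and> card F = M k}" for k and S :: "nat set"
    have Kk: "real k \<le> \<eta> * n" if "k \<in> {1..K}" for k
      
    proof -
      have "real k \<le> real K" using that by simp
      also have "\<dots> \<le> \<eta> * n" unfolding K_def using eta(1) by (intro of_nat_floor) simp
      finally show ?thesis .
    qed
    have fS: "finite (SS k)" for k unfolding SS_def by (rule finite_subset[of _ "Pow {1..n}"]) auto
    have fF: "finite (FF k S)" if "S \<in> SS k" for k S
    proof -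
      have "finite S" using that finite_subset[of S "{1..n}"] by (auto simp: SS_def)
      moreover have "FF k S \<subseteq> Pow (Pow S)" unfolding FF_def by blast
      ultimately show ?thesis by (simp add: finite_subset)
    qed
    have "{E. E \<subseteq> all_edges n \<and> \<not> sparse n \<eta> \<epsilon> E} \<subseteq> (\<Union>k\<in>{1..K}. \<Union>S\<in>SS k. \<Union>F\<in>FF k S. {E. F \<subseteq> E})"
    proof
      fix E assume "E \<in> {E. E \<subseteq> all_edges n \<and> \<not> sparse n \<eta> \<epsilon> E}"
      then obtain S where E: "E \<subseteq> all_edges n" and S: "S \<subseteq> {1..n}" "real (card S) \<le> \<eta> * n" "(1 + \<epsilon>) * card S < card {e \<in> E. e \<subseteq> S}"
        unfolding sparse_def by auto
      let ?D = "{e \<in> E. e \<subseteq> S}"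
      have finS: "finite S" using S(1) finite_subset by blast
      have finD: "finite ?D" using finS by (intro finite_subset[of ?D "Pow S"]) auto
      have "card S \<noteq> 0"
      proof
        assume "card S = 0"
        then have "S = {}" using finS by simp
        then have D: "?D = {}" using E by (auto simp: all_edges_def)
        show False using S(3) unfolding D \<open>card S = 0\<close> by simp
      qed
      moreover have "card S \<le> K" using S(2) unfolding K_def by (simp add: le_nat_floor)
      ultimately have k: "card S \<in> {1..K}" by simp
      have "0 \<le> (1 + \<epsilon>) * card S" using eps by simp
      then have "M (card S) \<le> card ?D" using S(3) unfolding M_def by linarith
      then obtain F where F: "F \<subseteq> ?D" "card F = M (card S)" by (rule obtain_subset_with_card_n) auto
      then have "F \<in> FF (card S) S" using E by (auto simp: FF_def all_edges_def)
      moreover have "S \<in> SS (card S)" using S(1) by (simp add: SS_def)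
      ultimately show "E \<in> (\<Union>k\<in>{1..K}. \<Union>S\<in>SS k. \<Union>F\<in>FF k S. {E. F \<subseteq> E})"
        using k F(1) by (intro UN_I[of "card S"] UN_I[of S] UN_I[of F]) auto
    qed
    then have "measure_pmf.prob p {E. E \<subseteq> all_edges n \<and> \<not> sparse n \<eta> \<epsilon> E} \<le>
        measure_pmf.prob p (\<Union>k\<in>{1..K}. \<Union>S\<in>SS k. \<Union>F\<in>FF k S. {E. F \<subseteq> E})"
      by (intro measure_pmf.finite_measure_mono) auto
    also have "\<dots> \<le> (\<Sum>k=1..K. \<Sum>S\<in>SS k. \<Sum>F\<in>FF k S. (C / n) ^ M k)"
    proof (intro prob_Union_le fS fF finite_atLeastAtMost)
      fix k S F assume k: "k \<in> {1..K}" and S: "S \<in> SS k" and F: "F \<in> FF k S"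
      have "F \<subseteq> all_edges n" using S F by (auto simp: SS_def FF_def all_edges_def)
      moreover have "real (card F) \<le> c * n"
      proof -
        have "0 \<le> (1 + \<epsilon>) * k" using eps by simp
        then have "real (M k) \<le> (1 + \<epsilon>) * k + 1" unfolding M_def by linarith
        also have "\<dots> \<le> (2 + \<epsilon>) * k" using k by (simp add: distrib_right)
        also have "\<dots> \<le> (2 + \<epsilon>) * (\<eta> * n)" using Kk[OF k] eps by (intro mult_left_mono) auto
        also have "\<dots> \<le> c * n" using eta(3) eps n by (simp add: pos_le_divide_eq mult_ac)
        finally show ?thesis using F by (simp add: FF_def)
      qed
      ultimately have "measure_pmf.prob p {E. F \<subseteq> E} \<le> (C / n) ^ card F" using eb unfolding edge_bound_def by blast
      then show "measure_pmf.prob p {E. F \<subseteq> E} \<le> (C / n) ^ M k" using F by (simp add: FF_def)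
    qed
    also have "\<dots> = (\<Sum>k=1..K. real (n choose k) * real ((k choose 2) choose M k) * (C / n) ^ M k)"
    proof (rule sum.cong[OF refl])
      fix k
      have cF: "card (FF k S) = (k choose 2) choose M k" if "S \<in> SS k" for S
      proof -
        have "finite S" "card S = k" using that finite_subset[of S "{1..n}"] by (auto simp: SS_def)
        then show ?thesis unfolding FF_def by (simp add: n_subsets)
      qed
      have "card (SS k) = n choose k" unfolding SS_def by (simp add: n_subsets)
      then show "(\<Sum>S\<in>SS k. \<Sum>F\<in>FF k S. (C / n) ^ M k) = real (n choose k) * real ((k choose 2) choose M k) * (C / n) ^ M k"
        by (simp add: cF)
    qed
    also have "\<dots> \<le> (\<Sum>k=1..K. (1 / 2) ^ k / sqrt n)"
      by (intro sum_mono union_bound_term[OF C eps r _ Kk eta(2) n eta(1) M_def Aeta]) auto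
    also have "\<dots> = (\<Sum>k=1..K. (1 / 2) ^ k) / sqrt n" by (simp add: sum_divide_distrib)
    also have "\<dots> \<le> 1 / sqrt n" by (intro divide_right_mono sum_half) auto
    finally show ?thesis .
  qed
  then show ?thesis using that[OF eta(1)] by blast
qed

section \<open>Sparse Erdos-Renyi graphs\<close>

lemma finite_all_edges: "finite (all_edges n)"
  unfolding all_edges_def by (rule finite_subset[of _ "Pow {1..n}"]) auto

lemma card_all_edges: "2 * card (all_edges n) = n * (n - 1)"
proof -
  have "card (all_edges n) = n choose 2" unfolding all_edges_def by (simp add: n_subsets)
  moreover have "2 dvd n * (n - 1)" by (cases "even n") auto
  ultimately show ?thesis by (simp add: choose_two del: One_nat_def)
qed

lemma erdos_renyi_edge_bound:
  assumes p: "0 \<le> l / real n" "l / real n \<le> 1"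
  shows "edge_bound n l c (erdos_renyi_graph n (l / n))"
  unfolding edge_bound_def
proof (intro allI impI)
  fix F assume F: "F \<subseteq> all_edges n"
  let ?P = "Pi_pmf (all_edges n) False (\<lambda>_. bernoulli_pmf (l / n))"
  have "measure_pmf.prob (erdos_renyi_graph n (l / n)) {E. F \<subseteq> E} =
      measure_pmf.prob ?P (Pi (all_edges n) (\<lambda>e. if e \<in> F then {True} else UNIV))"
    unfolding erdos_renyi_graph_def measure_map_pmf
    by (rule arg_cong[where f = "measure_pmf.prob ?P"]) (use F in \<open>auto simp: Pi_iff subset_iff split: if_splits\<close>)
  also have "\<dots> = (\<Prod>e\<in>all_edges n. measure_pmf.prob (bernoulli_pmf (l / n)) (if e \<in> F then {True} else UNIV))"
    by (rule measure_Pi_pmf_Pi[OF finite_all_edges])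
  also have "\<dots> = (\<Prod>e\<in>all_edges n. if e \<in> F then l / n else 1)"
    using p by (intro prod.cong refl) (simp add: measure_pmf_single)
  also have "\<dots> = (l / n) ^ card F"
    using F finite_all_edges by (simp add: prod.If_cases Int_absorb1)
  finally show "measure_pmf.prob (erdos_renyi_graph n (l / n)) {E. F \<subseteq> E} \<le> (l / n) ^ card F" by simp
qed

text \<open>Markov's inequality for \<open>exp (- s * |E|)\<close>, whose expectation is a
  product over the possible edges.\<close>

lemma erdos_renyi_few_edges:
  assumes l: "0 < l" and q: "0 < q" "q < l / 2"
  obtains \<beta> D where "0 < \<beta>" "\<And>n. 0 < n \<Longrightarrow> l \<le> real n \<Longrightarrow>
    measure_pmf.prob (erdos_renyi_graph n (l / n)) {E. real (card E) < q * n} \<le> D * exp (- \<beta>) ^ n"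
proof -
  \<comment> \<open>The mean number of edges is \<open>l (n - 1) / 2\<close>, and \<open>1 - exp (- s) \<ge> s / (1 + s)\<close>. The bound thus decays
    at rate \<open>l s / (2 (1 + s)) - s q\<close>, which is positive for this \<open>s\<close>. The constant \<open>D\<close> absorbs the difference
    between \<open>n - 1\<close> and \<open>n\<close>.\<close>
  define s where "s = (l / 2 - q) / (2 * q)"
  have s: "0 < s" using q by (simp add: s_def)
  have qs: "q * (1 + s) < l / 2" using q by (simp add: s_def field_simps)
  define \<beta> where "\<beta> = l * s / (2 * (1 + s)) - s * q"
  have "s * q < s * (l / (2 * (1 + s)))" using qs s by (intro mult_strict_left_mono) (auto simp: field_simps)
  then have beta: "0 < \<beta>" by (simp add: \<beta>_def mult.commute)
  define D where "D = exp (l * s / (2 * (1 + s)))"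
  have "measure_pmf.prob (erdos_renyi_graph n (l / n)) {E. real (card E) < q * n} \<le> D * exp (- \<beta>) ^ n"
    if n: "0 < n" "l \<le> real n" for n
  proof -
    let ?A = "all_edges n" and ?p = "l / real n"
    let ?P = "Pi_pmf ?A False (\<lambda>_. bernoulli_pmf ?p)"
    have p: "0 \<le> ?p" "?p \<le> 1" using l n by auto
    define f where "f (e :: nat set) b = (if b then exp (- s) else 1 :: real)" for e b
    define U where "U y = (\<Prod>e\<in>?A. f e (y e))" for y
    have U: "U y = exp (- s * card {e \<in> ?A. y e})" for y
    proof -
      have "U y = exp (- s) ^ card {e \<in> ?A. y e}"
        unfolding U_def f_def using finite_all_edges by (simp add: prod.If_cases Int_def)
      then show ?thesis by (simp add: exp_of_nat_mult[symmetric] mult.commute)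
    qed
    have U1: "0 \<le> U y" "U y \<le> 1" for y unfolding U using s by auto
    have "measure_pmf.prob (erdos_renyi_graph n ?p) {E. real (card E) < q * n} = measure_pmf.prob ?P {y. real (card {e \<in> ?A. y e}) < q * n}"
      unfolding erdos_renyi_graph_def measure_map_pmf by (simp add: vimage_def)
    also have "\<dots> \<le> measure_pmf.prob ?P {y \<in> space (measure_pmf ?P). U y \<ge> exp (- s * (q * n))}"
      by (intro measure_pmf.finite_measure_mono) (use s in \<open>auto simp: U\<close>)
    also have "\<dots> \<le> measure_pmf.expectation ?P U / exp (- s * (q * n))"
      by (rule integral_Markov_inequality_measure[where A = UNIV])
        (use U1 in \<open>auto intro!: measure_pmf.integrable_const_bound[where B = 1]\<close>)
    also have "measure_pmf.expectation ?P U = (\<Prod>e\<in>?A. measure_pmf.expectation (bernoulli_pmf ?p) (f e))"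
      unfolding U_def by (rule expectation_prod_Pi_pmf[OF finite_all_edges])
        (use s in \<open>auto simp: f_def intro!: measure_pmf.integrable_const_bound[where B = 1]\<close>)
    also have "\<dots> = (1 - ?p * (1 - exp (- s))) ^ card ?A"
      using p by (simp add: f_def algebra_simps)
    also have "\<dots> \<le> exp (- (?p * (1 - exp (- s)))) ^ card ?A"
    proof (rule power_mono)
      show "1 - ?p * (1 - exp (- s)) \<le> exp (- (?p * (1 - exp (- s))))" using exp_ge_add_one_self[of "- (?p * (1 - exp (- s)))"] by simp
      have "?p * (1 - exp (- s)) \<le> 1 * 1" using p s by (intro mult_mono) auto
      then show "0 \<le> 1 - ?p * (1 - exp (- s))" by simp
    qed
    also have "\<dots> = exp (- (card ?A * ?p * (1 - exp (- s))))" by (simp only: exp_of_nat_mult[symmetric] mult_minus_right mult.assoc)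
    also have "\<dots> \<le> exp (- ((real n - 1) * l / 2 * (s / (1 + s))))"
    proof -
      have "2 * real (card ?A) = real n * (real n - 1)"
        using card_all_edges[of n] n by (metis of_nat_1 of_nat_diff of_nat_mult of_nat_numeral Suc_leI One_nat_def)
      then have c2: "real (card ?A) = real n * (real n - 1) / 2" by simp
      have cp: "card ?A * ?p = (real n - 1) * l / 2" unfolding c2 using n by simp
      have "exp (- s) \<le> 1 / (1 + s)"
        using exp_ge_add_one_self[of s] s by (simp add: exp_minus field_simps)
      then have "s / (1 + s) \<le> 1 - exp (- s)" using s by (simp add: field_simps)
      then have "(real n - 1) * l / 2 * (s / (1 + s)) \<le> (real n - 1) * l / 2 * (1 - exp (- s))"
        using n l by (intro mult_left_mono) auto
      then show ?thesis unfolding cp by simp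
    qed
    finally have "measure_pmf.prob (erdos_renyi_graph n ?p) {E. real (card E) < q * n} \<le>
        exp (- ((real n - 1) * l / 2 * (s / (1 + s)))) / exp (- s * (q * n))" by (simp add: divide_right_mono)
    also have "\<dots> = exp (- ((real n - 1) * l / 2 * (s / (1 + s))) - (- s * (q * n)))" by (rule exp_diff[symmetric])
    also have "- ((real n - 1) * l / 2 * (s / (1 + s))) - (- s * (q * n)) = l * s / (2 * (1 + s)) + real n * (- \<beta>)"
    proof -
      have gen: "- ((a - 1) * l / 2 * Q) - (- s * (q * a)) = l / 2 * Q + a * (- (l / 2 * Q - s * q))" for a Q
        by (simp add: field_simps)
      have eq: "l * s / (2 * (1 + s)) = l / 2 * (s / (1 + s))" by simp
      show ?thesis unfolding \<beta>_def eq by (rule gen)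
    qed
    also have "exp \<dots> = D * exp (- \<beta>) ^ n" unfolding D_def exp_add exp_of_nat_mult ..
    finally show ?thesis .
  qed
  then show ?thesis using that[OF beta] by blast
qed

section \<open>Switchings of pairings\<close>

definition partner :: "'h set set \<Rightarrow> 'h \<Rightarrow> 'h" where
  "partner \<pi> h = (THE h'. h' \<noteq> h \<and> {h, h'} \<in> \<pi>)"

lemma pairing_inter: "\<pi> \<in> pairings H \<Longrightarrow> a \<in> \<pi> \<Longrightarrow> b \<in> \<pi> \<Longrightarrow> h \<in> a \<Longrightarrow> h \<in> b \<Longrightarrow> a = b"
  unfolding pairings_def disjoint_def by blast

lemma partner_props:
  assumes pi: "\<pi> \<in> pairings H" and h: "h \<in> H"
  shows "partner \<pi> h \<noteq> h" "{h, partner \<pi> h} \<in> \<pi>" "partner \<pi> h \<in> H"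
    and "\<And>h'. h' \<noteq> h \<Longrightarrow> {h, h'} \<in> \<pi> \<Longrightarrow> partner \<pi> h = h'"
proof -
  have "h \<in> \<Union>\<pi>" using pi h by (simp add: pairings_def)
  then obtain b where b: "b \<in> \<pi>" "h \<in> b" by blast
  have "card b = 2" using pi b by (simp add: pairings_def)
  then obtain x y where xy: "b = {x, y}" "x \<noteq> y" by (meson card_2_iff)
  then have "h = x \<or> h = y" using b(2) by blast
  then obtain h' where h': "h' \<noteq> h" "b = {h, h'}" using xy by (metis insert_commute)
  have u: "g = h'" if "g \<noteq> h" "{h, g} \<in> \<pi>" for g
  proof -
    have "{h, g} = b" by (rule pairing_inter[OF pi that(2) b(1), of h]) (use b in auto)
    then have "{h, g} = {h, h'}" using h'(2) by simp
    then show ?thesis using that(1) unfolding doubleton_eq_iff by blast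
  qed
  have hb: "{h, h'} \<in> \<pi>" using h'(2) b(1) by simp
  have p: "partner \<pi> h = h'" unfolding partner_def
  proof (rule the_equality)
    show "h' \<noteq> h \<and> {h, h'} \<in> \<pi>" using h'(1) hb by blast
    show "g = h'" if "g \<noteq> h \<and> {h, g} \<in> \<pi>" for g using u that by blast
  qed
  show "partner \<pi> h \<noteq> h" unfolding p by (rule h'(1))
  show "{h, partner \<pi> h} \<in> \<pi>" unfolding p by (rule hb)
  have "h' \<in> \<Union>\<pi>" using hb by blast
  then show "partner \<pi> h \<in> H" unfolding p using pi unfolding pairings_def by blast
  show "partner \<pi> h = g" if "g \<noteq> h" "{h, g} \<in> \<pi>" for g unfolding p using u[OF that] by simp
qed

lemma partner_invol: assumes "\<pi> \<in> pairings H" "h \<in> H" shows "partner \<pi> (partner \<pi> h) = h"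
  using partner_props(4)[OF assms(1) partner_props(3)[OF assms], of h] partner_props(1,2)[OF assms]
  by (simp add: insert_commute)

lemma finite_pairings: "finite H \<Longrightarrow> finite (pairings H)"
  by (rule finite_subset[of _ "Pow (Pow H)"]) (auto simp: pairings_def)

lemma finite_pairing: "finite H \<Longrightarrow> \<pi> \<in> pairings H \<Longrightarrow> finite \<pi>"
  by (rule finite_subset[of _ "Pow H"]) (auto simp: pairings_def)

definition switch :: "'h set set \<Rightarrow> 'h \<Rightarrow> 'h \<Rightarrow> 'h \<Rightarrow> 'h \<Rightarrow> 'h set set" where
  "switch \<pi> a b c d = (\<pi> - {{a, b}, {c, d}}) \<union> {{a, c}, {b, d}}"

lemma switch_pairing:
  assumes pi: "\<pi> \<in> pairings H" and ab: "{a, b} \<in> \<pi>" "{c, d} \<in> \<pi>" "a \<noteq> b" "c \<noteq> d" "{a, b} \<noteq> {c, d}"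
  shows "switch \<pi> a b c d \<in> pairings H" "{a, c} \<noteq> {b, d}" "{a, c} \<notin> \<pi>" "{b, d} \<notin> \<pi>" "a \<noteq> c" "b \<noteq> d" "a \<noteq> d" "b \<noteq> c"
proof -
  note I = pairing_inter[OF pi]
  show n: "a \<noteq> c" "b \<noteq> d" "a \<noteq> d" "b \<noteq> c" using I[OF ab(1,2)] ab(5) by auto
  then show "{a, c} \<noteq> {b, d}" using ab(3) by (auto simp: doubleton_eq_iff)
  show nac: "{a, c} \<notin> \<pi>" using I[OF _ ab(1), of "{a, c}" a] n by (auto simp: doubleton_eq_iff)
  show nbd: "{b, d} \<notin> \<pi>" using I[OF _ ab(1), of "{b, d}" b] n by (auto simp: doubleton_eq_iff)
  let ?R = "\<pi> - {{a, b}, {c, d}}"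
  have R: "h \<notin> {a, b, c, d}" if "e \<in> ?R" "h \<in> e" for e h
    using I[of e "{a, b}" h] I[of e "{c, d}" h] that ab by auto
  have "\<Union>(switch \<pi> a b c d) = \<Union>?R \<union> {a, b, c, d}" unfolding switch_def by auto
  also have "\<dots> = \<Union>\<pi>" using ab by auto
  finally have U: "\<Union>(switch \<pi> a b c d) = H" using pi by (simp add: pairings_def)
  have D: "disjoint (switch \<pi> a b c d)"
    unfolding disjoint_def
  proof (intro ballI impI)
    fix e f assume e: "e \<in> switch \<pi> a b c d" and f: "f \<in> switch \<pi> a b c d" and ef: "e \<noteq> f"
    have r4: "{a, c} \<inter> {b, d} = {}" using n ab(3,4) by simp
    have r1: "e \<inter> f = {}" if "e \<in> ?R" "f \<in> ?R" using that ef I[of e f] by blast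
    have r2: "g \<inter> {a, c} = {}" if "g \<in> ?R" for g using R[OF that] by blast
    have r3: "g \<inter> {b, d} = {}" if "g \<in> ?R" for g using R[OF that] by blast
    have es: "e \<in> ?R \<or> e = {a, c} \<or> e = {b, d}" "f \<in> ?R \<or> f = {a, c} \<or> f = {b, d}"
      using e f unfolding switch_def by blast+
    show "e \<inter> f = {}" using es ef r1 r2[of e] r2[of f] r3[of e] r3[of f] r4 Int_commute[of e f] by (elim disjE) simp_all
  qed
  have "\<forall>e\<in>switch \<pi> a b c d. card e = 2" 
  proof
    fix e assume "e \<in> switch \<pi> a b c d"
    then have "e \<in> \<pi> \<or> e = {a, c} \<or> e = {b, d}" unfolding switch_def by blast
    then show "card e = 2" using pi n by (elim disjE) (simp_all add: pairings_def)
  qed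
  with U D show "switch \<pi> a b c d \<in> pairings H" by (simp add: pairings_def)
qed

lemma switch_back:
  assumes pi: "\<pi> \<in> pairings H" and ab: "{a, b} \<in> \<pi>" "{c, d} \<in> \<pi>" "a \<noteq> b" "c \<noteq> d" "{a, b} \<noteq> {c, d}"
  shows "\<pi> = (switch \<pi> a b c d - {{a, c}, {b, d}}) \<union> {{a, b}, {c, d}}"
  using switch_pairing(3,4)[OF assms] ab unfolding switch_def by auto

lemma pairings_nonempty: assumes "finite H" "even (card H)" shows "pairings H \<noteq> {}"
  using assms
proof (induction "card H" arbitrary: H rule: less_induct)
  case less
  show ?case
  proof (cases "H = {}")
    case True
    then have "{} \<in> pairings H" by (simp add: pairings_def)
    then show ?thesis by blast
  next
    case False
    then obtain a where a: "a \<in> H" by blast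
    have "card H \<noteq> 1" using less.prems by auto
    then have "H - {a} \<noteq> {}" using a less.prems(1) by (metis card_1_singleton_iff card_gt_0_iff Diff_eq_empty_iff False subset_singletonD One_nat_def)
    then obtain b where b: "b \<in> H" "b \<noteq> a" by blast
    have c: "card (H - {a, b}) + 2 = card H"
    proof -
      have "card {a, b} \<le> card H" using a b less.prems by (intro card_mono) auto
      then show ?thesis using a b less.prems by (subst card_Diff_subset) auto
    qed
    then have "pairings (H - {a, b}) \<noteq> {}" using less.prems by (intro less.hyps) (auto, presburger)
    then obtain \<pi> where pi: "\<pi> \<in> pairings (H - {a, b})" by blast
    then have "insert {a, b} \<pi> \<in> pairings H"
      using a b unfolding pairings_def disjoint_def by auto
    then show ?thesis by blast
  qed
qed

locale degree_sequence =
  fixes n :: nat and d :: "nat \<Rightarrow> nat" and \<Delta> :: nat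
  assumes d: "\<And>i. i \<in> {1..n} \<Longrightarrow> 1 \<le> d i \<and> d i \<le> \<Delta>"
begin

abbreviation "H \<equiv> half_edges n d"

lemma finite_H: "finite H" by (simp add: half_edges_def)

lemma card_H: "card H = (\<Sum>i=1..n. d i)" by (simp add: half_edges_def)

lemma card_H_ge: "n \<le> card H"
proof -
  have "(\<Sum>i=1..n. 1) \<le> (\<Sum>i=1..n. d i)" using d by (intro sum_mono) auto
  then show ?thesis by (simp add: card_H)
qed

lemma card_at: "card {h \<in> H. fst h = x} \<le> \<Delta>"
proof (cases "x \<in> {1..n}")
  case True
  have "{h \<in> H. fst h = x} = {x} \<times> {..<d x}" using True by (auto simp: half_edges_def)
  then show ?thesis using d[OF True] by simp
next
  case False
  then have e: "{h \<in> H. fst h = x} = {}" by (auto simp: half_edges_def)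
  show ?thesis unfolding e by simp
qed

text \<open>The vertices at distance at most one from \<open>x\<close> or \<open>y\<close> in
  the multigraph of the pairing.\<close>

definition near :: "(nat \<times> nat) set set \<Rightarrow> nat \<Rightarrow> nat \<Rightarrow> nat set" where
  "near \<pi> x y = {x, y} \<union> (\<lambda>g. fst (partner \<pi> g)) ` {g \<in> H. fst g = x \<or> fst g = y}"

lemma card_near: assumes "1 \<le> \<Delta>" shows "card (near \<pi> x y) \<le> 4 * \<Delta>"
proof -
  have seq: "{g \<in> H. fst g = x \<or> fst g = y} = {g \<in> H. fst g = x} \<union> {g \<in> H. fst g = y}" by auto
  have "card {g \<in> H. fst g = x \<or> fst g = y} \<le> \<Delta> + \<Delta>"
    unfolding seq using card_Un_le[of "{g \<in> H. fst g = x}" "{g \<in> H. fst g = y}"] card_at[of x] card_at[of y] by linarith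
  then have "card ((\<lambda>g. fst (partner \<pi> g)) ` {g \<in> H. fst g = x \<or> fst g = y}) \<le> \<Delta> + \<Delta>"
    using card_image_le[of "{g \<in> H. fst g = x \<or> fst g = y}" "\<lambda>g. fst (partner \<pi> g)"] finite_H by simp
  moreover have "card {x, y} \<le> 2" by (simp add: card_insert_if)
  ultimately show ?thesis unfolding near_def using card_Un_le[of "{x, y}"] assms
    by (smt (verit) add_mono dual_order.trans mult_2 numeral_Bit0 distrib_right one_add_one mult_1)
qed

lemma finite_near: "finite (near \<pi> x y)" using finite_H by (simp add: near_def)

lemma near_adjacent:
  assumes pi: "\<pi> \<in> pairings H" and b: "b \<in> \<pi>" and f: "fst ` b = {x, v} \<or> fst ` b = {y, v}"
  shows "v \<in> near \<pi> x y"
proof -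
  have "card b = 2" "b \<subseteq> H" using pi b by (auto simp: pairings_def)
  then obtain g g' where g: "b = {g, g'}" "g \<noteq> g'" "g \<in> H" "g' \<in> H" by (metis card_2_iff insert_subset)
  have p: "partner \<pi> g = g'" "partner \<pi> g' = g"
    using partner_props(4)[OF pi g(3), of g'] partner_props(4)[OF pi g(4), of g] b g by (auto simp: insert_commute)
  from f have "fst g = x \<and> fst g' = v \<or> fst g' = x \<and> fst g = v \<or> fst g = y \<and> fst g' = v \<or> fst g' = y \<and> fst g = v"
    unfolding g by (auto simp: doubleton_eq_iff)
  then show ?thesis unfolding near_def using p g(3,4)
    by (elim disjE) (force intro!: image_eqI[of _ _ g] image_eqI[of _ _ g'])+
qed

text \<open>The half-edges whose pair can be switched with a pair joining \<open>x\<close> and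
  \<open>y\<close>: the two new edges do not exist yet, since a new neighbour of
  \<open>x\<close> or \<open>y\<close> is not among the old ones, and the pair does not
  represent an edge of \<open>F\<close>, which is to be kept.\<close>

definition far :: "(nat \<times> nat) set set \<Rightarrow> nat set set \<Rightarrow> nat \<Rightarrow> nat \<Rightarrow> (nat \<times> nat) set" where
  "far \<pi> F x y = {h \<in> H. fst h \<notin> near \<pi> x y \<and> fst (partner \<pi> h) \<notin> near \<pi> x y \<and> fst ` {h, partner \<pi> h} \<notin> F}"

text \<open>There are at least \<open>n\<close> half-edges. The sets excluded are those at one
  of at most \<open>4 \<Delta>\<close> near vertices, their partners, and the two half-edges of
  each edge in \<open>F\<close>; the last count needs that no edge of \<open>F\<close> is
  represented by several pairs.\<close>

lemma card_far:
  assumes pi: "\<pi> \<in> pairings H" and D: "1 \<le> \<Delta>" and F: "finite F" and inj: "inj_on (\<lambda>b. fst ` b) \<pi> \<or> F = {}"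
  shows "n \<le> card (far \<pi> F x y) + 8 * \<Delta> * \<Delta> + 2 * card F"
proof -
  let ?W = "near \<pi> x y"
  let ?A = "{h \<in> H. fst h \<in> ?W}" and ?B = "{h \<in> H. fst (partner \<pi> h) \<in> ?W}" and ?C = "{h \<in> H. fst ` {h, partner \<pi> h} \<in> F}"
  have A: "card ?A \<le> 4 * \<Delta> * \<Delta>"
  proof -
    have Aeq: "?A = (\<Union>v\<in>?W. {h \<in> H. fst h = v})" by blast
    have "card ?A \<le> (\<Sum>v\<in>?W. card {h \<in> H. fst h = v})" by (subst Aeq) (rule card_UN_le[OF finite_near])
    also have "\<dots> \<le> (\<Sum>v\<in>?W. \<Delta>)" by (intro sum_mono card_at)
    also have "\<dots> \<le> 4 * \<Delta> * \<Delta>" using card_near[OF D] by (simp add: mult_right_mono)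
    finally show ?thesis .
  qed
  have "?B \<subseteq> partner \<pi> ` ?A"
  proof
    fix h assume "h \<in> ?B"
    then show "h \<in> partner \<pi> ` ?A"
      using partner_invol[OF pi, of h] partner_props(3)[OF pi, of h] by (intro image_eqI[of _ _ "partner \<pi> h"]) simp_all
  qed
  then have "card ?B \<le> card (partner \<pi> ` ?A)" using finite_H by (intro card_mono) simp_all
  also have "\<dots> \<le> card ?A" using finite_H by (intro card_image_le) simp
  finally have B: "card ?B \<le> 4 * \<Delta> * \<Delta>" using A by linarith
  have C: "card ?C \<le> 2 * card F"
  proof (cases "F = {}")
    case False
    then have inj: "inj_on (\<lambda>b. fst ` b) \<pi>" using assms by blast
    let ?P = "{b \<in> \<pi>. fst ` b \<in> F}"
    have fin: "finite ?P" using finite_pairing[OF finite_H pi] by simp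
    have "?C \<subseteq> (\<Union>b\<in>?P. b)"
    proof
      fix h assume h: "h \<in> ?C"
      then have "{h, partner \<pi> h} \<in> ?P" using partner_props(2)[OF pi, of h] by blast
      then show "h \<in> (\<Union>b\<in>?P. b)" by (intro UN_I[of "{h, partner \<pi> h}"]) auto
    qed
    moreover have fb: "card b = 2" if "b \<in> ?P" for b using pi that by (simp add: pairings_def)
    moreover have "finite (\<Union>b\<in>?P. b)" using fin fb by (metis (no_types, lifting) card.infinite finite_UN_I zero_neq_numeral)
    ultimately have "card ?C \<le> card (\<Union>b\<in>?P. b)" by (intro card_mono)
    also have "\<dots> \<le> (\<Sum>b\<in>?P. card b)" by (rule card_UN_le[OF fin])
    also have "\<dots> = 2 * card ?P" using fb by simp
    also have "card ?P = card ((\<lambda>b. fst ` b) ` ?P)" by (rule card_image[symmetric]) (use inj in \<open>auto intro: inj_on_subset\<close>)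
    also have "\<dots> \<le> card F" using F by (intro card_mono) auto
    finally show ?thesis by simp
  qed simp
  have "H \<subseteq> far \<pi> F x y \<union> (?A \<union> ?B \<union> ?C)" by (auto simp: far_def)
  then have "card H \<le> card (far \<pi> F x y \<union> (?A \<union> ?B \<union> ?C))" using finite_H by (intro card_mono) (auto simp: far_def)
  also have "\<dots> \<le> card (far \<pi> F x y) + (card ?A + card ?B + card ?C)"
    using card_Un_le[of "far \<pi> F x y" "?A \<union> ?B \<union> ?C"] card_Un_le[of "?A \<union> ?B" ?C] card_Un_le[of ?A ?B] by linarith
  finally show ?thesis using A B C card_H_ge by linarith
qed

lemma far_switch:
  assumes pi: "\<pi> \<in> pairings H" and ab: "{a, b} \<in> \<pi>" "a \<noteq> b" and c: "c \<in> far \<pi> F (fst a) (fst b)"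
  defines "e \<equiv> partner \<pi> c"
  shows "{c, e} \<in> \<pi>" "c \<noteq> e" "{a, b} \<noteq> {c, e}" "fst c \<notin> {fst a, fst b}" "fst e \<notin> {fst a, fst b}"
    "\<And>g. g \<in> \<pi> \<Longrightarrow> fst ` g \<noteq> {fst a, fst c}" "\<And>g. g \<in> \<pi> \<Longrightarrow> fst ` g \<noteq> {fst b, fst e}" "fst ` {c, e} \<notin> F"
proof -
  have c': "c \<in> H" "fst c \<notin> near \<pi> (fst a) (fst b)" "fst e \<notin> near \<pi> (fst a) (fst b)" "fst ` {c, e} \<notin> F"
    using c unfolding far_def e_def by blast+
  show "{c, e} \<in> \<pi>" unfolding e_def by (rule partner_props(2)[OF pi c'(1)])
  show "c \<noteq> e" unfolding e_def by (rule partner_props(1)[OF pi c'(1), symmetric])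
  show "fst c \<notin> {fst a, fst b}" "fst e \<notin> {fst a, fst b}" using c'(2,3) unfolding near_def by blast+
  then show "{a, b} \<noteq> {c, e}" by (auto simp: doubleton_eq_iff)
  show "fst ` g \<noteq> {fst a, fst c}" "fst ` g \<noteq> {fst b, fst e}" if "g \<in> \<pi>" for g
    using near_adjacent[OF pi that, of "fst a" "fst c" "fst b"] near_adjacent[OF pi that, of "fst a" "fst e" "fst b"] c'(2,3) by blast+
  show "fst ` {c, e} \<notin> F" by (rule c'(4))
qed

definition simple_with :: "nat set set \<Rightarrow> (nat \<times> nat) set set set" where
  "simple_with F = {\<pi> \<in> pairings H. simple_pairing \<pi> \<and> F \<subseteq> (\<lambda>b. fst ` b) ` \<pi>}"

lemma finite_simple_with: "finite (simple_with F)"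
  using finite_pairings[OF finite_H] by (simp add: simple_with_def)

text \<open>The edge \<open>{x, y}\<close> of a simple pairing is switched away with any of at
  least \<open>n / 2\<close> half-edges \<open>c\<close>. The result is a simple pairing that
  still contains \<open>F\<close>, and the original pairing can be recovered from it and the two
  half-edges at \<open>x\<close> and \<open>y\<close> that formed the edge, for which there are
  at most \<open>\<Delta>\<^sup>2\<close> possibilities.\<close>

lemma switching_count:
  assumes D: "1 \<le> \<Delta>" and F: "finite F" and e: "{x, y} \<notin> F" and n: "32 * \<Delta> * \<Delta> \<le> n" "8 * card F \<le> n"
  shows "n * card (simple_with (insert {x, y} F)) \<le> 2 * \<Delta> * \<Delta> * card (simple_with F)"
proof -
  let ?X = "simple_with (insert {x, y} F)" and ?Y = "simple_with F"
  define ends where "ends \<pi> = (SOME ab. {fst ab, snd ab} \<in> \<pi> \<and> fst ab \<noteq> snd ab \<and> fst (fst ab) = x \<and> fst (snd ab) = y)" for \<pi> :: "(nat \<times> nat) set set"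
  have ends: "{fst (ends \<pi>), snd (ends \<pi>)} \<in> \<pi>" "fst (ends \<pi>) \<noteq> snd (ends \<pi>)" "fst (fst (ends \<pi>)) = x" "fst (snd (ends \<pi>)) = y"
    if pi: "\<pi> \<in> ?X" for \<pi>
  proof -
    obtain b where b: "b \<in> \<pi>" "fst ` b = {x, y}" using pi by (auto simp: simple_with_def)
    then have "card b = 2" using pi by (auto simp: simple_with_def pairings_def)
    then obtain g g' where g: "b = {g, g'}" "g \<noteq> g'" by (meson card_2_iff)
    have "fst g = x \<and> fst g' = y \<or> fst g' = x \<and> fst g = y" using b(2) unfolding g by (auto simp: doubleton_eq_iff)
    then have "\<exists>ab. {fst ab, snd ab} \<in> \<pi> \<and> fst ab \<noteq> snd ab \<and> fst (fst ab) = x \<and> fst (snd ab) = y"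
    proof
      assume "fst g = x \<and> fst g' = y"
      then show ?thesis using b g by (intro exI[of _ "(g, g')"]) auto
    next
      assume "fst g' = x \<and> fst g = y"
      then show ?thesis using b g by (intro exI[of _ "(g', g)"]) (auto simp: insert_commute)
    qed
    from someI_ex[OF this] show "{fst (ends \<pi>), snd (ends \<pi>)} \<in> \<pi>" "fst (ends \<pi>) \<noteq> snd (ends \<pi>)" "fst (fst (ends \<pi>)) = x" "fst (snd (ends \<pi>)) = y"
      unfolding ends_def by blast+
  qed
  define ch where "ch \<pi> = far \<pi> F (fst (fst (ends \<pi>))) (fst (snd (ends \<pi>)))" for \<pi>
  define sw where "sw \<pi> c = switch \<pi> (fst (ends \<pi>)) (snd (ends \<pi>)) c (partner \<pi> c)" for \<pi> c
  have X: "\<pi> \<in> pairings H" "simple_pairing \<pi>" if "\<pi> \<in> ?X" for \<pi> using that by (auto simp: simple_with_def)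
  have sw: "sw \<pi> c \<in> ?Y" if pi: "\<pi> \<in> ?X" and c: "c \<in> ch \<pi>" for \<pi> c
  proof -
    let ?a = "fst (ends \<pi>)" and ?b = "snd (ends \<pi>)" and ?d = "partner \<pi> c"
    note f = far_switch[OF X(1)[OF pi] ends(1,2)[OF pi] c[unfolded ch_def]]
    note s = switch_pairing[OF X(1)[OF pi] ends(1)[OF pi] f(1) ends(2)[OF pi] f(2,3)]
    have simp: "\<forall>b\<in>\<pi>. card (fst ` b) = 2" "inj_on (\<lambda>b. fst ` b) \<pi>" using X(2)[OF pi] by (auto simp: simple_pairing_def)
    have ab: "fst ?a \<noteq> fst ?b" using simp(1) ends(1)[OF pi] by fastforce
    have "inj_on (\<lambda>b. fst ` b) (switch \<pi> ?a ?b c ?d)"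
    proof (rule inj_onI)
      fix g h assume g: "g \<in> switch \<pi> ?a ?b c ?d" and h: "h \<in> switch \<pi> ?a ?b c ?d" and eq: "fst ` g = fst ` h"
      have 1: "fst ` {?a, c} \<noteq> fst ` {?b, ?d}" using ab f(4,5) by (auto simp: doubleton_eq_iff)
      have 2: "fst ` k \<noteq> fst ` {?a, c}" "fst ` k \<noteq> fst ` {?b, ?d}" if "k \<in> \<pi>" for k using f(6,7)[OF that] by auto
      from g h consider "g \<in> \<pi>" "h \<in> \<pi>" | "g = h" | "g \<in> {{?a, c}, {?b, ?d}}" "h \<in> \<pi>" | "h \<in> {{?a, c}, {?b, ?d}}" "g \<in> \<pi>"
        | "g = {?a, c}" "h = {?b, ?d}" | "h = {?a, c}" "g = {?b, ?d}"
      proof -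
        have "g \<in> \<pi> \<or> g = {?a, c} \<or> g = {?b, ?d}" "h \<in> \<pi> \<or> h = {?a, c} \<or> h = {?b, ?d}"
          using g h unfolding switch_def by blast+
        with that show ?thesis by (elim disjE) simp_all
      qed
      then show "g = h"
      proof cases
        case 1 then show ?thesis using inj_onD[OF simp(2) eq] by blast
      next
        case 3 then show ?thesis using 2(1,2)[of h] eq by (elim insertE) simp_all
      next
        case 4 then show ?thesis using 2(1,2)[of g] eq by (elim insertE) simp_all
      next
        case 5 then show ?thesis using 1 eq by simp
      next
        case 6 then show ?thesis using 1 eq by simp
      qed
    qed
    moreover have "card (fst ` g) = 2" if "g \<in> switch \<pi> ?a ?b c ?d" for g
      using that simp(1) f(4,5) unfolding switch_def by (auto simp: card_insert_if)
    moreover have "F \<subseteq> (\<lambda>b. fst ` b) ` switch \<pi> ?a ?b c ?d"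
    proof
      fix k assume k: "k \<in> F"
      then obtain g where g: "g \<in> \<pi>" "fst ` g = k" using pi by (auto simp: simple_with_def)
      have "g \<noteq> {?a, ?b}" using g k e ends(3,4)[OF pi] by auto
      moreover have "g \<noteq> {c, ?d}" using g k f(8) by auto
      ultimately have "g \<in> switch \<pi> ?a ?b c ?d" using g by (auto simp: switch_def)
      then show "k \<in> (\<lambda>b. fst ` b) ` switch \<pi> ?a ?b c ?d" using g by blast
    qed
    ultimately show ?thesis using s(1) unfolding sw_def simple_with_def simple_pairing_def by auto
  qed
  have big: "n \<le> 2 * card (ch \<pi>)" if pi: "\<pi> \<in> ?X" for \<pi>
  proof -
    have "n \<le> card (ch \<pi>) + 8 * \<Delta> * \<Delta> + 2 * card F"
      unfolding ch_def by (rule card_far[OF X(1)[OF pi] D F]) (use X(2)[OF pi] in \<open>simp add: simple_pairing_def\<close>)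
    then show ?thesis using n by linarith
  qed
  have finch: "finite (ch \<pi>)" for \<pi> unfolding ch_def far_def using finite_H by simp
  define \<Phi> where "\<Phi> = (\<lambda>(\<pi>, c). (sw \<pi> c, ends \<pi>))"
  have inj: "inj_on \<Phi> (SIGMA \<pi>:?X. ch \<pi>)"
  proof (rule inj_onI, clarify)
    fix \<pi> c \<pi>' c' assume 1: "\<pi> \<in> ?X" "c \<in> ch \<pi>" and 2: "\<pi>' \<in> ?X" "c' \<in> ch \<pi>'" and eq: "\<Phi> (\<pi>, c) = \<Phi> (\<pi>', c')"
    then have sweq: "sw \<pi> c = sw \<pi>' c'" and eeq: "ends \<pi> = ends \<pi>'" by (auto simp: \<Phi>_def)
    have rec: "c = partner (sw \<pi> c) (fst (ends \<pi>)) \<and> partner \<pi> c = partner (sw \<pi> c) (snd (ends \<pi>)) \<and>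
       \<pi> = (sw \<pi> c - {{fst (ends \<pi>), c}, {snd (ends \<pi>), partner \<pi> c}}) \<union> {{fst (ends \<pi>), snd (ends \<pi>)}, {c, partner \<pi> c}}"
      if pi: "\<pi> \<in> ?X" and c: "c \<in> ch \<pi>" for \<pi> c
    proof -
      let ?a = "fst (ends \<pi>)" and ?b = "snd (ends \<pi>)" and ?d = "partner \<pi> c"
      note f = far_switch[OF X(1)[OF pi] ends(1,2)[OF pi] c[unfolded ch_def]]
      note s = switch_pairing[OF X(1)[OF pi] ends(1)[OF pi] f(1) ends(2)[OF pi] f(2,3)]
      have abH: "?a \<in> H" "?b \<in> H" using ends(1)[OF pi] X(1)[OF pi] by (auto simp: pairings_def)
      have "partner (sw \<pi> c) ?a = c" unfolding sw_def
        by (rule partner_props(4)[OF s(1) abH(1)]) (use s(5) in \<open>auto simp: switch_def\<close>)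
      moreover have "partner (sw \<pi> c) ?b = ?d" unfolding sw_def
        by (rule partner_props(4)[OF s(1) abH(2)]) (use s(6) in \<open>auto simp: switch_def\<close>)
      moreover have "\<pi> = (sw \<pi> c - {{?a, c}, {?b, ?d}}) \<union> {{?a, ?b}, {c, ?d}}"
        unfolding sw_def by (rule switch_back[OF X(1)[OF pi] ends(1)[OF pi] f(1) ends(2)[OF pi] f(2,3)])
      ultimately show ?thesis by simp
    qed
    have "c = c'" using rec[OF 1] rec[OF 2] sweq eeq by metis
    moreover have "\<pi> = \<pi>'" using rec[OF 1] rec[OF 2] sweq eeq by metis
    ultimately show "\<pi> = \<pi>' \<and> c = c'" by simp
  qed
  have "\<Phi> ` (SIGMA \<pi>:?X. ch \<pi>) \<subseteq> ?Y \<times> ({h \<in> H. fst h = x} \<times> {h \<in> H. fst h = y})"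
  proof
    fix z assume "z \<in> \<Phi> ` (SIGMA \<pi>:?X. ch \<pi>)"
    then obtain \<pi> c where pi: "\<pi> \<in> ?X" "c \<in> ch \<pi>" and eq: "z = (sw \<pi> c, ends \<pi>)" by (auto simp: \<Phi>_def)
    have "fst (ends \<pi>) \<in> H" "snd (ends \<pi>) \<in> H" using ends(1)[OF pi(1)] X(1)[OF pi(1)] unfolding pairings_def by blast+
    then show "z \<in> ?Y \<times> ({h \<in> H. fst h = x} \<times> {h \<in> H. fst h = y})"
      unfolding eq using sw[OF pi] ends(3,4)[OF pi(1)] by (simp add: mem_Times_iff)
  qed
  then have "card (SIGMA \<pi>:?X. ch \<pi>) \<le> card (?Y \<times> ({h \<in> H. fst h = x} \<times> {h \<in> H. fst h = y}))"
    by (rule card_inj_on_le[OF inj]) (intro finite_cartesian_product finite_simple_with; simp add: finite_H)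
  also have "\<dots> = card ?Y * (card {h \<in> H. fst h = x} * card {h \<in> H. fst h = y})" by (simp add: card_cartesian_product)
  also have "\<dots> \<le> card ?Y * (\<Delta> * \<Delta>)" by (intro mult_left_mono mult_mono card_at) auto
  also have "card (SIGMA \<pi>:?X. ch \<pi>) = (\<Sum>\<pi>\<in>?X. card (ch \<pi>))"
    using finite_simple_with finch by (intro card_SigmaI) auto
  finally have "2 * (\<Sum>\<pi>\<in>?X. card (ch \<pi>)) \<le> 2 * (card ?Y * (\<Delta> * \<Delta>))" by simp
  moreover have "(\<Sum>\<pi>\<in>?X. n) \<le> (\<Sum>\<pi>\<in>?X. 2 * card (ch \<pi>))" by (rule sum_mono) (rule big)
  ultimately show ?thesis by (simp add: sum_distrib_left mult_ac)
qed

lemma simple_with_ratio: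
  assumes D: "1 \<le> \<Delta>" and F: "finite F" and F2: "\<And>e. e \<in> F \<Longrightarrow> card e = 2" and n: "32 * \<Delta> * \<Delta> \<le> n" "8 * card F \<le> n" "0 < n"
  shows "real (card (simple_with F)) \<le> (2 * real \<Delta> ^ 2 / n) ^ card F * card (simple_with {})"
  using F F2 n(2)
proof (induction F rule: finite_induct)
  case (insert e F)
  obtain x y where e: "e = {x, y}" using insert.prems(1)[of e] by (auto simp: card_2_iff)
  have "n * card (simple_with (insert {x, y} F)) \<le> 2 * \<Delta> * \<Delta> * card (simple_with F)"
    by (rule switching_count[OF D insert.hyps(1) _ n(1)]) (use insert e in auto)
  then have "real (n * card (simple_with (insert e F))) \<le> real (2 * \<Delta> * \<Delta> * card (simple_with F))"
    unfolding e of_nat_le_iff .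
  then have "real (card (simple_with (insert e F))) \<le> 2 * real \<Delta> ^ 2 / n * card (simple_with F)"
    using n(3) by (simp add: field_simps power2_eq_square)
  also have "\<dots> \<le> 2 * real \<Delta> ^ 2 / n * ((2 * real \<Delta> ^ 2 / n) ^ card F * card (simple_with {}))"
    using insert by (intro mult_left_mono insert.IH) auto
  finally show ?case using insert.hyps by (simp add: mult_ac)
qed simp

text \<open>Take a pairing with the least number of bad pairs (self-loops and repeated edges),
  counting self-loops twice, and suppose that there is a bad one. Switching it with a far pair
  creates no bad pair and removes one, unless the two new pairs are parallel. In this case both
  switched pairs were self-loops, and although two bad pairs remain, the number of self-loops
  has dropped.\<close>

lemma simple_exists:
  assumes D: "1 \<le> \<Delta>" and ev: "even (card H)" and n: "8 * \<Delta> * \<Delta> < n"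
  shows "simple_with {} \<noteq> {}"
proof -
  define bad where "bad \<pi> = {g \<in> \<pi>. card (fst ` g) \<noteq> 2 \<or> (\<exists>g'\<in>\<pi>. g' \<noteq> g \<and> fst ` g' = fst ` g)}" for \<pi> :: "(nat \<times> nat) set set"
  define loop where "loop \<pi> = {g \<in> \<pi>. card (fst ` g) \<noteq> 2}" for \<pi> :: "(nat \<times> nat) set set"
  obtain \<pi>0 where "\<pi>0 \<in> pairings H" using pairings_nonempty[OF finite_H ev] by blast
  then obtain \<pi> where pi: "\<pi> \<in> pairings H"
    and least: "\<And>\<pi>'. \<pi>' \<in> pairings H \<Longrightarrow> card (bad \<pi>) + card (loop \<pi>) \<le> card (bad \<pi>') + card (loop \<pi>')"
    using ex_has_least_nat[of "\<lambda>\<pi>. \<pi> \<in> pairings H" \<pi>0 "\<lambda>\<pi>. card (bad \<pi>) + card (loop \<pi>)"] by blast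
  have "bad \<pi> = {}"
  proof (rule ccontr)
    assume "bad \<pi> \<noteq> {}"
    then obtain g0 where g0: "g0 \<in> bad \<pi>" by blast
    then have "card g0 = 2" using pi unfolding bad_def pairings_def by blast
    then obtain a b where ab: "g0 = {a, b}" "a \<noteq> b" by (meson card_2_iff)
    have abp: "{a, b} \<in> \<pi>" using g0 ab by (simp add: bad_def)
    have "far \<pi> {} (fst a) (fst b) \<noteq> {}"
      using card_far[OF pi D, of "{}" "fst a" "fst b"] n by auto
    then obtain c where c: "c \<in> far \<pi> {} (fst a) (fst b)" by blast
    define e where "e = partner \<pi> c"
    note f = far_switch[OF pi abp ab(2) c, folded e_def]
    note s = switch_pairing[OF pi abp f(1) ab(2) f(2,3)]
    let ?\<pi>' = "switch \<pi> a b c e"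
    have mem: "g \<in> ?\<pi>' \<Longrightarrow> (g \<in> \<pi> \<and> g \<noteq> {a, b} \<and> g \<noteq> {c, e}) \<or> g = {a, c} \<or> g = {b, e}" for g
      unfolding switch_def by blast
    have new2: "card (fst ` {a, c}) = 2" "card (fst ` {b, e}) = 2" using f(4,5) by (simp_all add: card_insert_if)
    have newne: "fst ` g \<noteq> fst ` {a, c}" "fst ` g \<noteq> fst ` {b, e}" if "g \<in> \<pi>" for g
      using f(6,7)[OF that] by simp_all
    have fin: "finite (bad \<pi>)" "finite (loop \<pi>)" using finite_pairing[OF finite_H pi] by (simp_all add: bad_def loop_def)
    have loop': "loop ?\<pi>' \<subseteq> loop \<pi> - {{a, b}, {c, e}}"
    proof
      fix g assume "g \<in> loop ?\<pi>'"
      then have gm: "g \<in> ?\<pi>'" and g2: "card (fst ` g) \<noteq> 2" by (simp_all add: loop_def)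
      have "g \<noteq> {a, c}" using new2(1) g2 by (rule_tac notI) (simp only:)
      moreover have "g \<noteq> {b, e}" using new2(2) g2 by (rule_tac notI) (simp only:)
      ultimately have "g \<in> \<pi> \<and> g \<noteq> {a, b} \<and> g \<noteq> {c, e}" using mem[OF gm] by blast
      then show "g \<in> loop \<pi> - {{a, b}, {c, e}}" using g2 by (simp add: loop_def)
    qed
    have badR: "g \<in> bad \<pi> - {{a, b}, {c, e}}" if g: "g \<in> bad ?\<pi>'" "g \<in> \<pi>" for g
    proof -
      have gm: "g \<in> ?\<pi>'" using g by (simp add: bad_def)
      have "g \<noteq> {a, c}" "g \<noteq> {b, e}" using newne[OF g(2)] by blast+
      then have ne: "g \<noteq> {a, b}" "g \<noteq> {c, e}" using mem[OF gm] by blast+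
      have "g \<in> bad \<pi>"
      proof (cases "card (fst ` g) = 2")
        case True
        then obtain g' where g': "g' \<in> ?\<pi>'" "g' \<noteq> g" "fst ` g' = fst ` g" using g(1) by (auto simp: bad_def)
        then have "g' \<in> \<pi>" using mem[OF g'(1)] newne[OF g(2)] by metis
        then show ?thesis using g(2) g' by (auto simp: bad_def)
      qed (use g(2) in \<open>simp add: bad_def\<close>)
      then show ?thesis using ne by simp
    qed
    show False
    proof (cases "fst ` {a, c} = fst ` {b, e}")
      case False
      have "bad ?\<pi>' \<subseteq> bad \<pi> - {{a, b}}"
      proof
        fix g assume g: "g \<in> bad ?\<pi>'"
        have gm: "g \<in> ?\<pi>'" using g by (simp add: bad_def)
        have "g \<noteq> {a, c} \<and> g \<noteq> {b, e}"
        proof (rule ccontr)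
          assume "\<not> (g \<noteq> {a, c} \<and> g \<noteq> {b, e})"
          then have gn: "g = {a, c} \<or> g = {b, e}" by blast
          then have "card (fst ` g) = 2" using new2 by blast
          then obtain g' where g': "g' \<in> ?\<pi>'" "g' \<noteq> g" "fst ` g' = fst ` g" using g by (auto simp: bad_def)
          then show False using mem[OF g'(1)] newne[of g'] gn False by metis
        qed
        then have "g \<in> \<pi>" using mem[OF gm] by blast
        then show "g \<in> bad \<pi> - {{a, b}}" using badR[OF g] by blast
      qed
      then have "card (bad ?\<pi>') \<le> card (bad \<pi> - {{a, b}})" using fin by (intro card_mono) auto
      also have "\<dots> < card (bad \<pi>)" using fin g0 ab by (intro psubset_card_mono) auto
      finally have 1: "card (bad ?\<pi>') < card (bad \<pi>)" .
      have "card (loop ?\<pi>') \<le> card (loop \<pi>)" using fin loop' by (intro card_mono) auto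
      then show False using least[OF s(1)] 1 by linarith
    next
      case True
      then have "fst a = fst b" "fst c = fst e" using f(4,5) by (auto simp: doubleton_eq_iff)
      then have l: "{a, b} \<in> loop \<pi>" "{c, e} \<in> loop \<pi>" using abp f(1) by (simp_all add: loop_def)
      then have bd: "{a, b} \<in> bad \<pi>" "{c, e} \<in> bad \<pi>" by (simp_all add: loop_def bad_def)
      have two: "card {{a, b}, {c, e}} = 2" using f(3) by simp
      have c2: "card (S - {{a, b}, {c, e}}) + 2 = card S" if "finite S" "{a, b} \<in> S" "{c, e} \<in> S" for S
      proof -
        have "card {{a, b}, {c, e}} \<le> card S" using that by (intro card_mono) auto
        then show ?thesis using that two by (subst card_Diff_subset) auto
      qed
      have lp: "card (loop ?\<pi>') \<le> card (loop \<pi> - {{a, b}, {c, e}})" using fin loop' by (intro card_mono) auto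
      have "bad ?\<pi>' \<subseteq> (bad \<pi> - {{a, b}, {c, e}}) \<union> {{a, c}, {b, e}}"
      proof
        fix g assume g: "g \<in> bad ?\<pi>'"
        have gm: "g \<in> ?\<pi>'" using g by (simp add: bad_def)
        show "g \<in> (bad \<pi> - {{a, b}, {c, e}}) \<union> {{a, c}, {b, e}}"
        proof (cases "g \<in> \<pi>")
          case True then show ?thesis using badR[OF g] by blast
        next
          case False then show ?thesis using mem[OF gm] by blast
        qed
      qed
      then have "card (bad ?\<pi>') \<le> card ((bad \<pi> - {{a, b}, {c, e}}) \<union> {{a, c}, {b, e}})" using fin by (intro card_mono) auto
      also have "\<dots> \<le> card (bad \<pi> - {{a, b}, {c, e}}) + 2"
        using card_Un_le[of "bad \<pi> - {{a, b}, {c, e}}" "{{a, c}, {b, e}}"] s(2) by simp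
      finally have "card (bad ?\<pi>') \<le> card (bad \<pi> - {{a, b}, {c, e}}) + 2" .
      then show False using lp c2[OF fin(1) bd] c2[OF fin(2) l] least[OF s(1)] by linarith
    qed
  qed
  then have "simple_pairing \<pi>" unfolding simple_pairing_def bad_def inj_on_def by blast
  then show ?thesis using pi by (auto simp: simple_with_def)
qed

end

section \<open>Simple graphs from the configuration model\<close>

abbreviation proj :: "(nat \<times> nat) set set \<Rightarrow> nat set set" where "proj \<pi> \<equiv> (\<lambda>b. fst ` b) ` \<pi>"

context degree_sequence
begin

lemma simple_props:
  assumes "\<pi> \<in> simple_with F"
  shows "\<pi> \<in> pairings H" "\<And>b. b \<in> \<pi> \<Longrightarrow> card (fst ` b) = 2" "inj_on (\<lambda>b. fst ` b) \<pi>" "F \<subseteq> proj \<pi>"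
    "\<And>b. b \<in> \<pi> \<Longrightarrow> card b = 2" "\<And>b. b \<in> \<pi> \<Longrightarrow> b \<subseteq> H"
  using assms unfolding simple_with_def simple_pairing_def pairings_def by blast+

lemma proj_edges: assumes "\<pi> \<in> simple_with F" shows "proj \<pi> \<subseteq> all_edges n" "2 * card (proj \<pi>) = card H"
proof -
  note p = simple_props[OF assms]
  have "fst ` H \<subseteq> {1..n}" by (auto simp: half_edges_def)
  then show "proj \<pi> \<subseteq> all_edges n" unfolding all_edges_def using p(2,6) by blast
  have "card (\<Union>\<pi>) = (\<Sum>b\<in>\<pi>. card b)"
    using p(1,5,6) finite_subset[OF _ finite_H] unfolding pairings_def disjoint_def
    by (intro card_Union_disjoint) (auto simp: pairwise_def disjnt_def)
  also have "\<dots> = 2 * card \<pi>" using p(5) by simp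
  finally show "2 * card (proj \<pi>) = card H" using p(1) card_image[OF p(3)] by (simp add: pairings_def)
qed

definition degree_graphs :: "nat set set set" where
  "degree_graphs = {E. E \<subseteq> all_edges n \<and> (\<forall>v\<in>{1..n}. card {e \<in> E. v \<in> e} = d v)}"

text \<open>The map that sends a half-edge at \<open>v\<close> to the edge of its pair is a
  bijection onto the edges at \<open>v\<close>, because the pairing is simple.\<close>

lemma proj_degree: assumes pi: "\<pi> \<in> simple_with F" shows "proj \<pi> \<in> degree_graphs"
proof -
  note p = simple_props[OF pi]
  have "card {e \<in> proj \<pi>. v \<in> e} = d v" if v: "v \<in> {1..n}" for v
  proof -
    let ?h = "\<lambda>i. fst ` {(v, i), partner \<pi> (v, i)}"
    have vH: "(v, i) \<in> H" if "i < d v" for i using v that by (simp add: half_edges_def)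
    have blk: "{(v, i), partner \<pi> (v, i)} \<in> \<pi>" if "i < d v" for i by (rule partner_props(2)[OF p(1) vH[OF that]])
    have "bij_betw ?h {..<d v} {e \<in> proj \<pi>. v \<in> e}"
      unfolding bij_betw_def
    proof
      show "inj_on ?h {..<d v}"
      proof (rule inj_onI)
        fix i j assume ij: "i \<in> {..<d v}" "j \<in> {..<d v}" "?h i = ?h j"
        then have eq: "{(v, i), partner \<pi> (v, i)} = {(v, j), partner \<pi> (v, j)}"
          using inj_onD[OF p(3) _ blk blk, of i j] by simp
        show "i = j"
        proof (rule ccontr)
          assume "i \<noteq> j"
          then have "{(v, i), partner \<pi> (v, i)} = {(v, i), (v, j)}" using eq by (auto simp: doubleton_eq_iff)
          then have "card (fst ` {(v, i), (v, j)}) = 2" using p(2)[OF blk, of i] ij(1) by simp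
          then show False by simp
        qed
      qed
      show "?h ` {..<d v} = {e \<in> proj \<pi>. v \<in> e}"
      proof (intro equalityI subsetI)
        fix e assume "e \<in> ?h ` {..<d v}"
        then obtain i where i: "i < d v" and e: "e = ?h i" by blast
        have "e \<in> proj \<pi>" unfolding e by (rule imageI[OF blk[OF i]])
        then show "e \<in> {e \<in> proj \<pi>. v \<in> e}" unfolding e by simp
      next
        fix e assume "e \<in> {e \<in> proj \<pi>. v \<in> e}"
        then obtain b h where b: "b \<in> \<pi>" "e = fst ` b" "h \<in> b" "fst h = v" by auto
        then obtain i where h: "h = (v, i)" by (cases h) auto
        have "h \<in> H" using p(6)[OF b(1)] b(3) by blast
        then have i: "i < d v" unfolding h by (simp add: half_edges_def)
        have "{(v, i), partner \<pi> (v, i)} = b" by (rule pairing_inter[OF p(1) blk[OF i] b(1), of h]) (use h b in auto)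
        then show "e \<in> ?h ` {..<d v}" using b(2) i by blast
      qed
    qed
    then show ?thesis using bij_betw_same_card by fastforce
  qed
  then show ?thesis using proj_edges(1)[OF pi] by (simp add: degree_graphs_def)
qed

text \<open>Fix a numbering \<open>f0 x\<close> of the edges at each vertex \<open>x\<close>. A
  simple pairing over \<open>G\<close> amounts to a choice of the half-edge at \<open>x\<close>
  used by each edge at \<open>x\<close>, that is, to a permutation of the numbers below \<open>d
  x\<close> for every \<open>x\<close>.\<close>

lemma card_fibre:
  assumes G: "G \<in> degree_graphs"
  shows "card {\<pi> \<in> simple_with {}. proj \<pi> = G} = (\<Prod>x\<in>{1..n}. fact (d x))"
proof -
  let ?V = "{1..n}"
  have GE: "e \<subseteq> ?V" "card e = 2" if "e \<in> G" for e using G that by (auto simp: degree_graphs_def all_edges_def)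
  have finG: "finite G" using G finite_subset[of G "Pow ?V"] by (auto simp: degree_graphs_def all_edges_def)
  define inc where "inc x = {e \<in> G. x \<in> e}" for x
  have "\<exists>h. bij_betw h (inc x) {..<d x}" if "x \<in> ?V" for x
    using G that finG by (intro finite_same_card_bij) (auto simp: inc_def degree_graphs_def)
  then obtain f0 where f0: "\<And>x. x \<in> ?V \<Longrightarrow> bij_betw (f0 x) (inc x) {..<d x}" by metis
  have f0_lt: "f0 x e < d x" if "e \<in> G" "x \<in> e" for x e
    using bij_betwE[OF f0, of x] GE(1)[OF that(1)] that by (auto simp: inc_def)
  have f0_inj: "e = e'" if m: "e \<in> G" "e' \<in> G" "x \<in> e" "x \<in> e'" and eq: "f0 x e = f0 x e'" for x e e'
  proof -
    have "x \<in> ?V" using GE(1)[OF m(1)] m(3) by (rule subsetD)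
    from inj_onD[OF bij_betw_imp_inj_on[OF f0[OF this]] eq] show ?thesis using m by (simp add: inc_def)
  qed
  have f0_sur: "\<exists>e\<in>G. x \<in> e \<and> f0 x e = i" if "x \<in> ?V" "i < d x" for x i
  proof -
    have "i \<in> f0 x ` inc x" using bij_betw_imp_surj_on[OF f0[OF that(1)]] that(2) by simp
    then show ?thesis by (auto simp: inc_def)
  qed
  define \<Sigma> where "\<Sigma> = Pi\<^sub>E ?V (\<lambda>x. {p. p permutes {..<d x}})"
  define lab where "lab \<sigma> e x = (x, \<sigma> x (f0 x e) :: nat)" for \<sigma> :: "nat \<Rightarrow> nat \<Rightarrow> nat" and e :: "nat set" and x
  define \<Psi> where "\<Psi> \<sigma> = (\<lambda>e. lab \<sigma> e ` e) ` G" for \<sigma>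
  have fst_lab: "fst ` lab \<sigma> e ` e = e" for \<sigma> e unfolding lab_def by force
  have perm: "\<sigma> x permutes {..<d x}" if "\<sigma> \<in> \<Sigma>" "x \<in> ?V" for \<sigma> x using that by (auto simp: \<Sigma>_def)
  have into: "\<Psi> \<sigma> \<in> {\<pi> \<in> simple_with {}. proj \<pi> = G}" if s: "\<sigma> \<in> \<Sigma>" for \<sigma>
  proof -
    have lt: "\<sigma> x (f0 x e) < d x" if "e \<in> G" "x \<in> e" for x e
      using permutes_in_image[OF perm[OF s, of x], of "f0 x e"] f0_lt[OF that] GE(1)[OF that(1)] that by auto
    have U: "\<Union>(\<Psi> \<sigma>) = H"
    proof (intro equalityI subsetI)
      fix h assume "h \<in> \<Union>(\<Psi> \<sigma>)"
      then obtain e x where "e \<in> G" "x \<in> e" "h = (x, \<sigma> x (f0 x e))" by (auto simp: \<Psi>_def lab_def)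
      then show "h \<in> H" using lt GE(1)[THEN subsetD] by (simp add: half_edges_def)
    next
      fix h assume "h \<in> H"
      then obtain x i where h: "h = (x, i)" "x \<in> ?V" "i < d x" by (auto simp: half_edges_def)
      have "i \<in> \<sigma> x ` {..<d x}" using permutes_image[OF perm[OF s h(2)]] h(3) by simp
      then obtain j where j: "j < d x" "\<sigma> x j = i" by auto
      then obtain e where "e \<in> G" "x \<in> e" "f0 x e = j" using f0_sur[OF h(2)] by blast
      then show "h \<in> \<Union>(\<Psi> \<sigma>)" using h j by (auto simp: \<Psi>_def lab_def)
    qed
    have same: "e = e'" if m: "e \<in> G" "e' \<in> G" and h: "h \<in> lab \<sigma> e ` e" "h \<in> lab \<sigma> e' ` e'" for e e' h
    proof -
      obtain x where x: "x \<in> e" "x \<in> e'" "\<sigma> x (f0 x e) = \<sigma> x (f0 x e')" using h by (auto simp: lab_def)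
      have "x \<in> ?V" using GE(1)[OF m(1)] x by blast
      then have "f0 x e = f0 x e'" using injD[OF permutes_inj[OF perm[OF s]] x(3)] by simp
      then show ?thesis by (rule f0_inj[OF m x(1,2)])
    qed
    have "disjoint (\<Psi> \<sigma>)"
    proof (rule disjointI)
      fix b b' assume b: "b \<in> \<Psi> \<sigma>" "b' \<in> \<Psi> \<sigma>" "b \<noteq> b'"
      then obtain e e' where e: "e \<in> G" "e' \<in> G" "b = lab \<sigma> e ` e" "b' = lab \<sigma> e' ` e'" unfolding \<Psi>_def by blast
      show "b \<inter> b' = {}"
      proof (rule ccontr)
        assume "b \<inter> b' \<noteq> {}"
        then obtain h where "h \<in> b" "h \<in> b'" by blast
        then have "e = e'" using same[OF e(1,2), of h] e(3,4) by simp
        then show False using b(3) e(3,4) by simp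
      qed
    qed
    moreover
    have "card (lab \<sigma> e ` e) = 2" if "e \<in> G" for e
      using GE(2)[OF that] by (subst card_image) (auto simp: inj_on_def lab_def)
    then have "\<forall>b\<in>\<Psi> \<sigma>. card b = 2" unfolding \<Psi>_def by blast
    ultimately have "\<Psi> \<sigma> \<in> pairings H" using U by (simp add: pairings_def)
    moreover have "simple_pairing (\<Psi> \<sigma>)" unfolding simple_pairing_def inj_on_def \<Psi>_def by (simp add: fst_lab GE(2))
    moreover have "proj (\<Psi> \<sigma>) = (\<lambda>e. fst ` lab \<sigma> e ` e) ` G" unfolding \<Psi>_def by (rule image_image)
    then have "proj (\<Psi> \<sigma>) = G" unfolding fst_lab by simp
    ultimately show ?thesis by (simp add: simple_with_def)
  qed
  have inj: "inj_on \<Psi> \<Sigma>"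
  proof (rule inj_onI)
    fix \<sigma> \<tau> assume s: "\<sigma> \<in> \<Sigma>" "\<tau> \<in> \<Sigma>" and eq: "\<Psi> \<sigma> = \<Psi> \<tau>"
    show "\<sigma> = \<tau>"
    proof (rule PiE_ext[OF s[unfolded \<Sigma>_def]])
      fix x assume x: "x \<in> ?V"
      show "\<sigma> x = \<tau> x"
      proof
        fix i
        show "\<sigma> x i = \<tau> x i"
        proof (cases "i < d x")
          case True
          then obtain e where e: "e \<in> G" "x \<in> e" "f0 x e = i" using f0_sur[OF x] by blast
          have "lab \<sigma> e ` e \<in> \<Psi> \<tau>" unfolding eq[symmetric] using e by (auto simp: \<Psi>_def)
          then obtain e' where e': "e' \<in> G" "lab \<sigma> e ` e = lab \<tau> e' ` e'" by (auto simp: \<Psi>_def)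
          then have "e = e'" using fst_lab by metis
          then have "lab \<sigma> e x \<in> lab \<tau> e ` e" using e' e(2) by blast
          then show ?thesis using e by (auto simp: lab_def)
        next
          case False
          then show ?thesis using permutes_not_in[OF perm[OF s(1) x], of i] permutes_not_in[OF perm[OF s(2) x], of i] by simp
        qed
      qed
    qed
  qed
  have onto: "\<exists>\<sigma>\<in>\<Sigma>. \<Psi> \<sigma> = \<pi>" if pi: "\<pi> \<in> simple_with {}" "proj \<pi> = G" for \<pi>
  proof -
    note p = simple_props[OF pi(1)]
    define bl where "bl e = (THE b. b \<in> \<pi> \<and> fst ` b = e)" for e
    have bl_eq: "bl (fst ` b) = b" if "b \<in> \<pi>" for b
      unfolding bl_def by (rule the_equality) (use that inj_onD[OF p(3)] in auto)
    have bl: "bl e \<in> \<pi>" "fst ` bl e = e" if e: "e \<in> G" for e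
    proof -
      obtain b where "b \<in> \<pi>" "e = fst ` b" using e pi(2) by blast
      then show "bl e \<in> \<pi>" "fst ` bl e = e" using bl_eq by auto
    qed
    define hf where "hf e x = (SOME j. (x, j) \<in> bl e)" for e x
    have hf: "(x, hf e x) \<in> bl e" if "e \<in> G" "x \<in> e" for e x
    proof -
      have "x \<in> fst ` bl e" using bl(2)[OF that(1)] that(2) by simp
      then have "\<exists>j. (x, j) \<in> bl e" by force
      from someI_ex[OF this] show ?thesis unfolding hf_def .
    qed
    define ed where "ed x i = (SOME e. e \<in> G \<and> x \<in> e \<and> f0 x e = i)" for x i
    have ed: "ed x i \<in> G" "x \<in> ed x i" "f0 x (ed x i) = i" if "x \<in> ?V" "i < d x" for x i
    proof -
      have "\<exists>e. e \<in> G \<and> x \<in> e \<and> f0 x e = i" using f0_sur[OF that] by blast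
      from someI_ex[OF this] show "ed x i \<in> G" "x \<in> ed x i" "f0 x (ed x i) = i" unfolding ed_def by blast+
    qed
    define \<sigma> where "\<sigma> = (\<lambda>x\<in>?V. \<lambda>i. if i < d x then hf (ed x i) x else i)"
    have "(\<lambda>i. if i < d x then hf (ed x i) x else i) permutes {..<d x}" if x: "x \<in> ?V" for x
    proof (rule bij_imp_permutes)
      let ?s = "\<lambda>i. if i < d x then hf (ed x i) x else i"
      have inj: "inj_on ?s {..<d x}"
      proof (rule inj_onI)
        fix i j assume ij: "i \<in> {..<d x}" "j \<in> {..<d x}" "?s i = ?s j"
        then have i: "i < d x" and j: "j < d x" by auto
        have "(x, hf (ed x i) x) \<in> bl (ed x i)" "(x, hf (ed x i) x) \<in> bl (ed x j)"
          using hf[OF ed(1,2)[OF x i]] hf[OF ed(1,2)[OF x j]] ij i j by auto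
        then have "bl (ed x i) = bl (ed x j)" using pairing_inter[OF p(1) bl(1)[OF ed(1)[OF x i]] bl(1)[OF ed(1)[OF x j]]] by blast
        then have "ed x i = ed x j" using bl(2)[OF ed(1)[OF x i]] bl(2)[OF ed(1)[OF x j]] by metis
        then show "i = j" using ed(3)[OF x i] ed(3)[OF x j] by metis
      qed
      moreover have "?s ` {..<d x} \<subseteq> {..<d x}"
      proof
        fix k assume "k \<in> ?s ` {..<d x}"
        then obtain i where i: "i < d x" "k = hf (ed x i) x" by auto
        have "(x, k) \<in> H" using hf[OF ed(1,2)[OF x i(1)]] p(6)[OF bl(1)[OF ed(1)[OF x i(1)]]] i(2) by blast
        then show "k \<in> {..<d x}" by (simp add: half_edges_def)
      qed
      ultimately show "bij_betw ?s {..<d x} {..<d x}" unfolding bij_betw_def by (intro conjI endo_inj_surj) simp_all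
    qed simp
    then have s\<Sigma>: "\<sigma> \<in> \<Sigma>" unfolding \<Sigma>_def \<sigma>_def by auto
    have lb: "lab \<sigma> e ` e = bl e" if e: "e \<in> G" for e
    proof (rule card_subset_eq)
      show "finite (bl e)" using p(5)[OF bl(1)[OF e]] by (metis card.infinite zero_neq_numeral)
      show "lab \<sigma> e ` e \<subseteq> bl e"
      proof
        fix h assume "h \<in> lab \<sigma> e ` e"
        then obtain x where x: "x \<in> e" "h = (x, \<sigma> x (f0 x e))" by (auto simp: lab_def)
        have xV: "x \<in> ?V" using GE(1)[OF e] x by blast
        have lt: "f0 x e < d x" by (rule f0_lt[OF e x(1)])
        have "ed x (f0 x e) = e" using f0_inj[OF ed(1)[OF xV lt] e ed(2)[OF xV lt] x(1) ed(3)[OF xV lt]] .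
        then have "h = (x, hf e x)" using x xV lt by (simp add: \<sigma>_def)
        then show "h \<in> bl e" using hf[OF e x(1)] by simp
      qed
      have "card (lab \<sigma> e ` e) = card e" by (rule card_image) (auto simp: inj_on_def lab_def)
      then show "card (lab \<sigma> e ` e) = card (bl e)" using GE(2)[OF e] p(5)[OF bl(1)[OF e]] by simp
    qed
    have "\<Psi> \<sigma> = bl ` G" unfolding \<Psi>_def using lb by (intro image_cong) auto
    also have "\<dots> = \<pi>" unfolding pi(2)[symmetric] image_image using bl_eq by simp
    finally show ?thesis using s\<Sigma> by blast
  qed
  have "{\<pi> \<in> simple_with {}. proj \<pi> = G} = \<Psi> ` \<Sigma>" using into onto by blast
  then have "card {\<pi> \<in> simple_with {}. proj \<pi> = G} = card \<Sigma>" using card_image[OF inj] by simp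
  also have "\<dots> = (\<Prod>x\<in>?V. card {p. p permutes {..<d x}})" unfolding \<Sigma>_def by (rule card_PiE) simp
  also have "\<dots> = (\<Prod>x\<in>?V. fact (d x))" by (intro prod.cong refl) (simp add: card_permutations)
  finally show ?thesis .
qed

lemma card_simple_graphs: "card (simple_with F) = (\<Prod>x\<in>{1..n}. fact (d x)) * card {G \<in> degree_graphs. F \<subseteq> G}"
proof -
  let ?D = "{G \<in> degree_graphs. F \<subseteq> G}"
  have fin: "finite ?D" by (rule finite_subset[of _ "Pow (Pow {1..n})"]) (auto simp: degree_graphs_def all_edges_def)
  have "simple_with F = (\<Union>G\<in>?D. {\<pi> \<in> simple_with {}. proj \<pi> = G})"
  proof (intro equalityI subsetI)
    fix \<pi> assume pi: "\<pi> \<in> simple_with F"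
    then have "\<pi> \<in> simple_with {}" by (simp add: simple_with_def)
    then show "\<pi> \<in> (\<Union>G\<in>?D. {\<pi> \<in> simple_with {}. proj \<pi> = G})" using proj_degree[OF pi] simple_props(4)[OF pi] by blast
  next
    fix \<pi> assume "\<pi> \<in> (\<Union>G\<in>?D. {\<pi> \<in> simple_with {}. proj \<pi> = G})"
    then show "\<pi> \<in> simple_with F" by (auto simp: simple_with_def)
  qed
  then have "card (simple_with F) = (\<Sum>G\<in>?D. card {\<pi> \<in> simple_with {}. proj \<pi> = G})"
    using fin finite_simple_with[of "{}"] by (simp only:) (rule card_UN_disjoint, auto)
  also have "\<dots> = (\<Sum>G\<in>?D. (\<Prod>x\<in>{1..n}. fact (d x)))" by (rule sum.cong) (auto simp: card_fibre)
  finally show ?thesis by simp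
qed

text \<open>Conditioning the uniform pairing on being simple gives the uniform simple pairing.\<close>

lemma configuration_graph_law:
  assumes ne: "simple_with {} \<noteq> {}"
  shows "measure_pmf.prob (simple_configuration_graph n d) {E. F \<subseteq> E} = card (simple_with F) / card (simple_with {})"
    and "set_pmf (simple_configuration_graph n d) \<subseteq> proj ` simple_with {}"
proof -
  have finp: "finite (pairings H)" by (rule finite_pairings[OF finite_H])
  have sw: "simple_with {} = pairings H \<inter> {\<pi>. simple_pairing \<pi>}" by (auto simp: simple_with_def)
  have nep: "pairings H \<noteq> {}" and ne': "pairings H \<inter> {\<pi>. simple_pairing \<pi>} \<noteq> {}" using ne sw by auto
  have law: "cond_pmf (pmf_of_set (pairings H)) {\<pi>. simple_pairing \<pi>} = pmf_of_set (simple_with {})"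
    unfolding sw
    by (rule pmf_eqI) (use ne' in \<open>simp add: pmf_cond set_pmf_of_set[OF nep finp] pmf_of_set[OF nep finp]
      pmf_of_set[OF ne'] finp measure_pmf_of_set[OF nep finp] indicator_def\<close>)
  have "measure_pmf.prob (simple_configuration_graph n d) {E. F \<subseteq> E} = measure_pmf.prob (pmf_of_set (simple_with {})) {\<pi>. F \<subseteq> proj \<pi>}"
    unfolding simple_configuration_graph_def law measure_map_pmf by (simp add: vimage_def)
  also have "\<dots> = card (simple_with {} \<inter> {\<pi>. F \<subseteq> proj \<pi>}) / card (simple_with {})"
    by (rule measure_pmf_of_set[OF ne finite_simple_with])
  also have "simple_with {} \<inter> {\<pi>. F \<subseteq> proj \<pi>} = simple_with F" by (auto simp: simple_with_def)
  finally show "measure_pmf.prob (simple_configuration_graph n d) {E. F \<subseteq> E} = card (simple_with F) / card (simple_with {})" .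
  show "set_pmf (simple_configuration_graph n d) \<subseteq> proj ` simple_with {}"
    unfolding simple_configuration_graph_def law by (simp add: set_pmf_of_set[OF ne finite_simple_with])
qed

lemma ratio_bound:
  assumes D: "1 \<le> \<Delta>" and ev: "even (card H)" and n: "32 * \<Delta> * \<Delta> \<le> n" and F: "F \<subseteq> all_edges n" "real (card F) \<le> 1 / 8 * n"
  shows "real (card (simple_with F)) / card (simple_with {}) \<le> (2 * real \<Delta> ^ 2 / n) ^ card F"
proof -
  have "0 < \<Delta> * \<Delta>" using D by simp
  then have n': "8 * \<Delta> * \<Delta> < n" "0 < n" using n by linarith+
  have ne: "0 < card (simple_with {})" using simple_exists[OF D ev n'(1)] finite_simple_with by (simp add: card_gt_0_iff)
  have "finite F" using F(1) by (rule finite_subset) (auto simp: all_edges_def intro: finite_subset[of _ "Pow {1..n}"])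
  moreover have "8 * card F \<le> n" using F(2) by linarith
  moreover have "card e = 2" if "e \<in> F" for e using F(1) that by (auto simp: all_edges_def)
  ultimately have "real (card (simple_with F)) \<le> (2 * real \<Delta> ^ 2 / n) ^ card F * card (simple_with {})"
    by (intro simple_with_ratio[OF D _ _ n _ n'(2)]) auto
  then show ?thesis using ne by (simp add: pos_divide_le_eq)
qed

lemma configuration_edge_bound:
  assumes D: "1 \<le> \<Delta>" and ev: "even (card H)" and n: "32 * \<Delta> * \<Delta> \<le> n"
  shows "edge_bound n (2 * real \<Delta> ^ 2) (1 / 8) (simple_configuration_graph n d)"
    and "\<And>E. E \<in> set_pmf (simple_configuration_graph n d) \<Longrightarrow> E \<subseteq> all_edges n \<and> 2 * card E = card H"
proof -
  have "0 < \<Delta> * \<Delta>" using D by simp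
  then have "8 * \<Delta> * \<Delta> < n" using n by linarith
  note ne = simple_exists[OF D ev this]
  show "edge_bound n (2 * real \<Delta> ^ 2) (1 / 8) (simple_configuration_graph n d)"
    unfolding edge_bound_def configuration_graph_law(1)[OF ne] using ratio_bound[OF D ev n] by blast
  show "E \<subseteq> all_edges n \<and> 2 * card E = card H" if "E \<in> set_pmf (simple_configuration_graph n d)" for E
    using that configuration_graph_law(2)[OF ne] proj_edges by blast
qed

text \<open>As all fibres have the same size, the proportion of graphs that contain
  \<open>F\<close> equals the proportion of simple pairings that do.\<close>

lemma degree_graphs_edge_bound:
  assumes D: "1 \<le> \<Delta>" and ev: "even (card H)" and n: "32 * \<Delta> * \<Delta> \<le> n"
  shows "edge_bound n (2 * real \<Delta> ^ 2) (1 / 8) (pmf_of_set degree_graphs)"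
    and "\<And>E. E \<in> set_pmf (pmf_of_set degree_graphs) \<Longrightarrow> E \<subseteq> all_edges n \<and> 2 * card E = card H"
proof -
  have "0 < \<Delta> * \<Delta>" using D by simp
  then have "8 * \<Delta> * \<Delta> < n" using n by linarith
  note ne = simple_exists[OF D ev this]
  let ?c = "\<Prod>x\<in>{1..n}. fact (d x) :: nat"
  have c: "?c > 0" by (simp add: prod_pos)
  have fin: "finite degree_graphs" by (rule finite_subset[of _ "Pow (Pow {1..n})"]) (auto simp: degree_graphs_def all_edges_def)
  have ne': "degree_graphs \<noteq> {}" using ne proj_degree by blast
  show "edge_bound n (2 * real \<Delta> ^ 2) (1 / 8) (pmf_of_set degree_graphs)"
    unfolding edge_bound_def
  proof (intro allI impI)
    fix F assume F: "F \<subseteq> all_edges n" "real (card F) \<le> 1 / 8 * n"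
    have "measure_pmf.prob (pmf_of_set degree_graphs) {E. F \<subseteq> E} = card (degree_graphs \<inter> {E. F \<subseteq> E}) / card degree_graphs"
      by (rule measure_pmf_of_set[OF ne' fin])
    also have "degree_graphs \<inter> {E. F \<subseteq> E} = {G \<in> degree_graphs. F \<subseteq> G}" by blast
    also have "card {G \<in> degree_graphs. F \<subseteq> G} / card degree_graphs = real (card (simple_with F)) / card (simple_with {})"
      using c unfolding card_simple_graphs by simp
    also have "\<dots> \<le> (2 * real \<Delta> ^ 2 / n) ^ card F" by (rule ratio_bound[OF D ev n F])
    finally show "measure_pmf.prob (pmf_of_set degree_graphs) {E. F \<subseteq> E} \<le> (2 * real \<Delta> ^ 2 / n) ^ card F" .
  qed
  fix E assume "E \<in> set_pmf (pmf_of_set degree_graphs)"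
  then have E: "E \<in> degree_graphs" by (simp add: set_pmf_of_set[OF ne' fin])
  have "card {\<pi> \<in> simple_with {}. proj \<pi> = E} > 0" unfolding card_fibre[OF E] using c by simp
  then obtain \<pi> where "\<pi> \<in> simple_with {}" "proj \<pi> = E" by (metis (mono_tags, lifting) card.empty empty_Collect_eq less_irrefl)
  then show "E \<subseteq> all_edges n \<and> 2 * card E = card H" using proj_edges by blast
qed

end

section \<open>Large loops with high probability\<close>

text \<open>The constants are chosen before the random graph: \<open>\<epsilon>\<close> and
  \<open>\<delta>\<close> exhaust the gap between \<open>q\<close> and the threshold, and
  \<open>\<eta>\<close> is the one that makes graphs \<open>\<epsilon>\<close>-sparse. The
  statement is for a general filter, to include the regular graphs, which exist for some
  \<open>n\<close> only.\<close>

lemma large_loops_whp: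
  fixes u \<theta> q C c0 :: real
  assumes u: "0 \<le> u" "u \<le> 1" and \<theta>: "0 < \<theta>" and q: "loop_threshold \<theta> u < q" and C: "1 \<le> C" and c0: "0 < c0"
  obtains \<eta> s c where "0 < \<eta>" "0 < s" "0 < c"
    and "\<And>(F :: nat filter) (p :: nat \<Rightarrow> nat set set pmf) a. F \<le> sequentially \<Longrightarrow>
      (\<forall>\<^sub>F n in F. edge_bound n C c0 (p n) \<and> set_pmf (p n) \<subseteq> Pow (all_edges n)) \<Longrightarrow>
      ((\<lambda>n. measure_pmf.prob (p n) {E. real (card E) < q * n}) \<longlongrightarrow> 0) F \<Longrightarrow> 0 \<le> a \<Longrightarrow>
      ((\<lambda>n. measure_pmf.prob (p n) {E. c \<le> time_averaged_prob {1..n} E \<theta> u \<eta> a s}) \<longlongrightarrow> 1) F"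
proof -
  \<comment> \<open>With these values \<open>k (1 + \<epsilon>) + 2 \<delta> = q\<close>.\<close>
  define k where "k = loop_threshold \<theta> u"
  define \<epsilon> \<delta> where "\<epsilon> = (q - k) / (2 * k)" and "\<delta> = (q - k) / 4"
  have k: "0 < k" using u \<theta> unfolding k_def loop_threshold_def by (simp add: add_pos_nonneg le_max_iff_disj)
  have \<epsilon>: "0 < \<epsilon>" and \<delta>: "0 < \<delta>" using q k by (simp_all add: \<epsilon>_def \<delta>_def k_def)
  have "k * \<epsilon> = (q - k) / 2" using k by (simp add: \<epsilon>_def)
  moreover have "2 * \<delta> = (q - k) / 2" by (simp add: \<delta>_def)
  ultimately have sum: "k * (1 + \<epsilon>) + 2 * \<delta> = q"
    unfolding distrib_left mult_1_right using field_sum_of_halves[of "q - k"] by linarith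
  define s where "s = (if \<theta> = 1 then 1 else ln \<theta> / (\<theta> - 1)) * \<theta> / \<delta>"
  have "0 < ln \<theta> / (\<theta> - 1)" if "\<theta> \<noteq> 1"
    using \<theta> that by (cases "\<theta> < 1") (auto simp: zero_less_divide_iff)
  then have s: "0 < s" unfolding s_def using \<theta> \<delta> by auto
  define c where "c = \<delta> / (k * q)"
  have c: "0 < c" unfolding c_def using \<delta> k q by (simp add: k_def)
  obtain \<eta> where \<eta>: "0 < \<eta>" and sp: "\<And>n p. 0 < n \<Longrightarrow> edge_bound n C c0 p \<Longrightarrow>
      measure_pmf.prob p {E. E \<subseteq> all_edges n \<and> \<not> sparse n \<eta> \<epsilon> E} \<le> 1 / sqrt n"
    using sparse_whp[OF C \<epsilon> c0] by metis
  have good: "c \<le> time_averaged_prob {1..n} E \<theta> u \<eta> a s"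
    if n: "0 < n" and graph: "E \<subseteq> all_edges n" "sparse n \<eta> \<epsilon> E" "q * n \<le> card E" and a: "0 \<le> a" for n E a
  proof -
    interpret loop_graph "{1..n}" E u \<theta> \<eta>
      by unfold_locales (use graph(1) u \<theta> in \<open>auto simp: all_edges_def\<close>)
    have "\<delta> / (loop_threshold \<theta> u * (loop_threshold \<theta> u * (1 + \<epsilon>) + 2 * \<delta>)) \<le> time_averaged_prob {1..n} E \<theta> u \<eta> a s"
      by (rule time_average_bound[OF _ _ \<delta> _ _ a s_def s])
        (use graph(2,3) n \<epsilon> in \<open>simp_all add: sparse_def sum[unfolded k_def]\<close>)
    then show ?thesis unfolding c_def sum[unfolded k_def] unfolding k_def .
  qed
  show ?thesis
  proof (rule that[OF \<eta> s c])
    fix F :: "nat filter" and p :: "nat \<Rightarrow> nat set set pmf" and a :: real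
    assume F: "F \<le> sequentially" and p: "\<forall>\<^sub>F n in F. edge_bound n C c0 (p n) \<and> set_pmf (p n) \<subseteq> Pow (all_edges n)"
      and few: "((\<lambda>n. measure_pmf.prob (p n) {E. real (card E) < q * n}) \<longlongrightarrow> 0) F" and a: "0 \<le> a"
    let ?A = "\<lambda>n. {E. c \<le> time_averaged_prob {1..n} E \<theta> u \<eta> a s}"
    let ?few = "\<lambda>n. {E. real (card E) < q * real n}"
    have low: "1 - (1 / sqrt n + measure_pmf.prob (p n) (?few n)) \<le> measure_pmf.prob (p n) (?A n)"
      if n: "0 < n" and pn: "edge_bound n C c0 (p n) \<and> set_pmf (p n) \<subseteq> Pow (all_edges n)" for n
    proof -
      let ?S = "{E. E \<subseteq> all_edges n \<and> \<not> sparse n \<eta> \<epsilon> E}"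
      have "measure_pmf.prob (p n) (- ?A n) = measure_pmf.prob (p n) (- ?A n \<inter> set_pmf (p n))"
        by (simp add: measure_Int_set_pmf)
      also have "\<dots> \<le> measure_pmf.prob (p n) (?S \<union> ?few n)"
      proof (rule measure_pmf.finite_measure_mono)
        show "- ?A n \<inter> set_pmf (p n) \<subseteq> ?S \<union> ?few n"
        proof
          fix E assume E: "E \<in> - ?A n \<inter> set_pmf (p n)"
          then have "E \<subseteq> all_edges n" using pn by blast
          moreover have "\<not> c \<le> time_averaged_prob {1..n} E \<theta> u \<eta> a s" using E by simp
          ultimately show "E \<in> ?S \<union> ?few n" using good[OF n _ _ _ a, of E] by fastforce
        qed
      qed simp
      also have "\<dots> \<le> measure_pmf.prob (p n) ?S + measure_pmf.prob (p n) (?few n)"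
        by (rule measure_Un_le) simp_all
      also have "\<dots> \<le> 1 / sqrt n + measure_pmf.prob (p n) (?few n)" using sp[OF n] pn by simp
      finally show ?thesis using measure_pmf.prob_compl[of "?A n" "p n"] by (simp add: Compl_eq_Diff_UNIV)
    qed
    have ev: "\<forall>\<^sub>F n in F. 1 - (1 / sqrt n + measure_pmf.prob (p n) (?few n)) \<le> measure_pmf.prob (p n) (?A n)"
      using p filter_leD[OF F eventually_gt_at_top[of 0]] by eventually_elim (rule low)
    have "((\<lambda>n. 1 / sqrt (real n)) \<longlongrightarrow> 0) F"
      by (rule tendsto_mono[OF F]) real_asymp
    then have "((\<lambda>n. 1 - (1 / sqrt (real n) + measure_pmf.prob (p n) (?few n))) \<longlongrightarrow> 1 - (0 + 0)) F"
      by (intro tendsto_intros few)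
    then show "((\<lambda>n. measure_pmf.prob (p n) (?A n)) \<longlongrightarrow> 1) F"
      by (intro tendsto_sandwich[OF ev _ _ tendsto_const[of 1]]) (simp_all add: always_eventually)
  qed
qed

lemma no_small_graphs:
  assumes "\<And>E. E \<in> set_pmf p \<Longrightarrow> m \<le> real (card E)"
  shows "measure_pmf.prob p {E. real (card E) < m} = 0"
  using assms by (subst measure_pmf_zero_iff) (force simp: disjoint_iff)

lemma set_pmf_erdos_renyi: "set_pmf (erdos_renyi_graph n p) \<subseteq> Pow (all_edges n)"
  unfolding erdos_renyi_graph_def by auto

lemma card_half_edges: "card (half_edges n d) = (\<Sum>i=1..n. d i)"
  unfolding half_edges_def by (subst card_SigmaI) auto

lemma regular_case:
  fixes u \<theta> :: real and d :: nat
  assumes u: "0 \<le> u" "u \<le> 1" and \<theta>: "0 < \<theta>" and d3: "3 \<le> d" and d: "2 * loop_threshold \<theta> u < real d"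
  shows "\<exists>\<eta>>0. \<exists>s>0. \<exists>c>0. \<forall>a\<ge>0.
          ((\<lambda>n. measure_pmf.prob (random_regular_graph d n)
                 {E. time_averaged_prob {1..n} E \<theta> u \<eta> a s \<ge> c})
             \<longlongrightarrow> 1) (inf sequentially (principal {n. even (n * d)}))"
proof -
  let ?F = "inf sequentially (principal {n. even (n * d)})"
  have C: "1 \<le> 2 * real d ^ 2" using one_le_power[of "real d" 2] d3 by linarith
  obtain \<eta> s c where *: "0 < \<eta>" "0 < s" "0 < c"
    and lim: "\<And>F p a. F \<le> sequentially \<Longrightarrow>
      (\<forall>\<^sub>F n in F. edge_bound n (2 * real d ^ 2) (1 / 8) (p n) \<and> set_pmf (p n) \<subseteq> Pow (all_edges n)) \<Longrightarrow>
      ((\<lambda>n. measure_pmf.prob (p n) {E. real (card E) < real d / 2 * n}) \<longlongrightarrow> 0) F \<Longrightarrow> 0 \<le> a \<Longrightarrow>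
      ((\<lambda>n. measure_pmf.prob (p n) {E. c \<le> time_averaged_prob {1..n} E \<theta> u \<eta> a s}) \<longlongrightarrow> 1) F"
    by (rule large_loops_whp[OF u \<theta> _ C, of "real d / 2" "1 / 8"]) (use d in auto)
  have all: "\<forall>\<^sub>F n in ?F. edge_bound n (2 * real d ^ 2) (1 / 8) (random_regular_graph d n) \<and>
      (\<forall>E\<in>set_pmf (random_regular_graph d n). E \<subseteq> all_edges n \<and> 2 * card E = n * d)"
    unfolding eventually_inf_principal
    using eventually_ge_at_top[of "32 * d * d"]
  proof eventually_elim
    case (elim n)
    show ?case
    proof
      assume "n \<in> {n. even (n * d)}"
      then have ev: "even (card (half_edges n (\<lambda>_. d)))" by (simp add: card_half_edges)
      interpret degree_sequence n "\<lambda>_. d" d by unfold_locales (use d3 in auto)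
      have "random_regular_graph d n = pmf_of_set degree_graphs"
        by (simp add: random_regular_graph_def regular_graphs_def degree_graphs_def)
      then show "edge_bound n (2 * real d ^ 2) (1 / 8) (random_regular_graph d n) \<and>
          (\<forall>E\<in>set_pmf (random_regular_graph d n). E \<subseteq> all_edges n \<and> 2 * card E = n * d)"
        using degree_graphs_edge_bound[OF _ ev elim] d3 card_half_edges[of n "\<lambda>_. d"] by simp
    qed
  qed
  have ev: "\<forall>\<^sub>F n in ?F. edge_bound n (2 * real d ^ 2) (1 / 8) (random_regular_graph d n) \<and>
      set_pmf (random_regular_graph d n) \<subseteq> Pow (all_edges n)"
    using all by eventually_elim blast
  have few: "((\<lambda>n. measure_pmf.prob (random_regular_graph d n) {E. real (card E) < real d / 2 * n}) \<longlongrightarrow> 0) ?F"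
  proof (rule tendsto_eventually, use all in eventually_elim)
    case (elim n)
    have "real d / 2 * n \<le> real (card E)" if "E \<in> set_pmf (random_regular_graph d n)" for E
    proof -
      have "real (2 * card E) = real (n * d)" using elim that by simp
      then show ?thesis by (simp add: mult.commute)
    qed
    then show ?case by (rule no_small_graphs)
  qed
  show ?thesis by (intro exI[of _ \<eta>] exI[of _ s] exI[of _ c] conjI * allI impI lim[OF inf_le1 ev few])
qed

lemma erdos_renyi_case:
  fixes u \<theta> l :: real
  assumes u: "0 \<le> u" "u \<le> 1" and \<theta>: "0 < \<theta>" and l: "2 * loop_threshold \<theta> u < l"
  shows "\<exists>\<eta>>0. \<exists>s>0. \<exists>c>0. \<forall>a\<ge>0.
          (\<lambda>n. measure_pmf.prob (erdos_renyi_graph n (l / real n))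
                 {E. time_averaged_prob {1..n} E \<theta> u \<eta> a s \<ge> c}) \<longlonglongrightarrow> 1"
proof -
  have "1 \<le> loop_threshold \<theta> u" using u \<theta> unfolding loop_threshold_def by (simp add: le_max_iff_disj)
  then have l1: "1 \<le> l" "0 < l" using l by linarith+
  \<comment> \<open>Halfway between the threshold and the expected number of edges per vertex.\<close>
  define q where "q = (loop_threshold \<theta> u + l / 2) / 2"
  have q: "loop_threshold \<theta> u < q" "q < l / 2" "0 < q"
    using l \<open>1 \<le> loop_threshold \<theta> u\<close> by (simp_all add: q_def field_simps)
  obtain \<eta> s c where *: "0 < \<eta>" "0 < s" "0 < c"
    and lim: "\<And>F p a. F \<le> sequentially \<Longrightarrow>
      (\<forall>\<^sub>F n in F. edge_bound n l 1 (p n) \<and> set_pmf (p n) \<subseteq> Pow (all_edges n)) \<Longrightarrow>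
      ((\<lambda>n. measure_pmf.prob (p n) {E. real (card E) < q * n}) \<longlongrightarrow> 0) F \<Longrightarrow> 0 \<le> a \<Longrightarrow>
      ((\<lambda>n. measure_pmf.prob (p n) {E. c \<le> time_averaged_prob {1..n} E \<theta> u \<eta> a s}) \<longlongrightarrow> 1) F"
    by (rule large_loops_whp[OF u \<theta> q(1) l1(1), of 1]) auto
  have large: "\<forall>\<^sub>F n :: nat in sequentially. 0 < n \<and> l \<le> real n"
    using eventually_gt_at_top[of 0] eventually_ge_at_top[of "nat \<lceil>l\<rceil>"]
    by eventually_elim linarith
  have ev: "\<forall>\<^sub>F n in sequentially. edge_bound n l 1 (erdos_renyi_graph n (l / real n)) \<and>
      set_pmf (erdos_renyi_graph n (l / real n)) \<subseteq> Pow (all_edges n)"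
    using large
  proof eventually_elim
    case (elim n)
    then have "0 \<le> l / real n" "l / real n \<le> 1" using l1 by simp_all
    then show ?case by (intro conjI erdos_renyi_edge_bound set_pmf_erdos_renyi)
  qed
  obtain \<beta> D where \<beta>: "0 < \<beta>" and few: "\<And>n. 0 < n \<Longrightarrow> l \<le> real n \<Longrightarrow>
      measure_pmf.prob (erdos_renyi_graph n (l / real n)) {E. real (card E) < q * real n} \<le> D * exp (- \<beta>) ^ n"
    using erdos_renyi_few_edges[OF l1(2) q(3,2)] by metis
  have "(\<lambda>n. D * exp (- \<beta>) ^ n) \<longlonglongrightarrow> D * 0"
    by (intro tendsto_intros LIMSEQ_power_zero) (use \<beta> in simp)
  then have D0: "(\<lambda>n. D * exp (- \<beta>) ^ n) \<longlonglongrightarrow> 0" by simp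
  have ub: "\<forall>\<^sub>F n in sequentially. measure_pmf.prob (erdos_renyi_graph n (l / real n)) {E. real (card E) < q * n} \<le> D * exp (- \<beta>) ^ n"
    using large by eventually_elim (rule few, simp_all)
  have "(\<lambda>n. measure_pmf.prob (erdos_renyi_graph n (l / real n)) {E. real (card E) < q * n}) \<longlonglongrightarrow> 0"
    by (rule tendsto_sandwich[OF always_eventually ub tendsto_const D0]) (intro allI measure_nonneg)
  from lim[OF order_refl ev this] show ?thesis
    by (intro exI[of _ \<eta>] exI[of _ s] exI[of _ c] conjI * allI impI)
qed

lemma configuration_case:
  fixes u \<theta> \<rho> :: real and deg :: "nat \<Rightarrow> nat \<Rightarrow> nat"
  assumes u: "0 \<le> u" "u \<le> 1" and \<theta>: "0 < \<theta>" and ev: "\<forall>n. even (\<Sum>i=1..n. deg n i)"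
    and bd: "\<forall>n. \<forall>i\<in>{1..n}. 1 \<le> deg n i \<and> deg n i \<le> \<Delta>"
    and mean: "(\<lambda>n. 1 / real n * (\<Sum>i=1..n. real (deg n i))) \<longlonglongrightarrow> \<rho>"
    and \<rho>: "2 * loop_threshold \<theta> u < \<rho>"
  shows "\<exists>\<eta>>0. \<exists>s>0. \<exists>c>0. \<forall>a\<ge>0.
          (\<lambda>n. measure_pmf.prob (simple_configuration_graph n (deg n))
                 {E. time_averaged_prob {1..n} E \<theta> u \<eta> a s \<ge> c}) \<longlonglongrightarrow> 1"
proof -
  have "1 \<le> deg 1 1 \<and> deg 1 1 \<le> \<Delta>" using bd by auto
  then have D: "1 \<le> \<Delta>" by linarith
  have C: "1 \<le> 2 * real \<Delta> ^ 2" using one_le_power[of "real \<Delta>" 2] D by linarith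
  define q where "q = (loop_threshold \<theta> u + \<rho> / 2) / 2"
  have q: "loop_threshold \<theta> u < q" "2 * q < \<rho>" using \<rho> by (simp_all add: q_def field_simps)
  obtain \<eta> s c where *: "0 < \<eta>" "0 < s" "0 < c"
    and lim: "\<And>F p a. F \<le> sequentially \<Longrightarrow>
      (\<forall>\<^sub>F n in F. edge_bound n (2 * real \<Delta> ^ 2) (1 / 8) (p n) \<and> set_pmf (p n) \<subseteq> Pow (all_edges n)) \<Longrightarrow>
      ((\<lambda>n. measure_pmf.prob (p n) {E. real (card E) < q * n}) \<longlongrightarrow> 0) F \<Longrightarrow> 0 \<le> a \<Longrightarrow>
      ((\<lambda>n. measure_pmf.prob (p n) {E. c \<le> time_averaged_prob {1..n} E \<theta> u \<eta> a s}) \<longlongrightarrow> 1) F"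
    by (rule large_loops_whp[OF u \<theta> q(1) C, of "1 / 8"]) auto
  have all: "edge_bound n (2 * real \<Delta> ^ 2) (1 / 8) (simple_configuration_graph n (deg n)) \<and>
      (\<forall>E\<in>set_pmf (simple_configuration_graph n (deg n)). E \<subseteq> all_edges n \<and> 2 * card E = (\<Sum>i=1..n. deg n i))"
    if n: "32 * \<Delta> * \<Delta> \<le> n" for n
  proof -
    interpret degree_sequence n "deg n" \<Delta> by unfold_locales (use bd in auto)
    have "even (card (half_edges n (deg n)))" using ev by (simp add: card_half_edges)
    then show ?thesis using configuration_edge_bound[OF D _ n] card_half_edges[of n "deg n"] by simp
  qed
  have bnd: "\<forall>\<^sub>F n in sequentially. edge_bound n (2 * real \<Delta> ^ 2) (1 / 8) (simple_configuration_graph n (deg n)) \<and>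
      set_pmf (simple_configuration_graph n (deg n)) \<subseteq> Pow (all_edges n)"
    using eventually_ge_at_top[of "32 * \<Delta> * \<Delta>"] by eventually_elim (use all in blast)
  have few: "(\<lambda>n. measure_pmf.prob (simple_configuration_graph n (deg n)) {E. real (card E) < q * n}) \<longlonglongrightarrow> 0"
  proof (rule tendsto_eventually)
    show "\<forall>\<^sub>F n in sequentially. measure_pmf.prob (simple_configuration_graph n (deg n)) {E. real (card E) < q * n} = 0"
      using eventually_ge_at_top[of "32 * \<Delta> * \<Delta>"] eventually_gt_at_top[of 0] order_tendstoD(1)[OF mean q(2)]
    proof eventually_elim
      case (elim n)
      have "q * n \<le> real (card E)" if "E \<in> set_pmf (simple_configuration_graph n (deg n))" for E
      proof -
        have "2 * card E = (\<Sum>i=1..n. deg n i)" using all[OF elim(1)] that by blast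
        then have "2 * real (card E) = (\<Sum>i=1..n. real (deg n i))" by (metis of_nat_mult of_nat_numeral of_nat_sum)
        then show ?thesis using elim(2,3) by (simp add: field_simps)
      qed
      then show ?case by (rule no_small_graphs)
    qed
  qed
  show ?thesis by (intro exI[of _ \<eta>] exI[of _ s] exI[of _ c] conjI * allI impI lim[OF order_refl bnd few])
qed

theorem corollary2p6:
  fixes u \<theta> :: real
  assumes "0 \<le> u" and "u \<le> 1" and "0 < \<theta>"
  shows
    "(\<forall>d::nat. 3 \<le> d \<longrightarrow> real d > 2 * loop_threshold \<theta> u \<longrightarrow>
        (\<exists>\<eta>>0. \<exists>s>0. \<exists>c>0. \<forall>a\<ge>0.
          ((\<lambda>n. measure_pmf.prob (random_regular_graph d n)
                 {E. time_averaged_prob {1..n} E \<theta> u \<eta> a s \<ge> c})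
             \<longlongrightarrow> 1) (inf sequentially (principal {n. even (n * d)}))))
     \<and>
     (\<forall>l::real. 0 < l \<longrightarrow> l > 2 * loop_threshold \<theta> u \<longrightarrow>
        (\<exists>\<eta>>0. \<exists>s>0. \<exists>c>0. \<forall>a\<ge>0.
          (\<lambda>n. measure_pmf.prob (erdos_renyi_graph n (l / real n))
                 {E. time_averaged_prob {1..n} E \<theta> u \<eta> a s \<ge> c})
             \<longlonglongrightarrow> 1))
     \<and>
     (\<forall>(deg :: nat \<Rightarrow> nat \<Rightarrow> nat) (\<Delta>::nat) (\<rho>::real).
        (\<forall>n. even (\<Sum>i=1..n. deg n i)) \<longrightarrow>
        (\<forall>n. \<forall>i\<in>{1..n}. 1 \<le> deg n i \<and> deg n i \<le> \<Delta>) \<longrightarrow>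
        (\<lambda>n. 1 / real n * (\<Sum>i=1..n. real (deg n i))) \<longlonglongrightarrow> \<rho> \<longrightarrow>
        \<rho> > 2 * loop_threshold \<theta> u \<longrightarrow>
        (\<exists>\<eta>>0. \<exists>s>0. \<exists>c>0. \<forall>a\<ge>0.
          (\<lambda>n. measure_pmf.prob (simple_configuration_graph n (deg n))
                 {E. time_averaged_prob {1..n} E \<theta> u \<eta> a s \<ge> c})
             \<longlonglongrightarrow> 1))"
proof (intro conjI allI impI)
qed (rule regular_case[OF assms], assumption+, rule erdos_renyi_case[OF assms], assumption,
  rule configuration_case[OF assms], assumption+)

end
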